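(* Let $K,V:\mathbb{R}^d\to\mathbb{R}$ satisfy: (i) $K\ge 0$, $K(x)=K(-x)$, and $\int_{\mathbb{R}^d} (K\ast\xi)\cdot\xi\,dx\ge 0$ for all test functions $\xi:\mathbb{R}^d\to\mathbb{R}^d$; (ii) $V$ is smooth and nonnegative; (iii) there exist $p>0$, $C_0>0$, $R>0$ such that for all $|x|>R$: $\frac{1}{C_0}(|x|^{p}-1)\le V(x)\le C_0(|x|^p+1)$, $\frac{1}{C_0}(|x|^{p-1}-1)\le |\nabla V(x)|\le C_0(|x|^{p-1}+1)$, $\frac{1}{C_0}(|x|^{p-2}-1)\le |\nabla^2 V(x)|\le C_0(|x|^{p-2}+1)$; (iv) $K\in W^{3,\infty}(\mathbb{R}^d)$; (v) $\displaystyle\sup_{x\in\mathbb{R}^d}\left\|\frac{\nabla V(x)}{1+V(\cdot)}\cdot\nabla K(x-\cdot)\right\|_{BL}<\infty$ and $\displaystyle\sup_{x\in\mathbb{R}^d}\left\|\frac{\nabla V(x)\cdot\nabla V(\cdot)}{1+V(\cdot)}K(x-\cdot)\right\|_{BL}<\infty$. Let $\rho_\infty=e^{-V}/Z$ with $Z=\int_{\mathbb{R}^d}e^{-V}dx$. Then there exists a constant $C$, depending only on $K$ and $V$, such that for every measure solution $\{\rho_t\}_{t\ge 0}$ of $$\partial_t\rho_t=\operatorname{div}(\rho_t\,K\ast(\nabla\rho_t+\nabla V\,\rho_t))$$ and all times $t\ge0$ satisfying $1-C\,t\,(t+1)\,\|\rho_0-\rho_\infty\|_{BL^*_V}>0$,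 we have $$\|\rho_t-\rho_\infty\|_{BL^*_V}\le\frac{C\,(t+1)\,\|\rho_0-\rho_\infty\|_{BL^*_V}}{1-C\,(t+1)\,t\,\|\rho_0-\rho_\infty\|_{BL^*_V}}.$$
   Context: $BL(\mathbb{R}^d)$ is the space of bounded Lipschitz functions, with $|\psi|_{Lip}=\sup_{x\ne y}\frac{|\psi(x)-\psi(y)|}{|x-y|}$ and $\|\psi\|_{BL}=\max(\|\psi\|_{L^\infty},|\psi|_{Lip})$. For a signed measure $\mu$ with $\int(1+V)\,d|\mu|<\infty$, $$\|\mu\|_{BL^*_V}=\sup_{\|\varphi\|_{BL}\le1}\int_{\mathbb{R}^d}\varphi(x)(1+V(x))\,d\mu(x).$$ For a measure $\mu$, $K\ast(\nabla\mu+\nabla V\,\mu)$ denotes $\nabla K\ast\mu+K\ast(\mu\,\nabla V)$. Measure solution: a family of probability measures $\{\rho_t\}_{t\ge0}$ is a measure solution if $t\mapsto\rho_t$ is narrowly continuous, for each $T>0$ $\sup_{t\in[0,T]}\|\rho_t\|_{BL^*_V}=\sup_{t\in[0,T]}\int(1+V)\,d\rho_t\le C(T)<\infty$, and for all $\phi\in C_c^\infty([0,\infty)\times\mathbb{R}^d)$ $$\int_0^\infty\int_{\mathbb{R}^d}\big(\partial_t\phi(t,x)-\nabla\phi(t,x)\cdot K\ast(\nabla\rho_t+\rho_t\nabla V)(x)\big)\,d\rho_t(x)\,dt+\int_{\mathbb{R}^d}\phi(0,x)\,d\rho_0(x)=0.$$ *)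

theory Defs
  imports "HOL-Probability.Probability"
begin

text \<open>
  The Euclidean space of dimension d is a type of class \<open>euclidean_space\<close>; this covers
  every d at least 1.
\<close>

definition grad :: "('a::euclidean_space \<Rightarrow> real) \<Rightarrow> 'a \<Rightarrow> 'a" where
  "grad f x = (\<Sum>b\<in>Basis. frechet_derivative f (at x) b *\<^sub>R b)"

primrec iter_deriv ::
  "'a list \<Rightarrow> ('a::euclidean_space \<Rightarrow> 'b::real_normed_vector) \<Rightarrow> 'a \<Rightarrow> 'b" where
  "iter_deriv [] f = f"
| "iter_deriv (v # vs) f = (\<lambda>x. frechet_derivative (iter_deriv vs f) (at x) v)"

text \<open>
  All iterated directional derivatives exist and are themselves Frechet differentiable, hence
  continuous: this is membership in the class of infinitely often differentiable functions.
\<close>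

definition smooth :: "('a::euclidean_space \<Rightarrow> 'b::real_normed_vector) \<Rightarrow> bool" where
  "smooth f \<longleftrightarrow> (\<forall>vs x. iter_deriv vs f differentiable (at x))"

definition test_function :: "('a::euclidean_space \<Rightarrow> 'b::real_normed_vector) \<Rightarrow> bool" where
  "test_function f \<longleftrightarrow> smooth f \<and> compact (closure {x. f x \<noteq> 0})"

definition linf_norm :: "('a::euclidean_space \<Rightarrow> real) \<Rightarrow> ennreal" where
  "linf_norm f = esssup lborel (\<lambda>x. ennreal \<bar>f x\<bar>)"

definition lip_seminorm :: "('a::euclidean_space \<Rightarrow> real) \<Rightarrow> ennreal" where
  "lip_seminorm f = (SUP (x, y)\<in>{(x, y). x \<noteq> y}. ennreal (\<bar>f x - f y\<bar> / norm (x - y)))"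

definition bl_norm :: "('a::euclidean_space \<Rightarrow> real) \<Rightarrow> ennreal" where
  "bl_norm f = max (linf_norm f) (lip_seminorm f)"

definition in_linf :: "('a::euclidean_space \<Rightarrow> real) \<Rightarrow> bool" where
  "in_linf f \<longleftrightarrow> f \<in> borel_measurable lborel \<and> linf_norm f < \<infinity>"

text \<open>
  The Sobolev space with k weak derivatives in \<open>L\<^sup>\<infinity>\<close>. The lists bs of basis vectors
  play the role of multi-indices of order \<open>length bs\<close>. A class of functions modulo null sets is
  represented by any member; where pointwise values matter, the continuous representative has to be
  selected by a separate assumption.
\<close>

definition sobolev_inf :: "nat \<Rightarrow> ('a::euclidean_space \<Rightarrow> real) \<Rightarrow> bool" where
  "sobolev_inf k f \<longleftrightarrow> in_linf f \<and>
     (\<forall>bs. set bs \<subseteq> Basis \<and> length bs \<le> k \<longrightarrow>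
       (\<exists>g. in_linf g \<and>
         (\<forall>\<phi> :: 'a \<Rightarrow> real. test_function \<phi> \<longrightarrow>
           (\<integral>x. f x * iter_deriv bs \<phi> x \<partial>lborel)
             = (-1) ^ length bs * (\<integral>x. g x * \<phi> x \<partial>lborel))))"

definition positive_definite_kernel :: "('a::euclidean_space \<Rightarrow> real) \<Rightarrow> bool" where
  "positive_definite_kernel K \<longleftrightarrow>
     (\<forall>\<xi> :: 'a \<Rightarrow> 'a. test_function \<xi> \<longrightarrow>
       (\<integral>x. (\<integral>y. K (x - y) *\<^sub>R \<xi> y \<partial>lborel) \<bullet> \<xi> x \<partial>lborel) \<ge> 0)"

text \<open>
  The norm of the Hessian is the operator norm of the derivative of the gradient; any other
  matrix norm only changes \<open>C\<^sub>0\<close>.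
\<close>

definition power_growth :: "('a::euclidean_space \<Rightarrow> real) \<Rightarrow> bool" where
  "power_growth V \<longleftrightarrow>
     (\<exists>p>0. \<exists>C\<^sub>0>0. \<exists>R>0. \<forall>x. norm x > R \<longrightarrow>
        1 / C\<^sub>0 * (norm x powr p - 1) \<le> V x \<and>
        V x \<le> C\<^sub>0 * (norm x powr p + 1) \<and>
        1 / C\<^sub>0 * (norm x powr (p - 1) - 1) \<le> norm (grad V x) \<and>
        norm (grad V x) \<le> C\<^sub>0 * (norm x powr (p - 1) + 1) \<and>
        1 / C\<^sub>0 * (norm x powr (p - 2) - 1) \<le> onorm (frechet_derivative (grad V) (at x)) \<and>
        onorm (frechet_derivative (grad V) (at x)) \<le> C\<^sub>0 * (norm x powr (p - 2) + 1))"

text \<open>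
  The weighted dual norm of the signed measure \<open>\<mu> - \<nu>\<close>, for finite positive Borel measures
  \<open>\<mu>\<close> and \<open>\<nu>\<close> which both integrate \<open>1 + V\<close>. Integration against \<open>\<mu> - \<nu>\<close> is the difference
  of the two integrals, so the value depends on \<open>\<mu> - \<nu>\<close> only. The supremum is taken in the reals;
  for such \<open>\<mu>\<close> and \<open>\<nu>\<close> it ranges over a nonempty bounded set.
\<close>

definition blv_norm_diff ::
  "('a::euclidean_space \<Rightarrow> real) \<Rightarrow> 'a measure \<Rightarrow> 'a measure \<Rightarrow> real" where
  "blv_norm_diff V \<mu> \<nu> =
     (SUP \<phi>\<in>{\<phi>. bl_norm \<phi> \<le> 1}.
        (\<integral>x. \<phi> x * (1 + V x) \<partial>\<mu>) - (\<integral>x. \<phi> x * (1 + V x) \<partial>\<nu>))"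

definition gibbs :: "('a::euclidean_space \<Rightarrow> real) \<Rightarrow> 'a measure" where
  "gibbs V = density lborel (\<lambda>x. ennreal (exp (- V x) / (\<integral>y. exp (- V y) \<partial>lborel)))"

text \<open>The vector field \<open>K \<star> (\<nabla>\<mu> + \<mu> \<nabla>V)\<close>, read as \<open>\<nabla>K \<star> \<mu> + K \<star> (\<mu> \<nabla>V)\<close>.\<close>

definition velocity ::
  "('a::euclidean_space \<Rightarrow> real) \<Rightarrow> ('a \<Rightarrow> real) \<Rightarrow> 'a measure \<Rightarrow> 'a \<Rightarrow> 'a" where
  "velocity K V \<mu> x =
     (\<integral>y. grad K (x - y) \<partial>\<mu>) + (\<integral>y. K (x - y) *\<^sub>R grad V y \<partial>\<mu>)"

definition narrowly_continuous :: "(real \<Rightarrow> 'a::euclidean_space measure) \<Rightarrow> bool" where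
  "narrowly_continuous \<rho> \<longleftrightarrow>
     (\<forall>f :: 'a \<Rightarrow> real. continuous_on UNIV f \<and> bounded (range f) \<longrightarrow>
        continuous_on {0..} (\<lambda>t. \<integral>x. f x \<partial>\<rho> t))"

text \<open>
  Only the values of \<open>\<rho>\<close> at times \<open>t \<ge> 0\<close> matter. The test functions on the closed half space
  \<open>[0,\<infinity>) \<times> \<real>\<^sup>d\<close> are the restrictions of the test functions on \<open>\<real> \<times> \<real>\<^sup>d\<close>; in particular they
  need not vanish at time 0.
\<close>

definition measure_solution ::
  "('a::euclidean_space \<Rightarrow> real) \<Rightarrow> ('a \<Rightarrow> real) \<Rightarrow> (real \<Rightarrow> 'a measure) \<Rightarrow> bool" where
  "measure_solution K V \<rho> \<longleftrightarrow>
     (\<forall>t\<ge>0. prob_space (\<rho> t) \<and> sets (\<rho> t) = sets borel) \<and>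
     narrowly_continuous \<rho> \<and>
     (\<forall>T>0. (SUP t\<in>{0..T}. \<integral>\<^sup>+ x. ennreal (1 + V x) \<partial>\<rho> t) < \<infinity>) \<and>
     (\<forall>\<phi> :: real \<times> 'a \<Rightarrow> real. test_function \<phi> \<longrightarrow>
        (LINT t:{0..}|lborel. (\<integral>x. deriv (\<lambda>s. \<phi> (s, x)) t
              - grad (\<lambda>y. \<phi> (t, y)) x \<bullet> velocity K V (\<rho> t) x \<partial>\<rho> t))
          + (\<integral>x. \<phi> (0, x) \<partial>\<rho> 0) = 0)"

end

theory Submission imports Defs begin

text \<open>
  The distance is estimated by duality. A test function \<open>f\<close> at time \<open>T\<close> is transported backwards along
  the flow by an explicit Euler scheme for the adjoint equation: with \<open>u\<close> the velocity of \<open>\<rho>\<^sub>t\<close>,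
  \<open>\<phi>\<close> is replaced by \<open>\<phi>(x - \<delta> u(x)) + \<delta> L \<phi>(x)\<close>, where \<open>L\<close> is the adjoint of the operator linearised
  at the Gibbs measure. This choice keeps the pairing with \<open>\<rho>\<^sub>t - \<rho>\<^sub>\<infinity>\<close> constant up to \<open>O(\<delta>\<^sup>2)\<close>.

  Since \<open>K\<close> is positive definite, \<open>L\<close> is dissipative in \<open>L\<^sup>2(\<rho>\<^sub>\<infinity>)\<close>, and since \<open>K\<close> is smooth, \<open>L\<close> maps
  \<open>L\<^sup>2(\<rho>\<^sub>\<infinity>)\<close> into the weighted Lipschitz space. So the \<open>L\<^sup>2\<close> norm of \<open>\<phi>\<close>, hence also the contribution
  of \<open>L\<close> per unit time, stays bounded up to a factor \<open>exp (C \<integral> y)\<close>, where \<open>y\<^sub>t = \<parallel>\<rho>\<^sub>t - \<rho>\<^sub>\<infinity>\<parallel>\<close>; both \<open>u\<close>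
  and its Lipschitz constant are bounded by a multiple of \<open>y\<close>. This yields
  \<open>y\<^sub>T \<le> C (1 + T) y\<^sub>0 exp (C \<integral>\<^sub>0\<^sup>T y)\<close>, and integrating this nonlinear Gronwall inequality gives the
  claim.
\<close>

section \<open>Smooth functions and mollification\<close>

text \<open>\<open>\<rho>\<close> is only a measure, so all regularity has to sit on the test
  function. An Euler scheme avoids solving the adjoint equation: every iterate is explicit, and only
  its weighted Lipschitz constant, its L2 norm and the Lipschitz constant of its gradient have to be
  followed. Apart from the additive contribution of \<open>L\<close>, the first two must grow at
  rates linear in \<open>y\<close>; the third enters the errors only and may grow in any way. Yet it
  has to stay finite, and the gradient of \<open>L \<phi>\<close> contains the Hessian of
  \<open>V\<close>, which is controlled in size only. Hence \<open>grad V\<close> is replaced inside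
  \<open>L\<close> by a compactly supported \<open>q\<close>, with an error
  \<open>\<epsilon>\<close>; \<open>\<delta>\<close> tends to 0 before \<open>\<epsilon>\<close>
  does. The rates are linear in \<open>y\<close> because the velocity, its derivative and its
  weighted divergence vanish at the Gibbs measure. Estimating \<open>L \<phi>\<close> by the
  weighted Lipschitz constant of \<open>\<phi>\<close> would make the final bound exponential in
  \<open>T\<close>; the L2 norm, whose own rate is linear in \<open>y\<close>, makes it
  \<open>1 + T\<close>.\<close>

lemma iter_deriv_append: "iter_deriv (us @ vs) f = iter_deriv us (iter_deriv vs f)"
  by (induction us) auto

lemma frechet_derivative_eq: "(f has_derivative f') (at x) \<Longrightarrow> frechet_derivative f (at x) v = f' v"
  by (metis frechet_derivative_at)

text \<open>\<open>iter_deriv\<close> puts the last derivative outermost, so \<open>smooth\<close>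
  offers no induction over the order. Peeling off the first derivative instead turns sum, product
  and chain rule into inductions that pass from \<open>f\<close> to its directional
  derivatives.\<close>

primrec diff_times :: "nat \<Rightarrow> ('a::euclidean_space \<Rightarrow> 'b::real_normed_vector) \<Rightarrow> bool" where
  "diff_times 0 f \<longleftrightarrow> True"
| "diff_times (Suc k) f \<longleftrightarrow> (\<forall>x. f differentiable (at x)) \<and>
     (\<forall>v. diff_times k (\<lambda>x. frechet_derivative f (at x) v))"

lemma diff_times_iter_deriv:
  "diff_times (Suc (length vs)) f \<Longrightarrow> iter_deriv vs f differentiable (at x)"
proof (induction vs arbitrary: f rule: rev_induct)
  case (snoc v vs)
  then show ?case by (simp add: iter_deriv_append)
qed simp

lemma smooth_imp_diff_times: "smooth f \<Longrightarrow> diff_times k f"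
proof (induction k arbitrary: f)
  case (Suc k)
  have "f differentiable (at x)" for x
    using Suc.prems unfolding smooth_def by (metis iter_deriv.simps(1))
  moreover have "smooth (\<lambda>x. frechet_derivative f (at x) v)" for v
    using Suc.prems iter_deriv_append[of _ "[v]" f] unfolding smooth_def
    by (simp) metis
  ultimately show ?case using Suc.IH by simp
qed simp

lemma smooth_iff: "smooth f \<longleftrightarrow> (\<forall>k. diff_times k f)"
  using smooth_imp_diff_times diff_times_iter_deriv unfolding smooth_def by blast

lemma smooth_frechet: "smooth f \<Longrightarrow> smooth (\<lambda>x. frechet_derivative f (at x) v)"
  unfolding smooth_iff by (metis diff_times.simps(2))

lemma smooth_differentiable: "smooth f \<Longrightarrow> f differentiable (at x)"
  unfolding smooth_iff by (metis diff_times.simps(2))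

lemma smooth_has_derivative:
  "smooth f \<Longrightarrow> (f has_derivative frechet_derivative f (at x)) (at x)"
  using smooth_differentiable frechet_derivative_works by blast

lemma smooth_continuous: "smooth f \<Longrightarrow> continuous_on S f"
  using smooth_differentiable differentiable_imp_continuous_within
  by (metis continuous_at_imp_continuous_on)

lemma smooth_iter_deriv: "smooth f \<Longrightarrow> smooth (iter_deriv vs f)"
  by (induction vs) (auto intro: smooth_frechet)

lemma diff_times_const: "diff_times k (\<lambda>x. c)"
  by (induction k arbitrary: c) (auto simp: frechet_derivative_const)

lemma diff_times_antimono: "diff_times (Suc k) f \<Longrightarrow> diff_times k f"
  by (induction k arbitrary: f) auto

lemma diff_times_add: "diff_times k f \<Longrightarrow> diff_times k g \<Longrightarrow> diff_times k (\<lambda>x. f x + g x)"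
proof (induction k arbitrary: f g)
  case (Suc k)
  have d: "((\<lambda>x. f x + g x) has_derivative
     (\<lambda>v. frechet_derivative f (at x) v + frechet_derivative g (at x) v)) (at x)" for x
    using Suc.prems by (intro has_derivative_add) (auto simp: frechet_derivative_works[symmetric])
  show ?case using Suc frechet_derivative_eq[OF d] differentiableI[OF d] by simp
qed simp

lemma frechet_derivative_bilinear:
  assumes "bounded_bilinear pr" "f differentiable (at x)" "g differentiable (at x)"
  shows "frechet_derivative (\<lambda>x. pr (f x) (g x)) (at x) v =
     pr (f x) (frechet_derivative g (at x) v) + pr (frechet_derivative f (at x) v) (g x)"
    and "(\<lambda>x. pr (f x) (g x)) differentiable (at x)"
proof -
  have d: "((\<lambda>x. pr (f x) (g x)) has_derivative
     (\<lambda>v. pr (f x) (frechet_derivative g (at x) v) + pr (frechet_derivative f (at x) v) (g x))) (at x)"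
    using assms by (intro bounded_bilinear.FDERIV) (auto simp: frechet_derivative_works[symmetric])
  show "frechet_derivative (\<lambda>x. pr (f x) (g x)) (at x) v =
     pr (f x) (frechet_derivative g (at x) v) + pr (frechet_derivative f (at x) v) (g x)"
    by (rule frechet_derivative_eq[OF d])
  show "(\<lambda>x. pr (f x) (g x)) differentiable (at x)" using d by (auto simp: differentiable_def)
qed

lemma diff_times_bilinear:
  assumes b: "bounded_bilinear pr"
  shows "diff_times k f \<Longrightarrow> diff_times k g \<Longrightarrow> diff_times k (\<lambda>x. pr (f x) (g x))"
proof (induction k arbitrary: f g)
  case (Suc k)
  then have 1: "frechet_derivative (\<lambda>x. pr (f x) (g x)) (at x) v =
     pr (f x) (frechet_derivative g (at x) v) + pr (frechet_derivative f (at x) v) (g x)"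
    "(\<lambda>x. pr (f x) (g x)) differentiable (at x)" for x v
    using frechet_derivative_bilinear[OF b, of f x g] by auto
  have "diff_times k f" "diff_times k g" using Suc.prems diff_times_antimono by auto
  then show ?case using Suc by (auto simp: 1 intro!: diff_times_add)
qed simp

text \<open>The derivative of the composition is the derivative of \<open>g\<close> composed with
  \<open>f\<close>, times a derivative of \<open>f\<close>. So the induction runs over all smooth
  outer functions at once and is closed by the product rule.\<close>

lemma diff_times_compose:
  fixes g :: "real \<Rightarrow> real"
  shows "smooth g \<Longrightarrow> diff_times k f \<Longrightarrow> diff_times k (\<lambda>x. g (f x))"
proof (induction k arbitrary: g)
  case (Suc k)
  have d: "((\<lambda>x. g (f x)) has_derivative
      (\<lambda>v. frechet_derivative g (at (f x)) 1 * frechet_derivative f (at x) v)) (at x)" for x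
  proof -
    have "(g has_derivative frechet_derivative g (at (f x))) (at (f x))"
      by (rule smooth_has_derivative) fact
    moreover have "(f has_derivative frechet_derivative f (at x)) (at x)"
      using Suc.prems by (simp add: frechet_derivative_works[symmetric])
    ultimately have *: "((\<lambda>x. g (f x)) has_derivative
      (\<lambda>v. frechet_derivative g (at (f x)) (frechet_derivative f (at x) v))) (at x)"
      by (rule has_derivative_compose[rotated])
    have lin: "linear (frechet_derivative g (at (f x)))"
      by (rule linear_frechet_derivative[OF smooth_differentiable]) fact
    have "frechet_derivative g (at (f x)) s = frechet_derivative g (at (f x)) 1 * s" for s
      using linear_scale[OF lin, of s 1] by (simp add: mult.commute)
    then have "(\<lambda>v. frechet_derivative g (at (f x)) (frechet_derivative f (at x) v)) =
      (\<lambda>v. frechet_derivative g (at (f x)) 1 * frechet_derivative f (at x) v)" by blast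
    with * show ?thesis by simp
  qed
  then have "(\<lambda>x. g (f x)) differentiable (at x)" for x by (auto simp: differentiable_def)
  moreover have "frechet_derivative (\<lambda>x. g (f x)) (at x) v =
      frechet_derivative g (at (f x)) 1 * frechet_derivative f (at x) v" for x v
    by (rule frechet_derivative_eq[OF d])
  moreover have "diff_times k (\<lambda>x. frechet_derivative g (at (f x)) 1 * frechet_derivative f (at x) v)" for v
  proof (rule diff_times_bilinear[OF bounded_bilinear_mult])
    show "diff_times k (\<lambda>x. frechet_derivative g (at (f x)) 1)"
      by (rule Suc.IH[OF smooth_frechet[OF Suc.prems(1)] diff_times_antimono[OF Suc.prems(2)]])
    show "diff_times k (\<lambda>x. frechet_derivative f (at x) v)" using Suc.prems by simp
  qed
  ultimately show ?case by simp
qed simp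

lemma smooth_const: "smooth (\<lambda>x. c)"
  and smooth_add: "smooth f \<Longrightarrow> smooth g \<Longrightarrow> smooth (\<lambda>x. f x + g x)"
  and smooth_bilinear: "bounded_bilinear pr \<Longrightarrow> smooth a \<Longrightarrow> smooth b \<Longrightarrow> smooth (\<lambda>x. pr (a x) (b x))"
  and smooth_compose: "smooth h \<Longrightarrow> smooth u \<Longrightarrow> smooth (\<lambda>x. h (u x))"
  for h :: "real \<Rightarrow> real"
  by (auto simp: smooth_iff diff_times_const diff_times_add diff_times_bilinear)
     (use diff_times_compose smooth_iff in blast)

lemmas smooth_mult = smooth_bilinear[OF bounded_bilinear_mult]
lemmas smooth_scaleR = smooth_bilinear[OF bounded_bilinear_scaleR]
lemmas smooth_inner = smooth_bilinear[OF bounded_bilinear_inner]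

lemma smooth_linear:
  assumes "bounded_linear f" shows "smooth f"
proof -
  have d: "(f has_derivative f) (at x)" for x using assms by (rule bounded_linear_imp_has_derivative)
  have "diff_times k f" for k
  proof (cases k)
    case (Suc n)
    have "frechet_derivative f (at x) v = f v" for x v by (rule frechet_derivative_eq[OF d])
    then show ?thesis using d by (auto simp: Suc diff_times_const differentiable_def)
  qed simp
  then show ?thesis by (simp add: smooth_iff)
qed

lemma smooth_sum: "(\<And>i. i \<in> A \<Longrightarrow> smooth (f i)) \<Longrightarrow> smooth (\<lambda>x. \<Sum>i\<in>A. f i x)"
  by (induction A rule: infinite_finite_induct) (auto intro: smooth_const smooth_add)

lemma iter_deriv_affine:
  assumes "bounded_linear L" "smooth f"
  shows "iter_deriv vs (\<lambda>x. f (c + L x)) = (\<lambda>x. iter_deriv (map L vs) f (c + L x))"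
proof (induction vs)
  case (Cons v vs)
  have "frechet_derivative (\<lambda>x. iter_deriv (map L vs) f (c + L x)) (at x) v =
    frechet_derivative (iter_deriv (map L vs) f) (at (c + L x)) (L v)" for x
  proof -
    have "((\<lambda>x. c + L x) has_derivative L) (at x)"
      using bounded_linear_imp_has_derivative[OF assms(1)] by (auto intro!: derivative_eq_intros)
    from has_derivative_compose[OF this smooth_has_derivative[OF smooth_iter_deriv[OF assms(2)]]]
    show ?thesis by (metis frechet_derivative_at)
  qed
  with Cons show ?case by simp
qed simp

lemma smooth_affine:
  assumes "bounded_linear L" "smooth f"
  shows "smooth (\<lambda>x. f (c + L x))"
proof -
  have "(\<lambda>x. iter_deriv (map L vs) f (c + L x)) differentiable at x" for vs x
  proof -
    have "((\<lambda>x. c + L x) has_derivative L) (at x)"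
      using bounded_linear_imp_has_derivative[OF assms(1)] by (auto intro!: derivative_eq_intros)
    from has_derivative_compose[OF this smooth_has_derivative[OF smooth_iter_deriv[OF assms(2)]]]
    show ?thesis by (auto simp: differentiable_def)
  qed
  then show ?thesis unfolding smooth_def iter_deriv_affine[OF assms] by blast
qed

text \<open>The family of all \<open>P(1/s) exp (-1/s)\<close>, extended by zero to \<open>s \<le> 0\<close>, is closed under
  differentiation.\<close>

definition flat_exp :: "real poly \<Rightarrow> real \<Rightarrow> real" where
  "flat_exp p s = (if s > 0 then poly p (1 / s) * exp (- (1 / s)) else 0)"

lemma tendsto_poly_exp_at_top: "((\<lambda>x::real. poly p x * exp (- x)) \<longlongrightarrow> 0) at_top"
proof -
  have "((\<lambda>x::real. x ^ i * exp (- x)) \<longlongrightarrow> 0) at_top" for i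
    using tendsto_power_div_exp_0[of i] by (simp add: exp_minus field_simps)
  then have "((\<lambda>x::real. \<Sum>i\<le>degree p. coeff p i * (x ^ i * exp (- x))) \<longlongrightarrow> (\<Sum>i\<le>degree p. coeff p i * 0)) at_top"
    by (intro tendsto_sum tendsto_mult tendsto_const)
  then show ?thesis by (simp add: poly_altdef sum_distrib_right mult.assoc)
qed

lemma flat_exp_tendsto_0: "((flat_exp p) \<longlongrightarrow> 0) (at 0)"
proof -
  have "((\<lambda>s. poly p (inverse s) * exp (- (inverse s))) \<longlongrightarrow> 0) (at_right 0)"
    using filterlim_compose[OF tendsto_poly_exp_at_top filterlim_inverse_at_top_right] by simp
  moreover have "eventually (\<lambda>s. poly p (inverse s) * exp (- (inverse s)) = flat_exp p s) (at_right 0)"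
    by (auto simp: eventually_at_filter flat_exp_def inverse_eq_divide)
  ultimately have "(flat_exp p \<longlongrightarrow> 0) (at_right 0)" by (rule Lim_transform_eventually)
  moreover have "(flat_exp p \<longlongrightarrow> 0) (at_left 0)"
    by (rule Lim_transform_eventually[of "\<lambda>_. 0"]) (auto simp: eventually_at_filter flat_exp_def)
  ultimately show ?thesis by (simp add: filterlim_split_at)
qed

text \<open>For \<open>s > 0\<close>, differentiating \<open>P(1/s) exp(-1/s)\<close> produces the
  factor \<open>1/s^2\<close>, once with \<open>P\<close> from the exponential and once with
  \<open>-P'\<close>; hence the polynomial \<open>X^2 (P - P')\<close>.\<close>

lemma flat_exp_deriv:
  "(flat_exp p has_real_derivative flat_exp (monom 1 2 * (p - pderiv p)) s) (at s)"
proof (cases s "0::real" rule: linorder_cases)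
  case greater
  have "((\<lambda>s. poly p (1 / s) * exp (- (1 / s))) has_real_derivative flat_exp (monom 1 2 * (p - pderiv p)) s) (at s)"
    using greater by (auto intro!: derivative_eq_intros DERIV_chain2[OF poly_DERIV]
      simp: flat_exp_def poly_monom field_simps power2_eq_square)
  then show ?thesis
    by (rule has_field_derivative_transform_within_open[where S="{0<..}"]) (use greater in \<open>auto simp: flat_exp_def\<close>)
next
  case less
  have "((\<lambda>s. 0::real) has_real_derivative 0) (at s)" by simp
  then have "(flat_exp p has_real_derivative 0) (at s)"
    by (rule has_field_derivative_transform_within_open[where S="{..<0}"]) (use less in \<open>auto simp: flat_exp_def\<close>)
  then show ?thesis using less by (simp add: flat_exp_def)
next
  case equal
  \<comment> \<open>At 0 the difference quotient of \<open>flat_exp p\<close> is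
    \<open>flat_exp\<close> of \<open>X p\<close>, which tends to 0 as well.\<close>
  have "((\<lambda>h. (flat_exp p (0 + h) - flat_exp p 0) / h) \<longlongrightarrow> 0) (at 0)"
    by (rule Lim_transform_eventually[OF flat_exp_tendsto_0[of "monom 1 1 * p"]])
       (auto simp: eventually_at_filter flat_exp_def poly_monom)
  then have "(flat_exp p has_real_derivative 0) (at 0)" unfolding DERIV_def .
  moreover have "flat_exp (monom 1 2 * (p - pderiv p)) s = 0" using equal by (simp add: flat_exp_def)
  ultimately show ?thesis using equal by simp
qed

lemma smooth_flat_exp: "smooth (flat_exp p)"
proof -
  \<comment> \<open>The factor \<open>c\<close> makes the claim stable under differentiation: the
    derivative in direction \<open>v\<close> carries an extra factor \<open>v\<close>.\<close>
  have "diff_times k (\<lambda>s. c * flat_exp p s)" for k c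
  proof (induction k arbitrary: c p)
    case (Suc k)
    have d: "((\<lambda>s. c * flat_exp p s) has_derivative (\<lambda>v. v * (c * flat_exp (monom 1 2 * (p - pderiv p)) s))) (at s)" for s
      using DERIV_cmult[OF flat_exp_deriv[of p s], of c]
      by (simp add: has_field_derivative_def mult_commute_abs)
    have "frechet_derivative (\<lambda>s. c * flat_exp p s) (at s) v = (v * c) * flat_exp (monom 1 2 * (p - pderiv p)) s" for s v
      by (subst frechet_derivative_eq[OF d]) simp
    then show ?case using Suc differentiableI[OF d] by simp
  qed simp
  from this[of _ 1] show ?thesis by (simp add: smooth_iff)
qed

lemma flat_exp_1_pos: "flat_exp 1 s \<ge> 0" "flat_exp 1 s > 0 \<longleftrightarrow> s > 0" "s \<le> 0 \<Longrightarrow> flat_exp 1 s = 0"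
  by (auto simp: flat_exp_def)

section \<open>Translation invariance and differentiation under the integral\<close>

lemma lborel_integral_translate:
  fixes f :: "'a::euclidean_space \<Rightarrow> 'b::{banach, second_countable_topology}"
  assumes [measurable]: "f \<in> borel_measurable borel"
  shows "(\<integral>y. f (x + y) \<partial>lborel) = (\<integral>y. f y \<partial>lborel)"
    and "integrable lborel (\<lambda>y. f (x + y)) \<longleftrightarrow> integrable lborel f"
proof -
  have [measurable]: "(+) x \<in> borel_measurable borel" by measurable
  show "(\<integral>y. f (x + y) \<partial>lborel) = (\<integral>y. f y \<partial>lborel)"
    by (subst (2) lborel_distr_plus[of x, symmetric], subst integral_distr) auto
  show "integrable lborel (\<lambda>y. f (x + y)) \<longleftrightarrow> integrable lborel f"
    by (subst (2) lborel_distr_plus[of x, symmetric], subst integrable_distr_eq) auto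
qed

lemma lborel_integral_reflect:
  fixes f :: "'a::euclidean_space \<Rightarrow> 'b::{banach, second_countable_topology}"
  assumes [measurable]: "f \<in> borel_measurable borel"
  shows "(\<integral>y. f (x - y) \<partial>lborel) = (\<integral>y. f y \<partial>lborel)"
    and "integrable lborel (\<lambda>y. f (x - y)) \<longleftrightarrow> integrable lborel f"
proof -
  have *: "lborel = distr lborel borel (\<lambda>y. x - y)"
    using lborel_affine[of "-1" x] by (simp add: density_1)
  show "(\<integral>y. f (x - y) \<partial>lborel) = (\<integral>y. f y \<partial>lborel)"
    by (subst (2) *, subst integral_distr) auto
  show "integrable lborel (\<lambda>y. f (x - y)) \<longleftrightarrow> integrable lborel f"
    by (subst (2) *, subst integrable_distr_eq) auto
qed

text \<open>By translation invariance \<open>F(x + b) - F(x)\<close> has integral 0, and this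
  difference is the integral of the derivative along the segment from \<open>x\<close> to
  \<open>x + b\<close>. After Fubini the segment parameter disappears, again by translation
  invariance. Integrability of \<open>F\<close> and of the derivative replaces any decay at
  infinity.\<close>

lemma integral_directional_derivative_eq_0:
  fixes F :: "'a::euclidean_space \<Rightarrow> real"
  assumes F': "\<And>x. (F has_derivative F' x) (at x)"
    and iF: "integrable lborel F" and iF': "integrable lborel (\<lambda>x. F' x b)"
    and cont: "continuous_on UNIV (\<lambda>x. F' x b)"
  shows "(\<integral>x. F' x b \<partial>lborel) = 0"
proof -
  define g where "g x = F' x b" for x
  have [measurable]: "g \<in> borel_measurable borel"
    using cont unfolding g_def by (rule borel_measurable_continuous_onI)
  have [measurable]: "F \<in> borel_measurable borel" using iF by auto
  have ig: "integrable lborel g" using iF' by (simp add: g_def[abs_def])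
  let ?f = "\<lambda>(x::'a) (\<theta>::real). indicator {0..1} \<theta> * g (x + \<theta> *\<^sub>R b)"
  have tr: "(\<integral>x. g (x + c) \<partial>lborel) = (\<integral>x. g x \<partial>lborel)" "integrable lborel (\<lambda>x. g (x + c))"
     "(\<integral>x. \<bar>g (x + c)\<bar> \<partial>lborel) = (\<integral>x. \<bar>g x\<bar> \<partial>lborel)" for c
    using lborel_integral_translate[of g c] lborel_integral_translate[of "\<lambda>x. \<bar>g x\<bar>" c] ig
    by (auto simp: add.commute)
  have int2: "integrable (lborel \<Otimes>\<^sub>M lborel) (\<lambda>(\<theta>, x). ?f x \<theta>)"
  proof (rule lborel_pair.Fubini_integrable)
    show "integrable lborel (\<lambda>\<theta>. \<integral> x. norm (case (\<theta>, x) of (\<theta>, x) \<Rightarrow> ?f x \<theta>) \<partial>lborel)"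
      by (simp add: abs_mult tr)
    show "AE \<theta> in lborel. integrable lborel (\<lambda>x. case (\<theta>, x) of (\<theta>, x) \<Rightarrow> ?f x \<theta>)"
      by (simp add: tr)
  qed measurable
  then have int1: "integrable (lborel \<Otimes>\<^sub>M lborel) (case_prod ?f)"
    using lborel_pair.integrable_product_swap_iff[of "case_prod ?f"] by (simp add: case_prod_unfold)
  have "(\<integral>x. g x \<partial>lborel) = (\<integral>\<theta>. (\<integral>x. ?f x \<theta> \<partial>lborel) \<partial>lborel)"
    by (simp add: tr)
  also have "\<dots> = (\<integral>x. (\<integral>\<theta>. ?f x \<theta> \<partial>lborel) \<partial>lborel)"
    using lborel_pair.integral_fst[OF int1] lborel_pair.integral_snd[OF int1] by simp
  also have "\<dots> = (\<integral>x. F (x + b) - F x \<partial>lborel)"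
  proof (rule Bochner_Integration.integral_cong[OF refl])
    fix x :: 'a
    have d: "((\<lambda>\<theta>. F (x + \<theta> *\<^sub>R b)) has_real_derivative g (x + \<theta> *\<^sub>R b)) (at \<theta> within {0..1})" for \<theta>
    proof -
      have "((\<lambda>\<theta>. x + \<theta> *\<^sub>R b) has_derivative (\<lambda>s. s *\<^sub>R b)) (at \<theta>)"
        by (auto intro!: derivative_eq_intros)
      from has_derivative_compose[OF this F']
      have "((\<lambda>\<theta>. F (x + \<theta> *\<^sub>R b)) has_derivative (\<lambda>s. F' (x + \<theta> *\<^sub>R b) (s *\<^sub>R b))) (at \<theta>)" .
      moreover have "F' (x + \<theta> *\<^sub>R b) (s *\<^sub>R b) = g (x + \<theta> *\<^sub>R b) * s" for s
        using linear_scale[OF has_derivative_linear[OF F']] by (simp add: g_def)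
      ultimately have "((\<lambda>\<theta>. F (x + \<theta> *\<^sub>R b)) has_real_derivative g (x + \<theta> *\<^sub>R b)) (at \<theta>)"
        by (simp add: has_field_derivative_def)
      then show ?thesis by (rule has_field_derivative_at_within)
    qed
    have c: "continuous_on {0..1} (\<lambda>\<theta>. g (x + \<theta> *\<^sub>R b))"
      using cont unfolding g_def[symmetric]
      by (rule continuous_on_compose2) (auto intro!: continuous_intros)
    show "(\<integral>\<theta>. ?f x \<theta> \<partial>lborel) = F (x + b) - F x"
      using integral_FTC_atLeastAtMost[of 0 1, OF _ d[unfolded has_real_derivative_iff_has_vector_derivative] c]
      by simp
  qed
  also have "(\<integral>x. F (x + b) - F x \<partial>lborel) = 0"
    using lborel_integral_translate[of F b] iF by (subst Bochner_Integration.integral_diff) (auto simp: add.commute)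
  finally show ?thesis by (simp add: g_def)
qed

text \<open>If \<open>f\<close> is not integrable, its integral is 0 by default and the bound only
  says that the integral of \<open>g\<close> is nonnegative; so integrability of \<open>f\<close>
  need not be checked at each use.\<close>

lemma integral_norm_bound_ineq:
  fixes f :: "'a \<Rightarrow> 'b::{banach, second_countable_topology}"
  assumes "integrable M g" "\<And>x. x \<in> space M \<Longrightarrow> norm (f x) \<le> g x"
  shows "norm (\<integral>x. f x \<partial>M) \<le> (\<integral>x. g x \<partial>M)"
proof (cases "integrable M f")
  case True
  have "norm (\<integral>x. f x \<partial>M) \<le> (\<integral>x. norm (f x) \<partial>M)" by (rule integral_norm_bound)
  also have "\<dots> \<le> (\<integral>x. g x \<partial>M)" by (rule integral_mono) (use True assms in auto)
  finally show ?thesis .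
next
  case False
  have "0 \<le> (\<integral>x. g x \<partial>M)"
    by (rule Bochner_Integration.integral_nonneg) (use assms(2) norm_ge_zero order_trans in blast)
  then show ?thesis using False by (simp add: not_integrable_integral_eq)
qed

text \<open>An integrable bound on the second order remainder replaces dominated convergence:
  integrating it leaves a remainder quadratic in \<open>x' - x\<close>. Convolutions, velocity and
  adjoint operator are all differentiated in this way.\<close>

lemma has_derivative_integral_quadratic:
  fixes f :: "'a::euclidean_space \<Rightarrow> 'b \<Rightarrow> 'c::{banach, second_countable_topology}"
  assumes int: "\<And>x'. integrable M (f x')" and int': "\<And>v. integrable M (\<lambda>y. f' y v)" and ic: "integrable M c"
    and lin: "\<And>y. linear (f' y)" and "r > 0"
    and rem: "\<And>y x'. y \<in> space M \<Longrightarrow> norm (x' - x) \<le> r \<Longrightarrow>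
       norm (f x' y - f x y - f' y (x' - x)) \<le> c y * (norm (x' - x))\<^sup>2"
  shows "((\<lambda>x'. \<integral>y. f x' y \<partial>M) has_derivative (\<lambda>v. \<integral>y. f' y v \<partial>M)) (at x)"
proof (rule has_derivativeI_sandwich)
  have "linear (\<lambda>v. \<integral>y. f' y v \<partial>M)"
    by (rule linearI) (simp_all add: linear_add[OF lin] linear_scale[OF lin] int')
  then show "bounded_linear (\<lambda>v. \<integral>y. f' y v \<partial>M)"
    by (simp add: linear_conv_bounded_linear)
  show "0 < r" by fact
  fix z assume z: "z \<in> UNIV" "z \<noteq> x" "dist z x < r"
  have "(\<integral>y. f z y \<partial>M) - (\<integral>y. f x y \<partial>M) - (\<integral>y. f' y (z - x) \<partial>M) = (\<integral>y. f z y - f x y - f' y (z - x) \<partial>M)"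
    by (simp add: int int')
  also have "norm \<dots> \<le> (\<integral>y. c y * (norm (z - x))\<^sup>2 \<partial>M)"
    using z rem by (intro integral_norm_bound_ineq) (auto simp: int int' ic dist_norm)
  also have "\<dots> = (\<integral>y. c y \<partial>M) * (norm (z - x))\<^sup>2" by simp
  finally show "norm ((\<integral>y. f z y \<partial>M) - (\<integral>y. f x y \<partial>M) - (\<integral>y. f' y (z - x) \<partial>M)) / norm (z - x)
       \<le> (\<integral>y. c y \<partial>M) * norm (z - x)"
    using z by (simp add: divide_simps power2_eq_square mult.assoc)
next
  have "((\<lambda>z. (\<integral>y. c y \<partial>M) * norm (z - x)) \<longlongrightarrow> (\<integral>y. c y \<partial>M) * norm (x - x)) (at x)"
    by (intro tendsto_intros)
  then show "((\<lambda>z. (\<integral>y. c y \<partial>M) * norm (z - x)) \<longlongrightarrow> 0) (at x)" by simp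
qed

lemma lipschitz_if_derivative_bound:
  fixes f :: "'a::euclidean_space \<Rightarrow> 'b::real_normed_vector"
  assumes "\<And>x. (f has_derivative f' x) (at x)" "\<And>x v. norm (f' x v) \<le> L * norm v"
  shows "norm (f x - f z) \<le> L * norm (x - z)"
proof (rule differentiable_bound[of UNIV])
  show "(f has_derivative f' x) (at x within UNIV)" for x using assms(1) by simp
  show "onorm (f' x) \<le> L" for x using assms(2)
    by (rule onorm_bound[rotated]) (use assms(2)[of x] order_trans[OF norm_ge_zero assms(2)] in
      \<open>metis norm_ge_zero nonzero_norm_divide norm_one SOME_Basis norm_Basis mult.right_neutral\<close>)
qed auto

text \<open>The mean value inequality for the linearisation error loses the factor 1/2 of Taylor's
  formula, which does not matter. The hypotheses are confined to the segment so that
  \<open>L\<close> may contain a weight evaluated near \<open>x\<close>.\<close>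

lemma quadratic_remainder:
  fixes f :: "'a::euclidean_space \<Rightarrow> 'b::real_normed_vector"
  assumes d: "\<And>z. z \<in> closed_segment x x' \<Longrightarrow> (f has_derivative f' z) (at z)"
    and L: "\<And>z v. z \<in> closed_segment x x' \<Longrightarrow> norm (f' z v - f' x v) \<le> L * norm (z - x) * norm v"
    and "L \<ge> 0"
  shows "norm (f x' - f x - f' x (x' - x)) \<le> L * (norm (x' - x))\<^sup>2"
proof -
  have "norm (f x' - f x - f' x (x' - x)) \<le> norm (x' - x) * (L * norm (x' - x))"
  proof (rule differentiable_bound_linearization[of _ _ "closed_segment x x'"])
    show "x + t *\<^sub>R (x' - x) \<in> closed_segment x x'" if "t \<in> {0..1}" for t
      using that by (auto simp: in_segment algebra_simps intro!: exI[of _ t])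
    show "(f has_derivative f' z) (at z within closed_segment x x')" if "z \<in> closed_segment x x'" for z
      using d[OF that] by (rule has_derivative_at_withinI)
    show "onorm (f' z - f' x) \<le> L * norm (x' - x)" if z: "z \<in> closed_segment x x'" for z
    proof (rule onorm_bound)
      show "0 \<le> L * norm (x' - x)" using \<open>L \<ge> 0\<close> by simp
      have "norm (z - x) \<le> norm (x' - x)" using z segment_bound1 by (metis norm_minus_commute)
      then show "norm ((f' z - f' x) v) \<le> L * norm (x' - x) * norm v" for v
        using L[OF z, of v] \<open>L \<ge> 0\<close>
        by (simp) (meson mult_left_mono mult_right_mono norm_ge_zero order_trans)
    qed
  qed auto
  then show ?thesis by (simp add: power2_eq_square mult.commute mult.left_commute)
qed

section \<open>Test functions\<close>

lemma test_functionI: "smooth f \<Longrightarrow> (\<And>x. norm x > R \<Longrightarrow> f x = 0) \<Longrightarrow> test_function f"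
  unfolding test_function_def
  by (intro conjI, assumption, rule compact_closure[THEN iffD2], rule bounded_subset[OF bounded_cball[of 0 R]])
     (auto simp: not_less[symmetric])

lemma test_function_support:
  assumes "test_function f" obtains R where "R > 0" "\<And>x. norm x > R \<Longrightarrow> f x = 0"
proof -
  have "bounded {x. f x \<noteq> 0}" using assms by (auto simp: test_function_def compact_closure)
  then show ?thesis using that unfolding bounded_pos by (metis mem_Collect_eq not_less)
qed

lemma test_function_smooth: "test_function f \<Longrightarrow> smooth f" by (simp add: test_function_def)

lemma test_function_frechet:
  assumes "test_function f" shows "test_function (\<lambda>x. frechet_derivative f (at x) v)"
proof -
  obtain R where R: "R > 0" "\<And>x. norm x > R \<Longrightarrow> f x = 0" by (rule test_function_support[OF assms]) blast
  show ?thesis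
  proof (rule test_functionI[of _ R])
    show "smooth (\<lambda>x. frechet_derivative f (at x) v)" using assms by (intro smooth_frechet test_function_smooth)
    fix x :: 'a assume x: "norm x > R"
    have "((\<lambda>x. 0) has_derivative (\<lambda>v. 0)) (at x)" by simp
    then have "(f has_derivative (\<lambda>v. 0)) (at x)"
      by (rule has_derivative_transform_within_open[of _ _ x UNIV "- cball 0 R"]) (use R x in auto)
    then show "frechet_derivative f (at x) v = 0" by (rule frechet_derivative_eq)
  qed
qed

lemma continuous_compact_support_bounded:
  fixes f :: "'a::euclidean_space \<Rightarrow> 'b::real_normed_vector"
  assumes "continuous_on UNIV f" "\<And>x. norm x > R \<Longrightarrow> f x = 0"
  obtains M where "M \<ge> 0" "\<And>x. norm (f x) \<le> M"
proof -
  have "compact (f ` cball 0 R)"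
    by (intro compact_continuous_image continuous_on_subset[OF assms(1)]) auto
  then obtain M where "M > 0" "\<And>x. norm x \<le> R \<Longrightarrow> norm (f x) \<le> M"
    using compact_imp_bounded[of "f ` cball 0 R"] unfolding bounded_pos by auto
  then show ?thesis using that[of M] assms(2) by (metis less_eq_real_def norm_zero not_less)
qed

lemma test_function_bounded:
  assumes "test_function f" obtains M where "M \<ge> 0" "\<And>x. norm (f x) \<le> M"
  using assms continuous_compact_support_bounded test_function_support smooth_continuous test_function_smooth
  by metis

lemma frechet_derivative_basis:
  assumes "f differentiable (at x)"
  shows "frechet_derivative f (at x) v = (\<Sum>b\<in>Basis. (v \<bullet> b) *\<^sub>R frechet_derivative f (at x) b)"
proof -
  have l: "linear (frechet_derivative f (at x))" by (rule linear_frechet_derivative) fact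
  have "frechet_derivative f (at x) v = frechet_derivative f (at x) (\<Sum>b\<in>Basis. (v \<bullet> b) *\<^sub>R b)"
    by (simp add: euclidean_representation)
  then show ?thesis by (simp add: linear_sum[OF l] linear_scale[OF l])
qed

text \<open>Compact support bounds the function and each partial derivative; a general direction is
  expanded in the basis.\<close>

lemma test_function_lipschitz:
  assumes f: "test_function f"
  obtains L where "L \<ge> 0" "\<And>x. norm (f x) \<le> L" "\<And>x v. norm (frechet_derivative f (at x) v) \<le> L * norm v"
    "\<And>x z. norm (f x - f z) \<le> L * norm (x - z)"
proof -
  obtain M where M: "M \<ge> 0" "\<And>x. norm (f x) \<le> M" by (rule test_function_bounded[OF f]) blast
  have "\<exists>N\<ge>0. \<forall>x. norm (frechet_derivative f (at x) b) \<le> N" for b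
    using test_function_bounded[OF test_function_frechet[OF f]] by metis
  then obtain N where N: "\<And>b. N b \<ge> 0" "\<And>x b. norm (frechet_derivative f (at x) b) \<le> N b" by metis
  define L where "L = M + sum N Basis"
  have "norm (frechet_derivative f (at x) v) \<le> (\<Sum>b\<in>Basis. norm v * N b)" for x v
  proof -
    have "norm (frechet_derivative f (at x) v) \<le> (\<Sum>b\<in>Basis. norm ((v \<bullet> b) *\<^sub>R frechet_derivative f (at x) b))"
      by (subst frechet_derivative_basis) (auto intro!: smooth_differentiable test_function_smooth f norm_sum simp del: norm_scaleR)
    also have "\<dots> \<le> (\<Sum>b\<in>Basis. norm v * N b)"
      by (intro sum_mono) (auto intro!: mult_mono N Basis_le_norm)
    finally show ?thesis .
  qed
  then have *: "norm (frechet_derivative f (at x) v) \<le> norm v * sum N Basis" for x v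
    by (simp add: sum_distrib_left)
  have 1: "norm (frechet_derivative f (at x) v) \<le> L * norm v" for x v
    using *[of x v] mult_nonneg_nonneg[OF M(1) norm_ge_zero[of v]] by (simp add: L_def algebra_simps)
  have 2: "norm (f x - f z) \<le> L * norm (x - z)" for x z
    by (rule lipschitz_if_derivative_bound[OF smooth_has_derivative[OF test_function_smooth[OF f]] 1])
  show ?thesis
    by (rule that[of L]) (use M N 1 2 in \<open>auto simp: L_def sum_nonneg add_increasing2\<close>)
qed

lemma test_function_C11:
  assumes f: "test_function f"
  obtains L where "L \<ge> 0" "\<And>x. norm (f x) \<le> L" "\<And>x v. norm (frechet_derivative f (at x) v) \<le> L * norm v"
    "\<And>x z. norm (f x - f z) \<le> L * norm (x - z)"
    "\<And>x z v. norm (frechet_derivative f (at x) v - frechet_derivative f (at z) v) \<le> L * norm (x - z) * norm v"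
proof -
  obtain M where M: "M \<ge> 0" "\<And>x. norm (f x) \<le> M" "\<And>x v. norm (frechet_derivative f (at x) v) \<le> M * norm v"
    "\<And>x z. norm (f x - f z) \<le> M * norm (x - z)"
    by (rule test_function_lipschitz[OF f]) blast
  have "\<exists>N\<ge>0. \<forall>x z. norm (frechet_derivative f (at x) b - frechet_derivative f (at z) b) \<le> N * norm (x - z)" for b
    using test_function_lipschitz[OF test_function_frechet[OF f]] by metis
  then obtain N where N: "\<And>b. N b \<ge> 0"
    "\<And>x z b. norm (frechet_derivative f (at x) b - frechet_derivative f (at z) b) \<le> N b * norm (x - z)" by metis
  define L where "L = M + sum N Basis"
  have MleL: "M \<le> L" using N by (simp add: L_def sum_nonneg)
  have "norm (frechet_derivative f (at x) v - frechet_derivative f (at z) v) \<le> L * norm (x - z) * norm v" for x z v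
  proof -
    have "norm (frechet_derivative f (at x) v - frechet_derivative f (at z) v)
      = norm (\<Sum>b\<in>Basis. (v \<bullet> b) *\<^sub>R (frechet_derivative f (at x) b - frechet_derivative f (at z) b))"
      by (subst (1 2) frechet_derivative_basis)
         (auto intro: smooth_differentiable test_function_smooth f simp: sum_subtractf scaleR_diff_right)
    also have "\<dots> \<le> (\<Sum>b\<in>Basis. norm v * (N b * norm (x - z)))"
      by (rule sum_norm_le) (auto intro!: mult_mono N Basis_le_norm)
    also have "\<dots> = sum N Basis * norm (x - z) * norm v"
      by (simp add: sum_distrib_right sum_distrib_left mult_ac)
    also have "\<dots> \<le> L * norm (x - z) * norm v"
      using M by (intro mult_right_mono) (auto simp: L_def)
    finally show ?thesis .
  qed
  moreover have "M * norm v \<le> L * norm v" for v :: 'a using MleL by (simp add: mult_right_mono)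
  ultimately show ?thesis
    using that[of L] M MleL by (meson order_trans)
qed

text \<open>The classical bump \<open>exp(-1/(1 - |x|^2))\<close> of the unit ball.\<close>

definition bump :: "'a::euclidean_space \<Rightarrow> real" where
  "bump x = flat_exp 1 (1 - x \<bullet> x)"

lemma bump_nonneg: "bump x \<ge> 0" and bump_pos_iff: "bump x > 0 \<longleftrightarrow> norm x < 1"
  and bump_eq_0: "norm x \<ge> 1 \<Longrightarrow> bump x = 0"
proof -
  have *: "1 - x \<bullet> x > 0 \<longleftrightarrow> norm x < 1"
    by (simp add: dot_square_norm power2_eq_square abs_square_less_1[symmetric])
       (simp add: power2_eq_square[symmetric] abs_square_less_1)
  show "bump x \<ge> 0" unfolding bump_def by (rule flat_exp_1_pos)
  show 1: "bump x > 0 \<longleftrightarrow> norm x < 1" unfolding bump_def flat_exp_1_pos by (rule *)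
  show "norm x \<ge> 1 \<Longrightarrow> bump x = 0" using * by (auto simp: bump_def intro!: flat_exp_1_pos(3))
qed

lemma smooth_bump: "smooth bump"
proof -
  have "smooth (\<lambda>x::'a. 1 + (-1) * (x \<bullet> x))"
    by (intro smooth_add smooth_const smooth_mult smooth_inner smooth_linear bounded_linear_ident)
  then show ?thesis unfolding bump_def[abs_def]
    using smooth_compose[OF smooth_flat_exp[of 1]] by force
qed

section \<open>Mollifiers\<close>

lemma test_function_scale:
  assumes "test_function f" "\<epsilon> > 0"
  shows "test_function (\<lambda>x. f (c + x /\<^sub>R \<epsilon>))"
proof -
  obtain R where R: "R > 0" "\<And>x. norm x > R \<Longrightarrow> f x = 0" by (rule test_function_support[OF assms(1)]) blast
  show ?thesis
  proof (rule test_functionI)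
    show "smooth (\<lambda>x. f (c + x /\<^sub>R \<epsilon>))"
      by (intro smooth_affine bounded_linear_scaleR_right test_function_smooth assms)
    fix x :: 'a assume "norm x > (R + norm c) * \<epsilon>"
    then have "norm (x /\<^sub>R \<epsilon>) > R + norm c" using \<open>\<epsilon> > 0\<close> by (simp add: field_simps)
    then have "norm (c + x /\<^sub>R \<epsilon>) > R"
      using norm_triangle_ineq2[of "x /\<^sub>R \<epsilon>" "- c"] by (simp add: add.commute)
    then show "f (c + x /\<^sub>R \<epsilon>) = 0" by (rule R)
  qed
qed

lemma test_function_integrable:
  fixes f :: "'a::euclidean_space \<Rightarrow> 'b::{banach, second_countable_topology}"
  assumes "test_function f" shows "integrable lborel f"
proof -
  obtain R where R: "R > 0" "\<And>x. norm x > R \<Longrightarrow> f x = 0" by (rule test_function_support[OF assms(1)]) blast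
  have "integrable lborel (\<lambda>x. indicator (cball 0 R) x *\<^sub>R f x)"
    by (rule borel_integrable_compact) (auto intro: smooth_continuous test_function_smooth assms)
  moreover have "indicator (cball 0 R) x *\<^sub>R f x = f x" for x
    using R by (auto simp: indicator_def not_le)
  ultimately show ?thesis by simp
qed

lemma test_function_mult:
  fixes f :: "'a::euclidean_space \<Rightarrow> real"
  assumes "smooth g" "test_function f" shows "test_function (\<lambda>x. g x * f x)"
proof -
  obtain R where R: "R > 0" "\<And>x. norm x > R \<Longrightarrow> f x = 0" by (rule test_function_support[OF assms(2)]) blast
  show ?thesis
    by (rule test_functionI[of _ R]) (auto intro: smooth_mult assms test_function_smooth simp: R)
qed

text \<open>Dividing by the integral of the scaled bump itself normalises the mass without a change
  of variables.\<close>

definition mollifier :: "real \<Rightarrow> 'a::euclidean_space \<Rightarrow> real" where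
  "mollifier \<epsilon> x = inverse (\<integral>y. bump (y /\<^sub>R \<epsilon>) \<partial>(lborel :: 'a measure)) * bump (x /\<^sub>R \<epsilon>)"

context
  fixes \<epsilon> :: real assumes eps: "\<epsilon> > 0"
begin

lemma test_function_bump_scaled: "test_function (\<lambda>x::'a::euclidean_space. bump (x /\<^sub>R \<epsilon>))"
proof -
  have "test_function (bump :: 'a \<Rightarrow> real)" by (rule test_functionI[OF smooth_bump, of 1]) (simp add: bump_eq_0)
  from test_function_scale[OF this eps, of 0] show ?thesis by simp
qed

lemma integral_bump_pos: "(\<integral>y. bump (y /\<^sub>R \<epsilon>) \<partial>(lborel :: 'a::euclidean_space measure)) > 0"
proof -
  let ?f = "\<lambda>y::'a. bump (y /\<^sub>R \<epsilon>)"
  have i: "integrable lborel ?f" by (rule test_function_integrable[OF test_function_bump_scaled])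
  have "(\<integral>y. ?f y \<partial>lborel) \<ge> 0" by (rule Bochner_Integration.integral_nonneg) (simp add: bump_nonneg)
  moreover have "(\<integral>y. ?f y \<partial>lborel) \<noteq> 0"
  proof
    assume "(\<integral>y. ?f y \<partial>lborel) = 0"
    then have "AE y in lborel. ?f y = 0"
      using integral_nonneg_eq_0_iff_AE[OF i] by (simp add: bump_nonneg)
    then have "AE y in lborel. y \<notin> ball (0::'a) \<epsilon>"
      proof eventually_elim
      fix y :: 'a assume "?f y = 0"
      then have "\<not> norm (y /\<^sub>R \<epsilon>) < 1" using bump_pos_iff[of "y /\<^sub>R \<epsilon>"] by simp
      then show "y \<notin> ball 0 \<epsilon>" using eps by (simp add: field_simps)
    qed
    then have "emeasure lborel (ball (0::'a) \<epsilon>) = 0"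
      by (subst (asm) AE_iff_measurable[OF _ refl]) (auto simp: ball_def)
    then show False using emeasure_lborel_ball_finite
      content_ball_pos[OF eps, of "0::'a"] by (simp add: measure_def)
  qed
  ultimately show ?thesis by linarith
qed

lemma test_function_mollifier: "test_function (mollifier \<epsilon>)"
  unfolding mollifier_def[abs_def] by (intro test_function_mult smooth_const test_function_bump_scaled)

lemma mollifier_nonneg: "mollifier \<epsilon> x \<ge> 0"
  unfolding mollifier_def
  by (intro mult_nonneg_nonneg bump_nonneg) (simp add: less_imp_le[OF integral_bump_pos])

lemma mollifier_eq_0: "norm x \<ge> \<epsilon> \<Longrightarrow> mollifier \<epsilon> x = 0"
  unfolding mollifier_def using eps by (subst bump_eq_0) (auto simp: field_simps)

lemma integrable_mollifier: "integrable lborel (mollifier \<epsilon>)"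
  by (rule test_function_integrable[OF test_function_mollifier])

lemma integral_mollifier: "(\<integral>x. mollifier \<epsilon> x \<partial>(lborel::'a::euclidean_space measure)) = 1"
  unfolding mollifier_def using integral_bump_pos[where 'a='a] by (simp add: less_imp_neq[symmetric])

end

section \<open>Convolution with a test function\<close>

definition conv :: "('a::euclidean_space \<Rightarrow> real) \<Rightarrow> ('a \<Rightarrow> real) \<Rightarrow> 'a \<Rightarrow> real" where
  "conv g \<eta> x = (\<integral>y. g y * \<eta> (x - y) \<partial>lborel)"

text \<open>Convolution in time is later applied to a function of which only measurability and
  bounds on bounded sets are known, so continuity is not built in.\<close>

definition locally_bdd :: "('a::euclidean_space \<Rightarrow> real) \<Rightarrow> bool" where
  "locally_bdd g \<longleftrightarrow> g \<in> borel_measurable borel \<and> (\<forall>R. \<exists>B. \<forall>y. norm y \<le> R \<longrightarrow> \<bar>g y\<bar> \<le> B)"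

lemma locally_bdd_continuous: "continuous_on UNIV g \<Longrightarrow> locally_bdd g"
  unfolding locally_bdd_def
proof (intro conjI allI)
  fix R assume c: "continuous_on UNIV g"
  have "compact (g ` cball 0 R)"
    by (intro compact_continuous_image continuous_on_subset[OF c]) auto
  from compact_imp_bounded[OF this] show "\<exists>B. \<forall>y. norm y \<le> R \<longrightarrow> \<bar>g y\<bar> \<le> B"
    unfolding bounded_iff by (metis imageI mem_cball_0 real_norm_def)
qed (rule borel_measurable_continuous_onI)

lemma integrable_locally_bdd:
  assumes "locally_bdd g" shows "integrable lborel (\<lambda>y. g y * indicator (cball x R) y)"
proof -
  have [measurable]: "g \<in> borel_measurable borel" using assms by (simp add: locally_bdd_def)
  obtain B where B: "\<And>y. norm y \<le> norm x + R \<Longrightarrow> \<bar>g y\<bar> \<le> B"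
    using assms unfolding locally_bdd_def by metis
  have "integrable lborel (\<lambda>y. indicator (cball x R) y * B)"
    by (intro integrable_mult_left integrable_real_indicator) (use emeasure_lborel_cball_finite in \<open>auto simp: less_top\<close>)
  then show ?thesis
  proof (rule Bochner_Integration.integrable_bound)
    show "AE y in lborel. norm (g y * indicator (cball x R) y) \<le> norm (indicator (cball x R) y * B)"
    proof (rule AE_I2)
      fix y show "norm (g y * indicator (cball x R) y) \<le> norm (indicator (cball x R) y * B)"
      proof (cases "y \<in> cball x R")
        case True
        have "norm y \<le> norm x + norm (x - y)" using norm_triangle_ineq4[of x "x - y"] by simp
        then have "\<bar>g y\<bar> \<le> B" using True by (intro B) (auto simp: dist_norm)
        then show ?thesis using True by simp
      qed simp
    qed
  qed (intro borel_measurable_times borel_measurable_indicator, auto)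
qed

lemma integrable_conv:
  assumes g: "locally_bdd g" and \<eta>: "test_function \<eta>"
  shows "integrable lborel (\<lambda>y. g y * \<eta> (x - y))"
proof -
  obtain R where R: "R > 0" "\<And>x. norm x > R \<Longrightarrow> \<eta> x = 0" by (rule test_function_support[OF \<eta>]) blast
  obtain M where M: "M \<ge> 0" "\<And>x. norm (\<eta> x) \<le> M" by (rule test_function_bounded[OF \<eta>]) blast
  have [measurable]: "g \<in> borel_measurable borel" using g by (simp add: locally_bdd_def)
  have [measurable]: "\<eta> \<in> borel_measurable borel"
    by (rule borel_measurable_continuous_onI[OF smooth_continuous[OF test_function_smooth[OF \<eta>]]])
  have "integrable lborel (\<lambda>y. (g y * indicator (cball x R) y) * M)"
    by (intro integrable_mult_left integrable_locally_bdd g)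
  then show ?thesis
  proof (rule Bochner_Integration.integrable_bound)
    show "AE y in lborel. norm (g y * \<eta> (x - y)) \<le> norm (g y * indicator (cball x R) y * M)"
      using M R by (intro AE_I2) (auto simp: abs_mult indicator_def dist_norm intro!: mult_left_mono)
  qed simp
qed

lemma conv_has_derivative:
  assumes g: "locally_bdd g" and \<eta>: "test_function \<eta>"
  shows "(conv g \<eta> has_derivative (\<lambda>v. conv g (\<lambda>x. frechet_derivative \<eta> (at x) v) x)) (at x)"
proof -
  obtain R where R: "R > 0" "\<And>x. norm x > R \<Longrightarrow> \<eta> x = 0" by (rule test_function_support[OF \<eta>]) blast
  obtain L where L: "L \<ge> 0" "\<And>x. norm (\<eta> x) \<le> L" "\<And>x v. norm (frechet_derivative \<eta> (at x) v) \<le> L * norm v"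
    "\<And>x z. norm (\<eta> x - \<eta> z) \<le> L * norm (x - z)"
    "\<And>x z v. norm (frechet_derivative \<eta> (at x) v - frechet_derivative \<eta> (at z) v) \<le> L * norm (x - z) * norm v"
    by (rule test_function_C11[OF \<eta>]) blast
  have d: "(\<eta> has_derivative frechet_derivative \<eta> (at z)) (at z)" for z
    by (rule smooth_has_derivative[OF test_function_smooth[OF \<eta>]])
  have d0: "frechet_derivative \<eta> (at z) v = 0" if "norm z > R" for z v
  proof (rule frechet_derivative_eq)
    have "((\<lambda>x. 0) has_derivative (\<lambda>v. 0)) (at z)" by simp
    then show "(\<eta> has_derivative (\<lambda>v. 0)) (at z)"
      by (rule has_derivative_transform_within_open[of _ _ z UNIV "- cball 0 R"]) (use R that in auto)
  qed
  have q: "\<bar>\<eta> z' - \<eta> z - frechet_derivative \<eta> (at z) (z' - z)\<bar> \<le> L * (norm (z' - z))\<^sup>2" for z z'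
    using quadratic_remainder[of z z' \<eta> "\<lambda>z. frechet_derivative \<eta> (at z)" L] d L by auto
  show ?thesis unfolding conv_def[abs_def]
  proof (rule has_derivative_integral_quadratic[where r=1 and c="\<lambda>y. \<bar>g y * indicator (cball x (R+1)) y\<bar> * L"])
    show "integrable lborel (\<lambda>y. \<bar>g y * indicator (cball x (R+1)) y\<bar> * L)"
      by (intro integrable_mult_left integrable_abs integrable_locally_bdd g)
    show "integrable lborel (\<lambda>y. g y * \<eta> (x' - y))" for x' by (rule integrable_conv[OF g \<eta>])
    show "integrable lborel (\<lambda>y. g y * frechet_derivative \<eta> (at (x - y)) v)" for v
      by (rule integrable_conv[OF g test_function_frechet[OF \<eta>]])
    show "linear (\<lambda>v. g y * frechet_derivative \<eta> (at (x - y)) v)" for y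
      using linear_compose[OF has_derivative_linear[OF d] linear_times[of "g y"]] by (simp add: o_def)
    fix y x' :: 'a assume x': "norm (x' - x) \<le> 1"
    have e: "g y * \<eta> (x' - y) - g y * \<eta> (x - y) - g y * frechet_derivative \<eta> (at (x - y)) (x' - x)
       = g y * (\<eta> (x' - y) - \<eta> (x - y) - frechet_derivative \<eta> (at (x - y)) (x' - x))"
      by (simp add: algebra_simps)
    show "norm (g y * \<eta> (x' - y) - g y * \<eta> (x - y) - g y * frechet_derivative \<eta> (at (x - y)) (x' - x))
       \<le> \<bar>g y * indicator (cball x (R+1)) y\<bar> * L * (norm (x' - x))\<^sup>2"
    \<comment> \<open>For \<open>x'\<close> within distance 1 of \<open>x\<close>, all terms at
      \<open>x\<close> and \<open>x'\<close> vanish unless \<open>y\<close> is within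
      \<open>R + 1\<close> of \<open>x\<close>; this localises the majorant and makes it
      integrable.\<close>
    proof (cases "y \<in> cball x (R + 1)")
      case True
      then show ?thesis using q[of "x' - y" "x - y"] unfolding e
        by (auto simp: abs_mult mult.assoc intro!: mult_left_mono)
    next
      case False
      then have "norm (x - y) > R + 1" by (auto simp: dist_norm)
      moreover have "norm (x - y) \<le> norm (x' - y) + norm (x' - x)"
        using norm_triangle_ineq4[of "x' - y" "x' - x"] by simp
      ultimately have "norm (x - y) > R" "norm (x' - y) > R" using x' by auto
      then show ?thesis using R d0 L(1) by simp
    qed
  qed simp
qed

lemma iter_deriv_conv:
  assumes g: "locally_bdd g"
  shows "test_function \<eta> \<Longrightarrow> iter_deriv vs (conv g \<eta>) = conv g (iter_deriv vs \<eta>) \<and> test_function (iter_deriv vs \<eta>)"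
proof (induction vs)
  case (Cons v vs)
  then show ?case using frechet_derivative_eq[OF conv_has_derivative[OF g, of "iter_deriv vs \<eta>"]]
    by (auto intro: test_function_frechet)
qed simp

lemma smooth_conv:
  assumes g: "locally_bdd g" and \<eta>: "test_function \<eta>"
  shows "smooth (conv g \<eta>)"
  unfolding smooth_def using iter_deriv_conv[OF g \<eta>] conv_has_derivative[OF g]
  by (metis differentiableI)

lemma conv_reflect:
  assumes "locally_bdd g" "test_function \<eta>"
  shows "conv g \<eta> x = (\<integral>z. g (x - z) * \<eta> z \<partial>lborel)"
    and "integrable lborel (\<lambda>z. g (x - z) * \<eta> z)"
proof -
  have [measurable]: "g \<in> borel_measurable borel" using assms by (simp add: locally_bdd_def)
  have [measurable]: "\<eta> \<in> borel_measurable borel"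
    by (rule borel_measurable_continuous_onI[OF smooth_continuous[OF test_function_smooth[OF assms(2)]]])
  show "conv g \<eta> x = (\<integral>z. g (x - z) * \<eta> z \<partial>lborel)"
    using lborel_integral_reflect(1)[of "\<lambda>z. g (x - z) * \<eta> z" x] by (simp add: conv_def)
  show "integrable lborel (\<lambda>z. g (x - z) * \<eta> z)"
    using lborel_integral_reflect(2)[of "\<lambda>z. g (x - z) * \<eta> z" x] integrable_conv[OF assms, of x] by simp
qed

lemma conv_eq_0:
  assumes "\<And>y. norm y > R \<Longrightarrow> g y = 0" "\<And>y. norm y > r \<Longrightarrow> \<eta> y = 0" "norm x > R + r"
  shows "conv g \<eta> x = 0"
proof -
  have "g y * \<eta> (x - y) = 0" for y
    using assms norm_triangle_ineq[of y "x - y"] by (cases "norm y > R") auto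
  then have "(\<lambda>y. g y * \<eta> (x - y)) = (\<lambda>y. 0)" by blast
  then show ?thesis by (simp add: conv_def)
qed

text \<open>An average of values within \<open>B\<close> of \<open>c\<close> is within
  \<open>B\<close> of \<open>c\<close>. The free constant \<open>c\<close> covers sup bounds
  (\<open>c = 0\<close>), convergence (\<open>c = g x\<close>), plateaus and ranges alike.\<close>

lemma conv_mollifier_bound:
  fixes c :: real and x :: "'a::euclidean_space"
  assumes g: "locally_bdd g" and e: "\<epsilon> > 0" and b: "\<And>z. norm z < \<epsilon> \<Longrightarrow> \<bar>g (x - z) - c\<bar> \<le> B"
  shows "\<bar>conv g (mollifier \<epsilon>) x - c\<bar> \<le> B"
proof -
  note m = integrable_mollifier[OF e, where 'a='a] and m1 = integral_mollifier[OF e, where 'a='a]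
  note r = conv_reflect[OF g test_function_mollifier[OF e]]
  have "conv g (mollifier \<epsilon>) x - c = (\<integral>z. g (x - z) * mollifier \<epsilon> z - c * mollifier \<epsilon> z \<partial>lborel)"
    using m1 by (subst Bochner_Integration.integral_diff) (auto simp: r m)
  also have "norm \<dots> \<le> (\<integral>z. B * mollifier \<epsilon> z \<partial>(lborel :: 'a measure))"
  proof (rule integral_norm_bound_ineq)
    fix z :: 'a
    show "norm (g (x - z) * mollifier \<epsilon> z - c * mollifier \<epsilon> z) \<le> B * mollifier \<epsilon> z"
      using b[of z] mollifier_eq_0[OF e, of z] mollifier_nonneg[OF e, of z]
      by (cases "norm z < \<epsilon>") (auto simp: left_diff_distrib[symmetric] abs_mult intro!: mult_right_mono)
  qed (simp add: m)
  finally show ?thesis using m1 by simp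
qed

section \<open>Regularity of the kernel\<close>

lemma frechet_derivative_bound_basis:
  fixes f :: "'a::euclidean_space \<Rightarrow> 'b::real_normed_vector"
  fixes N :: real
  assumes "f differentiable (at x)" "\<And>b. b \<in> Basis \<Longrightarrow> norm (frechet_derivative f (at x) b) \<le> N"
  shows "norm (frechet_derivative f (at x) v) \<le> (DIM('a) * N) * norm v"
proof -
  have "norm (frechet_derivative f (at x) v) \<le> (\<Sum>b\<in>(Basis::'a set). norm v * N)"
    unfolding frechet_derivative_basis[OF assms(1), of v]
    by (rule sum_norm_le) (auto intro!: mult_mono assms Basis_le_norm)
  then show ?thesis by (simp add: mult_ac)
qed

lemma frechet_derivative_diff_bound_basis:
  fixes f :: "'a::euclidean_space \<Rightarrow> 'b::real_normed_vector"
  fixes N :: real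
  assumes "f differentiable (at x)" "f differentiable (at z)"
    "\<And>b. b \<in> Basis \<Longrightarrow> norm (frechet_derivative f (at x) b - frechet_derivative f (at z) b) \<le> N"
  shows "norm (frechet_derivative f (at x) v - frechet_derivative f (at z) v) \<le> (DIM('a) * N) * norm v"
proof -
  have "norm (frechet_derivative f (at x) v - frechet_derivative f (at z) v) =
     norm (\<Sum>b\<in>(Basis::'a set). (v \<bullet> b) *\<^sub>R (frechet_derivative f (at x) b - frechet_derivative f (at z) b))"
    unfolding frechet_derivative_basis[OF assms(1), of v] frechet_derivative_basis[OF assms(2), of v]
    by (simp add: sum_subtractf scaleR_diff_right)
  also have "\<dots> \<le> (\<Sum>b\<in>(Basis::'a set). norm v * N)"
    by (rule sum_norm_le) (auto intro!: mult_mono assms Basis_le_norm)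
  finally show ?thesis by (simp add: mult_ac)
qed

text \<open>The second order remainders of the \<open>fn n\<close> are bounded independently of
  \<open>n\<close>. So the derivatives stay close to difference quotients, which converge, and are
  therefore Cauchy; in the limit the same remainder bound proves differentiability. Of the functions
  themselves only pointwise convergence is asked.\<close>

lemma C11_limit:
  fixes f :: "'a::euclidean_space \<Rightarrow> real"
  assumes lim: "\<And>x. (\<lambda>n. fn n x) \<longlonglongrightarrow> f x"
    and d: "\<And>n x. (fn n has_derivative D n x) (at x)"
    and L: "\<And>n x z v. \<bar>D n x v - D n z v\<bar> \<le> L * norm (x - z) * norm v" and "L \<ge> 0"
  shows "\<exists>D'. (\<forall>x. (f has_derivative D' x) (at x)) \<and> (\<forall>x v. (\<lambda>n. D n x v) \<longlonglongrightarrow> D' x v)"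
proof -
  have q: "\<bar>fn n x' - fn n x - D n x (x' - x)\<bar> \<le> L * (norm (x' - x))\<^sup>2" for n x x'
    using quadratic_remainder[of x x' "fn n" "D n" L] d L \<open>L \<ge> 0\<close> by auto
  have "Cauchy (\<lambda>n. D n x v)" for x v
  proof (rule metric_CauchyI)
    fix e :: real assume e: "e > 0"
    \<comment> \<open>This step size makes the error \<open>s L |v|^2\<close> of the difference
      quotient at most \<open>e/4\<close>; the \<open>+ 1\<close> covers the case
      \<open>L |v|^2 = 0\<close>.\<close>
    define s where "s = e / (4 * (L * (norm v)\<^sup>2 + 1))"
    have pos: "L * (norm v)\<^sup>2 + 1 > 0" using \<open>L \<ge> 0\<close> by (simp add: add_nonneg_pos)
    have s: "s > 0" using e pos by (simp add: s_def)
    have "s * (L * (norm v)\<^sup>2) \<le> s * (L * (norm v)\<^sup>2 + 1)" using s by (intro mult_left_mono) auto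
    also have "\<dots> = e / 4" using pos by (simp add: s_def field_simps)
    finally have sm: "s * (L * (norm v)\<^sup>2) \<le> e / 4" .
    have "convergent (\<lambda>n. (fn n (x + s *\<^sub>R v) - fn n x) / s)"
      by (rule convergentI) (use s in \<open>auto intro!: tendsto_intros lim\<close>)
    then have "Cauchy (\<lambda>n. (fn n (x + s *\<^sub>R v) - fn n x) / s)" by (rule convergent_Cauchy)
    from metric_CauchyD[OF this, of "e / 4"] obtain M where
      M: "\<And>m n. m \<ge> M \<Longrightarrow> n \<ge> M \<Longrightarrow>
        \<bar>(fn m (x + s *\<^sub>R v) - fn m x) / s - (fn n (x + s *\<^sub>R v) - fn n x) / s\<bar> < e / 4"
      using e by (auto simp: dist_real_def)
    have q': "\<bar>(fn n (x + s *\<^sub>R v) - fn n x) / s - D n x v\<bar> \<le> e / 4" for n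
    proof -
      have "D n x (s *\<^sub>R v) = s * D n x v"
        using linear_scale[OF has_derivative_linear[OF d]] by simp
      then have "\<bar>(fn n (x + s *\<^sub>R v) - fn n x) - s * D n x v\<bar> \<le> L * (s * norm v)\<^sup>2"
        using q[of n "x + s *\<^sub>R v" x] s by simp
      then have "\<bar>(fn n (x + s *\<^sub>R v) - fn n x) - s * D n x v\<bar> / s \<le> s * (L * (norm v)\<^sup>2)"
        using s by (simp add: divide_le_eq power2_eq_square mult_ac)
      moreover have "(fn n (x + s *\<^sub>R v) - fn n x) / s - D n x v = ((fn n (x + s *\<^sub>R v) - fn n x) - s * D n x v) / s"
        using s by (simp add: field_simps)
      ultimately show ?thesis using sm s abs_divide[of _ s] by (metis abs_of_pos order_trans)
    qed
    have "dist (D m x v) (D n x v) < e" if "m \<ge> M" "n \<ge> M" for m n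
      using q'[of m] q'[of n] M[OF that] unfolding dist_real_def by linarith
    then show "\<exists>M. \<forall>m\<ge>M. \<forall>n\<ge>M. dist (D m x v) (D n x v) < e" by blast
  qed
  then have "\<exists>l. (\<lambda>n. D n x v) \<longlonglongrightarrow> l" for x v by (simp add: Cauchy_convergent_iff convergent_def)
  then obtain D' where D': "\<And>x v. (\<lambda>n. D n x v) \<longlonglongrightarrow> D' x v" by metis
  have lin: "linear (D' x)" for x
  proof (rule linearI)
    show "D' x (v + u) = D' x v + D' x u" for v u
    proof (rule LIMSEQ_unique[OF D'])
      show "(\<lambda>n. D n x (v + u)) \<longlonglongrightarrow> D' x v + D' x u"
        unfolding linear_add[OF has_derivative_linear[OF d]] by (intro tendsto_intros D')
    qed
    show "D' x (r *\<^sub>R v) = r *\<^sub>R D' x v" for r v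
    proof (rule LIMSEQ_unique[OF D'])
      show "(\<lambda>n. D n x (r *\<^sub>R v)) \<longlonglongrightarrow> r *\<^sub>R D' x v"
        unfolding linear_scale[OF has_derivative_linear[OF d]] by (intro tendsto_intros D')
    qed
  qed
  have "(f has_derivative D' x) (at x)" for x
  proof (rule has_derivativeI_sandwich[where e=1])
    show "bounded_linear (D' x)" using lin by (simp add: linear_conv_bounded_linear)
    fix x' assume x': "x' \<in> UNIV" "x' \<noteq> x" "dist x' x < 1"
    have "\<bar>f x' - f x - D' x (x' - x)\<bar> \<le> L * (norm (x' - x))\<^sup>2"
    proof (rule LIMSEQ_le_const2)
      show "(\<lambda>n. \<bar>fn n x' - fn n x - D n x (x' - x)\<bar>) \<longlonglongrightarrow> \<bar>f x' - f x - D' x (x' - x)\<bar>"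
        by (intro tendsto_intros lim D')
    qed (use q in blast)
    then show "norm (f x' - f x - D' x (x' - x)) / norm (x' - x) \<le> L * norm (x' - x)"
      using x' by (simp add: divide_simps power2_eq_square mult.assoc)
  next
    have "((\<lambda>x'. L * norm (x' - x)) \<longlongrightarrow> L * norm (x - x)) (at x)" by (intro tendsto_intros)
    then show "((\<lambda>x'. L * norm (x' - x)) \<longlongrightarrow> 0) (at x)" by simp
  qed simp
  with D' show ?thesis by blast
qed

lemma iter_deriv_uminus:
  fixes f :: "'a::euclidean_space \<Rightarrow> real"
  assumes "smooth f" shows "iter_deriv (map uminus vs) f = (\<lambda>x. (-1) ^ length vs * iter_deriv vs f x)"
proof (induction vs)
  case (Cons v vs)
  have d: "((\<lambda>x. (-1) ^ length vs * iter_deriv vs f x) has_derivative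
     (\<lambda>v. (-1) ^ length vs * frechet_derivative (iter_deriv vs f) (at x) v)) (at x)" for x
    by (intro has_derivative_mult_right smooth_has_derivative smooth_iter_deriv assms)
  have "frechet_derivative (iter_deriv vs f) (at x) (- v) = - frechet_derivative (iter_deriv vs f) (at x) v" for x
    by (rule linear_neg[OF linear_frechet_derivative[OF smooth_differentiable[OF smooth_iter_deriv[OF assms]]]])
  then show ?case unfolding list.map iter_deriv.simps Cons.IH frechet_derivative_eq[OF d] by simp
qed simp

lemma in_linf_AE_bound:
  assumes "in_linf g" obtains M where "M \<ge> 0" "AE x in lborel. \<bar>g x\<bar> \<le> M"
proof -
  have "linf_norm g < \<top>" using assms by (simp add: in_linf_def)
  then obtain M where M: "M \<ge> 0" "linf_norm g = ennreal M" by (cases "linf_norm g") auto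
  have "AE x in lborel. ennreal \<bar>g x\<bar> \<le> linf_norm g" unfolding linf_norm_def by (rule esssup_AE)
  then have "AE x in lborel. \<bar>g x\<bar> \<le> M" by eventually_elim (use M in auto)
  then show ?thesis using M(1) that by blast
qed

text \<open>A strict violation at one point would persist on a ball, which has positive
  measure.\<close>

lemma AE_lborel_continuous_le:
  fixes f :: "'a::euclidean_space \<Rightarrow> real"
  assumes "continuous_on UNIV f" "AE x in lborel. f x \<le> M" shows "f x \<le> M"
proof (rule ccontr)
  assume "\<not> f x \<le> M"
  then have x: "x \<in> {x. M < f x}" by simp
  have op: "open {x. M < f x}" using assms(1)
    by (intro open_Collect_less continuous_on_const)
  obtain e where e: "e > 0" "ball x e \<subseteq> {x. M < f x}" by (rule openE[OF op x])
  have "AE y in lborel. y \<notin> ball x e" using assms(2)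
  proof eventually_elim
    fix y assume "f y \<le> M"
    then show "y \<notin> ball x e" using e(2) by (metis linorder_not_le mem_Collect_eq subsetD)
  qed
  then have "emeasure lborel (ball x e) = 0"
    using AE_iff_null_sets[of "ball x e"] by (simp add: null_sets_def)
  then show False using content_ball_pos[OF e(1), of x] by (simp add: measure_def)
qed

text \<open>Testing the weak derivative \<open>g\<close> against
  \<open>\<lambda>y. \<eta> (x - y)\<close> shows that the derivative of the mollified kernel is
  \<open>g\<close> convolved with \<open>\<eta>\<close>; as \<open>\<eta>\<close> is nonnegative
  with mass 1, the essential bound of \<open>g\<close> is inherited, uniformly in
  \<open>\<epsilon>\<close>. The sign from the reflection cancels the sign in the definition of the
  weak derivative.\<close>

lemma conv_mollifier_iter_deriv_bound:
  assumes K: "continuous_on UNIV K" "sobolev_inf k K" and bs: "set bs \<subseteq> Basis" "length bs \<le> k"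
  shows "\<exists>M\<ge>0. \<forall>\<epsilon>>0. \<forall>x. \<bar>iter_deriv bs (conv K (mollifier \<epsilon>)) x\<bar> \<le> M"
proof -
  obtain g where g: "in_linf g" and w: "\<And>\<phi>::'a \<Rightarrow> real. test_function \<phi> \<Longrightarrow>
    (\<integral>x. K x * iter_deriv bs \<phi> x \<partial>lborel) = (-1) ^ length bs * (\<integral>x. g x * \<phi> x \<partial>lborel)"
    using K(2) bs unfolding sobolev_inf_def by metis
  obtain M where M: "M \<ge> 0" "AE x in lborel. \<bar>g x\<bar> \<le> M" by (rule in_linf_AE_bound[OF g])
  have [measurable]: "g \<in> borel_measurable borel" using g by (simp add: in_linf_def)
  show ?thesis
  proof (intro exI[of _ M] conjI allI impI M(1))
    fix \<epsilon> :: real and x assume e: "\<epsilon> > 0"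
    let ?\<eta> = "mollifier \<epsilon> :: 'a \<Rightarrow> real"
    note t = test_function_mollifier[OF e, where 'a='a] and sm = test_function_smooth[OF test_function_mollifier[OF e, where 'a='a]]
    have [measurable]: "?\<eta> \<in> borel_measurable borel"
      by (rule borel_measurable_continuous_onI[OF smooth_continuous[OF sm]])
    have tf: "test_function (\<lambda>y. ?\<eta> (x + - y))"
    proof (rule test_functionI[of _ "\<epsilon> + norm x"])
      show "smooth (\<lambda>y. ?\<eta> (x + - y))" by (rule smooth_affine[OF bounded_linear_minus[OF bounded_linear_ident] sm])
      fix y :: 'a assume "norm y > \<epsilon> + norm x"
      then have "norm (x - y) \<ge> \<epsilon>" using norm_triangle_ineq2[of y x] by (simp add: norm_minus_commute)
      then show "?\<eta> (x + - y) = 0" using mollifier_eq_0[OF e] by simp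
    qed
    have "iter_deriv bs (\<lambda>y. ?\<eta> (x + - y)) y = (-1) ^ length bs * iter_deriv bs ?\<eta> (x - y)" for y
      using iter_deriv_affine[OF bounded_linear_minus[OF bounded_linear_ident] sm, of bs x] iter_deriv_uminus[OF sm, of bs]
      by simp
    then have "(-1) ^ length bs * conv K (iter_deriv bs ?\<eta>) x = (-1) ^ length bs * (\<integral>y. g y * ?\<eta> (x - y) \<partial>lborel)"
      using w[OF tf] by (simp add: conv_def mult.left_commute[of "K _"])
    then have e1: "iter_deriv bs (conv K ?\<eta>) x = (\<integral>y. g y * ?\<eta> (x - y) \<partial>lborel)"
      using iter_deriv_conv[OF locally_bdd_continuous[OF K(1)] t, of bs] by simp
    have i1: "integrable lborel (\<lambda>y. M * ?\<eta> (x - y))"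
      using lborel_integral_reflect(2)[of ?\<eta> x] integrable_mollifier[OF e, where 'a='a] by simp
    have b: "AE y in lborel. \<bar>g y * ?\<eta> (x - y)\<bar> \<le> M * ?\<eta> (x - y)"
      using M(2) by eventually_elim (auto simp: abs_mult mollifier_nonneg[OF e] intro!: mult_right_mono)
    then have "AE y in lborel. norm (g y * ?\<eta> (x - y)) \<le> norm (M * ?\<eta> (x - y))"
      by eventually_elim auto
    then have i2: "integrable lborel (\<lambda>y. g y * ?\<eta> (x - y))"
      by (rule Bochner_Integration.integrable_bound[OF i1, rotated]) simp
    have "\<bar>\<integral>y. g y * ?\<eta> (x - y) \<partial>lborel\<bar> \<le> (\<integral>y. \<bar>g y * ?\<eta> (x - y)\<bar> \<partial>lborel)"
      by (rule integral_abs_bound)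
    also have "\<dots> \<le> (\<integral>y. M * ?\<eta> (x - y) \<partial>lborel)"
      using i1 i2 b by (intro integral_mono_AE) auto
    also have "\<dots> = M" using lborel_integral_reflect(1)[of ?\<eta> x] integral_mollifier[OF e, where 'a='a] by simp
    finally show "\<bar>iter_deriv bs (conv K ?\<eta>) x\<bar> \<le> M" by (simp add: e1)
  qed
qed

lemma conv_mollifier_tendsto:
  assumes "continuous_on UNIV g"
  shows "(\<lambda>n. conv g (mollifier (1 / real (Suc n))) x) \<longlonglongrightarrow> g x"
proof (rule LIMSEQ_I)
  fix r :: real assume "r > 0"
  moreover have "isCont g x" using assms by (simp add: continuous_on_eq_continuous_at)
  ultimately obtain d where d: "d > 0" "\<And>y. dist y x < d \<Longrightarrow> dist (g y) (g x) < r / 2"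
    unfolding continuous_at_eps_delta by (metis half_gt_zero)
  obtain N where N: "1 / real (Suc N) < d" using d(1) nat_approx_posE by (metis)
  have "norm (conv g (mollifier (1 / real (Suc n))) x - g x) < r" if "n \<ge> N" for n
  proof -
    have "1 / real (Suc n) \<le> 1 / real (Suc N)" using that by (simp add: frac_le)
    then have "norm z < 1 / real (Suc n) \<Longrightarrow> \<bar>g (x - z) - g x\<bar> \<le> r / 2" for z
      using d(2)[of "x - z"] N by (simp add: dist_norm)
    then have "\<bar>conv g (mollifier (1 / real (Suc n))) x - g x\<bar> \<le> r / 2"
      by (intro conv_mollifier_bound locally_bdd_continuous assms) auto
    then show ?thesis using \<open>r > 0\<close> by simp
  qed
  then show "\<exists>N. \<forall>n\<ge>N. norm (conv g (mollifier (1 / real (Suc n))) x - g x) < r" by blast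
qed

lemma grad_inner:
  assumes "(f has_derivative f') (at x)" shows "grad f x \<bullet> v = f' v"
proof -
  have "grad f x \<bullet> v = (\<Sum>b\<in>Basis. (v \<bullet> b) * f' b)"
    unfolding grad_def frechet_derivative_eq[OF assms] by (simp add: inner_sum_left inner_sum_right mult.commute inner_commute)
  also have "\<dots> = f' (\<Sum>b\<in>Basis. (v \<bullet> b) *\<^sub>R b)"
    using has_derivative_linear[OF assms] by (simp add: linear_sum linear_scale)
  finally show ?thesis by (simp add: euclidean_representation)
qed

lemma grad_has_derivative:
  "f differentiable (at x) \<Longrightarrow> (f has_derivative (\<lambda>v. grad f x \<bullet> v)) (at x)"
  using grad_inner frechet_derivative_works by (metis (no_types, lifting) ext)

text \<open>Bounded third weak derivatives bound the third derivatives of the mollified kernels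
  uniformly, so their second derivatives are equi-Lipschitz. \<open>C11_limit\<close> is applied to
  the mollified kernels and then to each of their partial derivatives, and all bounds pass to the
  limit.\<close>

lemma sobolev_3_imp_C21:
  fixes K :: "'a::euclidean_space \<Rightarrow> real"
  assumes K: "continuous_on UNIV K" "sobolev_inf 3 K"
  shows "\<exists>K2 c. c \<ge> 1 \<and> (\<forall>x. (K has_derivative (\<lambda>v. grad K x \<bullet> v)) (at x)) \<and>
    (\<forall>x. (grad K has_derivative K2 x) (at x)) \<and> (\<forall>x. \<bar>K x\<bar> \<le> c) \<and> (\<forall>x. norm (grad K x) \<le> c) \<and>
    (\<forall>x v. norm (K2 x v) \<le> c * norm v) \<and> (\<forall>x z v. norm (K2 x v - K2 z v) \<le> c * norm (x - z) * norm v)"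
proof -
  define Kn where "Kn n = conv K (mollifier (1 / real (Suc n)))" for n
  let ?B = "Basis :: 'a set"
  let ?d = "real DIM('a)"
  have sm: "smooth (Kn n)" for n
    unfolding Kn_def by (intro smooth_conv locally_bdd_continuous K test_function_mollifier) simp
  have "\<exists>M\<ge>0. \<forall>n x. \<bar>iter_deriv bs (Kn n) x\<bar> \<le> M" if "set bs \<subseteq> ?B" "length bs \<le> 3" for bs
    using conv_mollifier_iter_deriv_bound[OF K that] unfolding Kn_def by (metis of_nat_0_less_iff zero_less_Suc zero_less_divide_1_iff)
  then obtain M where M: "\<And>bs. set bs \<subseteq> ?B \<Longrightarrow> length bs \<le> 3 \<Longrightarrow> M bs \<ge> 0"
    "\<And>bs n x. set bs \<subseteq> ?B \<Longrightarrow> length bs \<le> 3 \<Longrightarrow> \<bar>iter_deriv bs (Kn n) x\<bar> \<le> M bs" by metis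
  define Ms where "Ms = sum M {bs. set bs \<subseteq> ?B \<and> length bs \<le> 3}"
  have fin: "finite {bs. set bs \<subseteq> ?B \<and> length bs \<le> 3}" by (rule finite_lists_length_le) simp
  have Ms0: "Ms \<ge> 0" unfolding Ms_def by (rule sum_nonneg) (use M in auto)
  have Ms: "\<bar>iter_deriv bs (Kn n) x\<bar> \<le> Ms" if "set bs \<subseteq> ?B" "length bs \<le> 3" for bs n x
  proof -
    have "M bs \<le> Ms" unfolding Ms_def by (rule member_le_sum) (use that M fin in auto)
    then show ?thesis using M(2)[OF that] order_trans by blast
  qed
  have step: "\<bar>frechet_derivative (iter_deriv bs (Kn n)) (at x) v\<bar> \<le> ?d * Ms * norm v"
    if "set bs \<subseteq> ?B" "length bs \<le> 2" for bs n x v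
  proof -
    have "norm (frechet_derivative (iter_deriv bs (Kn n)) (at x) b) \<le> Ms" if "b \<in> ?B" for b
      using Ms[of "b # bs" n x] that \<open>set bs \<subseteq> ?B\<close> \<open>length bs \<le> 2\<close> by simp
    from frechet_derivative_bound_basis[OF smooth_differentiable[OF smooth_iter_deriv[OF sm]] this]
    show ?thesis by simp
  qed
  have lip: "\<bar>iter_deriv bs (Kn n) x - iter_deriv bs (Kn n) z\<bar> \<le> ?d * Ms * norm (x - z)"
    if "set bs \<subseteq> ?B" "length bs \<le> 2" for bs n x z
    using lipschitz_if_derivative_bound[OF smooth_has_derivative[OF smooth_iter_deriv[OF sm]], of bs n "?d * Ms" x z]
      step[OF that] by simp
  have dlip: "\<bar>frechet_derivative (iter_deriv bs (Kn n)) (at x) v - frechet_derivative (iter_deriv bs (Kn n)) (at z) v\<bar>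
     \<le> ?d * (?d * Ms) * norm (x - z) * norm v" if "set bs \<subseteq> ?B" "length bs \<le> 1" for bs n x z v
  proof -
    have "norm (frechet_derivative (iter_deriv bs (Kn n)) (at x) b - frechet_derivative (iter_deriv bs (Kn n)) (at z) b)
       \<le> ?d * Ms * norm (x - z)" if "b \<in> ?B" for b
      using lip[of "b # bs" n x z] that \<open>set bs \<subseteq> ?B\<close> \<open>length bs \<le> 1\<close> by simp
    from frechet_derivative_diff_bound_basis[OF smooth_differentiable[OF smooth_iter_deriv[OF sm]]
        smooth_differentiable[OF smooth_iter_deriv[OF sm]] this]
    show ?thesis by (simp add: mult_ac)
  qed
  have "\<exists>D'. (\<forall>x. (K has_derivative D' x) (at x)) \<and>
     (\<forall>x v. (\<lambda>n. frechet_derivative (Kn n) (at x) v) \<longlonglongrightarrow> D' x v)"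
  proof (rule C11_limit)
    show "(\<lambda>n. Kn n x) \<longlonglongrightarrow> K x" for x unfolding Kn_def by (rule conv_mollifier_tendsto[OF K(1)])
    show "(Kn n has_derivative frechet_derivative (Kn n) (at x)) (at x)" for n x by (rule smooth_has_derivative[OF sm])
    show "\<bar>frechet_derivative (Kn n) (at x) v - frechet_derivative (Kn n) (at z) v\<bar> \<le> ?d * (?d * Ms) * norm (x - z) * norm v" for n x z v
      using dlip[of "[]"] by simp
  qed (use Ms0 in simp)
  then obtain D1 where D1: "\<And>x. (K has_derivative D1 x) (at x)"
    "\<And>x v. (\<lambda>n. frechet_derivative (Kn n) (at x) v) \<longlonglongrightarrow> D1 x v" by blast
  have "\<exists>D'. (\<forall>x. ((\<lambda>x. D1 x b) has_derivative D' x) (at x)) \<and>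
     (\<forall>x v. (\<lambda>n. frechet_derivative (iter_deriv [b] (Kn n)) (at x) v) \<longlonglongrightarrow> D' x v)" if "b \<in> ?B" for b
  proof (rule C11_limit)
    show "(\<lambda>n. iter_deriv [b] (Kn n) x) \<longlonglongrightarrow> D1 x b" for x using D1 by simp
    show "(iter_deriv [b] (Kn n) has_derivative frechet_derivative (iter_deriv [b] (Kn n)) (at x)) (at x)" for n x
      by (rule smooth_has_derivative[OF smooth_iter_deriv[OF sm]])
    show "\<bar>frechet_derivative (iter_deriv [b] (Kn n)) (at x) v - frechet_derivative (iter_deriv [b] (Kn n)) (at z) v\<bar>
        \<le> ?d * (?d * Ms) * norm (x - z) * norm v" for n x z v
      using dlip[of "[b]"] that by simp
  qed (use Ms0 in simp)
  then obtain D2 where D2: "\<And>b x. b \<in> ?B \<Longrightarrow> ((\<lambda>x. D1 x b) has_derivative D2 b x) (at x)"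
    "\<And>b x v. b \<in> ?B \<Longrightarrow> (\<lambda>n. frechet_derivative (iter_deriv [b] (Kn n)) (at x) v) \<longlonglongrightarrow> D2 b x v" by metis
  have K1: "(K has_derivative (\<lambda>v. grad K x \<bullet> v)) (at x)" for x
    using D1 by (intro grad_has_derivative differentiableI)
  have gb: "grad K x \<bullet> v = D1 x v" for x v by (rule grad_inner[OF D1(1)])
  have gK: "grad K = (\<lambda>x. \<Sum>b\<in>?B. D1 x b *\<^sub>R b)"
    by (subst euclidean_representation[symmetric]) (simp add: gb[symmetric] euclidean_representation)
  define K2 where "K2 x v = (\<Sum>b\<in>?B. D2 b x v *\<^sub>R b)" for x v
  \<comment> \<open>A bound in the basis directions costs a factor \<open>d\<close> each time it is
    extended to vectors: once for the gradient, twice for the Hessian, three times for the Lipschitz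
    constant of the Hessian.\<close>
  define c where "c = 1 + Ms + ?d * Ms + ?d * (?d * (?d * Ms))"
  have dd: "?d \<ge> 1" using DIM_positive[where 'a='a] by linarith
  have m: "0 \<le> ?d * Ms" "?d * Ms \<le> ?d * (?d * Ms)" "?d * (?d * Ms) \<le> ?d * (?d * (?d * Ms))"
    using Ms0 dd mult_right_mono[OF dd, of "?d * Ms"] mult_right_mono[OF dd, of "?d * (?d * Ms)"] by auto
  have s: "norm (\<Sum>b\<in>?B. f b *\<^sub>R b) \<le> ?d * r" if "\<And>b. b \<in> ?B \<Longrightarrow> \<bar>f b\<bar> \<le> r" for f r
  proof -
    have "norm (\<Sum>b\<in>?B. f b *\<^sub>R b) \<le> (\<Sum>b\<in>?B. r)" by (rule sum_norm_le) (use that in auto)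
    then show ?thesis by simp
  qed
  show ?thesis
  proof (intro exI conjI allI)
    show "c \<ge> 1" using Ms0 m by (simp add: c_def)
    show "(K has_derivative (\<lambda>v. grad K x \<bullet> v)) (at x)" for x by (rule K1)
    show "(grad K has_derivative K2 x) (at x)" for x
      unfolding gK K2_def[abs_def] by (intro has_derivative_sum has_derivative_scaleR_left D2)
    show "\<bar>K x\<bar> \<le> c" for x
    proof -
      have "\<bar>K x\<bar> \<le> Ms"
        by (rule LIMSEQ_le_const2[OF tendsto_rabs[OF conv_mollifier_tendsto[OF K(1)]]])
           (use Ms[of "[]"] in \<open>auto simp: Kn_def\<close>)
      then show ?thesis using m Ms0 unfolding c_def by linarith
    qed
    show "norm (grad K x) \<le> c" for x
    proof -
      have "\<bar>D1 x b\<bar> \<le> Ms" if "b \<in> ?B" for b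
        by (rule LIMSEQ_le_const2[OF tendsto_rabs[OF D1(2)]]) (use Ms[of "[b]"] that in auto)
      from s[of "\<lambda>b. D1 x b", OF this] show ?thesis using m Ms0 unfolding gK c_def by linarith
    qed
    show "norm (K2 x v) \<le> c * norm v" for x v
    proof -
      have "\<bar>D2 b x v\<bar> \<le> ?d * Ms * norm v" if "b \<in> ?B" for b
        by (rule LIMSEQ_le_const2[OF tendsto_rabs[OF D2(2)[OF that]]]) (use step[of "[b]"] that in auto)
      from s[of "\<lambda>b. D2 b x v", OF this] have "norm (K2 x v) \<le> ?d * (?d * Ms) * norm v" by (simp add: K2_def mult_ac)
      also have "\<dots> \<le> c * norm v" by (intro mult_right_mono) (use m Ms0 c_def in linarith, simp)
      finally show ?thesis .
    qed
    show "norm (K2 x v - K2 z v) \<le> c * norm (x - z) * norm v" for x z v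
    proof -
      have "\<bar>D2 b x v - D2 b z v\<bar> \<le> ?d * (?d * Ms) * norm (x - z) * norm v" if "b \<in> ?B" for b
        by (rule LIMSEQ_le_const2[OF tendsto_rabs[OF tendsto_diff[OF D2(2)[OF that] D2(2)[OF that]]]])
           (use dlip[of "[b]"] that in auto)
      from s[of "\<lambda>b. D2 b x v - D2 b z v", OF this] have "norm (K2 x v - K2 z v) \<le> ?d * (?d * (?d * Ms)) * (norm (x - z) * norm v)"
        by (simp add: K2_def mult_ac sum_subtractf[symmetric] scaleR_diff_left)
      also have "\<dots> \<le> c * (norm (x - z) * norm v)" by (intro mult_right_mono) (use m Ms0 c_def in linarith, simp)
      finally show ?thesis by (simp add: mult_ac)
    qed
  qed
qed

section \<open>Confining potentials and the Gibbs measure\<close>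

text \<open>Each \<open>x\<close> is charged to the ball of radius \<open>n + 1\<close>, where
  \<open>n\<close> is the integer part of \<open>|x|\<close> and the integrand is at most
  \<open>(n + 1)^-(d + 2)\<close>. The volume is of order \<open>(n + 1)^d\<close>, and the
  remaining series of \<open>(n + 1)^-2\<close> converges.\<close>

lemma integrable_inverse_power_norm:
  "integrable lborel (\<lambda>x::'a::euclidean_space. 1 / (1 + norm x) ^ (DIM('a) + 2))"
proof (rule integrableI_nonneg)
  let ?d = "DIM('a)"
  define v where "v = unit_ball_vol (real ?d)"
  define a where "a n = 1 / (real (Suc n)) ^ (?d + 2)" for n
  let ?f = "\<lambda>x::'a. 1 / (1 + norm x) ^ (?d + 2)"
  have v: "v \<ge> 0" by (simp add: v_def)
  have le: "ennreal (?f x) \<le> (\<Sum>n. ennreal (a n) * indicator (cball (0::'a) (real (Suc n))) x)" for x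
  proof -
    define n where "n = nat \<lfloor>norm x\<rfloor>"
    have n: "real n \<le> norm x" "norm x \<le> real (Suc n)" unfolding n_def by (auto intro: of_nat_floor) linarith
    have "?f x \<le> a n" unfolding a_def using n by (intro divide_left_mono power_mono mult_pos_pos) auto
    then have "ennreal (?f x) \<le> ennreal (a n) * indicator (cball (0::'a) (real (Suc n))) x"
      using n by (simp add: ennreal_leI)
    also have "\<dots> \<le> (\<Sum>n. ennreal (a n) * indicator (cball (0::'a) (real (Suc n))) x)"
    proof -
      define F where "F i = ennreal (a i) * indicator (cball (0::'a) (real (Suc i))) x" for i
      have "sum F {n} \<le> suminf F" by (rule sum_le_suminf) auto
      then show ?thesis by (simp add: F_def[abs_def] del: of_nat_Suc sum_mult_indicator)
    qed
    finally show ?thesis .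
  qed
  have "(\<integral>\<^sup>+x. ennreal (?f x) \<partial>lborel) \<le> (\<integral>\<^sup>+x. (\<Sum>n. ennreal (a n) * indicator (cball (0::'a) (real (Suc n))) x) \<partial>lborel)"
    by (rule nn_integral_mono) (rule le)
  also have "\<dots> = (\<Sum>n. ennreal (a n) * emeasure lborel (cball (0::'a) (real (Suc n))))"
  proof (subst nn_integral_suminf)
    have [measurable]: "cball (0::'a) r \<in> sets borel" for r by simp
    show "(\<lambda>x. ennreal (a i) * indicator (cball (0::'a) (real (Suc i))) x) \<in> borel_measurable lborel" for i
      by measurable
  qed (simp add: nn_integral_cmult_indicator del: of_nat_Suc)
  also have "\<dots> = (\<Sum>n. ennreal (v * (1 / (real (Suc n))\<^sup>2)))"
  proof (intro suminf_cong)
    fix n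
    have "a n * (v * real (Suc n) ^ ?d) = v * (1 / (real (Suc n))\<^sup>2)"
      by (simp add: a_def power_add power2_eq_square)
    then show "ennreal (a n) * emeasure lborel (cball (0::'a) (real (Suc n))) = ennreal (v * (1 / (real (Suc n))\<^sup>2))"
      by (subst emeasure_cball) (simp_all add: v_def[symmetric] a_def ennreal_mult[symmetric] v)
  qed
  also have "\<dots> < \<infinity>"
  proof -
    have "summable (\<lambda>n. 1 / (real (Suc n))\<^sup>2)"
      using inverse_power_summable[of 2, where 'a=real] by (subst summable_Suc_iff) (simp add: inverse_eq_divide)
    then have "summable (\<lambda>n. v * (1 / (real (Suc n))\<^sup>2))" by (rule summable_mult)
    then show ?thesis using v by (subst suminf_ennreal2) auto
  qed
  finally show "(\<integral>\<^sup>+x. ennreal (?f x) \<partial>lborel) < \<infinity>" .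
qed auto

lemma grad_smooth: "smooth V \<Longrightarrow> smooth (grad V)"
  unfolding grad_def[abs_def] by (intro smooth_sum smooth_scaleR smooth_const smooth_frechet)

lemma power_le_exp:
  fixes s :: real assumes "s \<ge> 0" shows "s ^ k \<le> fact k * exp s"
proof -
  have "s ^ k /\<^sub>R fact k \<le> (\<Sum>n. s ^ n /\<^sub>R fact n)"
    using summable_exp_generic[of s] assms
    by (intro sum_le_suminf[of _ "{k}", simplified]) (auto simp: sum_le_suminf)
  then show ?thesis by (simp add: exp_def field_simps)
qed

lemma continuous_bounded_on_ball:
  fixes f :: "'a::euclidean_space \<Rightarrow> 'b::real_normed_vector"
  assumes "continuous_on UNIV f" obtains M where "M \<ge> 0" "\<And>x. norm x \<le> R \<Longrightarrow> norm (f x) \<le> M"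
proof -
  have "compact (f ` cball 0 R)"
    by (intro compact_continuous_image continuous_on_subset[OF assms]) auto
  then obtain M where "M > 0" "\<And>x. norm x \<le> R \<Longrightarrow> norm (f x) \<le> M"
    using compact_imp_bounded[of "f ` cball 0 R"] unfolding bounded_pos by auto
  then show ?thesis using that[of M] by simp
qed

locale confining =
  fixes V :: "'a::euclidean_space \<Rightarrow> real"
  assumes V_smooth: "smooth V" and V_nonneg: "\<And>x. V x \<ge> 0" and V_growth: "power_growth V"
begin

definition w where "w x = 1 + V x"

lemma w_ge_1: "w x \<ge> 1" and w_pos: "w x > 0" and w_nonneg: "w x \<ge> 0"
  using V_nonneg[of x] by (auto simp: w_def)

text \<open>The constants are enlarged to be at least 1, and the lower bound on \<open>V\<close> is
  turned into an upper bound of \<open>|x|^p\<close> by the weight, the form in which it is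
  applied.\<close>

lemma growth_bounds:
  obtains p C R where "p > 0" "C \<ge> 1" "R \<ge> 1"
    "\<And>x. norm x > R \<Longrightarrow> norm x powr p \<le> C * w x"
    "\<And>x. norm x > R \<Longrightarrow> norm (grad V x) \<le> C * (norm x powr (p - 1) + 1)"
    "\<And>x. norm x > R \<Longrightarrow> onorm (frechet_derivative (grad V) (at x)) \<le> C * (norm x powr (p - 2) + 1)"
proof -
  obtain p C R where *: "p > 0" "C > 0" "R > 0" and
   b: "\<And>x. norm x > R \<Longrightarrow> 1 / C * (norm x powr p - 1) \<le> V x \<and>
        norm (grad V x) \<le> C * (norm x powr (p - 1) + 1) \<and>
        onorm (frechet_derivative (grad V) (at x)) \<le> C * (norm x powr (p - 2) + 1)"
    using V_growth unfolding power_growth_def by metis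
  show ?thesis
  proof (rule that[of p "C + 1" "max R 1"])
    fix x :: 'a assume x: "norm x > max R 1"
    then have bx: "1 / C * (norm x powr p - 1) \<le> V x"
       "norm (grad V x) \<le> C * (norm x powr (p - 1) + 1)"
       "onorm (frechet_derivative (grad V) (at x)) \<le> C * (norm x powr (p - 2) + 1)" using b[of x] by auto
    have "norm x powr p \<le> C * V x + 1" using bx(1) *(2) by (simp add: field_simps)
    also have "\<dots> \<le> (C + 1) * w x" using V_nonneg[of x] *(2) by (simp add: w_def algebra_simps)
    finally show "norm x powr p \<le> (C + 1) * w x" .
    show "norm (grad V x) \<le> (C + 1) * (norm x powr (p - 1) + 1)"
      by (rule order_trans[OF bx(2)]) (auto intro!: mult_right_mono)
    show "onorm (frechet_derivative (grad V) (at x)) \<le> (C + 1) * (norm x powr (p - 2) + 1)"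
      by (rule order_trans[OF bx(3)]) (auto intro!: mult_right_mono)
  qed (use * in auto)
qed

text \<open>\<open>|x|^(p - 1)\<close> is \<open>|x|^p / |x|\<close>, and \<open>|x|^p\<close> is at
  most \<open>C w\<close>, so the gradient is of lower order than \<open>w\<close>. This allows
  \<open>grad V\<close> to be cut off at a large radius with a small error relative to
  \<open>w\<close>.\<close>

lemma grad_V_sublinear:
  assumes e: "\<epsilon> > 0" obtains R where "R \<ge> 1" "\<And>x. norm x > R \<Longrightarrow> norm (grad V x) \<le> \<epsilon> * w x"
proof -
  obtain p C R where *: "p > 0" "C \<ge> 1" "R \<ge> 1"
    "\<And>x. norm x > R \<Longrightarrow> norm x powr p \<le> C * w x"
    "\<And>x. norm x > R \<Longrightarrow> norm (grad V x) \<le> C * (norm x powr (p - 1) + 1)"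
    by (rule growth_bounds) blast
  \<comment> \<open>The second radius makes \<open>C C / |x|\<close> at most
    \<open>\<epsilon>/2\<close>; the third makes \<open>w\<close> large enough to absorb the
    additive constant, \<open>C \<le> \<epsilon> w / 2\<close>.\<close>
  define R' where "R' = max R (max (2 * C * C / \<epsilon>) ((2 * C * C / \<epsilon>) powr (1 / p)))"
  show ?thesis
  proof (rule that[of R'])
    show "R' \<ge> 1" using * by (simp add: R'_def)
    fix x :: 'a assume x: "norm x > R'"
    then have x1: "norm x > R" "norm x > 2 * C * C / \<epsilon>" "norm x > (2 * C * C / \<epsilon>) powr (1 / p)" "norm x > 0"
      using * by (auto simp: R'_def)
    have "2 * C * C / \<epsilon> = ((2 * C * C / \<epsilon>) powr (1 / p)) powr p"
      using * e by (simp add: powr_powr)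
    also have "\<dots> \<le> norm x powr p" using x1 * by (intro powr_mono2) auto
    also have "\<dots> \<le> C * w x" by (rule *(4)[OF x1(1)])
    finally have 1: "C \<le> \<epsilon> / 2 * w x" using * e by (simp add: field_simps)
    have "norm x powr (p - 1) = norm x powr p / norm x" using x1 by (simp add: powr_diff)
    also have "\<dots> \<le> C * w x / norm x" using *(4)[OF x1(1)] x1 by (intro divide_right_mono) auto
    finally have "C * norm x powr (p - 1) \<le> C * (C * w x / norm x)" using * by (intro mult_left_mono) auto
    also have "\<dots> = (C * C / norm x) * w x" by simp
    also have "\<dots> \<le> \<epsilon> / 2 * w x"
      using x1(2,4) e w_nonneg[of x] by (intro mult_right_mono) (auto simp: field_simps)
    finally have 2: "C * norm x powr (p - 1) \<le> \<epsilon> / 2 * w x" .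
    have "norm (grad V x) \<le> C * norm x powr (p - 1) + C" using *(5)[OF x1(1)] by (simp add: distrib_left)
    also have "\<dots> \<le> \<epsilon> * w x" using 1 2 by (simp add: field_simps)
    finally show "norm (grad V x) \<le> \<epsilon> * w x" .
  qed
qed

lemma grad_V_has_derivative: "(V has_derivative (\<lambda>v. grad V x \<bullet> v)) (at x)"
  by (rule grad_has_derivative[OF smooth_differentiable[OF V_smooth]])

abbreviation "hess \<equiv> \<lambda>x. frechet_derivative (grad V) (at x)"

lemma hess_has_derivative: "(grad V has_derivative hess x) (at x)"
  by (rule smooth_has_derivative[OF grad_smooth[OF V_smooth]])

lemma grad_V_bound: obtains c where "c \<ge> 0" "\<And>x. norm (grad V x) \<le> c * w x"
proof -
  obtain R where R: "\<And>x. norm x > R \<Longrightarrow> norm (grad V x) \<le> 1 * w x"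
    using grad_V_sublinear[of 1] by auto
  obtain M where M: "M \<ge> 0" "\<And>x. norm x \<le> R \<Longrightarrow> norm (grad V x) \<le> M"
    by (rule continuous_bounded_on_ball[OF smooth_continuous[OF grad_smooth[OF V_smooth]]]) blast
  show ?thesis
  proof (rule that[of "M + 1"])
    fix x
    have "M * 1 \<le> M * w x" using M(1) w_ge_1[of x] by (rule mult_left_mono[rotated])
    then show "norm (grad V x) \<le> (M + 1) * w x"
      using R[of x] M(2)[of x] w_ge_1[of x] mult_nonneg_nonneg[OF M(1) w_nonneg[of x]]
      by (cases "norm x > R") (auto simp: distrib_right)
  qed (use M in simp)
qed

text \<open>Outside the ball \<open>|x|^(p - 2) \<le> |x|^p\<close>, since the radius is at least 1;
  inside, continuity of the second derivatives suffices because \<open>w \<ge> 1\<close>.\<close>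

lemma hess_bound: obtains c where "c \<ge> 0" "\<And>x v. norm (hess x v) \<le> c * w x * norm v"
proof -
  obtain p C R where *: "p > 0" "C \<ge> 1" "R \<ge> 1"
    "\<And>x. norm x > R \<Longrightarrow> norm x powr p \<le> C * w x"
    "\<And>x. norm x > R \<Longrightarrow> onorm (hess x) \<le> C * (norm x powr (p - 2) + 1)"
    by (rule growth_bounds) blast
  have "\<exists>M\<ge>0. \<forall>x. norm x \<le> R \<longrightarrow> norm (hess x b) \<le> M" for b
    by (rule continuous_bounded_on_ball[OF smooth_continuous[OF smooth_frechet[OF grad_smooth[OF V_smooth]]]]) blast
  then obtain M where M: "\<And>b. M b \<ge> 0" "\<And>b x. norm x \<le> R \<Longrightarrow> norm (hess x b) \<le> M b" by metis
  define c where "c = real DIM('a) * sum M Basis + C * (C + 1)"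
  have c0: "real DIM('a) * sum M Basis \<ge> 0" using M by (intro mult_nonneg_nonneg sum_nonneg) auto
  show ?thesis
  proof (rule that[of c])
    show "c \<ge> 0" using c0 * by (simp add: c_def)
    fix x v
    show "norm (hess x v) \<le> c * w x * norm v"
    proof (cases "norm x > R")
      case True
      have "norm x powr (p - 2) \<le> norm x powr p" using True * by (intro powr_mono) auto
      also have "\<dots> \<le> C * w x" by (rule *(4)[OF True])
      finally have "norm x powr (p - 2) + 1 \<le> (C + 1) * w x" using w_ge_1[of x] by (simp add: distrib_right)
      then have "C * (norm x powr (p - 2) + 1) \<le> C * ((C + 1) * w x)" using * by (intro mult_left_mono) auto
      also have "\<dots> \<le> c * w x" using c0 w_nonneg[of x] unfolding c_def mult.assoc[symmetric] by (intro mult_right_mono) auto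
      finally have "onorm (hess x) \<le> c * w x" using *(5)[OF True] by linarith
      moreover have "norm (hess x v) \<le> onorm (hess x) * norm v"
        by (rule onorm[OF has_derivative_bounded_linear[OF hess_has_derivative]])
      ultimately show ?thesis by (meson mult_right_mono norm_ge_zero order_trans)
    next
      case False
      have "norm (hess x b) \<le> sum M Basis" if "b \<in> Basis" for b
      proof -
        have "M b \<le> sum M Basis" using that M by (intro member_le_sum) auto
        then show ?thesis using M(2)[of x b] False by simp
      qed
      from frechet_derivative_bound_basis[OF smooth_differentiable[OF grad_smooth[OF V_smooth]] this]
      have "norm (hess x v) \<le> real DIM('a) * sum M Basis * norm v" .
      also have "\<dots> \<le> c * norm v" using * by (intro mult_right_mono) (auto simp: c_def)
      also have "\<dots> \<le> c * w x * norm v" using w_ge_1[of x] c0 * \<open>c \<ge> 0\<close>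
        by (intro mult_right_mono) (auto simp: mult_le_cancel_left1)
      finally show ?thesis .
    qed
  qed
qed

lemma continuous_w: "continuous_on UNIV w"
  unfolding w_def[abs_def] by (intro continuous_intros smooth_continuous[OF V_smooth])

text \<open>\<open>m\<close> extra powers of \<open>w\<close> are absorbed by
  \<open>exp (- V)\<close>; with \<open>p m \<ge> d + 2\<close> the growth of \<open>w\<close>
  converts them into the integrable decay \<open>(1 + |x|)^-(d + 2)\<close>.\<close>

lemma integrable_w_power_exp: "integrable lborel (\<lambda>x. w x ^ k * exp (- V x))"
proof -
  obtain p C R where *: "p > 0" "C \<ge> 1" "R \<ge> 1"
    "\<And>x. norm x > R \<Longrightarrow> norm x powr p \<le> C * w x"
    by (rule growth_bounds) blast
  let ?d = "DIM('a)"
  obtain m :: nat where m: "real m \<ge> (?d + 2) / p" using real_arch_simple by blast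
  have exp_w: "w x ^ (k + m) * exp (- V x) \<le> fact (k + m) * exp 1" for x
  proof -
    have "w x ^ (k + m) \<le> fact (k + m) * exp (w x)" by (rule power_le_exp[OF w_nonneg])
    then have "w x ^ (k + m) * exp (- V x) \<le> fact (k + m) * exp (w x) * exp (- V x)"
      by (intro mult_right_mono) auto
    also have "\<dots> = fact (k + m) * exp 1" by (simp add: w_def mult.assoc exp_add[symmetric])
    finally show ?thesis .
  qed
  define A where "A = fact (k + m) * exp 1 * C ^ m * 2 ^ (?d + 2)"
  define B where "B = fact (k + m) * exp 1 * (1 + R) ^ (?d + 2)"
  have b: "w x ^ k * exp (- V x) \<le> (A + B) * (1 / (1 + norm x) ^ (?d + 2))" for x
  proof (cases "norm x > R")
    case True
    have n1: "norm x > 1" "x \<noteq> 0" using True * by auto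
    have "norm x ^ (?d + 2) = norm x powr (?d + 2)" using n1 by (subst powr_realpow[symmetric]) auto
    also have "\<dots> \<le> norm x powr (p * m)" using m n1 * by (intro powr_mono) (auto simp: field_simps)
    also have "\<dots> = (norm x powr p) ^ m" using n1 by (simp add: powr_powr[symmetric] powr_realpow)
    also have "\<dots> \<le> (C * w x) ^ m" by (intro power_mono *(4) True) auto
    finally have "(1 + norm x) ^ (?d + 2) \<le> 2 ^ (?d + 2) * (C ^ m * w x ^ m)"
    proof -
      assume a: "norm x ^ (?d + 2) \<le> (C * w x) ^ m"
      have "(1 + norm x) ^ (?d + 2) \<le> (2 * norm x) ^ (?d + 2)" using n1 by (intro power_mono) auto
      also have "\<dots> = 2 ^ (?d + 2) * norm x ^ (?d + 2)" by (rule power_mult_distrib)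
      also have "\<dots> \<le> 2 ^ (?d + 2) * (C * w x) ^ m" by (rule mult_left_mono[OF a]) simp
      finally show ?thesis by (simp only: power_mult_distrib)
    qed
    then have "(1 + norm x) ^ (?d + 2) * (w x ^ k * exp (- V x)) \<le> 2 ^ (?d + 2) * (C ^ m * w x ^ m) * (w x ^ k * exp (- V x))"
      by (intro mult_right_mono) (auto simp: w_nonneg)
    also have "\<dots> = 2 ^ (?d + 2) * C ^ m * (w x ^ (k + m) * exp (- V x))" by (simp only: power_add mult_ac)
    also have "\<dots> \<le> 2 ^ (?d + 2) * C ^ m * (fact (k + m) * exp 1)"
      by (rule mult_left_mono[OF exp_w]) (use * in auto)
    also have "\<dots> = A" by (simp add: A_def)
    also have "\<dots> \<le> A + B" using * by (simp add: B_def)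
    finally show ?thesis by (simp add: pos_le_divide_eq mult.commute add_pos_nonneg)
  next
    case False
    have "(1 + norm x) ^ (?d + 2) * (w x ^ k * exp (- V x)) \<le> (1 + R) ^ (?d + 2) * (w x ^ (k + m) * exp (- V x))"
    proof (intro mult_mono power_mono mult_right_mono)
      show "w x ^ k \<le> w x ^ (k + m)" using w_ge_1 by (intro power_increasing) auto
    qed (use False * w_nonneg in auto)
    also have "\<dots> \<le> (1 + R) ^ (?d + 2) * (fact (k + m) * exp 1)"
      by (rule mult_left_mono[OF exp_w]) (use * in auto)
    also have "\<dots> = B" by (simp add: B_def)
    also have "\<dots> \<le> A + B" using * by (simp add: A_def)
    finally show ?thesis by (simp add: pos_le_divide_eq mult.commute add_pos_nonneg)
  qed
  have "integrable lborel (\<lambda>x::'a. (A + B) * (1 / (1 + norm x) ^ (?d + 2)))"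
    by (rule integrable_mult_right[OF integrable_inverse_power_norm])
  then show ?thesis
  proof (rule Bochner_Integration.integrable_bound)
    have "continuous_on UNIV (\<lambda>x. w x ^ k * exp (- V x))"
      by (intro continuous_intros continuous_w smooth_continuous[OF V_smooth])
    then show "(\<lambda>x. w x ^ k * exp (- V x)) \<in> borel_measurable lborel"
      using borel_measurable_continuous_onI by simp
    show "AE x in lborel. norm (w x ^ k * exp (- V x)) \<le> norm ((A + B) * (1 / (1 + norm x) ^ (?d + 2)))"
    proof (rule AE_I2)
      fix x
      have "norm (w x ^ k * exp (- V x)) = w x ^ k * exp (- V x)" using w_nonneg by simp
      then show "norm (w x ^ k * exp (- V x)) \<le> norm ((A + B) * (1 / (1 + norm x) ^ (?d + 2)))"
        using order_trans[OF b abs_ge_self] by (simp only: real_norm_def)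
    qed
  qed
qed

section \<open>The Gibbs measure\<close>

definition Z where "Z = (\<integral>x. exp (- V x) \<partial>lborel)"

lemma Z_pos: "Z > 0"
proof -
  have i: "integrable lborel (\<lambda>x. exp (- V x))" using integrable_w_power_exp[of 0] by simp
  have "Z \<ge> 0" unfolding Z_def by (rule Bochner_Integration.integral_nonneg) simp
  moreover have "Z \<noteq> 0"
  proof
    assume "Z = 0"
    then have "AE x in lborel. exp (- V x) = 0"
      using integral_nonneg_eq_0_iff_AE[OF i] by (simp add: Z_def)
    then have "AE x in (lborel :: 'a measure). False" by simp
    then show False by (simp add: AE_iff_measurable[OF _ refl])
  qed
  ultimately show ?thesis by linarith
qed

abbreviation "\<gamma> \<equiv> gibbs V"

lemma V_measurable [measurable]: "V \<in> borel_measurable borel"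
  by (rule borel_measurable_continuous_onI[OF smooth_continuous[OF V_smooth]])

lemma w_measurable [measurable]: "w \<in> borel_measurable borel"
  by (rule borel_measurable_continuous_onI[OF continuous_w])

lemma sets_gibbs [measurable_cong]: "sets \<gamma> = sets borel" and space_gibbs [simp]: "space \<gamma> = UNIV"
  by (auto simp: gibbs_def)

lemma gibbs_integral:
  fixes f :: "'a \<Rightarrow> 'b::{banach, second_countable_topology}"
  assumes [measurable]: "f \<in> borel_measurable borel"
  shows "(\<integral>x. f x \<partial>\<gamma>) = (\<integral>x. (exp (- V x) / Z) *\<^sub>R f x \<partial>lborel)"
    and "integrable \<gamma> f \<longleftrightarrow> integrable lborel (\<lambda>x. (exp (- V x) / Z) *\<^sub>R f x)"
  unfolding gibbs_def Z_def[symmetric] using Z_pos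
  by (simp_all add: integral_density integrable_density)

lemma prob_space_gibbs: "prob_space \<gamma>"
proof
  have i: "integrable lborel (\<lambda>x. exp (- V x) / Z)" using integrable_w_power_exp[of 0] by simp
  have "emeasure \<gamma> (space \<gamma>) = (\<integral>\<^sup>+x. ennreal (exp (- V x) / Z) \<partial>lborel)"
    unfolding gibbs_def Z_def[symmetric] by (simp add: emeasure_density)
  also have "\<dots> = ennreal (\<integral>x. exp (- V x) / Z \<partial>lborel)"
    using Z_pos by (intro nn_integral_eq_integral i) auto
  also have "(\<integral>x. exp (- V x) / Z \<partial>lborel) = 1" using Z_pos by (simp add: Z_def)
  finally show "emeasure \<gamma> (space \<gamma>) = 1" by simp
qed

lemma integrable_gibbs:
  fixes f :: "'a \<Rightarrow> 'b::{banach, second_countable_topology}"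
  assumes f: "f \<in> borel_measurable borel" and b: "\<And>x. norm (f x) \<le> B * w x ^ k"
  shows "integrable \<gamma> f"
proof -
  have 1: "integrable \<gamma> (\<lambda>x. B * w x ^ k)"
    using integrable_mult_right[OF integrable_w_power_exp[of k], of "B / Z"]
    by (subst gibbs_integral(2)) (auto simp: field_simps)
  show ?thesis
    by (rule Bochner_Integration.integrable_bound[OF 1])
      (use f b in \<open>auto simp: measurable_cong_sets[OF sets_gibbs refl] intro!: AE_I2 order_trans[OF b abs_ge_self]\<close>)
qed

text \<open>A directional derivative of \<open>exp (- V) F\<close> integrates to 0, and
  differentiating the exponential produces the factor \<open>- (grad V x \<bullet> v)\<close>.
  Polynomial growth in \<open>w\<close> makes every term integrable.\<close>

lemma gibbs_integration_by_parts:
  assumes d: "\<And>x. (F has_derivative F' x) (at x)" and c: "continuous_on UNIV (\<lambda>x. F' x v)"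
    and b: "\<And>x. \<bar>F x\<bar> \<le> B * w x ^ k" "\<And>x. \<bar>F' x v\<bar> \<le> B * w x ^ k"
  shows "(\<integral>x. F' x v \<partial>\<gamma>) = (\<integral>x. F x * (grad V x \<bullet> v) \<partial>\<gamma>)"
proof -
  obtain cV where cV: "cV \<ge> 0" "\<And>x. norm (grad V x) \<le> cV * w x" by (rule grad_V_bound) blast
  have B: "B \<ge> 0" using b(1)[of 0] w_pos[of 0] by (meson abs_ge_zero order_trans zero_le_mult_iff zero_less_power less_le_not_le)
  have cF: "continuous_on UNIV F" using d has_derivative_continuous_on by (metis has_derivative_at_withinI)
  have cg: "continuous_on UNIV (grad V)" by (rule smooth_continuous[OF grad_smooth[OF V_smooth]])
  have [measurable]: "F \<in> borel_measurable borel" "(\<lambda>x. F' x v) \<in> borel_measurable borel" "grad V \<in> borel_measurable borel"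
    using cF c cg by (auto intro: borel_measurable_continuous_onI)
  have bg: "\<bar>F x * (grad V x \<bullet> v)\<bar> \<le> (B * cV * norm v) * w x ^ (Suc k)" for x
  proof -
    have "\<bar>grad V x \<bullet> v\<bar> \<le> cV * w x * norm v"
      using Cauchy_Schwarz_ineq2[of "grad V x" v] cV(2)[of x] by (meson mult_right_mono norm_ge_zero order_trans)
    then have "\<bar>F x * (grad V x \<bullet> v)\<bar> \<le> (B * w x ^ k) * (cV * w x * norm v)"
      unfolding abs_mult using b(1) by (intro mult_mono) (auto intro: order_trans[OF _ b(1)])
    then show ?thesis by (simp add: mult_ac)
  qed
  have i: "integrable \<gamma> F" "integrable \<gamma> (\<lambda>x. F' x v)" "integrable \<gamma> (\<lambda>x. F x * (grad V x \<bullet> v))"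
    using integrable_gibbs[of F B k] integrable_gibbs[of "\<lambda>x. F' x v" B k]
      integrable_gibbs[of "\<lambda>x. F x * (grad V x \<bullet> v)" "B * cV * norm v" "Suc k"] b bg by auto
  define G where "G x = exp (- V x) / Z * F x" for x
  define G' where "G' x u = exp (- V x) / Z * F' x u - exp (- V x) / Z * (F x * (grad V x \<bullet> u))" for x u
  have "(\<integral>x. G' x v \<partial>lborel) = 0"
  proof (rule integral_directional_derivative_eq_0)
    show "(G has_derivative G' x) (at x)" for x
      unfolding G_def[abs_def] G'_def[abs_def] using Z_pos
      by (auto intro!: derivative_eq_intros d grad_V_has_derivative simp: field_simps)
    show "integrable lborel G" using i(1) by (simp add: gibbs_integral G_def[abs_def])
    show "integrable lborel (\<lambda>x. G' x v)"
      unfolding G'_def using i(2,3) by (intro Bochner_Integration.integrable_diff) (simp_all add: gibbs_integral)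
    show "continuous_on UNIV (\<lambda>x. G' x v)" unfolding G'_def using Z_pos
      by (auto intro!: continuous_intros cF c cg smooth_continuous[OF V_smooth])
  qed
  then have "(\<integral>x. F' x v \<partial>\<gamma>) - (\<integral>x. F x * (grad V x \<bullet> v) \<partial>\<gamma>) = 0"
    unfolding G'_def using i(2,3) by (subst (asm) Bochner_Integration.integral_diff) (simp_all add: gibbs_integral)
  then show ?thesis by simp
qed

end

section \<open>Weighted Lipschitz functions and the dual distance\<close>

lemma difference_quotient_tendsto:
  fixes f :: "'a::real_normed_vector \<Rightarrow> real"
  assumes d: "(f has_derivative f') (at x)"
  shows "((\<lambda>s. (f (x + s *\<^sub>R v) - f x) / s) \<longlongrightarrow> f' v) (at 0)"
proof -
  have "((\<lambda>s. x + s *\<^sub>R v) has_derivative (\<lambda>s. s *\<^sub>R v)) (at 0)" by (auto intro!: derivative_eq_intros)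
  from has_derivative_compose[OF this, of f f'] d
  have "((\<lambda>s. f (x + s *\<^sub>R v)) has_derivative (\<lambda>s. f' (s *\<^sub>R v))) (at 0)" by simp
  then have "((\<lambda>s. f (x + s *\<^sub>R v)) has_real_derivative f' v) (at 0)"
    using linear_scale[OF has_derivative_linear[OF d]] by (simp add: has_field_derivative_def mult_commute_abs)
  then show ?thesis by (simp add: DERIV_def)
qed

text \<open>A single constant \<open>c \<ge> 1\<close> stands for every bound on \<open>K\<close>
  and \<open>V\<close>, so that the later constants are built from \<open>c\<close>, the dimension
  and moments of the Gibbs measure. \<open>K2\<close> is the second derivative of \<open>K\<close>
  as a family of linear maps.\<close>

locale stein = confining V for V :: "'a::euclidean_space \<Rightarrow> real" +
  fixes K :: "'a \<Rightarrow> real" and K2 :: "'a \<Rightarrow> 'a \<Rightarrow> 'a" and c :: real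
  assumes c_ge_1: "c \<ge> 1"
    and grad_V_le: "\<And>x. norm (grad V x) \<le> c * w x"
    and hess_le: "\<And>x v. norm (hess x v) \<le> c * w x * norm v"
    and K_has_derivative: "\<And>x. (K has_derivative (\<lambda>v. grad K x \<bullet> v)) (at x)"
    and grad_K_has_derivative: "\<And>x. (grad K has_derivative K2 x) (at x)"
    and K_le: "\<And>x. \<bar>K x\<bar> \<le> c" and grad_K_le: "\<And>x. norm (grad K x) \<le> c"
    and K2_le: "\<And>x v. norm (K2 x v) \<le> c * norm v"
    and K2_lip: "\<And>x z v. norm (K2 x v - K2 z v) \<le> c * norm (x - z) * norm v"
    and K_even: "\<And>x. K (- x) = K x"
    and K_posdef: "positive_definite_kernel K"
    and BL1: "\<And>x. bl_norm (\<lambda>y. (grad V x /\<^sub>R w y) \<bullet> grad K (x - y)) \<le> ennreal c"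
    and BL2: "\<And>x. bl_norm (\<lambda>y. (grad V x \<bullet> grad V y) / w y * K (x - y)) \<le> ennreal c"
begin

lemma c_nonneg: "c \<ge> 0" using c_ge_1 by simp

text \<open>\<open>ln w\<close> is Lipschitz with constant \<open>c\<close>, because
  \<open>grad V\<close> is bounded by \<open>c w\<close>.\<close>

lemma w_le_exp: "w x \<le> exp (c * norm (x - y)) * w y"
proof -
  have "\<bar>ln (w x) - ln (w y)\<bar> \<le> c * norm (x - y)"
  proof (rule lipschitz_if_derivative_bound[where f="\<lambda>x. ln (w x)", unfolded real_norm_def])
    show "((\<lambda>x. ln (w x)) has_derivative (\<lambda>v. (grad V x \<bullet> v) / w x)) (at x)" for x
      unfolding w_def[abs_def] using w_pos[of x] grad_V_has_derivative
      by (auto intro!: derivative_eq_intros simp: w_def field_simps)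
    show "\<bar>(grad V x \<bullet> v) / w x\<bar> \<le> c * norm v" for x v
    proof -
      have "\<bar>grad V x \<bullet> v\<bar> \<le> c * w x * norm v"
        using Cauchy_Schwarz_ineq2[of "grad V x" v] grad_V_le[of x] by (meson mult_right_mono norm_ge_zero order_trans)
      then show ?thesis using w_pos[of x] by (simp add: divide_le_eq mult_ac)
    qed
  qed
  then have "ln (w x) \<le> c * norm (x - y) + ln (w y)" by linarith
  then have "exp (ln (w x)) \<le> exp (c * norm (x - y) + ln (w y))" by simp
  then show ?thesis using w_pos[of x] w_pos[of y] by (simp add: exp_add)
qed

lemma w_diff: "\<bar>w x - w y\<bar> \<le> c * max (w x) (w y) * norm (x - y)"
proof -
  have *: "w x - w y \<le> c * w x * norm (x - y)" for x y
  proof -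
    have "w x * exp (- (c * norm (x - y))) \<le> w y"
      using w_le_exp[of x y] by (simp add: exp_minus field_simps)
    moreover have "w x * (1 - c * norm (x - y)) \<le> w x * exp (- (c * norm (x - y)))"
      using exp_ge_add_one_self[of "- (c * norm (x - y))"] w_nonneg by (intro mult_left_mono) auto
    ultimately show ?thesis by (simp add: algebra_simps)
  qed
  show ?thesis using *[of x y] *[of y x] by (auto simp: max_def norm_minus_commute)
qed

text \<open>Up to a constant factor, \<open>wlip A f\<close> says that the bounded Lipschitz norm of \<open>f / w\<close> is at most
  \<open>A\<close>, because \<open>ln w\<close> is Lipschitz; this form avoids the quotient.\<close>

definition wlip :: "real \<Rightarrow> ('a \<Rightarrow> 'b::real_normed_vector) \<Rightarrow> bool" where
  "wlip A f \<longleftrightarrow> (\<forall>x. norm (f x) \<le> A * w x) \<and> (\<forall>x z. norm (f x - f z) \<le> A * max (w x) (w z) * norm (x - z))"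

lemma wlipI: "(\<And>x. norm (f x) \<le> A * w x) \<Longrightarrow> (\<And>x z. norm (f x - f z) \<le> A * max (w x) (w z) * norm (x - z)) \<Longrightarrow> wlip A f"
  by (simp add: wlip_def)

lemma wlip_le: "wlip A f \<Longrightarrow> norm (f x) \<le> A * w x"
  and wlip_diff_le: "wlip A f \<Longrightarrow> norm (f x - f z) \<le> A * max (w x) (w z) * norm (x - z)"
  by (auto simp: wlip_def)

lemma wlip_nonneg: "wlip A f \<Longrightarrow> A \<ge> 0"
  using wlip_le[of A f 0] w_pos[of 0] by (meson norm_ge_zero order_trans zero_le_mult_iff less_le_not_le)

lemma max_w_pos: "max (w x) (w z) \<ge> 1" "max (w x) (w z) \<ge> 0" "max (w x) (w z) > 0"
  using w_ge_1[of x] by auto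

lemma wlip_mono: "wlip A f \<Longrightarrow> A \<le> B \<Longrightarrow> wlip B f"
  unfolding wlip_def using w_nonneg max_w_pos(2)
  by (meson mult_right_mono norm_ge_zero order_trans)

lemma wlip_add: "wlip A f \<Longrightarrow> wlip B g \<Longrightarrow> wlip (A + B) (\<lambda>x. f x + g x)"
  by (rule wlipI) (auto simp: distrib_right intro!: norm_triangle_mono wlip_le wlip_diff_le norm_diff_triangle_ineq[THEN order_trans] add_mono)

lemma wlip_minus: "wlip A f \<Longrightarrow> wlip A (\<lambda>x. - f x)"
  by (simp add: wlip_def norm_minus_commute)

lemma wlip_diff: "wlip A f \<Longrightarrow> wlip B g \<Longrightarrow> wlip (A + B) (\<lambda>x. f x - g x)"
  using wlip_add[OF _ wlip_minus] by fastforce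

text \<open>One factor carries the weight, the other is bounded and Lipschitz without weight. The
  abstract product covers multiplication, scaling and inner product; the 2 counts the two terms of
  the product rule.\<close>

lemma wlip_bilinear:
  assumes b: "bounded_bilinear pr" "\<And>a b. norm (pr a b) \<le> norm a * norm b"
    and f: "wlip A f" and g: "\<And>x. norm (g x) \<le> B" "\<And>x z. norm (g x - g z) \<le> B * norm (x - z)"
  shows "wlip (2 * A * B) (\<lambda>x. pr (f x) (g x))"
proof (rule wlipI)
  interpret bounded_bilinear pr by fact
  have A: "A \<ge> 0" by (rule wlip_nonneg[OF f])
  have B: "B \<ge> 0" using g(1)[of 0] norm_ge_zero order_trans by blast
  show "norm (pr (f x) (g x)) \<le> 2 * A * B * w x" for x
  proof -
    have "norm (pr (f x) (g x)) \<le> (A * w x) * B"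
      using b(2)[of "f x" "g x"] wlip_le[OF f, of x] g(1)[of x] A w_nonneg[of x]
      by (meson mult_mono mult_nonneg_nonneg norm_ge_zero order_trans)
    also have "\<dots> \<le> 2 * (A * w x * B)" using A B w_nonneg[of x] by simp
    finally show ?thesis by (simp add: mult_ac)
  qed
  show "norm (pr (f x) (g x) - pr (f z) (g z)) \<le> 2 * A * B * max (w x) (w z) * norm (x - z)" for x z
  proof -
    let ?m = "max (w x) (w z)"
    have "pr (f x) (g x) - pr (f z) (g z) = pr (f x - f z) (g x) + pr (f z) (g x - g z)"
      by (simp add: diff_left diff_right)
    also have "norm \<dots> \<le> norm (f x - f z) * norm (g x) + norm (f z) * norm (g x - g z)"
      by (intro norm_triangle_mono b)
    also have "\<dots> \<le> (A * ?m * norm (x - z)) * B + (A * ?m) * (B * norm (x - z))"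
    proof (intro add_mono mult_mono)
      show "norm (f z) \<le> A * ?m" using wlip_le[OF f, of z] A by (meson max.cobounded2 mult_left_mono order_trans)
    qed (use A B max_w_pos(2)[of x z] in \<open>auto intro: g wlip_diff_le[OF f]\<close>)
    finally show ?thesis by (simp add: mult_ac)
  qed
qed

lemma wlip_cmult: "wlip A f \<Longrightarrow> wlip (\<bar>r\<bar> * A) (\<lambda>x. r * f x)" for f :: "'a \<Rightarrow> real"
proof (rule wlipI)
  assume f: "wlip A f"
  show "norm (r * f x) \<le> \<bar>r\<bar> * A * w x" for x
    using wlip_le[OF f, of x] by (simp add: abs_mult mult.assoc mult_left_mono)
  show "norm (r * f x - r * f z) \<le> \<bar>r\<bar> * A * max (w x) (w z) * norm (x - z)" for x z
    using wlip_diff_le[OF f, of x z] by (simp add: right_diff_distrib[symmetric] abs_mult mult.assoc mult_left_mono)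
qed

lemma wlip_lipschitz:
  assumes "\<And>x. norm (g x) \<le> B" "\<And>x z. norm (g x - g z) \<le> B * norm (x - z)"
  shows "wlip B g"
proof (rule wlipI)
  have B: "B \<ge> 0" using assms(1)[of 0] norm_ge_zero order_trans by blast
  show "norm (g x) \<le> B * w x" for x
    using assms(1)[of x] mult_left_mono[OF w_ge_1[of x] B] by simp
  show "norm (g x - g z) \<le> B * max (w x) (w z) * norm (x - z)" for x z
    using assms(2)[of x z] mult_right_mono[OF mult_left_mono[OF max_w_pos(1)[of x z] B], of "norm (x - z)"] by simp
qed

lemma w_le_segment:
  assumes "norm (x - z) \<le> 1" "y \<in> closed_segment x z" shows "w y \<le> exp c * max (w x) (w z)"
proof -
  have "norm (y - x) \<le> 1" using assms segment_bound1[OF assms(2)] by (simp add: norm_minus_commute)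
  then have "c * norm (y - x) \<le> c" using c_nonneg by (simp add: mult_left_le)
  then have "exp (c * norm (y - x)) * w x \<le> exp c * max (w x) (w z)"
    using w_nonneg[of x] by (intro mult_mono) auto
  then show ?thesis using w_le_exp[of y x] by simp
qed

text \<open>For points at distance at most 1 the weights along the segment are comparable up to
  \<open>exp c\<close>, and the mean value inequality applies. For distant points the two values are
  bounded separately, which costs \<open>2 A\<close> and is paid by
  \<open>|x - z| > 1\<close>.\<close>

lemma wlip_if_derivative:
  fixes f :: "'a \<Rightarrow> 'b::real_normed_vector"
  assumes d: "\<And>x. (f has_derivative f' x) (at x)" and f: "\<And>x. norm (f x) \<le> A * w x"
    and f': "\<And>x v. norm (f' x v) \<le> B * w x * norm v"
  shows "wlip (2 * A + exp c * B) f"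
proof (rule wlipI)
  have A: "A \<ge> 0" using f[of 0] w_pos[of 0] by (meson norm_ge_zero order_trans zero_le_mult_iff less_le_not_le)
  obtain e :: 'a where e: "norm e = 1" using SOME_Basis norm_Basis by blast
  have "0 \<le> B * w 0" using order_trans[OF norm_ge_zero f'[of 0 e]] e by simp
  then have B: "B \<ge> 0" using w_pos[of 0] by (simp add: zero_le_mult_iff)
  show "norm (f x) \<le> (2 * A + exp c * B) * w x" for x
    using order_trans[OF f[of x] mult_right_mono[of A "2 * A + exp c * B"]] A B w_nonneg by simp
  show "norm (f x - f z) \<le> (2 * A + exp c * B) * max (w x) (w z) * norm (x - z)" for x z
  proof -
    let ?m = "max (w x) (w z)"
    have Am: "0 \<le> A * ?m * norm (x - z)" "0 \<le> exp c * B * ?m * norm (x - z)"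
      using A B max_w_pos(2)[of x z] by simp_all
    show ?thesis
    proof (cases "norm (x - z) \<le> 1")
      case True
      have "norm (f x - f z) \<le> (B * (exp c * ?m)) * norm (x - z)"
      proof (rule differentiable_bound[of "closed_segment x z"])
        fix y assume y: "y \<in> closed_segment x z"
        show "(f has_derivative f' y) (at y within closed_segment x z)" using d by (rule has_derivative_at_withinI)
        have "B * w y \<le> B * (exp c * ?m)" by (rule mult_left_mono[OF w_le_segment[OF True y] B])
        then show "onorm (f' y) \<le> B * (exp c * ?m)"
          using f'[of y] B max_w_pos(2)[of x z]
          by (intro onorm_bound) (auto intro: order_trans[OF f'[of y] mult_right_mono])
      qed auto
      then show ?thesis using Am by (simp add: algebra_simps)
    next
      case False
      have "norm (f x - f z) \<le> norm (f x) + norm (f z)" by (rule norm_triangle_ineq4)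
      also have "\<dots> \<le> A * ?m + A * ?m"
        using f[of x] f[of z] A by (intro add_mono) (auto intro: order_trans[OF f mult_left_mono])
      also have "\<dots> = (2 * A * ?m) * 1" by simp
      also have "\<dots> \<le> (2 * A * ?m) * norm (x - z)" using False A max_w_pos(2)[of x z] by (intro mult_left_mono) auto
      finally show ?thesis using Am by (simp add: algebra_simps)
    qed
  qed
qed

text \<open>Along \<open>x + s v\<close> the two weights in the difference quotient become equal as
  \<open>s\<close> tends to 0, so the maximum disappears in the limit.\<close>

lemma wlip_derivative_le:
  fixes f :: "'a \<Rightarrow> real"
  assumes f: "wlip A f" and d: "(f has_derivative f') (at x)"
  shows "\<bar>f' v\<bar> \<le> A * w x * norm v"
proof -
  have 1: "((\<lambda>s. \<bar>(f (x + s *\<^sub>R v) - f x) / s\<bar>) \<longlongrightarrow> \<bar>f' v\<bar>) (at 0)"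
    by (rule tendsto_rabs[OF difference_quotient_tendsto[OF d]])
  have "isCont w (x + 0 *\<^sub>R v)" using continuous_w by (simp add: continuous_on_eq_continuous_at)
  then have "((\<lambda>s. w (x + s *\<^sub>R v)) \<longlongrightarrow> w (x + 0 *\<^sub>R v)) (at 0)"
    by (rule isCont_tendsto_compose) (intro tendsto_intros)
  then have 2: "((\<lambda>s. A * max (w (x + s *\<^sub>R v)) (w x) * norm v) \<longlongrightarrow> A * max (w (x + 0 *\<^sub>R v)) (w x) * norm v) (at 0)"
    by (intro tendsto_intros)
  have "\<bar>f' v\<bar> \<le> A * max (w (x + 0 *\<^sub>R v)) (w x) * norm v"
  proof (rule tendsto_le[OF _ 2 1])
    show "\<forall>\<^sub>F s in at 0. \<bar>(f (x + s *\<^sub>R v) - f x) / s\<bar> \<le> A * max (w (x + s *\<^sub>R v)) (w x) * norm v"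
      unfolding eventually_at_filter
    proof (rule always_eventually, intro allI impI)
      fix s :: real assume "s \<noteq> 0"
      then show "\<bar>(f (x + s *\<^sub>R v) - f x) / s\<bar> \<le> A * max (w (x + s *\<^sub>R v)) (w x) * norm v"
        using wlip_diff_le[OF f, of "x + s *\<^sub>R v" x] by (simp add: abs_divide divide_le_eq mult_ac)
    qed
  qed simp
  then show ?thesis by simp
qed

lemma wlip_continuous:
  fixes f :: "'a \<Rightarrow> 'b::real_normed_vector"
  assumes f: "wlip A f" shows "continuous_on UNIV f"
proof -
  have "isCont f x" for x
  proof -
    have "((\<lambda>z. A * max (w z) (w x) * norm (z - x)) \<longlongrightarrow> A * max (w x) (w x) * norm (x - x)) (at x)"
      using continuous_w by (intro tendsto_intros) (simp add: continuous_on_eq_continuous_at isContD)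
    then have "((\<lambda>z. f z - f x) \<longlongrightarrow> 0) (at x)"
      by (intro Lim_null_comparison[of "\<lambda>z. f z - f x" "\<lambda>z. A * max (w z) (w x) * norm (z - x)"])
         (auto intro!: always_eventually wlip_diff_le[OF f])
    then show ?thesis by (simp add: isCont_def LIM_zero_iff)
  qed
  then show ?thesis by (simp add: continuous_on_eq_continuous_at)
qed

lemma wlip_measurable:
  fixes f :: "'a \<Rightarrow> 'b::real_normed_vector"
  shows "wlip A f \<Longrightarrow> f \<in> borel_measurable borel"
  by (rule borel_measurable_continuous_onI[OF wlip_continuous])

text \<open>The Lipschitz part makes \<open>\<psi>\<close> continuous, and then the essential
  supremum bounds every value.\<close>

lemma bl_norm_le_D:
  assumes b: "bl_norm \<psi> \<le> ennreal B" and B: "B \<ge> 0"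
  shows "\<bar>\<psi> x\<bar> \<le> B" "\<bar>\<psi> x - \<psi> z\<bar> \<le> B * norm (x - z)"
proof -
  have lip: "\<bar>\<psi> x - \<psi> z\<bar> \<le> B * norm (x - z)" for x z :: 'b
  proof (cases "x = z")
    case False
    have "ennreal (\<bar>\<psi> x - \<psi> z\<bar> / norm (x - z)) \<le> lip_seminorm \<psi>"
      unfolding lip_seminorm_def by (rule SUP_upper2[of "(x, z)"]) (use False in auto)
    also have "\<dots> \<le> ennreal B" using b by (simp add: bl_norm_def)
    finally have "\<bar>\<psi> x - \<psi> z\<bar> / norm (x - z) \<le> B" using B by (simp add: ennreal_le_iff)
    then show ?thesis using False by (simp add: divide_le_eq)
  qed simp
  have cont: "continuous_on UNIV \<psi>"
    using lip B by (intro lipschitz_on_continuous_on[of B] lipschitz_onI) (auto simp: dist_norm)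
  have "AE x in lborel. ennreal \<bar>\<psi> x\<bar> \<le> linf_norm \<psi>" unfolding linf_norm_def by (rule esssup_AE)
  then have "AE x in lborel. \<bar>\<psi> x\<bar> \<le> B"
  proof eventually_elim
    fix x assume "ennreal \<bar>\<psi> x\<bar> \<le> linf_norm \<psi>"
    also have "\<dots> \<le> ennreal B" using b by (simp add: bl_norm_def)
    finally show "\<bar>\<psi> x\<bar> \<le> B" using B by (simp add: ennreal_le_iff)
  qed
  then show "\<bar>\<psi> x\<bar> \<le> B" by (rule AE_lborel_continuous_le[rotated]) (intro continuous_intros cont)
  show "\<bar>\<psi> x - \<psi> z\<bar> \<le> B * norm (x - z)" by (rule lip)
qed

lemma bl_norm_le_I:
  fixes \<psi> :: "'b::euclidean_space \<Rightarrow> real"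
  assumes 1: "\<And>x. \<bar>\<psi> x\<bar> \<le> B" and 2: "\<And>x z. \<bar>\<psi> x - \<psi> z\<bar> \<le> B * norm (x - z)" and B: "B \<ge> 0"
  shows "bl_norm \<psi> \<le> ennreal B"
proof -
  have cont: "continuous_on UNIV \<psi>"
    using 2 B by (intro lipschitz_on_continuous_on[of B] lipschitz_onI) (auto simp: dist_norm)
  have "linf_norm \<psi> \<le> ennreal B" unfolding linf_norm_def
  proof (rule esssup_I)
    have [measurable]: "\<psi> \<in> borel_measurable borel" by (rule borel_measurable_continuous_onI[OF cont])
    show "(\<lambda>x. ennreal \<bar>\<psi> x\<bar>) \<in> borel_measurable lborel" by measurable
  qed (use 1 in \<open>auto intro: ennreal_leI\<close>)
  moreover have "lip_seminorm \<psi> \<le> ennreal B" unfolding lip_seminorm_def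
    by (rule SUP_least) (use 2 in \<open>auto intro!: ennreal_leI simp: divide_le_eq\<close>)
  ultimately show ?thesis by (simp add: bl_norm_def)
qed

lemma wlip_w: "wlip c w"
  using w_diff w_nonneg mult_right_mono[OF c_ge_1 w_nonneg] by (intro wlipI) auto

lemma wlip_of_bl:
  assumes b: "bl_norm \<psi> \<le> ennreal B" and B: "B \<ge> 0"
  shows "wlip (2 * c * B) (\<lambda>x. \<psi> x * w x)"
  using wlip_bilinear[OF bounded_bilinear_mult _ wlip_w, of \<psi> B] bl_norm_le_D[OF assms]
  by (simp add: abs_mult mult.commute[of _ "\<psi> _"])

text \<open>A quotient rule, arranged so that the larger of the two weights divides both
  differences; hence the distinction on the order of \<open>w x\<close> and
  \<open>w z\<close>.\<close>

lemma bl_of_wlip: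
  fixes f :: "'a \<Rightarrow> real"
  assumes f: "wlip A f"
  shows "bl_norm (\<lambda>x. f x / w x) \<le> ennreal ((1 + c) * A)"
proof (rule bl_norm_le_I)
  have A: "A \<ge> 0" by (rule wlip_nonneg[OF f])
  show "(1 + c) * A \<ge> 0" using A c_nonneg by simp
  have b: "\<bar>f x\<bar> / w x \<le> A" for x using wlip_le[OF f, of x] w_pos[of x] by (simp add: divide_le_eq)
  show "\<bar>f x / w x\<bar> \<le> (1 + c) * A" for x
    using b[of x] mult_nonneg_nonneg[OF c_nonneg A] w_pos[of x] by (simp add: abs_divide distrib_right)
  have *: "\<bar>f x / w x - f z / w z\<bar> \<le> (1 + c) * A * norm (x - z)" if "w z \<le> w x" for x z
  proof -
    have m: "max (w x) (w z) = w x" using that by simp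
    have "f x / w x - f z / w z = (f x - f z) / w x - (f z / w z) * ((w x - w z) / w x)"
      using w_pos[of x] w_pos[of z] by (simp add: field_simps)
    also have "\<bar>\<dots>\<bar> \<le> \<bar>f x - f z\<bar> / w x + (\<bar>f z\<bar> / w z) * (\<bar>w x - w z\<bar> / w x)"
      using w_pos[of x] w_pos[of z] by (intro order_trans[OF abs_triangle_ineq4]) (simp add: abs_mult)
    also have "\<dots> \<le> A * norm (x - z) + A * (c * norm (x - z))"
    proof (intro add_mono mult_mono b A)
      show "\<bar>f x - f z\<bar> / w x \<le> A * norm (x - z)"
        using wlip_diff_le[OF f, of x z] w_pos[of x] unfolding m by (simp add: divide_le_eq mult_ac)
      show "\<bar>w x - w z\<bar> / w x \<le> c * norm (x - z)"
        using w_diff[of x z] w_pos[of x] unfolding m by (simp add: divide_le_eq mult_ac)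
    qed (use w_pos[of x] in auto)
    finally show ?thesis by (simp add: algebra_simps)
  qed
  show "\<bar>f x / w x - f z / w z\<bar> \<le> (1 + c) * A * norm (x - z)" for x z
    using *[of x z] *[of z x] by (cases "w z \<le> w x") (auto simp: norm_minus_commute abs_minus_commute)
qed

section \<open>Admissible measures and pairing with the dual distance\<close>

definition adm :: "'a measure \<Rightarrow> bool" where
  "adm \<nu> \<longleftrightarrow> prob_space \<nu> \<and> sets \<nu> = sets borel \<and> integrable \<nu> w"

lemma adm_gibbs: "adm \<gamma>"
  using prob_space_gibbs integrable_gibbs[of w 1 1] w_nonneg by (simp add: adm_def sets_gibbs)

lemma adm_integrable:
  fixes f :: "'a \<Rightarrow> 'b::{banach, second_countable_topology}"
  assumes \<nu>: "adm \<nu>" and f: "f \<in> borel_measurable borel" and b: "\<And>x. norm (f x) \<le> B * w x"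
  shows "integrable \<nu> f"
proof -
  have s: "sets \<nu> = sets borel" and i: "integrable \<nu> (\<lambda>x. B * w x)" using \<nu> by (auto simp: adm_def)
  show ?thesis
    by (rule Bochner_Integration.integrable_bound[OF i])
       (use f in \<open>auto simp: measurable_cong_sets[OF s refl] intro!: AE_I2 order_trans[OF b abs_ge_self]\<close>)
qed

lemma adm_integrable_wlip:
  fixes f :: "'a \<Rightarrow> 'b::{banach, second_countable_topology}"
  shows "adm \<nu> \<Longrightarrow> wlip A f \<Longrightarrow> integrable \<nu> f"
  by (rule adm_integrable[OF _ wlip_measurable wlip_le])

definition mass where "mass \<nu> = (\<integral>x. w x \<partial>\<nu>)"

lemma mass_nonneg: "mass \<nu> \<ge> 0"
  unfolding mass_def by (rule Bochner_Integration.integral_nonneg) (rule w_nonneg)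

lemma adm_integral_bound:
  fixes f :: "'a \<Rightarrow> 'b::{banach, second_countable_topology}"
  assumes "adm \<nu>" "\<And>x. norm (f x) \<le> B * w x" shows "norm (\<integral>x. f x \<partial>\<nu>) \<le> B * mass \<nu>"
  using integral_norm_bound_ineq[of \<nu> "\<lambda>x. B * w x" f] assms by (simp add: adm_def mass_def)

abbreviation "dst \<nu> \<equiv> blv_norm_diff V \<nu> \<gamma>"

lemma dst_bdd_above:
  assumes "adm \<nu>"
  shows "bdd_above ((\<lambda>\<phi>. (\<integral>x. \<phi> x * (1 + V x) \<partial>\<nu>) - (\<integral>x. \<phi> x * (1 + V x) \<partial>\<gamma>)) ` {\<phi>. bl_norm \<phi> \<le> 1})"
proof (rule bdd_aboveI2)
  fix \<phi> :: "'a \<Rightarrow> real" assume "\<phi> \<in> {\<phi>. bl_norm \<phi> \<le> 1}"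
  then have "\<bar>\<phi> x\<bar> \<le> 1" for x using bl_norm_le_D(1)[of \<phi> 1] by simp
  then have b: "norm (\<phi> x * (1 + V x)) \<le> 1 * w x" for x
    using w_pos[of x] by (simp add: abs_mult w_def[symmetric] mult_le_cancel_right1)
  show "(\<integral>x. \<phi> x * (1 + V x) \<partial>\<nu>) - (\<integral>x. \<phi> x * (1 + V x) \<partial>\<gamma>) \<le> mass \<nu> + mass \<gamma>"
    using adm_integral_bound[OF assms b] adm_integral_bound[OF adm_gibbs b] by (simp add: abs_le_iff)
qed

lemma dst_upper:
  assumes "adm \<nu>" "bl_norm \<phi> \<le> 1"
  shows "(\<integral>x. \<phi> x * w x \<partial>\<nu>) - (\<integral>x. \<phi> x * w x \<partial>\<gamma>) \<le> dst \<nu>"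
  unfolding blv_norm_diff_def w_def using assms by (intro cSUP_upper dst_bdd_above) auto

lemma dst_least:
  assumes "\<And>\<phi>. bl_norm \<phi> \<le> 1 \<Longrightarrow> (\<integral>x. \<phi> x * w x \<partial>\<nu>) - (\<integral>x. \<phi> x * w x \<partial>\<gamma>) \<le> B"
  shows "dst \<nu> \<le> B"
  unfolding blv_norm_diff_def
proof (rule cSUP_least)
  have "bl_norm (\<lambda>x::'a. 0::real) \<le> 1" using bl_norm_le_I[of "\<lambda>x::'a. 0" 1] by simp
  then show "{\<phi> :: 'a \<Rightarrow> real. bl_norm \<phi> \<le> 1} \<noteq> {}" by blast
qed (use assms in \<open>simp add: w_def\<close>)

lemma dst_nonneg: "adm \<nu> \<Longrightarrow> dst \<nu> \<ge> 0"
  using dst_upper[of \<nu> "\<lambda>_. 0"] bl_norm_le_I[of "\<lambda>x::'a. 0" 1] by simp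

text \<open>\<open>f / (w B)\<close> competes in the supremum as soon as \<open>B\<close> is at
  least the bounded Lipschitz norm of \<open>f / w\<close>, which is at most
  \<open>(1 + c) A\<close>.\<close>

lemma wlip_dst:
  fixes f :: "'a \<Rightarrow> real"
  assumes \<nu>: "adm \<nu>" and f: "wlip A f"
  shows "\<bar>(\<integral>x. f x \<partial>\<nu>) - (\<integral>x. f x \<partial>\<gamma>)\<bar> \<le> (1 + c) * A * dst \<nu>"
proof -
  have *: "(\<integral>x. f x \<partial>\<nu>) - (\<integral>x. f x \<partial>\<gamma>) \<le> B * dst \<nu>" if f: "wlip A f" and B: "B > 0" "(1 + c) * A \<le> B"
    for f :: "'a \<Rightarrow> real" and B
  proof -
    have "bl_norm (\<lambda>x. f x / w x) \<le> ennreal B"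
      using bl_of_wlip[OF f] B(2) by (meson ennreal_leI order_trans)
    note b = bl_norm_le_D[OF this less_imp_le[OF B(1)]]
    have "bl_norm (\<lambda>x. f x / w x / B) \<le> ennreal 1"
    proof (rule bl_norm_le_I)
      show "\<bar>f x / w x / B\<bar> \<le> 1" for x using b(1)[of x] B(1) unfolding abs_divide[of "f x / w x" B]
          by (simp only: divide_le_eq_1_pos abs_of_pos)
      have "\<bar>f x / w x / B - f z / w z / B\<bar> = \<bar>f x / w x - f z / w z\<bar> / B" for x z
        using B(1) by (metis abs_divide abs_of_pos diff_divide_distrib)
      then show "\<bar>f x / w x / B - f z / w z / B\<bar> \<le> 1 * norm (x - z)" for x z
        using b(2)[of x z] B(1) by (simp only: pos_divide_le_eq mult_1 mult.commute[of _ B])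
    qed simp
    then have "(\<integral>x. f x / w x / B * w x \<partial>\<nu>) - (\<integral>x. f x / w x / B * w x \<partial>\<gamma>) \<le> dst \<nu>"
      by (intro dst_upper[OF \<nu>]) simp
    also have "(\<lambda>x. f x / w x / B * w x) = (\<lambda>x. f x / B)" using w_pos less_imp_neq by fastforce
    finally show ?thesis using B(1) by (simp add: field_simps)
  qed
  have **: "\<bar>(\<integral>x. f x \<partial>\<nu>) - (\<integral>x. f x \<partial>\<gamma>)\<bar> \<le> B * dst \<nu>" if B: "B > 0" "(1 + c) * A \<le> B" for B
    using *[OF f B] *[OF wlip_minus[OF f] B] by simp
  \<comment> \<open>\<open>B\<close> has to be positive to be divided by, while \<open>A\<close> may
    be 0; letting \<open>B\<close> decrease to \<open>(1 + c) A\<close> covers both cases.\<close>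
  have "((\<lambda>B. B * dst \<nu>) \<longlongrightarrow> ((1 + c) * A) * dst \<nu>) (at_right ((1 + c) * A))"
    by (intro tendsto_intros)
  then show ?thesis
  proof (rule tendsto_lowerbound)
    have "(1 + c) * A \<ge> 0" using wlip_nonneg[OF f] c_nonneg by simp
    then show "\<forall>\<^sub>F B in at_right ((1 + c) * A). \<bar>(\<integral>x. f x \<partial>\<nu>) - (\<integral>x. f x \<partial>\<gamma>)\<bar> \<le> B * dst \<nu>"
      by (auto simp: eventually_at_filter intro!: always_eventually **)
  qed simp
qed

text \<open>The scalar bound is applied to the component of \<open>f\<close> along the difference
  itself, so no dimension factor arises; the 2 comes from \<open>wlip_bilinear\<close>.\<close>

lemma wlip_dst_vector:
  fixes f :: "'a \<Rightarrow> 'b::euclidean_space"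
  assumes \<nu>: "adm \<nu>" and f: "wlip A f"
  shows "norm ((\<integral>x. f x \<partial>\<nu>) - (\<integral>x. f x \<partial>\<gamma>)) \<le> 2 * (1 + c) * A * dst \<nu>"
proof (cases "(\<integral>x. f x \<partial>\<nu>) - (\<integral>x. f x \<partial>\<gamma>) = 0")
  case True
  then show ?thesis using wlip_nonneg[OF f] c_nonneg dst_nonneg[OF \<nu>] by simp
next
  case False
  define u where "u = (\<integral>x. f x \<partial>\<nu>) - (\<integral>x. f x \<partial>\<gamma>)"
  have u: "norm u > 0" using False by (simp add: u_def)
  have "wlip (2 * A * norm u) (\<lambda>x. f x \<bullet> u)"
    by (rule wlip_bilinear[OF bounded_bilinear_inner _ f]) (auto simp: Cauchy_Schwarz_ineq2)
  from wlip_dst[OF \<nu> this]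
  have "u \<bullet> u \<le> (1 + c) * (2 * A * norm u) * dst \<nu>"
    using adm_integrable_wlip[OF \<nu> f] adm_integrable_wlip[OF adm_gibbs f]
    by (simp add: u_def inner_diff_left)
  then have "norm u * norm u \<le> (2 * (1 + c) * A * dst \<nu>) * norm u"
    by (simp add: dot_square_norm power2_eq_square mult_ac)
  then show ?thesis using u by (simp add: u_def)
qed

end

section \<open>The velocity field and the Stein kernel\<close>

text \<open>With a product majorant, Fubini can be applied below after checking joint measurability
  and one pointwise bound.\<close>

lemma pair_integrable_bound:
  fixes f :: "'a \<times> 'b \<Rightarrow> real"
  assumes "sigma_finite_measure M" "sigma_finite_measure N" and f: "f \<in> borel_measurable (M \<Otimes>\<^sub>M N)"
    and a: "integrable M a" and b: "integrable N b"
    and le: "\<And>x y. \<bar>f (x, y)\<bar> \<le> a x * b y"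
  shows "integrable (M \<Otimes>\<^sub>M N) f"
proof -
  interpret pair_sigma_finite M N using assms(1,2) by (simp add: pair_sigma_finite_def)
  have [measurable]: "a \<in> borel_measurable M" "b \<in> borel_measurable N" using a b by auto
  have "integrable (M \<Otimes>\<^sub>M N) (\<lambda>(x, y). a x * b y)"
  proof (rule Fubini_integrable)
    show "AE x in M. integrable N (\<lambda>y. case (x, y) of (x, y) \<Rightarrow> a x * b y)" using b by simp
    have "integrable M (\<lambda>x. \<bar>a x\<bar> * (\<integral>y. \<bar>b y\<bar> \<partial>N))" using a by simp
    then show "integrable M (\<lambda>x. \<integral>y. norm (case (x, y) of (x, y) \<Rightarrow> a x * b y) \<partial>N)"
      by (simp add: abs_mult)
  qed measurable
  then show ?thesis
    by (rule Bochner_Integration.integrable_bound[OF _ f])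
       (use le in \<open>auto intro!: AE_I2 order_trans[OF le abs_ge_self]\<close>)
qed

lemma iterated_integral_swap:
  fixes f :: "'a \<Rightarrow> 'b \<Rightarrow> real"
  assumes "sigma_finite_measure M" "sigma_finite_measure N" "case_prod f \<in> borel_measurable (M \<Otimes>\<^sub>M N)"
    "integrable M a" "integrable N b" "\<And>x y. \<bar>f x y\<bar> \<le> a x * b y"
  shows "(\<integral>x. (\<integral>y. f x y \<partial>N) \<partial>M) = (\<integral>y. (\<integral>x. f x y \<partial>M) \<partial>N)"
proof -
  interpret pair_sigma_finite M N using assms(1,2) by (simp add: pair_sigma_finite_def)
  have "integrable (M \<Otimes>\<^sub>M N) (case_prod f)"
    by (rule pair_integrable_bound[OF assms(1,2,3,4,5)]) (use assms(6) in simp)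
  then show ?thesis using integral_fst integral_snd by metis
qed

text \<open>Linearity in the second argument reduces joint measurability to the finitely many
  coefficient functions \<open>\<lambda>x. L x b\<close>.\<close>

lemma linear_measurable_compose:
  fixes L :: "'a \<Rightarrow> 'b::euclidean_space \<Rightarrow> real"
  assumes lin: "\<And>x. linear (L x)" and [measurable]: "\<And>v. (\<lambda>x. L x v) \<in> borel_measurable M"
    and [measurable]: "f \<in> measurable N M" "g \<in> borel_measurable N"
  shows "(\<lambda>p. L (f p) (g p)) \<in> borel_measurable N"
proof -
  have "L x v = (\<Sum>b\<in>Basis. (v \<bullet> b) * L x b)" for x v
  proof -
    have "L x v = L x (\<Sum>b\<in>Basis. (v \<bullet> b) *\<^sub>R b)" by (simp only: euclidean_representation)
    also have "\<dots> = (\<Sum>b\<in>Basis. (v \<bullet> b) * L x b)" by (simp only: linear_sum[OF lin] linear_scale[OF lin] real_scaleR_def)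
    finally show ?thesis .
  qed
  then have "(\<lambda>p. L (f p) (g p)) = (\<lambda>p. \<Sum>b\<in>Basis. (g p \<bullet> b) * L (f p) b)" by (intro ext)
  moreover have "(\<lambda>p. L (f p) b) \<in> borel_measurable N" for b
    by measurable
  ultimately show ?thesis by simp
qed

context stein begin

section \<open>Kernel bounds and the velocity field\<close>

lemma K_lip: "\<bar>K x - K z\<bar> \<le> c * norm (x - z)"
  by (rule lipschitz_if_derivative_bound[OF K_has_derivative, unfolded real_norm_def])
     (meson Cauchy_Schwarz_ineq2 grad_K_le mult_right_mono norm_ge_zero order_trans)

lemma grad_K_lip: "norm (grad K x - grad K z) \<le> c * norm (x - z)"
  by (rule lipschitz_if_derivative_bound[OF grad_K_has_derivative K2_le])

lemma linear_K2: "linear (K2 x)" by (rule has_derivative_linear[OF grad_K_has_derivative])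

lemma grad_K_odd: "grad K (- x) = - grad K x"
proof -
  have "((\<lambda>x. K (- x)) has_derivative (\<lambda>v. grad K (- x) \<bullet> (- v))) (at x)"
    by (rule has_derivative_compose[OF has_derivative_minus[OF has_derivative_ident] K_has_derivative])
  then have "(K has_derivative (\<lambda>v. - (grad K (- x) \<bullet> v))) (at x)" by (simp add: K_even)
  from grad_inner[OF this] have "grad K x \<bullet> v = (- grad K (- x)) \<bullet> v" for v by simp
  then have "grad K x = - grad K (- x)" by (metis vector_eq_rdot)
  then show ?thesis by simp
qed

lemma continuous_K: "continuous_on UNIV K" and continuous_grad_K: "continuous_on UNIV (grad K)"
  and continuous_K2: "continuous_on UNIV (\<lambda>z. K2 z v)" and continuous_grad_V: "continuous_on UNIV (grad V)"
proof -
  show "continuous_on UNIV K" "continuous_on UNIV (grad K)"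
    by (rule has_derivative_continuous_on, rule has_derivative_at_withinI,
        rule K_has_derivative grad_K_has_derivative)+
  show "continuous_on UNIV (\<lambda>z. K2 z v)"
    using K2_lip[of _ v] c_nonneg by (intro lipschitz_on_continuous_on[of "c * norm v"] lipschitz_onI)
      (auto simp: dist_norm mult_ac)
  show "continuous_on UNIV (grad V)" by (rule smooth_continuous[OF grad_smooth[OF V_smooth]])
qed

lemma K_measurable [measurable]: "K \<in> borel_measurable borel"
  and grad_K_measurable [measurable]: "grad K \<in> borel_measurable borel"
  and K2_measurable [measurable]: "(\<lambda>z. K2 z v) \<in> borel_measurable borel"
  and grad_V_measurable [measurable]: "grad V \<in> borel_measurable borel"
  by (auto intro!: borel_measurable_continuous_onI continuous_K continuous_grad_K continuous_K2 continuous_grad_V)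

lemma K_compose_measurable [measurable]:
  assumes "f \<in> borel_measurable M"
  shows "(\<lambda>p. K (f p)) \<in> borel_measurable M" "(\<lambda>p. grad K (f p)) \<in> borel_measurable M"
    "(\<lambda>p. K2 (f p) v) \<in> borel_measurable M" "(\<lambda>p. grad V (f p)) \<in> borel_measurable M"
  by (auto intro!: measurable_compose[OF assms] K_measurable grad_K_measurable K2_measurable grad_V_measurable)

definition cg where "cg = 2 * c + exp c * c"

lemma cg_nonneg: "cg \<ge> 0" using c_nonneg by (simp add: cg_def)

lemma wlip_grad_V: "wlip cg (grad V)"
  unfolding cg_def by (rule wlip_if_derivative[OF hess_has_derivative grad_V_le hess_le])

text \<open>The integrand of \<open>velocity\<close> as one function of both points;
  \<open>dPhi\<close> is its derivative in the first. Both are weighted Lipschitz in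
  \<open>y\<close>, so that their integrals against \<open>\<nu>\<close> and \<open>\<gamma>\<close>
  differ by a multiple of the dual distance.\<close>

definition Phi :: "'a \<Rightarrow> 'a \<Rightarrow> 'a" where "Phi x y = grad K (x - y) + K (x - y) *\<^sub>R grad V y"

definition dPhi :: "'a \<Rightarrow> 'a \<Rightarrow> 'a \<Rightarrow> 'a" where
  "dPhi x y v = K2 (x - y) v + (grad K (x - y) \<bullet> v) *\<^sub>R grad V y"

lemma Phi_measurable [measurable]:
  "f \<in> borel_measurable M \<Longrightarrow> g \<in> borel_measurable M \<Longrightarrow> (\<lambda>p. Phi (f p) (g p)) \<in> borel_measurable M"
  unfolding Phi_def by (intro borel_measurable_add borel_measurable_scaleR K_compose_measurable borel_measurable_diff)

definition cp where "cp = c + 2 * cg * c"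

lemma cp_nonneg: "cp \<ge> 0" using c_nonneg cg_nonneg by (simp add: cp_def)

lemma wlip_Phi: "wlip cp (Phi x)"
  unfolding Phi_def[abs_def] cp_def
proof (intro wlip_add)
  show "wlip c (\<lambda>y. grad K (x - y))"
  proof (rule wlip_lipschitz[OF grad_K_le])
    show "norm (grad K (x - y) - grad K (x - z)) \<le> c * norm (y - z)" for y z
      using grad_K_lip[of "x - y" "x - z"] by (simp add: norm_minus_commute)
  qed
  show "wlip (2 * cg * c) (\<lambda>y. K (x - y) *\<^sub>R grad V y)"
  proof (rule wlip_bilinear[OF bounded_bilinear.flip[OF bounded_bilinear_scaleR] _ wlip_grad_V])
    show "norm (K (x - y) - K (x - z)) \<le> c * norm (y - z)" for y z
      using K_lip[of "x - y" "x - z"] by (simp add: norm_minus_commute)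
  qed (auto simp: K_le)
qed

lemma wlip_dPhi: "wlip (cp * norm v) (\<lambda>y. dPhi x y v)"
proof -
  have 1: "wlip (c * norm v) (\<lambda>y. K2 (x - y) v)"
  proof (rule wlip_lipschitz)
    show "norm (K2 (x - y) v - K2 (x - z) v) \<le> c * norm v * norm (y - z)" for y z
      using K2_lip[of "x - y" v "x - z"] by (simp add: norm_minus_commute mult_ac)
  qed (rule K2_le)
  have 2: "wlip (2 * cg * (c * norm v)) (\<lambda>y. (grad K (x - y) \<bullet> v) *\<^sub>R grad V y)"
  proof (rule wlip_bilinear[OF bounded_bilinear.flip[OF bounded_bilinear_scaleR] _ wlip_grad_V])
    show "norm (grad K (x - y) \<bullet> v) \<le> c * norm v" for y
      using Cauchy_Schwarz_ineq2[of "grad K (x - y)" v] mult_right_mono[OF grad_K_le[of "x - y"], of "norm v"] by simp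
    show "norm (grad K (x - y) \<bullet> v - grad K (x - z) \<bullet> v) \<le> c * norm v * norm (y - z)" for y z
      using Cauchy_Schwarz_ineq2[of "grad K (x - y) - grad K (x - z)" v]
        mult_right_mono[OF grad_K_lip[of "x - y" "x - z"], of "norm v"]
      by (simp add: norm_minus_commute inner_diff_left mult_ac)
  qed auto
  show ?thesis using wlip_add[OF 1 2] by (simp add: dPhi_def cp_def algebra_simps)
qed

lemma Phi_has_derivative: "((\<lambda>x. Phi x y) has_derivative dPhi x y) (at x)"
proof -
  have s: "((\<lambda>x. x - y) has_derivative (\<lambda>v. v)) (at x)" by (auto intro!: derivative_eq_intros)
  show ?thesis unfolding Phi_def dPhi_def[abs_def]
    by (intro has_derivative_add has_derivative_scaleR_left
        has_derivative_compose[OF s grad_K_has_derivative] has_derivative_compose[OF s K_has_derivative])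
qed

lemma linear_dPhi: "linear (dPhi x y)" by (rule has_derivative_linear[OF Phi_has_derivative])

text \<open>The constant may grow like \<open>w y\<close>, as it is integrated against an admissible
  measure; it provides the quadratic remainder when the velocity is differentiated.\<close>

lemma dPhi_lip: "norm (dPhi x y v - dPhi z y v) \<le> (2 * c * c * w y) * norm (x - z) * norm v"
proof -
  have "dPhi x y v - dPhi z y v = (K2 (x - y) v - K2 (z - y) v) + ((grad K (x - y) - grad K (z - y)) \<bullet> v) *\<^sub>R grad V y"
    by (simp add: dPhi_def inner_diff_left scaleR_diff_left)
  also have "norm \<dots> \<le> c * norm (x - z) * norm v + (c * norm (x - z) * norm v) * (c * w y)"
  proof (intro norm_triangle_mono)
    show "norm (K2 (x - y) v - K2 (z - y) v) \<le> c * norm (x - z) * norm v" using K2_lip[of "x - y" v "z - y"] by simp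
    have "\<bar>(grad K (x - y) - grad K (z - y)) \<bullet> v\<bar> \<le> c * norm (x - z) * norm v"
      using Cauchy_Schwarz_ineq2[of "grad K (x - y) - grad K (z - y)" v]
        mult_right_mono[OF grad_K_lip[of "x - y" "z - y"], of "norm v"] by simp
    then show "norm (((grad K (x - y) - grad K (z - y)) \<bullet> v) *\<^sub>R grad V y) \<le> (c * norm (x - z) * norm v) * (c * w y)"
      unfolding norm_scaleR by (rule mult_mono[OF _ grad_V_le]) (use c_nonneg in auto)
  qed
  finally have 1: "norm (dPhi x y v - dPhi z y v) \<le> c * norm (x - z) * norm v + (c * norm (x - z) * norm v) * (c * w y)" .
  have "c * norm (x - z) * norm v \<le> (c * norm (x - z) * norm v) * (c * w y)"
  proof -
    have "1 \<le> c * w y" using mult_mono[OF c_ge_1 w_ge_1[of y]] c_nonneg by simp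
    then show ?thesis using mult_left_mono[of 1 "c * w y" "c * norm (x - z) * norm v"] c_nonneg by simp
  qed
  with 1 have "norm (dPhi x y v - dPhi z y v) \<le> 2 * ((c * norm (x - z) * norm v) * (c * w y))" by linarith
  then show ?thesis by (simp add: mult_ac)
qed

abbreviation "vel \<equiv> velocity K V"

definition dvel where "dvel \<nu> x v = (\<integral>y. dPhi x y v \<partial>\<nu>)"

context
  fixes \<nu> assumes \<nu>: "adm \<nu>"
begin

lemma integrable_Phi: "integrable \<nu> (Phi x)" by (rule adm_integrable_wlip[OF \<nu> wlip_Phi])

lemma integrable_dPhi: "integrable \<nu> (\<lambda>y. dPhi x y v)" by (rule adm_integrable_wlip[OF \<nu> wlip_dPhi])

lemma vel_eq: "vel \<nu> x = (\<integral>y. Phi x y \<partial>\<nu>)"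
proof -
  have b1: "integrable \<nu> (\<lambda>y. grad K (x - y))"
  proof (rule adm_integrable[OF \<nu>])
    show "norm (grad K (x - y)) \<le> c * w y" for y
      using grad_K_le[of "x - y"] mult_left_mono[OF w_ge_1[of y] c_nonneg] by simp
  qed measurable
  have b2: "integrable \<nu> (\<lambda>y. K (x - y) *\<^sub>R grad V y)"
  proof (rule adm_integrable[OF \<nu>])
    show "norm (K (x - y) *\<^sub>R grad V y) \<le> (c * c) * w y" for y
      using mult_mono[OF K_le[of "x - y"] grad_V_le[of y]] c_nonneg by (simp add: mult_ac)
  qed measurable
  show ?thesis unfolding velocity_def Phi_def using b1 b2 by simp
qed

lemma vel_has_derivative: "(vel \<nu> has_derivative dvel \<nu> x) (at x)"
proof -
  have "((\<lambda>x. \<integral>y. Phi x y \<partial>\<nu>) has_derivative (\<lambda>v. \<integral>y. dPhi x y v \<partial>\<nu>)) (at x)"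
  proof (rule has_derivative_integral_quadratic[where r=1 and c="\<lambda>y. 2 * c * c * w y"])
    show "integrable \<nu> (\<lambda>y. 2 * c * c * w y)" using \<nu> by (simp add: adm_def)
    fix y x' :: 'a
    show "norm (Phi x' y - Phi x y - dPhi x y (x' - x)) \<le> 2 * c * c * w y * (norm (x' - x))\<^sup>2"
      by (rule quadratic_remainder[where f'="\<lambda>x. dPhi x y"])
         (use Phi_has_derivative dPhi_lip c_nonneg w_nonneg in auto)
  qed (auto intro: integrable_Phi integrable_dPhi linear_dPhi)
  then show ?thesis unfolding vel_eq[abs_def] dvel_def[abs_def] .
qed

lemma dvel_lip: "norm (dvel \<nu> x v - dvel \<nu> z v) \<le> 2 * c * c * mass \<nu> * norm (x - z) * norm v"
proof -
  have "dvel \<nu> x v - dvel \<nu> z v = (\<integral>y. dPhi x y v - dPhi z y v \<partial>\<nu>)"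
    unfolding dvel_def using integrable_dPhi by simp
  also have "norm \<dots> \<le> (2 * c * c * norm (x - z) * norm v) * mass \<nu>"
    by (rule adm_integral_bound[OF \<nu>]) (use dPhi_lip in \<open>simp add: mult_ac\<close>)
  finally show ?thesis by (simp add: mult_ac)
qed

end

text \<open>\<open>grad V\<close> times the Gibbs density is minus the gradient of the density, so
  integration by parts cancels the two terms of the velocity. Because of this stationarity the
  velocity of \<open>\<nu>\<close> is of first order in the distance from \<open>\<nu>\<close> to
  \<open>\<gamma>\<close>.\<close>

lemma vel_gibbs: "vel \<gamma> x = 0"
proof -
  have "vel \<gamma> x \<bullet> v = 0" for v
  proof -
    have "(\<integral>y. - (grad K (x - y) \<bullet> v) \<partial>\<gamma>) = (\<integral>y. K (x - y) * (grad V y \<bullet> v) \<partial>\<gamma>)"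
    proof (rule gibbs_integration_by_parts[where F'="\<lambda>y v. - (grad K (x - y) \<bullet> v)" and k=0 and B="c + c * norm v"])
      fix y
      have s: "((\<lambda>y. x - y) has_derivative (\<lambda>v. - v)) (at y)" by (auto intro!: derivative_eq_intros)
      show "((\<lambda>y. K (x - y)) has_derivative (\<lambda>v. - (grad K (x - y) \<bullet> v))) (at y)"
        using has_derivative_compose[OF s K_has_derivative] by simp
      have cn: "0 \<le> c * norm v" using c_nonneg by simp
      show "\<bar>K (x - y)\<bar> \<le> (c + c * norm v) * w y ^ 0" using K_le[of "x - y"] cn unfolding power_0 mult_1_right by linarith
      show "\<bar>- (grad K (x - y) \<bullet> v)\<bar> \<le> (c + c * norm v) * w y ^ 0"
        using Cauchy_Schwarz_ineq2[of "grad K (x - y)" v] mult_right_mono[OF grad_K_le[of "x - y"], of "norm v"] c_nonneg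
        by simp
    next
      show "continuous_on UNIV (\<lambda>y. - (grad K (x - y) \<bullet> v))"
        by (intro continuous_intros continuous_on_compose2[OF continuous_grad_K]) auto
    qed
    moreover have "vel \<gamma> x \<bullet> v = (\<integral>y. Phi x y \<bullet> v \<partial>\<gamma>)"
      unfolding vel_eq[OF adm_gibbs] using integrable_Phi[OF adm_gibbs] by simp
    moreover have "(\<integral>y. Phi x y \<bullet> v \<partial>\<gamma>) = (\<integral>y. grad K (x - y) \<bullet> v \<partial>\<gamma>) + (\<integral>y. K (x - y) * (grad V y \<bullet> v) \<partial>\<gamma>)"
    proof -
      have "integrable \<gamma> (\<lambda>y. grad K (x - y) \<bullet> v)"
      proof (rule integrable_gibbs[where k=0])
        show "norm (grad K (x - y) \<bullet> v) \<le> (c * norm v) * w y ^ 0" for y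
          using Cauchy_Schwarz_ineq2[of "grad K (x - y)" v] mult_right_mono[OF grad_K_le[of "x - y"], of "norm v"] by simp
      qed measurable
      moreover have "integrable \<gamma> (\<lambda>y. Phi x y \<bullet> v)" using integrable_Phi[OF adm_gibbs] by simp
      moreover have "K (x - y) * (grad V y \<bullet> v) = Phi x y \<bullet> v - grad K (x - y) \<bullet> v" for y
        by (simp add: Phi_def inner_add_left)
      ultimately show ?thesis by simp
    qed
    ultimately show ?thesis by simp
  qed
  then show ?thesis using inner_eq_zero_iff by blast
qed

lemma dvel_gibbs: "dvel \<gamma> x v = 0"
proof -
  have "((\<lambda>x. 0) has_derivative (\<lambda>v. 0)) (at x)" by simp
  moreover have "((\<lambda>x. 0) has_derivative dvel \<gamma> x) (at x)"
    using vel_has_derivative[OF adm_gibbs, of x] vel_gibbs by (metis (no_types, lifting) ext)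
  ultimately show ?thesis by (metis has_derivative_unique)
qed

definition cv where "cv = 2 * (1 + c) * cp"

lemma cv_nonneg: "cv \<ge> 0" using c_nonneg cp_nonneg by (simp add: cv_def)

context
  fixes \<nu> assumes \<nu>: "adm \<nu>"
begin

lemma vel_le: "norm (vel \<nu> x) \<le> cv * dst \<nu>"
  using wlip_dst_vector[OF \<nu> wlip_Phi, of x] vel_gibbs[of x]
  by (simp add: vel_eq[OF \<nu>] vel_eq[OF adm_gibbs] cv_def)

lemma dvel_le: "norm (dvel \<nu> x v) \<le> cv * dst \<nu> * norm v"
  using wlip_dst_vector[OF \<nu> wlip_dPhi, of x v] dvel_gibbs[of x v]
  by (simp add: dvel_def cv_def mult_ac)

lemma vel_lip: "norm (vel \<nu> x - vel \<nu> z) \<le> cv * dst \<nu> * norm (x - z)"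
  by (rule lipschitz_if_derivative_bound[OF vel_has_derivative[OF \<nu>] dvel_le])

end

section \<open>The Stein kernel and integration by parts\<close>

definition Lap where "Lap z = (\<Sum>b\<in>Basis. K2 z b \<bullet> b)"

definition dm :: real where "dm = real DIM('a)"

lemma Lap_le: "\<bar>Lap z\<bar> \<le> dm * c"
proof -
  have "\<bar>Lap z\<bar> \<le> (\<Sum>b\<in>(Basis::'a set). c)" unfolding Lap_def
  proof (rule order_trans[OF sum_abs sum_mono])
    fix b :: 'a assume b: "b \<in> Basis"
    show "\<bar>K2 z b \<bullet> b\<bar> \<le> c" using Cauchy_Schwarz_ineq2[of "K2 z b" b] K2_le[of z b] b by simp
  qed
  then show ?thesis by (simp add: dm_def)
qed

lemma Lap_lip: "\<bar>Lap x - Lap z\<bar> \<le> dm * c * norm (x - z)"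
proof -
  have "Lap x - Lap z = (\<Sum>b\<in>Basis. (K2 x b - K2 z b) \<bullet> b)" by (simp add: Lap_def sum_subtractf inner_diff_left)
  also have "\<bar>\<dots>\<bar> \<le> (\<Sum>b\<in>(Basis::'a set). c * norm (x - z))"
  proof (rule order_trans[OF sum_abs sum_mono])
    fix b :: 'a assume b: "b \<in> Basis"
    show "\<bar>(K2 x b - K2 z b) \<bullet> b\<bar> \<le> c * norm (x - z)"
      using Cauchy_Schwarz_ineq2[of "K2 x b - K2 z b" b] K2_lip[of x b z] b by simp
  qed
  finally show ?thesis by (simp add: mult.assoc dm_def)
qed

lemma Lap_measurable [measurable]: "Lap \<in> borel_measurable borel"
  unfolding Lap_def[abs_def] by measurable

text \<open>For \<open>q = grad V x\<close> this is the Stein kernel, that is \<open>K\<close> with the adjoint of the gradient in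
  \<open>L\<^sup>2(\<gamma>)\<close> applied in both variables, up to sign. The unbounded terms are controlled by the assumptions
  \<open>BL1\<close> and \<open>BL2\<close>, and its integral in \<open>y\<close> against \<open>\<gamma>\<close> vanishes.\<close>

definition ell where
  "ell q x y = Lap (x - y) + grad K (x - y) \<bullet> grad V y - q \<bullet> grad K (x - y) - K (x - y) * (q \<bullet> grad V y)"

lemma ell_measurable [measurable]: "(\<lambda>(x, y). ell (grad V x) x y) \<in> borel_measurable (borel \<Otimes>\<^sub>M borel)"
  and ell_measurable1 [measurable]: "ell q x \<in> borel_measurable borel"
  unfolding ell_def[abs_def] by measurable

definition ck where "ck = dm * c + 2 * cg * c + 2 * c * c + 2 * c * c"

text \<open>The constant is independent of \<open>x\<close>, which later bounds the weighted
  divergence of the velocity by the dual distance alone. Multiplying by \<open>w y\<close> undoes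
  the quotients in \<open>BL1\<close> and \<open>BL2\<close>.\<close>

lemma wlip_stein_kernel: "wlip ck (ell (grad V x) x)"
  unfolding ell_def[abs_def] ck_def
proof (intro wlip_add wlip_diff)
  show "wlip (dm * c) (\<lambda>y. Lap (x - y))"
  proof (rule wlip_lipschitz, unfold real_norm_def)
    show "\<bar>Lap (x - y) - Lap (x - z)\<bar> \<le> dm * c * norm (y - z)" for y z
      using Lap_lip[of "x - y" "x - z"] by (simp add: norm_minus_commute)
  qed (rule Lap_le)
  show "wlip (2 * cg * c) (\<lambda>y. grad K (x - y) \<bullet> grad V y)"
  proof (rule wlip_bilinear[OF bounded_bilinear.flip[OF bounded_bilinear_inner] _ wlip_grad_V])
    show "norm (grad K (x - y) - grad K (x - z)) \<le> c * norm (y - z)" for y z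
      using grad_K_lip[of "x - y" "x - z"] by (simp add: norm_minus_commute)
    show "norm (b \<bullet> a) \<le> norm a * norm b" for a b :: 'a
      using Cauchy_Schwarz_ineq2[of b a] by (simp add: mult.commute)
  qed (rule grad_K_le)
  show "wlip (2 * c * c) (\<lambda>y. grad V x \<bullet> grad K (x - y))"
  proof -
    have eq: "(\<lambda>y. ((grad V x /\<^sub>R w y) \<bullet> grad K (x - y)) * w y) = (\<lambda>y. grad V x \<bullet> grad K (x - y))"
    proof
      show "((grad V x /\<^sub>R w y) \<bullet> grad K (x - y)) * w y = grad V x \<bullet> grad K (x - y)" for y
        using w_pos[of y] by simp
    qed
    show ?thesis using wlip_of_bl[OF BL1 c_nonneg, of x] unfolding eq .
  qed
  show "wlip (2 * c * c) (\<lambda>y. K (x - y) * (grad V x \<bullet> grad V y))"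
  proof -
    have eq: "(\<lambda>y. (grad V x \<bullet> grad V y) / w y * K (x - y) * w y) = (\<lambda>y. K (x - y) * (grad V x \<bullet> grad V y))"
    proof
      show "(grad V x \<bullet> grad V y) / w y * K (x - y) * w y = K (x - y) * (grad V x \<bullet> grad V y)" for y
        using w_pos[of y] by simp
    qed
    show ?thesis using wlip_of_bl[OF BL2 c_nonneg, of x] unfolding eq .
  qed
qed

text \<open>The class of functions that are integrated by parts: \<open>k = 1\<close> for the
  iterates, \<open>k = 2\<close> for their squares, \<open>k = 0\<close> for the constant 1.\<close>

definition gr where
  "gr B k F F' \<longleftrightarrow> (\<forall>x. (F has_derivative F' x) (at x)) \<and> (\<forall>x. \<bar>F x\<bar> \<le> B * w x ^ k) \<and>
     (\<forall>x v. \<bar>F' x v\<bar> \<le> B * w x ^ k * norm v) \<and> (\<forall>v. continuous_on UNIV (\<lambda>x. F' x (v::'a) :: real))"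

lemma grD:
  assumes "gr B k F F'"
  shows gr_has_derivative: "(F has_derivative F' x) (at x)" and gr_le: "\<bar>F x\<bar> \<le> B * w x ^ k"
    and gr_derivative_le: "\<bar>F' x v\<bar> \<le> B * w x ^ k * norm v" and gr_cont: "continuous_on UNIV (\<lambda>x. F' x v)"
    and gr_linear: "linear (F' x)" and gr_continuous: "continuous_on UNIV F"
    and gr_nonneg: "B \<ge> 0"
proof -
  show d: "(F has_derivative F' x) (at x)" for x using assms by (simp add: gr_def)
  show "linear (F' x)" by (rule has_derivative_linear[OF d])
  show "continuous_on UNIV F" by (rule has_derivative_continuous_on, rule has_derivative_at_withinI, rule d)
  have "0 \<le> B * w 0 ^ k" using assms unfolding gr_def by (metis abs_ge_zero order_trans)
  moreover have "w 0 ^ k > 0" using w_pos by simp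
  ultimately show "B \<ge> 0" by (simp add: zero_le_mult_iff)
qed (use assms in \<open>auto simp: gr_def\<close>)

lemma gr_measurable:
  assumes "gr B k F F'" shows "F \<in> borel_measurable borel" "(\<lambda>x. F' x v) \<in> borel_measurable borel"
  by (auto intro!: borel_measurable_continuous_onI gr_cont[OF assms] gr_continuous[OF assms])

lemma gr_measurable_compose:
  assumes "gr B k F F'" "f \<in> borel_measurable M" "g \<in> borel_measurable M"
  shows "(\<lambda>p. F' (f p) (g p)) \<in> borel_measurable M"
  by (rule linear_measurable_compose[OF gr_linear[OF assms(1)] gr_measurable(2)[OF assms(1)] assms(2,3)])

lemma gr_sum_basis:
  assumes "gr B k F F'" shows "F' x v = (\<Sum>b\<in>Basis. F' x b * (v \<bullet> b))"
proof -
  have "F' x v = F' x (\<Sum>b\<in>Basis. (v \<bullet> b) *\<^sub>R b)" by (simp only: euclidean_representation)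
  also have "\<dots> = (\<Sum>b\<in>Basis. F' x b * (v \<bullet> b))"
    by (simp add: linear_sum[OF gr_linear[OF assms]] linear_scale[OF gr_linear[OF assms]] mult.commute)
  finally show ?thesis .
qed

lemma inner_grad_K_le: "\<bar>grad K z \<bullet> v\<bar> \<le> c * norm v"
  using Cauchy_Schwarz_ineq2[of "grad K z" v] mult_right_mono[OF grad_K_le[of z], of "norm v"] by simp

lemma inner_grad_V_le: "\<bar>grad V z \<bullet> v\<bar> \<le> c * w z * norm v"
  using Cauchy_Schwarz_ineq2[of "grad V z" v] mult_right_mono[OF grad_V_le[of z], of "norm v"] by simp

lemma inner_K2_le: "\<bar>K2 z v \<bullet> u\<bar> \<le> c * norm v * norm u"
  using Cauchy_Schwarz_ineq2[of "K2 z v" u] mult_right_mono[OF K2_le[of z v], of "norm u"] by simp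

text \<open>Integration by parts is applied to \<open>F\<close> times each partial derivative of
  \<open>K\<close>; when summed over the basis, the derivatives falling on \<open>K\<close> add up
  to the Laplacian.\<close>

lemma ibp_grad_K:
  assumes F: "gr B k F F'"
  shows "(\<integral>x. F' x (grad K (x - y)) \<partial>\<gamma>) = (\<integral>x. F x * (grad K (x - y) \<bullet> grad V x - Lap (x - y)) \<partial>\<gamma>)"
    and "integrable \<gamma> (\<lambda>x. F' x (grad K (x - y)))"
    and "integrable \<gamma> (\<lambda>x. F x * (grad K (x - y) \<bullet> grad V x - Lap (x - y)))"
proof -
  note [measurable] = gr_measurable[OF F]
  have B: "B \<ge> 0" by (rule gr_nonneg[OF F])
  have Bw: "0 \<le> B * w x ^ k" for x using B w_nonneg by simp
  define G where "G b x = F x * (grad K (x - y) \<bullet> b)" for b x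
  define G' where "G' b x v = F x * (K2 (x - y) v \<bullet> b) + F' x v * (grad K (x - y) \<bullet> b)" for b x v
  have G: "\<bar>G b x\<bar> \<le> 2 * B * c * w x ^ k" if "b \<in> Basis" for b x
  proof -
    have "\<bar>G b x\<bar> \<le> (B * w x ^ k) * c" unfolding G_def abs_mult
      using gr_le[OF F, of x] inner_grad_K_le[of "x - y" b] that Bw by (intro mult_mono) auto
    also have "\<dots> \<le> 2 * ((B * w x ^ k) * c)" using mult_nonneg_nonneg[OF Bw[of x] c_nonneg] by linarith
    finally show ?thesis by (simp add: mult_ac)
  qed
  have G': "\<bar>G' b x b\<bar> \<le> 2 * B * c * w x ^ k" if "b \<in> Basis" for b x
  proof -
    have "\<bar>G' b x b\<bar> \<le> \<bar>F x\<bar> * \<bar>K2 (x - y) b \<bullet> b\<bar> + \<bar>F' x b\<bar> * \<bar>grad K (x - y) \<bullet> b\<bar>"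
      unfolding G'_def abs_mult[symmetric] by (rule abs_triangle_ineq)
    also have "\<dots> \<le> (B * w x ^ k) * c + (B * w x ^ k) * c"
      using gr_le[OF F, of x] gr_derivative_le[OF F, of x b] inner_grad_K_le[of "x - y" b] inner_K2_le[of "x - y" b b] that Bw
      by (intro add_mono mult_mono) auto
    finally show ?thesis by (simp add: mult_ac)
  qed
  have ibp: "(\<integral>x. G' b x b \<partial>\<gamma>) = (\<integral>x. G b x * (grad V x \<bullet> b) \<partial>\<gamma>)" if b: "b \<in> Basis" for b
  proof (rule gibbs_integration_by_parts[where F="G b" and F'="G' b" and B="2 * B * c" and k=k])
    fix x
    have s: "((\<lambda>x. x - y) has_derivative (\<lambda>v. v)) (at x)" by (auto intro!: derivative_eq_intros)
    show "(G b has_derivative G' b x) (at x)"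
      unfolding G_def[abs_def] G'_def[abs_def]
      by (rule has_derivative_mult[OF gr_has_derivative[OF F] has_derivative_inner_left[OF has_derivative_compose[OF s grad_K_has_derivative]]])
  next
    show "continuous_on UNIV (\<lambda>x. G' b x b)" unfolding G'_def
      by (intro continuous_intros gr_cont[OF F] gr_continuous[OF F] continuous_on_compose2[OF continuous_K2]
          continuous_on_compose2[OF continuous_grad_K]) auto
  qed (rule G[OF b] G'[OF b])+
  have i1: "integrable \<gamma> (\<lambda>x. G' b x b)" if "b \<in> Basis" for b
    by (rule integrable_gibbs[OF _ G'[OF that, folded real_norm_def]]) (simp add: G'_def)
  have i2: "integrable \<gamma> (\<lambda>x. G b x * (grad V x \<bullet> b))" if "b \<in> Basis" for b
  proof (rule integrable_gibbs[where B="2 * B * c * c" and k="Suc k"])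
    show "(\<lambda>x. G b x * (grad V x \<bullet> b)) \<in> borel_measurable borel" by (simp add: G_def)
    show "norm (G b x * (grad V x \<bullet> b)) \<le> 2 * B * c * c * w x ^ Suc k" for x
      using mult_mono[OF G[OF that, of x] inner_grad_V_le[of x b]] that B c_nonneg w_nonneg[of x] by (simp add: abs_mult mult_ac)
  qed
  have i3: "integrable \<gamma> (\<lambda>x. F x * Lap (x - y))"
  proof (rule integrable_gibbs[where B="B * (dm * c)" and k=k])
    show "norm (F x * Lap (x - y)) \<le> B * (dm * c) * w x ^ k" for x
      using mult_mono[OF gr_le[OF F, of x] Lap_le[of "x - y"]] Bw[of x] by (simp add: abs_mult mult_ac)
  qed measurable
  have e1: "F' x (grad K (x - y)) = (\<Sum>b\<in>Basis. G' b x b) - F x * Lap (x - y)" for x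
    by (subst gr_sum_basis[OF F]) (simp add: G'_def sum.distrib Lap_def sum_distrib_left)
  have e2: "F x * (grad K (x - y) \<bullet> grad V x - Lap (x - y)) = (\<Sum>b\<in>Basis. G b x * (grad V x \<bullet> b)) - F x * Lap (x - y)" for x
    by (subst euclidean_inner) (simp add: G_def right_diff_distrib sum_distrib_left mult.assoc)
  show "integrable \<gamma> (\<lambda>x. F' x (grad K (x - y)))" unfolding e1 using i1 i3 by simp
  show "integrable \<gamma> (\<lambda>x. F x * (grad K (x - y) \<bullet> grad V x - Lap (x - y)))" unfolding e2 using i2 i3 by simp
  show "(\<integral>x. F' x (grad K (x - y)) \<partial>\<gamma>) = (\<integral>x. F x * (grad K (x - y) \<bullet> grad V x - Lap (x - y)) \<partial>\<gamma>)"
    unfolding e1 e2 using i1 i2 i3 by (simp add: ibp)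
qed

lemma ibp_K:
  assumes F: "gr B k F F'"
  shows "(\<integral>x. K (x - y) * F' x q \<partial>\<gamma>) = (\<integral>x. F x * (K (x - y) * (grad V x \<bullet> q) - grad K (x - y) \<bullet> q) \<partial>\<gamma>)"
    and "integrable \<gamma> (\<lambda>x. K (x - y) * F' x q)"
    and "integrable \<gamma> (\<lambda>x. F x * (K (x - y) * (grad V x \<bullet> q) - grad K (x - y) \<bullet> q))"
proof -
  note [measurable] = gr_measurable[OF F]
  have B: "B \<ge> 0" by (rule gr_nonneg[OF F])
  have Bw: "0 \<le> B * w x ^ k" for x using B w_nonneg by simp
  define G where "G x = F x * K (x - y)" for x
  define G' where "G' x v = F x * (grad K (x - y) \<bullet> v) + F' x v * K (x - y)" for x v
  have G: "\<bar>G x\<bar> \<le> B * c * w x ^ k" for x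
    unfolding G_def abs_mult using mult_mono[OF gr_le[OF F, of x] K_le[of "x - y"]] Bw[of x] by (simp add: mult_ac)
  have b1: "\<bar>F x * (grad K (x - y) \<bullet> q)\<bar> \<le> B * c * norm q * w x ^ k" for x
    unfolding abs_mult using mult_mono[OF gr_le[OF F, of x] inner_grad_K_le[of "x - y" q]] Bw[of x] by (simp add: mult_ac)
  have b2: "\<bar>F' x q * K (x - y)\<bar> \<le> B * c * norm q * w x ^ k" for x
    unfolding abs_mult using mult_mono[OF gr_derivative_le[OF F, of x q] K_le[of "x - y"] mult_nonneg_nonneg[OF Bw norm_ge_zero]]
    by (simp add: mult_ac)
  have Gb: "\<bar>G x\<bar> \<le> (B * c + 2 * (B * c * norm q)) * w x ^ k" for x
    using G[of x] mult_nonneg_nonneg[OF mult_nonneg_nonneg[OF Bw[of x] c_nonneg] norm_ge_zero[of q]] by (simp add: algebra_simps)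
  have G'b: "\<bar>G' x q\<bar> \<le> (B * c + 2 * (B * c * norm q)) * w x ^ k" for x
    using order_trans[OF abs_triangle_ineq add_mono[OF b1[of x] b2[of x]]] mult_nonneg_nonneg[OF Bw[of x] c_nonneg]
    by (simp add: G'_def algebra_simps)
  have ibp: "(\<integral>x. G' x q \<partial>\<gamma>) = (\<integral>x. G x * (grad V x \<bullet> q) \<partial>\<gamma>)"
  proof (rule gibbs_integration_by_parts[where F=G and F'=G' and B="B * c + 2 * (B * c * norm q)" and k=k])
    fix x
    have s: "((\<lambda>x. x - y) has_derivative (\<lambda>v. v)) (at x)" by (auto intro!: derivative_eq_intros)
    show "(G has_derivative G' x) (at x)"
      unfolding G_def[abs_def] G'_def[abs_def]
      by (rule has_derivative_mult[OF gr_has_derivative[OF F] has_derivative_compose[OF s K_has_derivative]])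
  next
    show "continuous_on UNIV (\<lambda>x. G' x q)" unfolding G'_def
      by (intro continuous_intros gr_cont[OF F] gr_continuous[OF F] continuous_on_compose2[OF continuous_K]
          continuous_on_compose2[OF continuous_grad_K]) auto
  qed (rule Gb G'b)+
  have i1: "integrable \<gamma> (\<lambda>x. F x * (grad K (x - y) \<bullet> q))" "integrable \<gamma> (\<lambda>x. F' x q * K (x - y))"
    by (rule integrable_gibbs[OF _ b1[folded real_norm_def]], measurable)
       (rule integrable_gibbs[OF _ b2[folded real_norm_def]], measurable)
  have i2: "integrable \<gamma> (\<lambda>x. G x * (grad V x \<bullet> q))"
  proof (rule integrable_gibbs[where B="B * c * c * norm q" and k="Suc k"])
    show "(\<lambda>x. G x * (grad V x \<bullet> q)) \<in> borel_measurable borel" by (simp add: G_def)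
    show "norm (G x * (grad V x \<bullet> q)) \<le> B * c * c * norm q * w x ^ Suc k" for x
      using mult_mono[OF G[of x] inner_grad_V_le[of x q]] B c_nonneg w_nonneg[of x] by (simp add: abs_mult mult_ac)
  qed
  have e2: "F x * (K (x - y) * (grad V x \<bullet> q) - grad K (x - y) \<bullet> q) = G x * (grad V x \<bullet> q) - F x * (grad K (x - y) \<bullet> q)" for x
    by (simp add: G_def algebra_simps)
  show "integrable \<gamma> (\<lambda>x. K (x - y) * F' x q)" using i1(2) by (simp add: mult.commute)
  show "integrable \<gamma> (\<lambda>x. F x * (K (x - y) * (grad V x \<bullet> q) - grad K (x - y) \<bullet> q))" unfolding e2 using i1 i2 by simp
  show "(\<integral>x. K (x - y) * F' x q \<partial>\<gamma>) = (\<integral>x. F x * (K (x - y) * (grad V x \<bullet> q) - grad K (x - y) \<bullet> q) \<partial>\<gamma>)"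
    unfolding e2 using i1 i2 ibp by (simp add: G'_def mult.commute)
qed

text \<open>The vector \<open>q\<close> belongs to the point \<open>y\<close> that is held fixed: it
  is \<open>grad V y\<close> for the velocity and a value of the regularised field for the adjoint
  operator.\<close>

lemma ibp_Phi:
  assumes F: "gr B k F F'"
  shows "(\<integral>x. F' x (grad K (x - y) + K (x - y) *\<^sub>R q) \<partial>\<gamma>) =
    - (\<integral>x. F x * (Lap (x - y) - grad K (x - y) \<bullet> grad V x + grad K (x - y) \<bullet> q - K (x - y) * (grad V x \<bullet> q)) \<partial>\<gamma>)"
proof -
  have "(\<integral>x. F' x (grad K (x - y) + K (x - y) *\<^sub>R q) \<partial>\<gamma>) = (\<integral>x. F' x (grad K (x - y)) + K (x - y) * F' x q \<partial>\<gamma>)"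
    by (simp add: linear_add[OF gr_linear[OF F]] linear_scale[OF gr_linear[OF F]])
  also have "\<dots> = (\<integral>x. F x * (grad K (x - y) \<bullet> grad V x - Lap (x - y)) + F x * (K (x - y) * (grad V x \<bullet> q) - grad K (x - y) \<bullet> q) \<partial>\<gamma>)"
    using ibp_grad_K[OF F] ibp_K[OF F] by simp
  also have "\<dots> = (\<integral>x. - (F x * (Lap (x - y) - grad K (x - y) \<bullet> grad V x + grad K (x - y) \<bullet> q - K (x - y) * (grad V x \<bullet> q))) \<partial>\<gamma>)"
    by (rule Bochner_Integration.integral_cong) (auto simp: algebra_simps)
  finally show ?thesis by simp
qed

section \<open>Regular functions and the energy identity\<close>

definition reg where "reg A \<phi> \<phi>' \<longleftrightarrow> wlip A \<phi> \<and> gr A 1 \<phi> \<phi>'"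

lemma regI:
  assumes "wlip A \<phi>" "\<And>x. (\<phi> has_derivative \<phi>' x) (at x)" "\<And>v. continuous_on UNIV (\<lambda>x. \<phi>' x v)"
  shows "reg A \<phi> \<phi>'"
  using assms wlip_le[OF assms(1)] wlip_derivative_le[OF assms(1) assms(2)] by (simp add: reg_def gr_def)

lemma reg_wlip: "reg A \<phi> \<phi>' \<Longrightarrow> wlip A \<phi>" and reg_gr: "reg A \<phi> \<phi>' \<Longrightarrow> gr A 1 \<phi> \<phi>'"
  by (auto simp: reg_def)

lemma reg_le: "reg A \<phi> \<phi>' \<Longrightarrow> \<bar>\<phi> x\<bar> \<le> A * w x" and reg_derivative_le: "reg A \<phi> \<phi>' \<Longrightarrow> \<bar>\<phi>' x v\<bar> \<le> A * w x * norm v"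
  and reg_nonneg: "reg A \<phi> \<phi>' \<Longrightarrow> A \<ge> 0" and reg_linear: "reg A \<phi> \<phi>' \<Longrightarrow> linear (\<phi>' x)"
  and reg_has_derivative: "reg A \<phi> \<phi>' \<Longrightarrow> (\<phi> has_derivative \<phi>' x) (at x)"
  using grD[OF reg_gr] by auto

lemmas reg_measurable = gr_measurable[OF reg_gr]
lemmas reg_measurable_compose = gr_measurable_compose[OF reg_gr]

lemma gr_square:
  assumes r: "reg A \<phi> \<phi>'" shows "gr (2 * A * A) 2 (\<lambda>x. (\<phi> x)\<^sup>2) (\<lambda>x v. 2 * \<phi> x * \<phi>' x v)"
  unfolding gr_def
proof (intro conjI allI)
  have A: "A \<ge> 0" by (rule reg_nonneg[OF r])
  fix x v
  have "((\<lambda>x. \<phi> x * \<phi> x) has_derivative (\<lambda>v. \<phi> x * \<phi>' x v + \<phi>' x v * \<phi> x)) (at x)"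
    by (rule has_derivative_mult[OF reg_has_derivative[OF r] reg_has_derivative[OF r]])
  then show "((\<lambda>x. (\<phi> x)\<^sup>2) has_derivative (\<lambda>v. 2 * \<phi> x * \<phi>' x v)) (at x)"
    by (simp add: power2_eq_square mult_ac)
  have Aw: "0 \<le> A * w x" using A w_nonneg by simp
  have "(\<phi> x)\<^sup>2 = \<bar>\<phi> x\<bar> * \<bar>\<phi> x\<bar>" by (simp add: power2_eq_square)
  also have "\<dots> \<le> (A * w x) * (A * w x)" using reg_le[OF r, of x] by (intro mult_mono) (use Aw in auto)
  also have "\<dots> \<le> 2 * ((A * w x) * (A * w x))" using mult_nonneg_nonneg[OF Aw Aw] by linarith
  finally show "\<bar>(\<phi> x)\<^sup>2\<bar> \<le> 2 * A * A * w x ^ 2" by (simp add: power2_eq_square mult_ac)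
  have "\<bar>\<phi> x\<bar> * \<bar>\<phi>' x v\<bar> \<le> (A * w x) * (A * w x * norm v)"
    by (intro mult_mono reg_le[OF r] reg_derivative_le[OF r]) (use Aw in auto)
  then show "\<bar>2 * \<phi> x * \<phi>' x v\<bar> \<le> 2 * A * A * w x ^ 2 * norm v"
    by (simp add: abs_mult power2_eq_square mult_ac)
next
  show "continuous_on UNIV (\<lambda>x. 2 * \<phi> x * \<phi>' x v)" for v
    by (intro continuous_intros gr_cont[OF reg_gr[OF r]] gr_continuous[OF reg_gr[OF r]])
qed

text \<open>The divergence of the velocity minus its inner product with \<open>grad V\<close>, that
  is its divergence relative to the Gibbs measure, with all derivatives already inside the
  kernel.\<close>

definition hst where "hst \<nu> x = (\<integral>y. ell (grad V x) x y \<partial>\<nu>)"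

lemma sigma_finite_adm: "adm \<nu> \<Longrightarrow> sigma_finite_measure \<nu>"
  unfolding adm_def by (intro finite_measure.axioms(1)[OF prob_space.finite_measure]) auto

lemma sets_pair_adm: "adm \<nu> \<Longrightarrow> adm \<nu>' \<Longrightarrow> sets (\<nu> \<Otimes>\<^sub>M \<nu>') = sets (borel \<Otimes>\<^sub>M borel)"
  unfolding adm_def by (intro sets_pair_measure_cong) auto

lemma iterated_integral_swap_adm:
  assumes "adm \<nu>" "case_prod f \<in> borel_measurable (borel \<Otimes>\<^sub>M borel)"
    "\<And>x y. \<bar>f x y\<bar> \<le> B * w x ^ k * w y"
  shows "(\<integral>x. (\<integral>y. f x y \<partial>\<nu>) \<partial>\<gamma>) = (\<integral>y. (\<integral>x. f x y \<partial>\<gamma>) \<partial>\<nu>)"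
proof (rule iterated_integral_swap[OF sigma_finite_adm[OF adm_gibbs] sigma_finite_adm[OF assms(1)]])
  show "case_prod f \<in> borel_measurable (\<gamma> \<Otimes>\<^sub>M \<nu>)"
    using assms(2) measurable_cong_sets[OF sets_pair_adm[OF adm_gibbs assms(1)] refl] by blast
  show "integrable \<gamma> (\<lambda>x. \<bar>B\<bar> * w x ^ k)"
    by (rule integrable_gibbs[where B="\<bar>B\<bar>" and k=k]) (auto simp: abs_mult w_nonneg)
  show "integrable \<nu> w" using assms(1) by (simp add: adm_def)
  show "\<bar>f x y\<bar> \<le> \<bar>B\<bar> * w x ^ k * w y" for x y
    by (rule order_trans[OF assms(3)]) (auto intro!: mult_right_mono simp: w_nonneg)
qed

lemma bounded_linear_reg: "reg A \<phi> \<phi>' \<Longrightarrow> bounded_linear (\<phi>' x)"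
  using has_derivative_bounded_linear[OF reg_has_derivative] .

lemma Phi_le: "norm (Phi x y) \<le> cp * w y" by (rule wlip_le[OF wlip_Phi])

text \<open>The left side integrates the velocity against the gradient of \<open>\<phi>^2\<close>.
  Fubini comes first, so that integration by parts is needed only for a fixed \<open>y\<close>,
  against the kernel.\<close>

lemma energy_identity:
  assumes \<nu>: "adm \<nu>" and r: "reg A \<phi> \<phi>'"
  shows "(\<integral>x. 2 * \<phi> x * \<phi>' x (vel \<nu> x) \<partial>\<gamma>) = - (\<integral>x. (\<phi> x)\<^sup>2 * hst \<nu> x \<partial>\<gamma>)"
proof -
  note [measurable] = reg_measurable[OF r]
  have A: "A \<ge> 0" by (rule reg_nonneg[OF r])
  have "2 * \<phi> x * \<phi>' x (vel \<nu> x) = (\<integral>y. 2 * \<phi> x * \<phi>' x (Phi x y) \<partial>\<nu>)" for x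
    unfolding vel_eq[OF \<nu>] using integral_bounded_linear[OF bounded_linear_reg[OF r] integrable_Phi[OF \<nu>], of x x] by simp
  then have "(\<integral>x. 2 * \<phi> x * \<phi>' x (vel \<nu> x) \<partial>\<gamma>) = (\<integral>x. (\<integral>y. 2 * \<phi> x * \<phi>' x (Phi x y) \<partial>\<nu>) \<partial>\<gamma>)" by (simp only:)
  also have "\<dots> = (\<integral>y. (\<integral>x. 2 * \<phi> x * \<phi>' x (Phi x y) \<partial>\<gamma>) \<partial>\<nu>)"
  proof (rule iterated_integral_swap_adm[OF \<nu>])
    have "(\<lambda>p. \<phi>' (fst p) (Phi (fst p) (snd p))) \<in> borel_measurable (borel \<Otimes>\<^sub>M borel)"
      by (rule reg_measurable_compose[OF r]) measurable
    then show "(\<lambda>(x, y). 2 * \<phi> x * \<phi>' x (Phi x y)) \<in> borel_measurable (borel \<Otimes>\<^sub>M borel)"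
      by (simp add: case_prod_unfold)
    fix x y
    have "\<bar>\<phi>' x (Phi x y)\<bar> \<le> A * w x * (cp * w y)"
      by (rule order_trans[OF reg_derivative_le[OF r]], rule mult_left_mono[OF Phi_le]) (use A w_nonneg in auto)
    then have "\<bar>\<phi> x\<bar> * \<bar>\<phi>' x (Phi x y)\<bar> \<le> (A * w x) * (A * w x * (cp * w y))"
      by (intro mult_mono reg_le[OF r]) (use A w_nonneg in auto)
    then show "\<bar>2 * \<phi> x * \<phi>' x (Phi x y)\<bar> \<le> (2 * A * A * cp) * w x ^ 2 * w y"
      by (simp add: abs_mult power2_eq_square mult_ac)
  qed
  also have "\<dots> = (\<integral>y. - (\<integral>x. (\<phi> x)\<^sup>2 * ell (grad V x) x y \<partial>\<gamma>) \<partial>\<nu>)"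
  proof (rule Bochner_Integration.integral_cong[OF refl])
    fix y
    show "(\<integral>x. 2 * \<phi> x * \<phi>' x (Phi x y) \<partial>\<gamma>) = - (\<integral>x. (\<phi> x)\<^sup>2 * ell (grad V x) x y \<partial>\<gamma>)"
      unfolding Phi_def ibp_Phi[OF gr_square[OF r], of y "grad V y"]
      by (simp add: ell_def algebra_simps inner_commute)
  qed
  also have "\<dots> = - (\<integral>y. (\<integral>x. (\<phi> x)\<^sup>2 * ell (grad V x) x y \<partial>\<gamma>) \<partial>\<nu>)" by simp
  also have "(\<integral>y. (\<integral>x. (\<phi> x)\<^sup>2 * ell (grad V x) x y \<partial>\<gamma>) \<partial>\<nu>) = (\<integral>x. (\<integral>y. (\<phi> x)\<^sup>2 * ell (grad V x) x y \<partial>\<nu>) \<partial>\<gamma>)"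
  proof (rule iterated_integral_swap_adm[OF \<nu>, symmetric])
    show "(\<lambda>(x, y). (\<phi> x)\<^sup>2 * ell (grad V x) x y) \<in> borel_measurable (borel \<Otimes>\<^sub>M borel)"
      using ell_measurable by (simp add: case_prod_unfold)
    fix x y
    have "\<bar>(\<phi> x)\<^sup>2\<bar> * \<bar>ell (grad V x) x y\<bar> \<le> (2 * A * A * w x ^ 2) * (ck * w y)"
      using gr_le[OF gr_square[OF r], of x] wlip_le[OF wlip_stein_kernel, of x y] A
      by (intro mult_mono) auto
    then show "\<bar>(\<phi> x)\<^sup>2 * ell (grad V x) x y\<bar> \<le> (2 * A * A * ck) * w x ^ 2 * w y"
      by (simp add: abs_mult mult_ac)
  qed
  finally show ?thesis by (simp add: hst_def)
qed

lemma K2_even: "K2 (- x) v = K2 x v"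
proof -
  have "((\<lambda>x. grad K (- x)) has_derivative (\<lambda>v. K2 (- x) (- v))) (at x)"
    by (rule has_derivative_compose[OF has_derivative_minus[OF has_derivative_ident] grad_K_has_derivative])
  then have 1: "((\<lambda>x. - grad K x) has_derivative (\<lambda>v. K2 (- x) (- v))) (at x)" by (simp add: grad_K_odd)
  have 2: "((\<lambda>x. - grad K x) has_derivative (\<lambda>v. - K2 x v)) (at x)"
    by (rule has_derivative_minus[OF grad_K_has_derivative])
  from has_derivative_unique[OF 1 2] have "K2 (- x) (- v) = - K2 x v" by metis
  then show ?thesis using linear_neg[OF linear_K2, of "- x" v] by simp
qed

lemma K_swap: "K (x - y) = K (y - x)" and grad_K_swap: "grad K (x - y) = - grad K (y - x)" and Lap_swap: "Lap (x - y) = Lap (y - x)"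
  using K_even[of "y - x"] grad_K_odd[of "y - x"] K2_even[of "y - x"] by (simp_all add: Lap_def)

text \<open>Integration by parts of the constant 1, in the variable \<open>y\<close> with
  \<open>x\<close> as the fixed point; the evenness of \<open>K\<close> exchanges the two
  points.\<close>

lemma hst_gibbs: "hst \<gamma> x = 0"
proof -
  have "gr 1 0 (\<lambda>x. 1) (\<lambda>x v. 0)" by (simp add: gr_def)
  from ibp_Phi[OF this, of x "grad V x"]
  have "(\<integral>y. Lap (y - x) - grad K (y - x) \<bullet> grad V y + grad K (y - x) \<bullet> grad V x - K (y - x) * (grad V y \<bullet> grad V x) \<partial>\<gamma>) = 0"
    by simp
  moreover have "Lap (y - x) - grad K (y - x) \<bullet> grad V y + grad K (y - x) \<bullet> grad V x - K (y - x) * (grad V y \<bullet> grad V x) =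
      Lap (x - y) + grad K (x - y) \<bullet> grad V y - grad V x \<bullet> grad K (x - y) - K (x - y) * (grad V x \<bullet> grad V y)" for y
    unfolding K_swap[of x y] grad_K_swap[of x y] Lap_swap[of x y] by (simp add: inner_commute)
  ultimately show ?thesis unfolding hst_def ell_def by simp
qed

definition ch where "ch = (1 + c) * ck"

lemma ck_nonneg: "ck \<ge> 0" using wlip_nonneg[OF wlip_stein_kernel] .

lemma ch_nonneg: "ch \<ge> 0" using ck_nonneg c_nonneg by (simp add: ch_def)

lemma hst_le: "adm \<nu> \<Longrightarrow> \<bar>hst \<nu> x\<bar> \<le> ch * dst \<nu>"
  using wlip_dst[OF _ wlip_stein_kernel, of \<nu> x] hst_gibbs[of x] by (simp add: hst_def ch_def)

section \<open>The Hilbert space of the Gibbs measure and the adjoint operator\<close>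

definition l2 where "l2 \<phi> = sqrt (\<integral>x. (\<phi> x)\<^sup>2 \<partial>\<gamma>)"

lemma l2_nonneg: "l2 \<phi> \<ge> 0" by (simp add: l2_def)

lemma integrable_square:
  assumes "wlip A \<phi>" shows "integrable \<gamma> (\<lambda>x. (\<phi> x :: real)\<^sup>2)"
proof (rule integrable_gibbs[where B="A\<^sup>2" and k=2])
  show "(\<lambda>x. (\<phi> x)\<^sup>2) \<in> borel_measurable borel" using wlip_measurable[OF assms] by measurable
  show "norm ((\<phi> x)\<^sup>2) \<le> A\<^sup>2 * w x ^ 2" for x
    using power_mono[OF wlip_le[OF assms, of x], of 2] by (simp add: power_mult_distrib)
qed

definition M2 where "M2 = l2 w"

lemma l2_square: "(l2 \<phi>)\<^sup>2 = (\<integral>x. (\<phi> x)\<^sup>2 \<partial>\<gamma>)"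
  unfolding l2_def by (rule real_sqrt_pow2) simp

lemma M2_ge_1: "M2 \<ge> 1"
proof -
  interpret prob_space \<gamma> by (rule prob_space_gibbs)
  have "(\<integral>x. 1 \<partial>\<gamma>) \<le> (\<integral>x. (w x)\<^sup>2 \<partial>\<gamma>)"
    by (rule integral_mono) (use integrable_square[OF wlip_w] w_ge_1 in \<open>auto simp: one_le_power\<close>)
  moreover have "measure \<gamma> UNIV = 1" using prob_space by simp
  ultimately show ?thesis by (simp add: M2_def l2_def)
qed

lemma l2_cauchy_schwarz:
  assumes f: "wlip A \<phi>" shows "(\<integral>x. \<bar>\<phi> x\<bar> * w x \<partial>\<gamma>) \<le> M2 * l2 \<phi>"
proof -
  define I where "I = (\<integral>x. \<bar>\<phi> x\<bar> * w x \<partial>\<gamma>)"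
  have i: "integrable \<gamma> (\<lambda>x. \<bar>\<phi> x\<bar> * w x)"
  proof (rule integrable_gibbs[where B=A and k=2])
    show "(\<lambda>x. \<bar>\<phi> x\<bar> * w x) \<in> borel_measurable borel" using wlip_measurable[OF f] by measurable
    show "norm (\<bar>\<phi> x\<bar> * w x) \<le> A * w x ^ 2" for x
      using mult_right_mono[OF wlip_le[OF f, of x] w_nonneg[of x]] w_nonneg[of x] by (simp add: power2_eq_square abs_mult mult.assoc)
  qed
  have m: "M2\<^sup>2 > 0" using M2_ge_1 by simp
  \<comment> \<open>The minimiser in \<open>t\<close> of the integral of
    \<open>(|\<phi>| - t w)^2\<close>.\<close>
  define t where "t = I / M2\<^sup>2"
  have "0 \<le> (\<integral>x. (\<bar>\<phi> x\<bar> - t * w x)\<^sup>2 \<partial>\<gamma>)" by (rule Bochner_Integration.integral_nonneg) simp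
  also have "(\<integral>x. (\<bar>\<phi> x\<bar> - t * w x)\<^sup>2 \<partial>\<gamma>) = (\<integral>x. (\<phi> x)\<^sup>2 - 2 * t * (\<bar>\<phi> x\<bar> * w x) + t\<^sup>2 * (w x)\<^sup>2 \<partial>\<gamma>)"
    by (rule Bochner_Integration.integral_cong) (auto simp: power2_diff power_mult_distrib algebra_simps)
  also have "\<dots> = (l2 \<phi>)\<^sup>2 - 2 * t * I + t\<^sup>2 * M2\<^sup>2"
    using i integrable_square[OF f] integrable_square[OF wlip_w] by (simp add: l2_square I_def M2_def)
  also have "\<dots> = (l2 \<phi>)\<^sup>2 - I\<^sup>2 / M2\<^sup>2"
  proof -
    have "t * I = I\<^sup>2 / M2\<^sup>2" unfolding t_def power2_eq_square[of I] by simp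
    moreover have "t * M2\<^sup>2 = I" using m by (simp add: t_def)
    then have "t\<^sup>2 * M2\<^sup>2 = t * I" by (simp only: power2_eq_square[of t] mult.assoc)
    ultimately show ?thesis by linarith
  qed
  finally have "I\<^sup>2 / M2\<^sup>2 \<le> (l2 \<phi>)\<^sup>2" by simp
  then have "I\<^sup>2 \<le> (M2 * l2 \<phi>)\<^sup>2" unfolding power_mult_distrib pos_divide_le_eq[OF m] by (simp only: mult.commute)
  then show ?thesis unfolding I_def[symmetric]
    by (rule power2_le_imp_le) (use l2_nonneg[of \<phi>] M2_ge_1 in simp)
qed

text \<open>For \<open>q = grad V\<close> this is the adjoint of the operator linearised at the Gibbs measure. A bounded
  \<open>q\<close> is allowed because \<open>q x\<close> is differentiated when the iterates are differentiated, and the second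
  derivative of \<open>V\<close> need not be weighted Lipschitz.\<close>

definition Lop where "Lop q \<phi>' x = (\<integral>y. \<phi>' y (grad K (x - y) - K (x - y) *\<^sub>R q x) \<partial>\<gamma>)"

text \<open>Moving the derivative from \<open>\<phi>\<close> to the kernel is the smoothing effect:
  the result depends on the values of \<open>\<phi>\<close> only and can be bounded by its L2
  norm.\<close>

lemma Lop_eq:
  assumes r: "reg A \<phi> \<phi>'" shows "Lop q \<phi>' x = (\<integral>y. \<phi> y * ell (q x) x y \<partial>\<gamma>)"
proof -
  have "grad K (x - y) - K (x - y) *\<^sub>R q x = - (grad K (y - x) + K (y - x) *\<^sub>R q x)" for y
    unfolding K_swap[of x y] grad_K_swap[of x y] by simp
  then have "Lop q \<phi>' x = (\<integral>y. - \<phi>' y (grad K (y - x) + K (y - x) *\<^sub>R q x) \<partial>\<gamma>)"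
    unfolding Lop_def by (simp only: linear_neg[OF reg_linear[OF r]])
  then have "Lop q \<phi>' x = - (\<integral>y. \<phi>' y (grad K (y - x) + K (y - x) *\<^sub>R q x) \<partial>\<gamma>)" by simp
  also have "\<dots> = (\<integral>y. \<phi> y * ell (q x) x y \<partial>\<gamma>)"
    unfolding ibp_Phi[OF reg_gr[OF r]] ell_def minus_minus
  proof (rule Bochner_Integration.integral_cong[OF refl])
    fix y
    show "\<phi> y * (Lap (y - x) - grad K (y - x) \<bullet> grad V y + grad K (y - x) \<bullet> q x - K (y - x) * (grad V y \<bullet> q x)) =
      \<phi> y * (Lap (x - y) + grad K (x - y) \<bullet> grad V y - q x \<bullet> grad K (x - y) - K (x - y) * (q x \<bullet> grad V y))"
      unfolding K_swap[of x y] grad_K_swap[of x y] Lap_swap[of x y] by (simp add: inner_commute)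
  qed
  finally show ?thesis .
qed

text \<open>Covers both fields that occur as \<open>q\<close>: \<open>grad V\<close> itself, with
  constant \<open>cg\<close>, and its product with a cutoff, for which the product rule gives
  \<open>2 * cg\<close>.\<close>

definition cq where "cq = 2 * cg"
definition cl where "cl = (dm * c + c * c + 2 * cq * c + 2 * cq * c * c) * M2"

lemma cq_nonneg: "cq \<ge> 0" using cg_nonneg by (simp add: cq_def)
lemma dm_nonneg: "dm \<ge> 0" by (simp add: dm_def)
lemma cl_nonneg: "cl \<ge> 0" using cq_nonneg c_nonneg M2_ge_1 dm_nonneg by (simp add: cl_def)

text \<open>For a field that is only weighted Lipschitz the bound is of size \<open>w x w y\<close>,
  in contrast to the bound uniform in \<open>x\<close> for \<open>q = grad V\<close>. The factors 2
  are there to share one constant with \<open>ell_diff_le\<close>.\<close>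

lemma ell_le:
  assumes q: "wlip cq q"
  shows "\<bar>ell (q x) x y\<bar> \<le> (dm * c + c * c + 2 * cq * c + 2 * cq * c * c) * w x * w y"
proof -
  have 1: "\<bar>Lap (x - y)\<bar> \<le> (dm * c) * (w x * w y)"
  proof -
    have "1 \<le> w x * w y" using mult_mono[OF w_ge_1[of x] w_ge_1[of y]] w_nonneg[of x] by simp
    then have "(dm * c) * 1 \<le> (dm * c) * (w x * w y)"
      by (rule mult_left_mono) (use dm_nonneg c_nonneg in simp)
    then show ?thesis using Lap_le[of "x - y"] by simp
  qed
  have 2: "\<bar>grad K (x - y) \<bullet> grad V y\<bar> \<le> (c * c) * (w x * w y)"
  proof -
    have "\<bar>grad K (x - y) \<bullet> grad V y\<bar> \<le> c * norm (grad V y)" by (rule inner_grad_K_le)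
    also have "\<dots> \<le> c * (c * w y)" by (intro mult_left_mono grad_V_le c_nonneg)
    also have "\<dots> \<le> c * (c * (w x * w y))" using w_ge_1[of x] w_nonneg[of y] c_nonneg
      by (intro mult_left_mono) (auto simp: mult_le_cancel_right1)
    finally show ?thesis by (simp add: mult_ac)
  qed
  have qx: "norm (q x) \<le> cq * w x" by (rule wlip_le[OF q])
  have 3: "\<bar>q x \<bullet> grad K (x - y)\<bar> \<le> (cq * c) * (w x * w y)"
  proof -
    have "\<bar>q x \<bullet> grad K (x - y)\<bar> \<le> c * norm (q x)" using inner_grad_K_le[of "x - y" "q x"] by (simp add: inner_commute)
    also have "\<dots> \<le> c * (cq * w x)" by (intro mult_left_mono qx c_nonneg)
    also have "\<dots> \<le> c * (cq * (w x * w y))" using w_ge_1[of y] w_nonneg[of x] c_nonneg cq_nonneg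
      by (intro mult_left_mono) (auto simp: mult_le_cancel_left1)
    finally show ?thesis by (simp add: mult_ac)
  qed
  have 4: "\<bar>K (x - y) * (q x \<bullet> grad V y)\<bar> \<le> (cq * c * c) * (w x * w y)"
  proof -
    have "\<bar>q x \<bullet> grad V y\<bar> \<le> (cq * w x) * (c * w y)"
      by (rule order_trans[OF Cauchy_Schwarz_ineq2 mult_mono[OF qx grad_V_le]]) (use cq_nonneg w_nonneg in auto)
    then have "\<bar>K (x - y)\<bar> * \<bar>q x \<bullet> grad V y\<bar> \<le> c * ((cq * w x) * (c * w y))"
      by (intro mult_mono K_le c_nonneg) auto
    then show ?thesis by (simp add: abs_mult mult_ac)
  qed
  have "\<bar>ell (q x) x y\<bar> \<le> (dm * c) * (w x * w y) + (c * c) * (w x * w y) + (cq * c) * (w x * w y) + (cq * c * c) * (w x * w y)"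
    unfolding ell_def using 1 2 3 4 by linarith
  also have "\<dots> \<le> (dm * c + c * c + 2 * cq * c + 2 * cq * c * c) * (w x * w y)"
    using mult_nonneg_nonneg[OF mult_nonneg_nonneg[OF cq_nonneg c_nonneg] mult_nonneg_nonneg[OF w_nonneg[of x] w_nonneg[of y]]]
      mult_nonneg_nonneg[OF mult_nonneg_nonneg[OF mult_nonneg_nonneg[OF cq_nonneg c_nonneg] c_nonneg] mult_nonneg_nonneg[OF w_nonneg[of x] w_nonneg[of y]]]
    by (simp add: algebra_simps)
  finally show ?thesis by (simp add: mult.assoc)
qed

lemma ell_diff_le:
  assumes q: "wlip cq q"
  shows "\<bar>ell (q x) x y - ell (q z) z y\<bar> \<le> (dm * c + c * c + 2 * cq * c + 2 * cq * c * c) * (max (w x) (w z) * norm (x - z)) * w y"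
proof -
  define m where "m = max (w x) (w z)"
  define n where "n = norm (x - z)"
  have m1: "m \<ge> 1" and n0: "n \<ge> 0" and y1: "w y \<ge> 1" using max_w_pos w_ge_1 by (auto simp: m_def n_def)
  \<comment> \<open>All four terms are brought to the common form \<open>t * (m * n * w y)\<close>,
    using \<open>m \<ge> 1\<close> and \<open>w y \<ge> 1\<close>.\<close>
  have up: "t * n \<le> t * (m * n * w y)" "t * n * w y \<le> t * (m * n * w y)" "t * (m * n) \<le> t * (m * n * w y)" if "t \<ge> 0" for t
  proof -
    have "1 * n * w y \<le> m * n * w y" using m1 n0 y1 by (intro mult_right_mono) auto
    moreover have "n * 1 \<le> n * w y" by (rule mult_left_mono[OF y1 n0])
    moreover have "m * n * 1 \<le> m * n * w y" by (rule mult_left_mono[OF y1]) (use m1 n0 in simp)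
    ultimately have "n \<le> m * n * w y" "n * w y \<le> m * n * w y" "m * n \<le> m * n * w y" by auto
    then show "t * n \<le> t * (m * n * w y)" "t * n * w y \<le> t * (m * n * w y)" "t * (m * n) \<le> t * (m * n * w y)"
      using that by (auto intro: mult_left_mono simp: mult.assoc)
  qed
  have s: "x - y - (z - y) = x - z" by simp
  have 1: "\<bar>Lap (x - y) - Lap (z - y)\<bar> \<le> (dm * c) * (m * n * w y)"
    using Lap_lip[of "x - y" "z - y"] up(1)[of "dm * c"] dm_nonneg c_nonneg by (simp add: n_def)
  have gg: "norm (grad K (x - y) - grad K (z - y)) \<le> c * n" using grad_K_lip[of "x - y" "z - y"] by (simp add: n_def)
  have kk: "\<bar>K (x - y) - K (z - y)\<bar> \<le> c * n" using K_lip[of "x - y" "z - y"] by (simp add: n_def)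
  have 2: "\<bar>grad K (x - y) \<bullet> grad V y - grad K (z - y) \<bullet> grad V y\<bar> \<le> (c * c) * (m * n * w y)"
  proof -
    have "\<bar>(grad K (x - y) - grad K (z - y)) \<bullet> grad V y\<bar> \<le> (c * n) * (c * w y)"
      by (rule order_trans[OF Cauchy_Schwarz_ineq2 mult_mono[OF gg grad_V_le]]) (use c_nonneg n0 in auto)
    then show ?thesis using up(2)[of "c * c"] c_nonneg by (simp add: inner_diff_left mult_ac)
  qed
  have qz: "norm (q z) \<le> cq * m" "norm (q x) \<le> cq * m"
    using wlip_le[OF q, of z] wlip_le[OF q, of x] cq_nonneg
    by (auto simp: m_def intro: order_trans[OF _ mult_left_mono])
  have qd: "norm (q x - q z) \<le> cq * m * n" using wlip_diff_le[OF q, of x z] by (simp add: m_def n_def)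
  have 3: "\<bar>q x \<bullet> grad K (x - y) - q z \<bullet> grad K (z - y)\<bar> \<le> (2 * cq * c) * (m * n * w y)"
  proof -
    have "q x \<bullet> grad K (x - y) - q z \<bullet> grad K (z - y) = (q x - q z) \<bullet> grad K (x - y) + q z \<bullet> (grad K (x - y) - grad K (z - y))"
      by (simp add: inner_diff_left inner_diff_right)
    also have "\<bar>\<dots>\<bar> \<le> (cq * m * n) * c + (cq * m) * (c * n)"
      by (intro order_trans[OF abs_triangle_ineq] add_mono order_trans[OF Cauchy_Schwarz_ineq2] mult_mono qd qz gg grad_K_le)
         (use cq_nonneg m1 n0 in auto)
    also have "\<dots> = (2 * cq * c) * (m * n)" by simp
    also have "\<dots> \<le> (2 * cq * c) * (m * n * w y)" by (rule up(3)) (use cq_nonneg c_nonneg in auto)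
    finally show ?thesis .
  qed
  have 4: "\<bar>K (x - y) * (q x \<bullet> grad V y) - K (z - y) * (q z \<bullet> grad V y)\<bar> \<le> (2 * cq * c * c) * (m * n * w y)"
  proof -
    have "K (x - y) * (q x \<bullet> grad V y) - K (z - y) * (q z \<bullet> grad V y) =
      K (x - y) * ((q x - q z) \<bullet> grad V y) + (K (x - y) - K (z - y)) * (q z \<bullet> grad V y)"
      by (simp add: inner_diff_left algebra_simps)
    also have "\<bar>\<dots>\<bar> \<le> c * ((cq * m * n) * (c * w y)) + (c * n) * ((cq * m) * (c * w y))"
      unfolding abs_mult[of "K _"] abs_mult[of "K _ - K _"]
      by (intro order_trans[OF abs_triangle_ineq] add_mono)
         (auto simp only: abs_mult intro!: mult_mono order_trans[OF Cauchy_Schwarz_ineq2] qd qz kk K_le grad_V_le,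
          use cq_nonneg c_nonneg m1 n0 in auto)
    also have "\<dots> = (2 * cq * c * c) * (m * n * w y)" by simp
    finally show ?thesis .
  qed
  have "\<bar>ell (q x) x y - ell (q z) z y\<bar> \<le> (dm * c) * (m * n * w y) + (c * c) * (m * n * w y) + (2 * cq * c) * (m * n * w y) + (2 * cq * c * c) * (m * n * w y)"
    unfolding ell_def using 1 2 3 4 by linarith
  then show ?thesis by (simp add: m_def n_def algebra_simps)
qed

text \<open>Size and increments in \<open>x\<close> of the kernel are of order \<open>w y\<close>
  once the weights in \<open>x\<close> are factored out; Cauchy-Schwarz then separates
  \<open>\<phi>\<close> from \<open>w\<close> and leaves only the L2 norm of
  \<open>\<phi>\<close>.\<close>

lemma wlip_Lop:
  assumes r: "reg A \<phi> \<phi>'" and q: "wlip cq q"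
  shows "wlip (cl * l2 \<phi>) (Lop q \<phi>')"
proof (rule wlipI)
  let ?c = "dm * c + c * c + 2 * cq * c + 2 * cq * c * c"
  have c0: "?c \<ge> 0" using cq_nonneg c_nonneg dm_nonneg by simp
  note [measurable] = reg_measurable[OF r]
  note cs = l2_cauchy_schwarz[OF reg_wlip[OF r]]
  have i: "integrable \<gamma> (\<lambda>y. \<phi> y * ell (q x) x y)" for x
  proof (rule integrable_gibbs[where B="A * ?c * w x" and k=2])
    show "norm (\<phi> y * ell (q x) x y) \<le> A * ?c * w x * w y ^ 2" for y
      using mult_mono[OF reg_le[OF r, of y] ell_le[OF q, of x y]] reg_nonneg[OF r] w_nonneg[of y]
      by (simp add: abs_mult power2_eq_square mult_ac)
  qed measurable
  have iw: "integrable \<gamma> (\<lambda>x. \<bar>\<phi> x\<bar> * w x)"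
  proof (rule integrable_gibbs[where B=A and k=2])
    show "norm (\<bar>\<phi> x\<bar> * w x) \<le> A * w x ^ 2" for x
      using mult_right_mono[OF reg_le[OF r, of x] w_nonneg[of x]] w_nonneg[of x] by (simp add: power2_eq_square abs_mult mult.assoc)
  qed measurable
  have up: "\<bar>\<integral>y. g y \<partial>\<gamma>\<bar> \<le> cl * l2 \<phi> * t" if "\<And>y. \<bar>g y\<bar> \<le> \<bar>\<phi> y\<bar> * (?c * t * w y)" "t \<ge> 0" for g t
  proof -
    have "norm (\<integral>y. g y \<partial>\<gamma>) \<le> (\<integral>y. (?c * t) * (\<bar>\<phi> y\<bar> * w y) \<partial>\<gamma>)"
      by (rule integral_norm_bound_ineq[OF integrable_mult_right[OF iw]]) (use that(1) in \<open>simp add: mult_ac\<close>)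
    also have "\<dots> = (?c * t) * (\<integral>y. \<bar>\<phi> y\<bar> * w y \<partial>\<gamma>)" by simp
    also have "\<dots> \<le> (?c * t) * (M2 * l2 \<phi>)" using c0 that(2) by (intro mult_left_mono cs) auto
    finally show ?thesis by (simp add: cl_def mult_ac)
  qed
  show "norm (Lop q \<phi>' x) \<le> cl * l2 \<phi> * w x" for x
    unfolding Lop_eq[OF r] real_norm_def
  proof (rule up)
    show "\<bar>\<phi> y * ell (q x) x y\<bar> \<le> \<bar>\<phi> y\<bar> * (?c * w x * w y)" for y
      unfolding abs_mult by (intro mult_left_mono ell_le[OF q]) auto
  qed (rule w_nonneg)
  show "norm (Lop q \<phi>' x - Lop q \<phi>' z) \<le> cl * l2 \<phi> * max (w x) (w z) * norm (x - z)" for x z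
  proof -
    have "Lop q \<phi>' x - Lop q \<phi>' z = (\<integral>y. \<phi> y * ell (q x) x y - \<phi> y * ell (q z) z y \<partial>\<gamma>)"
      unfolding Lop_eq[OF r] using i by simp
    also have "\<bar>\<dots>\<bar> \<le> cl * l2 \<phi> * (max (w x) (w z) * norm (x - z))"
    proof (rule up)
      show "\<bar>\<phi> y * ell (q x) x y - \<phi> y * ell (q z) z y\<bar> \<le> \<bar>\<phi> y\<bar> * (?c * (max (w x) (w z) * norm (x - z)) * w y)" for y
        unfolding right_diff_distrib[symmetric] abs_mult by (intro mult_left_mono ell_diff_le[OF q]) auto
    qed (use max_w_pos(2) in simp)
    finally show ?thesis by (simp add: mult_ac)
  qed
qed

text \<open>Positivity of this form is given on test functions and is needed for
  \<open>exp (- V) e\<close> with \<open>e\<close> of growth \<open>w\<close>. Two dominated limits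
  bridge the gap: mollification reaches continuous functions of compact support, and cutting off
  reaches continuous functions with an integrable majorant.\<close>

definition quad where
  "quad \<xi> = (\<integral>x. (\<integral>y. K (x - y) *\<^sub>R \<xi> y \<partial>lborel) \<bullet> \<xi> x \<partial>lborel)" for \<xi> :: "'a \<Rightarrow> 'a"

lemma quad_limit:
  fixes \<xi> :: "'a \<Rightarrow> 'a"
  assumes m[measurable]: "\<And>n. \<xi>n n \<in> borel_measurable borel" "\<xi> \<in> borel_measurable borel"
    and lim: "\<And>x. (\<lambda>n. \<xi>n n x) \<longlonglongrightarrow> \<xi> x" and b: "\<And>n x. norm (\<xi>n n x) \<le> g x" and g: "integrable lborel g"
    and q: "\<And>n. quad (\<xi>n n) \<ge> 0"
  shows "quad \<xi> \<ge> 0"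
proof -
  have inner: "(\<lambda>n. \<integral>y. K (x - y) *\<^sub>R \<xi>n n y \<partial>lborel) \<longlonglongrightarrow> (\<integral>y. K (x - y) *\<^sub>R \<xi> y \<partial>lborel)" for x
  proof (rule integral_dominated_convergence[where w="\<lambda>y. c * g y"])
    show "AE y in lborel. norm (K (x - y) *\<^sub>R \<xi>n n y) \<le> c * g y" for n
      using mult_mono[OF K_le b c_nonneg norm_ge_zero] by (intro AE_I2) simp
  qed (auto intro!: tendsto_intros lim simp: g)
  have ib: "norm (\<integral>y. K (x - y) *\<^sub>R \<xi>n n y \<partial>lborel) \<le> c * (\<integral>y. g y \<partial>lborel)" for x n
  proof -
    have "norm (\<integral>y. K (x - y) *\<^sub>R \<xi>n n y \<partial>lborel) \<le> (\<integral>y. c * g y \<partial>lborel)"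
      by (rule integral_norm_bound_ineq) (use g mult_mono[OF K_le b c_nonneg norm_ge_zero] in auto)
    then show ?thesis by simp
  qed
  have ms: "(\<lambda>x. \<integral>y. K (x - y) *\<^sub>R \<xi> y \<partial>lborel) \<in> borel_measurable borel"
    if [measurable]: "\<xi> \<in> borel_measurable borel" for \<xi> :: "'a \<Rightarrow> 'a" by measurable
  have "(\<lambda>n. quad (\<xi>n n)) \<longlonglongrightarrow> quad \<xi>"
    unfolding quad_def
  proof (rule integral_dominated_convergence[where w="\<lambda>x. (c * (\<integral>y. g y \<partial>lborel)) * g x"])
    show "AE x in lborel. norm ((\<integral>y. K (x - y) *\<^sub>R \<xi>n n y \<partial>lborel) \<bullet> \<xi>n n x) \<le> c * (\<integral>y. g y \<partial>lborel) * g x" for n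
    proof (rule AE_I2)
      fix x
      show "norm ((\<integral>y. K (x - y) *\<^sub>R \<xi>n n y \<partial>lborel) \<bullet> \<xi>n n x) \<le> c * (\<integral>y. g y \<partial>lborel) * g x"
        unfolding real_norm_def
        by (rule order_trans[OF Cauchy_Schwarz_ineq2 mult_mono[OF ib b]]) (use order_trans[OF norm_ge_zero ib] in auto)
    qed
    show "(\<lambda>x. (\<integral>y. K (x - y) *\<^sub>R \<xi> y \<partial>lborel) \<bullet> \<xi> x) \<in> borel_measurable lborel"
      using borel_measurable_inner[OF ms[OF m(2)] m(2)] by simp
    show "(\<lambda>x. (\<integral>y. K (x - y) *\<^sub>R \<xi>n n y \<partial>lborel) \<bullet> \<xi>n n x) \<in> borel_measurable lborel" for n
      using borel_measurable_inner[OF ms[OF m(1)] m(1)] by simp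
  qed (auto intro!: AE_I2 tendsto_inner inner lim simp: g)
  then show ?thesis by (rule LIMSEQ_le_const) (use q in auto)
qed

lemma quad_nonneg_compact_support:
  fixes \<xi> :: "'a \<Rightarrow> 'a"
  assumes cont: "continuous_on UNIV \<xi>" and supp: "\<And>x. norm x > R \<Longrightarrow> \<xi> x = 0"
  shows "quad \<xi> \<ge> 0"
proof -
  obtain M where M: "M \<ge> 0" "\<And>x. norm (\<xi> x) \<le> M"
    using continuous_compact_support_bounded[OF cont supp] by blast
  define \<xi>n where "\<xi>n n x = (\<Sum>b\<in>Basis. conv (\<lambda>y. \<xi> y \<bullet> b) (mollifier (1 / real (Suc n))) x *\<^sub>R b)" for n x
  have cb: "continuous_on UNIV (\<lambda>y. \<xi> y \<bullet> b)" for b by (intro continuous_intros cont)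
  have lb: "locally_bdd (\<lambda>y. \<xi> y \<bullet> b)" for b by (rule locally_bdd_continuous[OF cb])
  have e: "1 / real (Suc n) > 0" for n by simp
  have sm: "smooth (\<xi>n n)" for n unfolding \<xi>n_def[abs_def]
    by (intro smooth_sum smooth_scaleR smooth_const smooth_conv lb test_function_mollifier e)
  have z: "\<xi>n n x = 0" if "norm x > R + 1" for n x
  proof -
    have "conv (\<lambda>y. \<xi> y \<bullet> b) (mollifier (1 / real (Suc n))) x = 0" for b
    proof (rule conv_eq_0[where R=R and r=1])
      show "mollifier (1 / real (Suc n)) y = 0" if "norm y > 1" for y :: 'a
      proof (rule mollifier_eq_0[OF e])
        have "1 / real (Suc n) \<le> 1" by simp
        then show "1 / real (Suc n) \<le> norm y" using that by linarith
      qed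
    qed (use supp that in auto)
    then show ?thesis by (simp add: \<xi>n_def)
  qed
  have bd: "norm (\<xi>n n x) \<le> dm * M" for n x
  proof -
    have "\<bar>conv (\<lambda>y. \<xi> y \<bullet> b) (mollifier (1 / real (Suc n))) x\<bar> \<le> M" if "b \<in> Basis" for b
      using conv_mollifier_bound[OF lb e, of n x b 0 M] order_trans[OF Basis_le_norm[OF that] M(2)] by simp
    then have "norm (\<xi>n n x) \<le> (\<Sum>b\<in>(Basis::'a set). M)" unfolding \<xi>n_def by (intro sum_norm_le) simp
    then show ?thesis by (simp add: dm_def)
  qed
  show ?thesis
  proof (rule quad_limit[where \<xi>n=\<xi>n and g="\<lambda>x. indicator (cball 0 (R + 1)) x * (dm * M)"])
    show "\<xi>n n \<in> borel_measurable borel" for n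
      by (rule borel_measurable_continuous_onI[OF smooth_continuous[OF sm]])
    show "\<xi> \<in> borel_measurable borel" by (rule borel_measurable_continuous_onI[OF cont])
    show "(\<lambda>n. \<xi>n n x) \<longlonglongrightarrow> \<xi> x" for x
    proof -
      have "(\<lambda>n. \<xi>n n x) \<longlonglongrightarrow> (\<Sum>b\<in>Basis. (\<xi> x \<bullet> b) *\<^sub>R b)"
        unfolding \<xi>n_def by (intro tendsto_sum tendsto_scaleR tendsto_const conv_mollifier_tendsto[OF cb])
      then show ?thesis by (simp add: euclidean_representation)
    qed
    show "norm (\<xi>n n x) \<le> indicator (cball 0 (R + 1)) x * (dm * M)" for n x
      using bd[of n x] z[of x n] by (cases "norm x > R + 1") auto
    show "integrable lborel (\<lambda>x::'a. indicator (cball 0 (R + 1)) x * (dm * M))"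
      by (intro integrable_mult_left integrable_real_indicator) (use emeasure_lborel_cball_finite in \<open>auto simp: less_top\<close>)
    have "test_function (\<xi>n n)" for n by (rule test_functionI[OF sm z])
    then show "quad (\<xi>n n) \<ge> 0" for n using K_posdef by (simp add: quad_def positive_definite_kernel_def)
  qed
qed

lemma quad_nonneg:
  fixes \<xi> :: "'a \<Rightarrow> 'a"
  assumes cont: "continuous_on UNIV \<xi>" and b: "\<And>x. norm (\<xi> x) \<le> g x" and g: "integrable lborel g"
  shows "quad \<xi> \<ge> 0"
proof -
  define ct where "ct n x = max 0 (min 1 (real n - norm (x::'a)))" for n x
  have c1: "continuous_on UNIV (\<lambda>x. ct n x *\<^sub>R \<xi> x)" for n unfolding ct_def by (intro continuous_intros cont)
  have ct01: "0 \<le> ct n x" "ct n x \<le> 1" for n x by (auto simp: ct_def)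
  show ?thesis
  proof (rule quad_limit[where \<xi>n="\<lambda>n x. ct n x *\<^sub>R \<xi> x" and g=g])
    show "(\<lambda>x. ct n x *\<^sub>R \<xi> x) \<in> borel_measurable borel" for n by (rule borel_measurable_continuous_onI[OF c1])
    show "\<xi> \<in> borel_measurable borel" by (rule borel_measurable_continuous_onI[OF cont])
    show "norm (ct n x *\<^sub>R \<xi> x) \<le> g x" for n x
      using mult_right_mono[OF ct01(2)[of n x], of "norm (\<xi> x)"] ct01(1)[of n x] b[of x] by simp
    show "quad (\<lambda>x. ct n x *\<^sub>R \<xi> x) \<ge> 0" for n
      by (rule quad_nonneg_compact_support[OF c1, of n]) (simp add: ct_def)
    show "(\<lambda>n. ct n x *\<^sub>R \<xi> x) \<longlonglongrightarrow> \<xi> x" for x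
    proof (rule tendsto_eventually)
      obtain N :: nat where "norm x + 1 \<le> real N" using real_arch_simple by blast
      then have "ct n x = 1" if "n \<ge> N" for n using that by (simp add: ct_def)
      then show "\<forall>\<^sub>F n in sequentially. ct n x *\<^sub>R \<xi> x = \<xi> x" unfolding eventually_sequentially by force
    qed
  qed (rule g)
qed

lemma quad_gibbs_nonneg:
  fixes \<xi> :: "'a \<Rightarrow> 'a"
  assumes cont: "continuous_on UNIV \<xi>" and b: "\<And>x. norm (\<xi> x) \<le> B * w x"
  shows "(\<integral>x. (\<integral>y. K (x - y) *\<^sub>R \<xi> y \<partial>\<gamma>) \<bullet> \<xi> x \<partial>\<gamma>) \<ge> 0"
proof -
  have [measurable]: "\<xi> \<in> borel_measurable borel" by (rule borel_measurable_continuous_onI[OF cont])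
  have "quad (\<lambda>x. (exp (- V x) / Z) *\<^sub>R \<xi> x) \<ge> 0"
  proof (rule quad_nonneg)
    show "continuous_on UNIV (\<lambda>x. (exp (- V x) / Z) *\<^sub>R \<xi> x)"
      using Z_pos by (intro continuous_intros cont smooth_continuous[OF V_smooth]) auto
    show "norm ((exp (- V x) / Z) *\<^sub>R \<xi> x) \<le> (B / Z) * (w x ^ 1 * exp (- V x))" for x
      using mult_left_mono[OF b[of x], of "exp (- V x) / Z"] Z_pos by (simp add: field_simps)
    show "integrable lborel (\<lambda>x. (B / Z) * (w x ^ 1 * exp (- V x)))"
      by (rule integrable_mult_right[OF integrable_w_power_exp])
  qed
  moreover have "(\<integral>x. (\<integral>y. K (x - y) *\<^sub>R \<xi> y \<partial>\<gamma>) \<bullet> \<xi> x \<partial>\<gamma>) = quad (\<lambda>x. (exp (- V x) / Z) *\<^sub>R \<xi> x)"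
  proof -
    have 1: "(\<integral>y. K (x - y) *\<^sub>R \<xi> y \<partial>\<gamma>) = (\<integral>y. K (x - y) *\<^sub>R (exp (- V y) / Z) *\<^sub>R \<xi> y \<partial>lborel)" for x
      by (subst gibbs_integral(1)) (simp_all add: mult.commute)
    show ?thesis unfolding 1 quad_def by (subst gibbs_integral(1)) simp_all
  qed
  ultimately show ?thesis by simp
qed

lemma Lop_grad_V: "Lop (grad V) \<phi>' x = (\<integral>y. - \<phi>' y (Phi y x) \<partial>\<gamma>)" if "reg A \<phi> \<phi>'"
proof -
  have "grad K (x - y) - K (x - y) *\<^sub>R grad V x = - Phi y x" for y
    unfolding Phi_def K_swap[of x y] grad_K_swap[of x y] by simp
  then show ?thesis unfolding Lop_def by (simp only: linear_neg[OF reg_linear[OF that]])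
qed

text \<open>The identity that dictates \<open>L\<close>: the shift by the velocity also changes the
  integral of \<open>\<phi>\<close> against \<open>\<gamma>\<close>, where no dynamics compensates
  it, and the integral of \<open>L \<phi>\<close> against \<open>\<nu>\<close> cancels precisely
  this change. For \<open>\<nu> = \<gamma>\<close> it says that \<open>L \<phi>\<close> has mean
  0.\<close>

lemma Lop_duality:
  assumes \<nu>: "adm \<nu>" and r: "reg A \<phi> \<phi>'"
  shows "(\<integral>x. Lop (grad V) \<phi>' x \<partial>\<nu>) = - (\<integral>x. \<phi>' x (vel \<nu> x) \<partial>\<gamma>)"
proof -
  have "(\<integral>x. Lop (grad V) \<phi>' x \<partial>\<nu>) = (\<integral>x. (\<integral>y. - \<phi>' y (Phi y x) \<partial>\<gamma>) \<partial>\<nu>)"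
    by (simp only: Lop_grad_V[OF r])
  also have "\<dots> = (\<integral>y. (\<integral>x. - \<phi>' y (Phi y x) \<partial>\<nu>) \<partial>\<gamma>)"
  proof (rule iterated_integral_swap_adm[OF \<nu>, symmetric])
    have "(\<lambda>p. \<phi>' (fst p) (Phi (fst p) (snd p))) \<in> borel_measurable (borel \<Otimes>\<^sub>M borel)"
      by (rule reg_measurable_compose[OF r]) measurable
    then show "(\<lambda>(y, x). - \<phi>' y (Phi y x)) \<in> borel_measurable (borel \<Otimes>\<^sub>M borel)"
      by (simp add: case_prod_unfold)
    show "\<bar>- \<phi>' y (Phi y x)\<bar> \<le> (A * cp) * w y ^ 1 * w x" for x y
      using order_trans[OF reg_derivative_le[OF r, of y "Phi y x"] mult_left_mono[OF Phi_le[of y x], of "A * w y"]]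
        reg_nonneg[OF r] w_nonneg[of y] by (simp add: mult_ac)
  qed
  also have "\<dots> = (\<integral>y. - \<phi>' y (vel \<nu> y) \<partial>\<gamma>)"
    unfolding vel_eq[OF \<nu>] using integral_bounded_linear[OF bounded_linear_reg[OF r] integrable_Phi[OF \<nu>]] by simp
  finally show ?thesis by simp
qed

text \<open>\<open>ibp_K\<close> moves the derivative of the kernel onto the undifferentiated factor
  \<open>\<phi>\<close>; what remains is minus the form of the positive definite \<open>K\<close> at
  the gradient \<open>e\<close> of \<open>\<phi>\<close>, weighted by the Gibbs density.\<close>

lemma Lop_nonpos:
  assumes r: "reg A \<phi> \<phi>'" shows "(\<integral>x. \<phi> x * Lop (grad V) \<phi>' x \<partial>\<gamma>) \<le> 0"
proof -
  note [measurable] = reg_measurable[OF r]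
  define e where "e x = (\<Sum>b\<in>Basis. \<phi>' x b *\<^sub>R b)" for x
  have e: "\<phi>' x v = e x \<bullet> v" for x v
    unfolding gr_sum_basis[OF reg_gr[OF r], of x v] e_def by (simp add: inner_sum_left inner_sum_right inner_commute)
  have ce: "continuous_on UNIV e" unfolding e_def[abs_def] by (intro continuous_intros gr_cont[OF reg_gr[OF r]])
  have [measurable]: "e \<in> borel_measurable borel" by (rule borel_measurable_continuous_onI[OF ce])
  have eb: "norm (e x) \<le> A * w x" for x
  proof (cases "e x = 0")
    case False
    have "norm (e x) * norm (e x) \<le> A * w x * norm (e x)"
      using reg_derivative_le[OF r, of x "e x"] by (simp add: e dot_square_norm power2_eq_square)
    then show ?thesis using False by simp
  qed (use reg_nonneg[OF r] w_nonneg in simp)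
  have "(\<integral>x. \<phi> x * Lop (grad V) \<phi>' x \<partial>\<gamma>) = (\<integral>x. (\<integral>y. - (\<phi> x * \<phi>' y (Phi y x)) \<partial>\<gamma>) \<partial>\<gamma>)"
    by (simp add: Lop_grad_V[OF r])
  also have "\<dots> = (\<integral>y. (\<integral>x. - (\<phi> x * \<phi>' y (Phi y x)) \<partial>\<gamma>) \<partial>\<gamma>)"
  proof (rule iterated_integral_swap)
    have "(\<lambda>p. \<phi>' (snd p) (Phi (snd p) (fst p))) \<in> borel_measurable (borel \<Otimes>\<^sub>M borel)"
      by (rule reg_measurable_compose[OF r]) measurable
    then have "(\<lambda>(x, y). - (\<phi> x * \<phi>' y (Phi y x))) \<in> borel_measurable (borel \<Otimes>\<^sub>M borel)"
      by (simp add: case_prod_unfold)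
    then show "(\<lambda>(x, y). - (\<phi> x * \<phi>' y (Phi y x))) \<in> borel_measurable (\<gamma> \<Otimes>\<^sub>M \<gamma>)"
      using measurable_cong_sets[OF sets_pair_adm[OF adm_gibbs adm_gibbs] refl] by blast
    show "integrable \<gamma> (\<lambda>x. A * A * cp * w x ^ 2)"
      by (rule integrable_gibbs[where B="A * A * cp" and k=2]) (use reg_nonneg[OF r] cp_nonneg in auto)
    show "integrable \<gamma> w" using adm_gibbs by (simp add: adm_def)
    fix x y
    have "\<bar>\<phi>' y (Phi y x)\<bar> \<le> A * w y * (cp * w x)"
      by (rule order_trans[OF reg_derivative_le[OF r] mult_left_mono[OF Phi_le]]) (use reg_nonneg[OF r] w_nonneg in auto)
    then have "\<bar>\<phi> x\<bar> * \<bar>\<phi>' y (Phi y x)\<bar> \<le> (A * w x) * (A * w y * (cp * w x))"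
      by (intro mult_mono reg_le[OF r]) (use reg_nonneg[OF r] w_nonneg in auto)
    then show "\<bar>- (\<phi> x * \<phi>' y (Phi y x))\<bar> \<le> A * A * cp * w x ^ 2 * w y"
      by (simp add: abs_mult power2_eq_square mult_ac)
  qed (intro sigma_finite_adm adm_gibbs)+
  also have "\<dots> = (\<integral>y. - ((\<integral>x. K (y - x) *\<^sub>R e x \<partial>\<gamma>) \<bullet> e y) \<partial>\<gamma>)"
  proof (rule Bochner_Integration.integral_cong[OF refl])
    fix y
    have iK: "integrable \<gamma> (\<lambda>x. K (y - x) *\<^sub>R e x)"
    proof (rule adm_integrable[OF adm_gibbs])
      show "norm (K (y - x) *\<^sub>R e x) \<le> (c * A) * w x" for x
        using mult_mono[OF K_le[of "y - x"] eb[of x]] c_nonneg by (simp add: mult_ac)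
    qed measurable
    have "(\<integral>x. \<phi> x * \<phi>' y (Phi y x) \<partial>\<gamma>) = (\<integral>x. \<phi> x * (K (x - y) * (grad V x \<bullet> e y) - grad K (x - y) \<bullet> e y) \<partial>\<gamma>)"
      unfolding e Phi_def K_swap[of y] grad_K_swap[of y] by (simp add: inner_diff_right inner_commute algebra_simps)
    also have "\<dots> = (\<integral>x. K (x - y) * \<phi>' x (e y) \<partial>\<gamma>)" by (rule ibp_K(1)[OF reg_gr[OF r], symmetric])
    also have "\<dots> = (\<integral>x. (K (y - x) *\<^sub>R e x) \<bullet> e y \<partial>\<gamma>)" unfolding e K_swap[of y] by simp
    also have "\<dots> = (\<integral>x. K (y - x) *\<^sub>R e x \<partial>\<gamma>) \<bullet> e y" by (rule integral_inner_left[OF iK])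
    finally show "(\<integral>x. - (\<phi> x * \<phi>' y (Phi y x)) \<partial>\<gamma>) = - ((\<integral>x. K (y - x) *\<^sub>R e x \<partial>\<gamma>) \<bullet> e y)" by simp
  qed
  also have "\<dots> \<le> 0" using quad_gibbs_nonneg[OF ce eb] by simp
  finally show ?thesis .
qed

text \<open>A bounded field with Lipschitz derivative in place of \<open>grad V\<close>.
  \<open>Lq\<close> may blow up as the approximation improves, which is harmless: it enters only
  terms with a factor \<open>\<delta>\<close>, and \<open>\<delta>\<close> tends to 0 first. The
  constant \<open>cq\<close>, in contrast, is the same for all approximations.\<close>

definition qreg where
  "qreg Lq q q' \<longleftrightarrow> (\<forall>x. (q has_derivative q' x) (at x)) \<and> (\<forall>x. norm (q x :: 'a) \<le> Lq) \<and>
     (\<forall>x z. norm (q x - q z) \<le> Lq * norm (x - z)) \<and> (\<forall>x v. norm (q' x v) \<le> Lq * norm (v :: 'a)) \<and>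
     (\<forall>x z v. norm (q' x v - q' z v) \<le> Lq * norm (x - z) * norm v) \<and> wlip cq q"

text \<open>The derivative in \<open>x\<close> of the vector to which \<open>\<phi>' y\<close> is
  applied in \<open>Lop\<close>; as \<open>\<phi>' y\<close> is linear, differentiating
  \<open>Lop\<close> never touches it.\<close>

definition Tk where "Tk q q' x y v = K2 (x - y) v - (K (x - y) *\<^sub>R q' x v + (grad K (x - y) \<bullet> v) *\<^sub>R q x)"

definition dLop where "dLop q q' \<phi>' x v = (\<integral>y. \<phi>' y (Tk q q' x y v) \<partial>\<gamma>)"

context
  fixes Lq q q' assumes q: "qreg Lq q q'"
begin

lemma qregD: "(q has_derivative q' x) (at x)" "norm (q x) \<le> Lq" "norm (q x - q z) \<le> Lq * norm (x - z)"
   "norm (q' x v) \<le> Lq * norm v" "norm (q' x v - q' z v) \<le> Lq * norm (x - z) * norm v" "wlip cq q" "Lq \<ge> 0"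
  using q norm_ge_zero[of "q 0"] order_trans unfolding qreg_def by blast+

lemma Tk_has_derivative: "((\<lambda>x. grad K (x - y) - K (x - y) *\<^sub>R q x) has_derivative Tk q q' x y) (at x)"
proof -
  have s: "((\<lambda>x. x - y) has_derivative (\<lambda>v. v)) (at x)" by (auto intro!: derivative_eq_intros)
  show ?thesis unfolding Tk_def[abs_def]
    by (intro has_derivative_diff has_derivative_scaleR has_derivative_compose[OF s grad_K_has_derivative]
      has_derivative_compose[OF s K_has_derivative] qregD(1))
qed

lemma Tk_lip: "norm (Tk q q' x y v - Tk q q' z y v) \<le> (c + 4 * c * Lq) * norm (x - z) * norm v"
proof -
  let ?n = "norm (x - z)"
  have "Tk q q' x y v - Tk q q' z y v = (K2 (x - y) v - K2 (z - y) v)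
     - ((K (x - y) *\<^sub>R (q' x v - q' z v) + (K (x - y) - K (z - y)) *\<^sub>R q' z v)
       + ((grad K (x - y) \<bullet> v) *\<^sub>R (q x - q z) + ((grad K (x - y) - grad K (z - y)) \<bullet> v) *\<^sub>R q z))"
    by (simp add: Tk_def algebra_simps inner_diff_left)
  also have "norm \<dots> \<le> c * ?n * norm v + ((c * (Lq * ?n * norm v) + (c * ?n) * (Lq * norm v))
       + ((c * norm v) * (Lq * ?n) + (c * ?n * norm v) * Lq))"
  proof -
    have 1: "norm (K2 (x - y) v - K2 (z - y) v) \<le> c * ?n * norm v" using K2_lip[of "x - y" v "z - y"] by simp
    have 2: "norm (K (x - y) *\<^sub>R (q' x v - q' z v)) \<le> c * (Lq * ?n * norm v)"
      unfolding norm_scaleR by (intro mult_mono K_le qregD c_nonneg norm_ge_zero)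
    have "\<bar>K (x - y) - K (z - y)\<bar> \<le> c * ?n" using K_lip[of "x - y" "z - y"] by simp
    then have 3: "norm ((K (x - y) - K (z - y)) *\<^sub>R q' z v) \<le> (c * ?n) * (Lq * norm v)"
      unfolding norm_scaleR by (intro mult_mono qregD) (use c_nonneg in auto)
    have 4: "norm ((grad K (x - y) \<bullet> v) *\<^sub>R (q x - q z)) \<le> (c * norm v) * (Lq * ?n)"
      unfolding norm_scaleR by (intro mult_mono inner_grad_K_le qregD) (use c_nonneg in auto)
    have "\<bar>(grad K (x - y) - grad K (z - y)) \<bullet> v\<bar> \<le> c * ?n * norm v"
      using Cauchy_Schwarz_ineq2[of "grad K (x - y) - grad K (z - y)" v]
        mult_right_mono[OF grad_K_lip[of "x - y" "z - y"], of "norm v"] by simp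
    then have 5: "norm (((grad K (x - y) - grad K (z - y)) \<bullet> v) *\<^sub>R q z) \<le> (c * ?n * norm v) * Lq"
      unfolding norm_scaleR by (intro mult_mono qregD) (use c_nonneg in auto)
    show ?thesis
      by (rule order_trans[OF norm_triangle_ineq4 add_mono[OF 1 norm_triangle_mono[OF norm_triangle_mono[OF 2 3] norm_triangle_mono[OF 4 5]]]])
  qed
  also have "\<dots> = (c + 4 * c * Lq) * norm (x - z) * norm v" by (simp add: algebra_simps)
  finally show ?thesis .
qed

lemma Tk_le: "norm (Tk q q' x y v) \<le> (c + 2 * c * Lq) * norm v"
proof -
  have "norm (Tk q q' x y v) \<le> c * norm v + (c * (Lq * norm v) + (c * norm v) * Lq)"
  proof -
    have 1: "norm (K (x - y) *\<^sub>R q' x v) \<le> c * (Lq * norm v)"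
      unfolding norm_scaleR by (intro mult_mono K_le qregD c_nonneg norm_ge_zero)
    have 2: "norm ((grad K (x - y) \<bullet> v) *\<^sub>R q x) \<le> (c * norm v) * Lq"
      unfolding norm_scaleR by (intro mult_mono inner_grad_K_le qregD) (use c_nonneg in auto)
    show ?thesis unfolding Tk_def
      by (rule order_trans[OF norm_triangle_ineq4 add_mono[OF K2_le norm_triangle_mono[OF 1 2]]])
  qed
  then show ?thesis by (simp add: algebra_simps)
qed

lemma linear_Tk: "linear (Tk q q' x y)" by (rule has_derivative_linear[OF Tk_has_derivative])

lemma Tk_measurable [measurable]: "(\<lambda>y. Tk q q' x y v) \<in> borel_measurable borel"
  unfolding Tk_def by measurable

lemma reg_integrable_compose:
  assumes r: "reg A \<phi> \<phi>'" and [measurable]: "g \<in> borel_measurable borel" and g: "\<And>y. norm (g y) \<le> B"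
  shows "integrable \<gamma> (\<lambda>y. \<phi>' y (g y))"
proof (rule adm_integrable[OF adm_gibbs])
  show "(\<lambda>y. \<phi>' y (g y)) \<in> borel_measurable borel" by (rule reg_measurable_compose[OF r]) simp_all
  show "norm (\<phi>' y (g y)) \<le> (A * B) * w y" for y
    using order_trans[OF reg_derivative_le[OF r, of y "g y"] mult_left_mono[OF g[of y], of "A * w y"]]
      reg_nonneg[OF r] w_nonneg[of y] by (simp add: mult_ac)
qed

lemma integrable_Lop:
  assumes r: "reg A \<phi> \<phi>'"
  shows "integrable \<gamma> (\<lambda>y. \<phi>' y (grad K (x - y) - K (x - y) *\<^sub>R u))"
proof (rule reg_integrable_compose[OF r])
  show "norm (grad K (x - y) - K (x - y) *\<^sub>R u) \<le> c + c * norm u" for y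
    using norm_triangle_ineq4[of "grad K (x - y)" "K (x - y) *\<^sub>R u"] grad_K_le[of "x - y"]
      mult_right_mono[OF K_le[of "x - y"] norm_ge_zero[of u]] by simp
qed measurable

lemma Lop_has_derivative:
  assumes r: "reg A \<phi> \<phi>'"
  shows "(Lop q \<phi>' has_derivative dLop q q' \<phi>' x) (at x)"
proof -
  have "((\<lambda>x. \<integral>y. \<phi>' y (grad K (x - y) - K (x - y) *\<^sub>R q x) \<partial>\<gamma>) has_derivative (\<lambda>v. \<integral>y. \<phi>' y (Tk q q' x y v) \<partial>\<gamma>)) (at x)"
  proof (rule has_derivative_integral_quadratic[where r=1 and c="\<lambda>y. A * w y * (c + 4 * c * Lq)"])
    show "integrable \<gamma> (\<lambda>y. A * w y * (c + 4 * c * Lq))" using adm_gibbs by (simp add: adm_def)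
    show "integrable \<gamma> (\<lambda>y. \<phi>' y (grad K (x' - y) - K (x' - y) *\<^sub>R q x'))" for x' by (rule integrable_Lop[OF r])
    show "integrable \<gamma> (\<lambda>y. \<phi>' y (Tk q q' x y v))" for v
      by (rule reg_integrable_compose[OF r Tk_measurable Tk_le])
    show "linear (\<lambda>v. \<phi>' y (Tk q q' x y v))" for y
      using linear_compose[OF linear_Tk reg_linear[OF r]] by (simp add: o_def)
    fix y x'
    let ?g = "\<lambda>x. grad K (x - y) - K (x - y) *\<^sub>R q x"
    have lin: "\<phi>' y (?g x') - \<phi>' y (?g x) - \<phi>' y (Tk q q' x y (x' - x)) = \<phi>' y (?g x' - ?g x - Tk q q' x y (x' - x))"
      by (simp only: linear_diff[OF reg_linear[OF r]])
    have "norm (?g x' - ?g x - Tk q q' x y (x' - x)) \<le> (c + 4 * c * Lq) * (norm (x' - x))\<^sup>2"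
      by (rule quadratic_remainder[where f="?g" and f'="\<lambda>x. Tk q q' x y"])
         (use Tk_has_derivative Tk_lip c_nonneg qregD(7) in auto)
    from mult_left_mono[OF this, of "A * w y"]
    show "norm (\<phi>' y (?g x') - \<phi>' y (?g x) - \<phi>' y (Tk q q' x y (x' - x))) \<le> A * w y * (c + 4 * c * Lq) * (norm (x' - x))\<^sup>2"
      unfolding lin using order_trans[OF reg_derivative_le[OF r, of y]] reg_nonneg[OF r] w_nonneg[of y]
      by (simp add: mult.assoc)
  qed simp
  then show ?thesis unfolding Lop_def[abs_def] dLop_def[abs_def] .
qed

lemma dLop_lip:
  assumes r: "reg A \<phi> \<phi>'"
  shows "\<bar>dLop q q' \<phi>' x v - dLop q q' \<phi>' z v\<bar> \<le> (c + 4 * c * Lq) * A * mass \<gamma> * norm (x - z) * norm v"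
proof -
  have "dLop q q' \<phi>' x v - dLop q q' \<phi>' z v = (\<integral>y. \<phi>' y (Tk q q' x y v - Tk q q' z y v) \<partial>\<gamma>)"
    unfolding dLop_def using reg_integrable_compose[OF r Tk_measurable Tk_le]
    by (simp add: linear_diff[OF reg_linear[OF r]])
  also have "norm \<dots> \<le> (A * ((c + 4 * c * Lq) * norm (x - z) * norm v)) * mass \<gamma>"
  proof (rule adm_integral_bound[OF adm_gibbs])
    show "norm (\<phi>' y (Tk q q' x y v - Tk q q' z y v)) \<le> (A * ((c + 4 * c * Lq) * norm (x - z) * norm v)) * w y" for y
      using order_trans[OF reg_derivative_le[OF r, of y] mult_left_mono[OF Tk_lip[of x y v z], of "A * w y"]]
        reg_nonneg[OF r] w_nonneg[of y] by (simp add: mult_ac)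
  qed
  finally show ?thesis by (simp add: mult_ac)
qed

text \<open>The two operators differ in the term with \<open>K\<close> alone, so the value of
  \<open>q - grad V\<close> at the point \<open>x\<close> controls the difference.\<close>

lemma Lop_diff_le:
  assumes r: "reg A \<phi> \<phi>'"
  shows "\<bar>Lop q \<phi>' x - Lop (grad V) \<phi>' x\<bar> \<le> c * A * mass \<gamma> * norm (q x - grad V x)"
proof -
  have "Lop q \<phi>' x - Lop (grad V) \<phi>' x = (\<integral>y. \<phi>' y (K (x - y) *\<^sub>R (grad V x - q x)) \<partial>\<gamma>)"
    unfolding Lop_def using integrable_Lop[OF r, of x "q x"] integrable_Lop[OF r, of x "grad V x"]
    by (simp add: Bochner_Integration.integral_diff[symmetric] linear_diff[OF reg_linear[OF r], symmetric] algebra_simps del: Bochner_Integration.integral_diff)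
  also have "norm \<dots> \<le> (A * (c * norm (q x - grad V x))) * mass \<gamma>"
  proof (rule adm_integral_bound[OF adm_gibbs])
    fix y
    have "norm (K (x - y) *\<^sub>R (grad V x - q x)) \<le> c * norm (q x - grad V x)"
      unfolding norm_scaleR norm_minus_commute[of "grad V x"] by (intro mult_right_mono K_le) simp
    from order_trans[OF reg_derivative_le[OF r, of y] mult_left_mono[OF this, of "A * w y"]]
    show "norm (\<phi>' y (K (x - y) *\<^sub>R (grad V x - q x))) \<le> (A * (c * norm (q x - grad V x))) * w y"
      using reg_nonneg[OF r] w_nonneg[of y] by (simp add: mult_ac)
  qed
  finally show ?thesis by (simp add: mult_ac)
qed

end

section \<open>One step of the dual Euler scheme\<close>

text \<open>The regularity of gradients that yields Taylor remainders of order
  \<open>\<delta>^2\<close>, with the same weight as in \<open>wlip\<close>.\<close>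

definition dlip where
  "dlip D \<phi>' \<longleftrightarrow> (\<forall>x z v. \<bar>\<phi>' x v - \<phi>' z v\<bar> \<le> D * max (w x) (w z) * norm (x - z) * norm (v :: 'a))"

lemma dlip_continuous:
  assumes "dlip D \<phi>'" shows "continuous_on UNIV (\<lambda>x. \<phi>' x v)"
proof -
  have "isCont (\<lambda>x. \<phi>' x v) x" for x
  proof -
    have "((\<lambda>z. D * max (w z) (w x) * norm (z - x) * norm v) \<longlongrightarrow> D * max (w x) (w x) * norm (x - x) * norm v) (at x)"
      using continuous_w by (intro tendsto_intros) (simp add: continuous_on_eq_continuous_at isContD)
    then have "((\<lambda>z. \<phi>' z v - \<phi>' x v) \<longlongrightarrow> 0) (at x)"
      by (intro Lim_null_comparison[of "\<lambda>z. \<phi>' z v - \<phi>' x v" "\<lambda>z. D * max (w z) (w x) * norm (z - x) * norm v"])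
         (use assms in \<open>auto intro!: always_eventually simp: dlip_def\<close>)
    then show ?thesis by (simp add: isCont_def LIM_zero_iff)
  qed
  then show ?thesis by (simp add: continuous_on_eq_continuous_at)
qed

lemma l2_le: assumes "wlip A \<phi>" shows "l2 \<phi> \<le> A * M2"
proof -
  have A: "A \<ge> 0" by (rule wlip_nonneg[OF assms])
  have "(\<integral>x. (\<phi> x)\<^sup>2 \<partial>\<gamma>) \<le> (\<integral>x. A\<^sup>2 * (w x)\<^sup>2 \<partial>\<gamma>)"
  proof (rule integral_mono[OF integrable_square[OF assms]])
    show "integrable \<gamma> (\<lambda>x. A\<^sup>2 * (w x)\<^sup>2)" using integrable_square[OF wlip_w] by simp
    show "(\<phi> x)\<^sup>2 \<le> A\<^sup>2 * (w x)\<^sup>2" for x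
      using power_mono[OF wlip_le[OF assms, of x], of 2] by (simp add: power_mult_distrib)
  qed
  then have "(l2 \<phi>)\<^sup>2 \<le> (A * M2)\<^sup>2" by (simp add: l2_square M2_def power_mult_distrib)
  then show ?thesis by (rule power2_le_imp_le) (use A M2_ge_1 in simp)
qed

text \<open>\<open>b\<close> is any bound for the velocity and its Lipschitz constant. It is
  instantiated in two ways: with \<open>cv * dst \<nu>\<close> itself for the growth factors, which
  must be linear in the distance, and with a bound uniform in time for the error constants.\<close>

context
  fixes \<nu> and \<delta> b :: real
  assumes \<nu>: "adm \<nu>" and \<delta>: "0 \<le> \<delta>" "\<delta> \<le> 1" and b_ge: "cv * dst \<nu> \<le> b"
begin

definition shift where "shift x = x - \<delta> *\<^sub>R vel \<nu> x"

lemma b_nonneg: "b \<ge> 0" using mult_nonneg_nonneg[OF cv_nonneg dst_nonneg[OF \<nu>]] b_ge by linarith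

lemma vel_le_b: "norm (vel \<nu> x) \<le> b" and dvel_le_b: "norm (dvel \<nu> x v) \<le> b * norm v"
  and vel_lip_b: "norm (vel \<nu> x - vel \<nu> z) \<le> b * norm (x - z)"
  using order_trans[OF vel_le[OF \<nu>] b_ge] order_trans[OF dvel_le[OF \<nu>] mult_right_mono[OF b_ge norm_ge_zero]]
    order_trans[OF vel_lip[OF \<nu>] mult_right_mono[OF b_ge norm_ge_zero]] .

lemma shift_dist: "norm (shift x - x) \<le> \<delta> * b"
  using mult_left_mono[OF vel_le_b \<delta>(1), of x] \<delta> by (simp add: shift_def)

lemma w_shift: "w (shift x) \<le> exp (c * \<delta> * b) * w x"
proof -
  have "c * norm (shift x - x) \<le> c * \<delta> * b" using mult_left_mono[OF shift_dist c_nonneg, of x] by simp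
  then have "exp (c * norm (shift x - x)) * w x \<le> exp (c * \<delta> * b) * w x" using w_nonneg by (intro mult_right_mono) auto
  then show ?thesis using w_le_exp[of "shift x" x] by simp
qed

lemma max_w_shift: "max (w (shift x)) (w (shift z)) \<le> exp (c * \<delta> * b) * max (w x) (w z)"
  using w_shift[of x] w_shift[of z] by (meson max.bounded_iff max.cobounded1 max.cobounded2 mult_left_mono exp_ge_zero order_trans)

lemma one_plus_le_exp: "1 + \<delta> * b \<le> exp (\<delta> * b)" by (rule exp_ge_add_one_self)

lemma shift_lip: "norm (shift x - shift z) \<le> exp (\<delta> * b) * norm (x - z)"
proof -
  have "shift x - shift z = (x - z) - \<delta> *\<^sub>R (vel \<nu> x - vel \<nu> z)" by (simp add: shift_def algebra_simps)
  also have "norm \<dots> \<le> norm (x - z) + \<delta> * (b * norm (x - z))"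
    using norm_triangle_ineq4[of "x - z" "\<delta> *\<^sub>R (vel \<nu> x - vel \<nu> z)"] mult_left_mono[OF vel_lip_b \<delta>(1), of x z] \<delta>(1) by simp
  also have "\<dots> = (1 + \<delta> * b) * norm (x - z)" by (simp add: algebra_simps)
  also have "\<dots> \<le> exp (\<delta> * b) * norm (x - z)" by (intro mult_right_mono one_plus_le_exp) simp
  finally show ?thesis .
qed

lemma shift_has_derivative: "(shift has_derivative (\<lambda>v. v - \<delta> *\<^sub>R dvel \<nu> x v)) (at x)"
  unfolding shift_def[abs_def] by (intro has_derivative_diff has_derivative_ident has_derivative_scaleR_right vel_has_derivative[OF \<nu>])

lemma dshift_le: "norm (v - \<delta> *\<^sub>R dvel \<nu> x v) \<le> exp (\<delta> * b) * norm v"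
proof -
  have "norm (v - \<delta> *\<^sub>R dvel \<nu> x v) \<le> norm v + \<delta> * (b * norm v)"
    using norm_triangle_ineq4[of v "\<delta> *\<^sub>R dvel \<nu> x v"] mult_left_mono[OF dvel_le_b \<delta>(1), of x v] \<delta>(1) by simp
  also have "\<dots> = (1 + \<delta> * b) * norm v" by (simp add: algebra_simps)
  also have "\<dots> \<le> exp (\<delta> * b) * norm v" by (intro mult_right_mono one_plus_le_exp) simp
  finally show ?thesis .
qed

text \<open>In the exponent, \<open>c\<close> accounts for the change of the weight along the shift
  and 1 for the Lipschitz constant of the shift.\<close>

lemma wlip_shift:
  assumes "wlip A \<phi>" shows "wlip (A * exp ((c + 1) * (\<delta> * b))) (\<lambda>x. \<phi> (shift x) :: real)"
proof (rule wlipI)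
  have A: "A \<ge> 0" by (rule wlip_nonneg[OF assms])
  have e: "exp ((c + 1) * (\<delta> * b)) = exp (c * \<delta> * b) * exp (\<delta> * b)" by (simp add: exp_add[symmetric] algebra_simps)
  have e1: "exp (\<delta> * b) \<ge> 1" using \<delta>(1) b_nonneg by simp
  show "norm (\<phi> (shift x)) \<le> A * exp ((c + 1) * (\<delta> * b)) * w x" for x
  proof -
    have "norm (\<phi> (shift x)) \<le> A * (exp (c * \<delta> * b) * w x)"
      by (rule order_trans[OF wlip_le[OF assms] mult_left_mono[OF w_shift A]])
    also have "\<dots> \<le> (A * (exp (c * \<delta> * b) * w x)) * exp (\<delta> * b)"
      using mult_left_mono[OF e1, of "A * (exp (c * \<delta> * b) * w x)"] A w_nonneg by simp
    finally show ?thesis unfolding e by (simp add: mult_ac)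
  qed
  show "norm (\<phi> (shift x) - \<phi> (shift z)) \<le> A * exp ((c + 1) * (\<delta> * b)) * max (w x) (w z) * norm (x - z)" for x z
  proof -
    have "norm (\<phi> (shift x) - \<phi> (shift z)) \<le> A * max (w (shift x)) (w (shift z)) * norm (shift x - shift z)"
      by (rule wlip_diff_le[OF assms])
    also have "\<dots> \<le> A * (exp (c * \<delta> * b) * max (w x) (w z)) * (exp (\<delta> * b) * norm (x - z))"
      by (intro mult_mono mult_left_mono max_w_shift shift_lip) (use A max_w_pos(2) in auto)
    finally show ?thesis unfolding e by (simp add: mult_ac)
  qed
qed

context
  fixes \<phi> \<phi>' A D q q' Lq
  assumes r: "reg A \<phi> \<phi>'" and dl: "dlip D \<phi>'" and D: "D \<ge> 0" and q: "qreg Lq q q'"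
begin

lemma A_nonneg: "A \<ge> 0" by (rule reg_nonneg[OF r])

definition step where "step x = \<phi> (shift x) + \<delta> * Lop q \<phi>' x"

definition dstep where "dstep x v = \<phi>' (shift x) (v - \<delta> *\<^sub>R dvel \<nu> x v) + \<delta> * dLop q q' \<phi>' x v"

lemma step_has_derivative: "(step has_derivative dstep x) (at x)"
  unfolding step_def[abs_def] dstep_def[abs_def]
  by (intro has_derivative_add has_derivative_mult_right Lop_has_derivative[OF q r]
      has_derivative_compose[OF shift_has_derivative reg_has_derivative[OF r]])

lemma wlip_step: "wlip (A * exp ((c + 1) * (\<delta> * b)) + \<delta> * (cl * l2 \<phi>)) step"
  unfolding step_def[abs_def]
  using wlip_add[OF wlip_shift[OF reg_wlip[OF r]] wlip_cmult[OF wlip_Lop[OF r qregD(6)[OF q]], of \<delta>]] \<delta> by simp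

text \<open>Compared with \<open>wlip_shift\<close> the derivative of the shift enters once more,
  hence \<open>c + 2\<close>. The terms with a factor \<open>\<delta>\<close> stem from the
  variation of that derivative and from \<open>dLop\<close>; they involve \<open>A\<close> but not
  \<open>D\<close>, so \<open>D\<close> grows at most exponentially.\<close>

lemma dlip_step:
  "dlip (D * exp ((c + 2) * (\<delta> * b)) + \<delta> * (A * (exp (c * \<delta> * b) * (2 * c * c * mass \<nu>) + (c + 4 * c * Lq) * mass \<gamma>))) dstep"
  unfolding dlip_def
proof (intro allI)
  fix x z v
  let ?m = "max (w x) (w z)" and ?n = "norm (x - z)"
  let ?T = "\<lambda>x. v - \<delta> *\<^sub>R dvel \<nu> x v"
  have e: "exp ((c + 2) * (\<delta> * b)) = exp (c * \<delta> * b) * exp (\<delta> * b) * exp (\<delta> * b)" by (simp add: exp_add[symmetric] algebra_simps)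
  have "\<bar>\<phi>' (shift x) (?T x) - \<phi>' (shift z) (?T x)\<bar> \<le> D * max (w (shift x)) (w (shift z)) * norm (shift x - shift z) * norm (?T x)"
    using dl by (simp add: dlip_def)
  also have "\<dots> \<le> D * (exp (c * \<delta> * b) * ?m) * (exp (\<delta> * b) * ?n) * (exp (\<delta> * b) * norm v)"
    by (intro mult_mono mult_left_mono max_w_shift shift_lip dshift_le) (use D max_w_pos(2) in auto)
  also have "\<dots> = (D * exp ((c + 2) * (\<delta> * b))) * (?m * ?n * norm v)" unfolding e by (simp add: mult_ac)
  finally have 1: "\<bar>\<phi>' (shift x) (?T x) - \<phi>' (shift z) (?T x)\<bar> \<le> (D * exp ((c + 2) * (\<delta> * b))) * (?m * ?n * norm v)" .
  have wz: "w (shift z) \<le> exp (c * \<delta> * b) * ?m"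
    by (rule order_trans[OF w_shift]) (auto intro!: mult_left_mono)
  have eq: "\<phi>' (shift z) (?T x) - \<phi>' (shift z) (?T z) = \<phi>' (shift z) (\<delta> *\<^sub>R (dvel \<nu> z v - dvel \<nu> x v))"
    by (simp add: linear_diff[OF reg_linear[OF r], symmetric] algebra_simps)
  have "\<bar>\<phi>' (shift z) (\<delta> *\<^sub>R (dvel \<nu> z v - dvel \<nu> x v))\<bar> \<le> A * w (shift z) * norm (\<delta> *\<^sub>R (dvel \<nu> z v - dvel \<nu> x v))"
    by (rule reg_derivative_le[OF r])
  also have "\<dots> \<le> A * (exp (c * \<delta> * b) * ?m) * (\<delta> * (2 * c * c * mass \<nu> * ?n * norm v))"
  proof (intro mult_mono mult_left_mono wz)
    show "norm (\<delta> *\<^sub>R (dvel \<nu> z v - dvel \<nu> x v)) \<le> \<delta> * (2 * c * c * mass \<nu> * ?n * norm v)"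
      using mult_left_mono[OF dvel_lip[OF \<nu>, of z v x] \<delta>(1)] \<delta>(1) by (simp add: norm_minus_commute)
  qed (use A_nonneg max_w_pos(2) w_nonneg in auto)
  also have "\<dots> = (\<delta> * (A * (exp (c * \<delta> * b) * (2 * c * c * mass \<nu>)))) * (?m * ?n * norm v)" by (simp add: mult_ac)
  finally have 2: "\<bar>\<phi>' (shift z) (?T x) - \<phi>' (shift z) (?T z)\<bar> \<le> (\<delta> * (A * (exp (c * \<delta> * b) * (2 * c * c * mass \<nu>)))) * (?m * ?n * norm v)" unfolding eq .
  define t where "t = (c + 4 * c * Lq) * A * mass \<gamma>"
  have t0: "t \<ge> 0" using A_nonneg mass_nonneg[of \<gamma>] c_nonneg qregD(7)[OF q] by (simp add: t_def)
  have "\<bar>dLop q q' \<phi>' x v - dLop q q' \<phi>' z v\<bar> \<le> t * ?n * norm v" unfolding t_def by (rule dLop_lip[OF q r])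
  also have "\<dots> \<le> t * (?m * ?n * norm v)"
    using mult_right_mono[OF max_w_pos(1)[of x z], of "t * ?n * norm v"] t0 by (simp add: mult_ac)
  finally have "\<delta> * \<bar>dLop q q' \<phi>' x v - dLop q q' \<phi>' z v\<bar> \<le> \<delta> * (t * (?m * ?n * norm v))"
    by (rule mult_left_mono) (rule \<delta>)
  then have 3: "\<bar>\<delta> * dLop q q' \<phi>' x v - \<delta> * dLop q q' \<phi>' z v\<bar> \<le> \<delta> * t * (?m * ?n * norm v)"
    using \<delta>(1) by (simp add: right_diff_distrib[symmetric] abs_mult)
  have "\<bar>dstep x v - dstep z v\<bar> \<le> (D * exp ((c + 2) * (\<delta> * b))) * (?m * ?n * norm v)
     + (\<delta> * (A * (exp (c * \<delta> * b) * (2 * c * c * mass \<nu>)))) * (?m * ?n * norm v) + \<delta> * t * (?m * ?n * norm v)"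
    unfolding dstep_def using 1 2 3 by linarith
  then show "\<bar>dstep x v - dstep z v\<bar> \<le> (D * exp ((c + 2) * (\<delta> * b)) + \<delta> * (A * (exp (c * \<delta> * b) * (2 * c * c * mass \<nu>) + (c + 4 * c * Lq) * mass \<gamma>))) * ?m * ?n * norm v"
    by (simp add: t_def algebra_simps)
qed

lemma reg_step: "reg (A * exp ((c + 1) * (\<delta> * b)) + \<delta> * (cl * l2 \<phi>)) step dstep"
  by (rule regI[OF wlip_step step_has_derivative dlip_continuous[OF dlip_step]])

definition Cr where "Cr = D * exp (c * b) * b\<^sup>2"

lemma Cr_nonneg: "Cr \<ge> 0" using D by (simp add: Cr_def)

text \<open>The segment from \<open>x\<close> to its shift stays within distance \<open>b\<close>,
  as \<open>\<delta> \<le> 1\<close>, so the weight along it is at most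
  \<open>exp (c b) w x\<close>; this is the origin of \<open>Cr\<close>.\<close>

lemma taylor: "\<bar>\<phi> (shift x) - \<phi> x + \<delta> * \<phi>' x (vel \<nu> x)\<bar> \<le> \<delta>\<^sup>2 * Cr * w x"
proof -
  have d1: "\<delta> * b \<le> b" using \<delta> b_nonneg by (simp add: mult_left_le_one_le)
  have "norm (\<phi> (shift x) - \<phi> x - \<phi>' x (shift x - x)) \<le> (D * (exp (c * b) * w x)) * (norm (shift x - x))\<^sup>2"
  proof (rule quadratic_remainder)
    show "(\<phi> has_derivative \<phi>' z) (at z)" for z by (rule reg_has_derivative[OF r])
    show "0 \<le> D * (exp (c * b) * w x)" using D w_nonneg by simp
    fix z v assume z: "z \<in> closed_segment x (shift x)"
    have "norm (z - x) \<le> norm (shift x - x)" using segment_bound1[OF z] by (simp add: norm_minus_commute)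
    also have "\<dots> \<le> b" using shift_dist[of x] d1 by simp
    finally have zb: "c * norm (z - x) \<le> c * b" using c_nonneg by (rule mult_left_mono)
    have "w z \<le> exp (c * norm (z - x)) * w x" by (rule w_le_exp)
    also have "\<dots> \<le> exp (c * b) * w x" using zb w_nonneg by (intro mult_right_mono) auto
    finally have 1: "w z \<le> exp (c * b) * w x" .
    have "1 \<le> exp (c * b)" using c_nonneg b_nonneg by simp
    then have "1 * w x \<le> exp (c * b) * w x" by (rule mult_right_mono) (rule w_nonneg)
    with 1 have m: "max (w z) (w x) \<le> exp (c * b) * w x" by simp
    have "\<bar>\<phi>' z v - \<phi>' x v\<bar> \<le> D * max (w z) (w x) * norm (z - x) * norm v" using dl by (simp add: dlip_def)
    also have "\<dots> \<le> D * (exp (c * b) * w x) * norm (z - x) * norm v"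
      by (intro mult_right_mono mult_left_mono m D) auto
    finally show "norm (\<phi>' z v - \<phi>' x v) \<le> D * (exp (c * b) * w x) * norm (z - x) * norm v" by simp
  qed
  also have "\<dots> \<le> (D * (exp (c * b) * w x)) * (\<delta> * b)\<^sup>2"
    by (intro mult_left_mono power_mono shift_dist) (use D w_nonneg in auto)
  also have "\<dots> = \<delta>\<^sup>2 * Cr * w x" by (simp add: Cr_def power_mult_distrib mult_ac)
  also have "\<phi>' x (shift x - x) = - (\<delta> * \<phi>' x (vel \<nu> x))"
    by (simp add: shift_def linear_neg[OF reg_linear[OF r]] linear_scale[OF reg_linear[OF r]])
  finally show ?thesis by simp
qed

context
  fixes \<epsilon> assumes \<epsilon>: "\<And>x. norm (q x - grad V x) \<le> \<epsilon> * w x"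
begin

lemma Lop_eps: "\<bar>Lop q \<phi>' x - Lop (grad V) \<phi>' x\<bar> \<le> (\<epsilon> * (c * A * mass \<gamma>)) * w x"
  using order_trans[OF Lop_diff_le[OF q r, of x] mult_left_mono[OF \<epsilon>[of x], of "c * A * mass \<gamma>"]]
    c_nonneg A_nonneg mass_nonneg[of \<gamma>] by (simp add: mult_ac)

lemma wlip_grad_V': "wlip cq (grad V)"
  by (rule wlip_mono[OF wlip_grad_V]) (use cg_nonneg in \<open>simp add: cq_def\<close>)

text \<open>Up to Taylor and regularisation errors, a step replaces \<open>\<phi>\<close> by
  \<open>\<phi> - \<delta> \<phi>'(vel) + \<delta> L \<phi>\<close>. In the difference of the two
  integrals \<open>Lop_duality\<close> removes the transport term against \<open>\<gamma>\<close>.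
  The one against \<open>\<nu>\<close> is left over, to be compensated by the evolution of
  \<open>\<nu>\<close>.\<close>

lemma dual_step:
  "\<bar>((\<integral>x. step x \<partial>\<nu>) - (\<integral>x. step x \<partial>\<gamma>)) - ((\<integral>x. \<phi> x \<partial>\<nu>) - (\<integral>x. \<phi> x \<partial>\<gamma>) - \<delta> * (\<integral>x. \<phi>' x (vel \<nu> x) \<partial>\<nu>))\<bar>
    \<le> (mass \<nu> + mass \<gamma>) * (\<delta>\<^sup>2 * Cr + \<delta> * (\<epsilon> * (c * A * mass \<gamma>)))"
proof -
  have ms: "vel \<nu> \<in> borel_measurable borel"
    by (rule borel_measurable_continuous_onI, rule has_derivative_continuous_on, rule has_derivative_at_withinI,
        rule vel_has_derivative[OF \<nu>])
  have main: "\<bar>(\<integral>x. step x \<partial>\<mu>) - ((\<integral>x. \<phi> x \<partial>\<mu>) - \<delta> * (\<integral>x. \<phi>' x (vel \<nu> x) \<partial>\<mu>) + \<delta> * (\<integral>x. Lop (grad V) \<phi>' x \<partial>\<mu>))\<bar>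
      \<le> (\<delta>\<^sup>2 * Cr + \<delta> * (\<epsilon> * (c * A * mass \<gamma>))) * mass \<mu>" if \<mu>: "adm \<mu>" for \<mu>
  proof -
    have i1: "integrable \<mu> step" by (rule adm_integrable_wlip[OF \<mu> wlip_step])
    have i2: "integrable \<mu> \<phi>" by (rule adm_integrable_wlip[OF \<mu> reg_wlip[OF r]])
    have i3: "integrable \<mu> (Lop (grad V) \<phi>')" by (rule adm_integrable_wlip[OF \<mu> wlip_Lop[OF r wlip_grad_V']])
    have i4: "integrable \<mu> (\<lambda>x. \<phi>' x (vel \<nu> x))"
    proof (rule adm_integrable[OF \<mu>])
      show "(\<lambda>x. \<phi>' x (vel \<nu> x)) \<in> borel_measurable borel" by (rule reg_measurable_compose[OF r _ ms]) simp
      show "norm (\<phi>' x (vel \<nu> x)) \<le> (A * b) * w x" for x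
        using order_trans[OF reg_derivative_le[OF r] mult_left_mono[OF vel_le_b], of x x] A_nonneg w_nonneg[of x] by (simp add: mult_ac)
    qed
    have "(\<integral>x. step x \<partial>\<mu>) - ((\<integral>x. \<phi> x \<partial>\<mu>) - \<delta> * (\<integral>x. \<phi>' x (vel \<nu> x) \<partial>\<mu>) + \<delta> * (\<integral>x. Lop (grad V) \<phi>' x \<partial>\<mu>))
      = (\<integral>x. step x - (\<phi> x - \<delta> * \<phi>' x (vel \<nu> x) + \<delta> * Lop (grad V) \<phi>' x) \<partial>\<mu>)"
      using i1 i2 i3 i4 by simp
    also have "norm \<dots> \<le> (\<delta>\<^sup>2 * Cr + \<delta> * (\<epsilon> * (c * A * mass \<gamma>))) * mass \<mu>"
    proof (rule adm_integral_bound[OF \<mu>])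
      fix x
      have "step x - (\<phi> x - \<delta> * \<phi>' x (vel \<nu> x) + \<delta> * Lop (grad V) \<phi>' x)
        = (\<phi> (shift x) - \<phi> x + \<delta> * \<phi>' x (vel \<nu> x)) + \<delta> * (Lop q \<phi>' x - Lop (grad V) \<phi>' x)"
        by (simp add: step_def algebra_simps)
      also have "\<bar>\<dots>\<bar> \<le> \<delta>\<^sup>2 * Cr * w x + \<delta> * ((\<epsilon> * (c * A * mass \<gamma>)) * w x)"
      proof (rule order_trans[OF abs_triangle_ineq add_mono[OF taylor[of x]]])
        show "\<bar>\<delta> * (Lop q \<phi>' x - Lop (grad V) \<phi>' x)\<bar> \<le> \<delta> * ((\<epsilon> * (c * A * mass \<gamma>)) * w x)"
          using mult_left_mono[OF Lop_eps[of x] \<delta>(1)] \<delta>(1) by (simp add: abs_mult)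
      qed
      finally show "norm (step x - (\<phi> x - \<delta> * \<phi>' x (vel \<nu> x) + \<delta> * Lop (grad V) \<phi>' x)) \<le> (\<delta>\<^sup>2 * Cr + \<delta> * (\<epsilon> * (c * A * mass \<gamma>))) * w x"
        by (simp add: algebra_simps)
    qed
    finally show ?thesis by simp
  qed
  have l1: "(\<integral>x. Lop (grad V) \<phi>' x \<partial>\<nu>) = - (\<integral>x. \<phi>' x (vel \<nu> x) \<partial>\<gamma>)" by (rule Lop_duality[OF \<nu> r])
  have l2: "(\<integral>x. Lop (grad V) \<phi>' x \<partial>\<gamma>) = 0"
    using Lop_duality[OF adm_gibbs r] vel_gibbs linear_0[OF reg_linear[OF r]] by simp
  show ?thesis using main[OF \<nu>] main[OF adm_gibbs] unfolding l1 l2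
    by (simp add: abs_le_iff algebra_simps)
qed

definition Pc where "Pc = A * b + cl * (A * M2)"

text \<open>When the square is expanded, the transport term becomes the weighted divergence by
  \<open>energy_identity\<close>, and the term with \<open>L\<close> is nonpositive. Everything else
  is of order \<open>\<delta>^2\<close> or carries \<open>\<epsilon>\<close>.\<close>

lemma energy_step:
  "(l2 step)\<^sup>2 \<le> (1 + \<delta> * (ch * dst \<nu>)) * (l2 \<phi>)\<^sup>2
     + \<delta> * (\<epsilon> * (2 * A * (c * A * mass \<gamma>) * M2\<^sup>2)) + \<delta>\<^sup>2 * ((Pc\<^sup>2 + Cr\<^sup>2 + 2 * Cr * (A + Pc)) * M2\<^sup>2)"
proof -
  define p where "p x = \<phi>' x (vel \<nu> x)" for x
  define l where "l x = Lop q \<phi>' x" for x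
  define l0 where "l0 x = Lop (grad V) \<phi>' x" for x
  define rr where "rr x = \<phi> (shift x) - \<phi> x + \<delta> * p x" for x
  note [measurable] = reg_measurable[OF r]
  have ms: "vel \<nu> \<in> borel_measurable borel"
    by (rule borel_measurable_continuous_onI, rule has_derivative_continuous_on, rule has_derivative_at_withinI,
        rule vel_has_derivative[OF \<nu>])
  have [measurable]: "p \<in> borel_measurable borel" unfolding p_def[abs_def] by (rule reg_measurable_compose[OF r _ ms]) simp
  have wl: "wlip (cl * l2 \<phi>) l" unfolding l_def[abs_def] by (rule wlip_Lop[OF r qregD(6)[OF q]])
  have wl0: "wlip (cl * l2 \<phi>) l0" unfolding l0_def[abs_def] by (rule wlip_Lop[OF r wlip_grad_V'])
  have [measurable]: "l \<in> borel_measurable borel" "l0 \<in> borel_measurable borel"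
    using wlip_measurable[OF wl] wlip_measurable[OF wl0] .
  have pb: "\<bar>p x\<bar> \<le> (A * b) * w x" for x
    using order_trans[OF reg_derivative_le[OF r] mult_left_mono[OF vel_le_b], of x x] A_nonneg w_nonneg[of x]
    by (simp add: p_def mult_ac)
  have lb: "\<bar>l x\<bar> \<le> cl * (A * M2) * w x" for x
    using order_trans[OF wlip_le[OF wl, of x] mult_right_mono[OF mult_left_mono[OF l2_le[OF reg_wlip[OF r]] cl_nonneg] w_nonneg[of x]]]
    by simp
  have lpb: "\<bar>l x - p x\<bar> \<le> Pc * w x" for x
    using pb[of x] lb[of x] by (simp add: Pc_def distrib_right)
  have rb: "\<bar>rr x\<bar> \<le> \<delta>\<^sup>2 * Cr * w x" for x unfolding rr_def p_def by (rule taylor)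
  have fb: "\<bar>\<phi> x\<bar> \<le> A * w x" for x by (rule reg_le[OF r])
  have dw: "\<bar>l x - l0 x\<bar> \<le> \<epsilon> * (c * A * mass \<gamma>) * w x" for x unfolding l_def l0_def by (rule Lop_eps)
  have sq: "(step x)\<^sup>2 = (\<phi> x)\<^sup>2 - \<delta> * (2 * \<phi> x * p x) + 2 * \<delta> * (\<phi> x * l0 x) + 2 * \<delta> * (\<phi> x * (l x - l0 x))
      + (\<delta>\<^sup>2 * (l x - p x)\<^sup>2 + (rr x)\<^sup>2 + 2 * rr x * (\<phi> x + \<delta> * (l x - p x)))" for x
  proof -
    have s: "step x = \<phi> x + \<delta> * (l x - p x) + rr x" by (simp add: step_def l_def rr_def algebra_simps)
    show ?thesis unfolding s by (simp add: power2_eq_square algebra_simps)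
  qed
  have w2: "0 \<le> (w x)\<^sup>2" for x by simp
  have 1: "2 * \<delta> * (\<phi> x * (l x - l0 x)) \<le> \<delta> * (\<epsilon> * (2 * A * (c * A * mass \<gamma>))) * (w x)\<^sup>2" for x
  proof -
    have "\<phi> x * (l x - l0 x) \<le> \<bar>\<phi> x\<bar> * \<bar>l x - l0 x\<bar>" by (metis abs_ge_self abs_mult)
    also have "\<dots> \<le> (A * w x) * (\<epsilon> * (c * A * mass \<gamma>) * w x)"
      by (intro mult_mono fb dw) (use A_nonneg w_nonneg in auto)
    finally have "\<phi> x * (l x - l0 x) \<le> (A * w x) * (\<epsilon> * (c * A * mass \<gamma>) * w x)" .
    from mult_left_mono[OF this, of "2 * \<delta>"] show ?thesis using \<delta>(1) by (simp add: power2_eq_square mult_ac)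
  qed
  have 2: "\<delta>\<^sup>2 * (l x - p x)\<^sup>2 + (rr x)\<^sup>2 + 2 * rr x * (\<phi> x + \<delta> * (l x - p x))
      \<le> \<delta>\<^sup>2 * (Pc\<^sup>2 + Cr\<^sup>2 + 2 * Cr * (A + Pc)) * (w x)\<^sup>2" for x
  proof -
    have a: "(l x - p x)\<^sup>2 \<le> Pc\<^sup>2 * (w x)\<^sup>2"
      using power_mono[OF lpb[of x], of 2] by (simp add: power_mult_distrib)
    \<comment> \<open>The remainder is of order \<open>\<delta>^2\<close>; one power is given up so
      that its square has the same factor \<open>\<delta>^2\<close> as the other terms.\<close>
    have "\<delta>\<^sup>2 * Cr * w x \<le> \<delta> * Cr * w x"
    proof (intro mult_right_mono)
      show "\<delta>\<^sup>2 \<le> \<delta>" using \<delta> by (simp add: power2_eq_square mult_left_le)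
    qed (use Cr_nonneg w_nonneg in auto)
    then have "\<bar>rr x\<bar> \<le> \<delta> * Cr * w x" using rb[of x] by linarith
    from power_mono[OF this, of 2] have bb: "(rr x)\<^sup>2 \<le> \<delta>\<^sup>2 * (Cr\<^sup>2 * (w x)\<^sup>2)" by (simp add: power_mult_distrib mult_ac)
    have "\<delta> * \<bar>l x - p x\<bar> \<le> 1 * \<bar>l x - p x\<bar>" by (intro mult_right_mono \<delta>) simp
    then have "\<bar>\<phi> x + \<delta> * (l x - p x)\<bar> \<le> (A + Pc) * w x"
      using fb[of x] lpb[of x] abs_triangle_ineq[of "\<phi> x" "\<delta> * (l x - p x)"] \<delta>(1) by (simp add: abs_mult distrib_right)
    then have "\<bar>rr x\<bar> * \<bar>\<phi> x + \<delta> * (l x - p x)\<bar> \<le> (\<delta>\<^sup>2 * Cr * w x) * ((A + Pc) * w x)"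
      by (intro mult_mono rb) (use Cr_nonneg w_nonneg in auto)
    then have cc: "rr x * (\<phi> x + \<delta> * (l x - p x)) \<le> \<delta>\<^sup>2 * (Cr * (A + Pc) * (w x)\<^sup>2)"
      using abs_ge_self[of "rr x * (\<phi> x + \<delta> * (l x - p x))"] by (simp add: abs_mult power2_eq_square mult_ac)
    show ?thesis using mult_left_mono[OF a zero_le_power2[of \<delta>]] bb cc by (simp add: algebra_simps)
  qed
  have iw2: "integrable \<gamma> (\<lambda>x. (w x)\<^sup>2)" by (rule integrable_square[OF wlip_w])
  have if2: "integrable \<gamma> (\<lambda>x. (\<phi> x)\<^sup>2)" by (rule integrable_square[OF reg_wlip[OF r]])
  have ip: "integrable \<gamma> (\<lambda>x. 2 * \<phi> x * p x)"
  proof (rule integrable_gibbs[where B="2 * A * (A * b)" and k=2])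
    show "norm (2 * \<phi> x * p x) \<le> 2 * A * (A * b) * w x ^ 2" for x
      using mult_mono[OF fb[of x] pb[of x]] A_nonneg w_nonneg[of x] by (simp add: abs_mult power2_eq_square mult_ac)
  qed measurable
  have il: "integrable \<gamma> (\<lambda>x. \<phi> x * l0 x)"
  proof (rule integrable_gibbs[where B="A * (cl * l2 \<phi>)" and k=2])
    show "norm (\<phi> x * l0 x) \<le> A * (cl * l2 \<phi>) * w x ^ 2" for x
      using mult_mono[OF fb[of x] wlip_le[OF wl0, of x]] A_nonneg w_nonneg[of x] by (simp add: abs_mult power2_eq_square mult_ac)
  qed measurable
  let ?C1 = "\<delta> * (\<epsilon> * (2 * A * (c * A * mass \<gamma>)))" and ?C2 = "\<delta>\<^sup>2 * (Pc\<^sup>2 + Cr\<^sup>2 + 2 * Cr * (A + Pc))"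
  have "(l2 step)\<^sup>2 = (\<integral>x. (step x)\<^sup>2 \<partial>\<gamma>)" by (rule l2_square)
  also have "\<dots> \<le> (\<integral>x. (\<phi> x)\<^sup>2 - \<delta> * (2 * \<phi> x * p x) + 2 * \<delta> * (\<phi> x * l0 x) + ?C1 * (w x)\<^sup>2 + ?C2 * (w x)\<^sup>2 \<partial>\<gamma>)"
  proof (rule integral_mono[OF integrable_square[OF wlip_step]])
    show "integrable \<gamma> (\<lambda>x. (\<phi> x)\<^sup>2 - \<delta> * (2 * \<phi> x * p x) + 2 * \<delta> * (\<phi> x * l0 x) + ?C1 * (w x)\<^sup>2 + ?C2 * (w x)\<^sup>2)"
      by (intro Bochner_Integration.integrable_add Bochner_Integration.integrable_diff integrable_mult_right iw2 if2 ip il)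
    show "(step x)\<^sup>2 \<le> (\<phi> x)\<^sup>2 - \<delta> * (2 * \<phi> x * p x) + 2 * \<delta> * (\<phi> x * l0 x) + ?C1 * (w x)\<^sup>2 + ?C2 * (w x)\<^sup>2" for x
      unfolding sq using 1[of x] 2[of x] by linarith
  qed
  also have "\<dots> = (\<integral>x. (\<phi> x)\<^sup>2 \<partial>\<gamma>) - \<delta> * (\<integral>x. 2 * \<phi> x * p x \<partial>\<gamma>) + 2 * \<delta> * (\<integral>x. \<phi> x * l0 x \<partial>\<gamma>)
     + ?C1 * (\<integral>x. (w x)\<^sup>2 \<partial>\<gamma>) + ?C2 * (\<integral>x. (w x)\<^sup>2 \<partial>\<gamma>)"
    using integrable_mult_right[OF iw2, of ?C1] integrable_mult_right[OF iw2, of ?C2] if2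
      integrable_mult_right[OF ip, of \<delta>] integrable_mult_right[OF il, of "2 * \<delta>"]
    by (simp only: Bochner_Integration.integral_add Bochner_Integration.integral_diff integral_mult_right_zero
        Bochner_Integration.integrable_add Bochner_Integration.integrable_diff)
  also have "(\<integral>x. 2 * \<phi> x * p x \<partial>\<gamma>) = - (\<integral>x. (\<phi> x)\<^sup>2 * hst \<nu> x \<partial>\<gamma>)"
    unfolding p_def by (rule energy_identity[OF \<nu> r])
  finally have main: "(l2 step)\<^sup>2 \<le> (l2 \<phi>)\<^sup>2 + \<delta> * (\<integral>x. (\<phi> x)\<^sup>2 * hst \<nu> x \<partial>\<gamma>) + 2 * \<delta> * (\<integral>x. \<phi> x * l0 x \<partial>\<gamma>)
     + ?C1 * M2\<^sup>2 + ?C2 * M2\<^sup>2" by (simp add: l2_square M2_def)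
  have "(\<integral>x. (\<phi> x)\<^sup>2 * hst \<nu> x \<partial>\<gamma>) \<le> (ch * dst \<nu>) * (l2 \<phi>)\<^sup>2"
  proof -
    have "norm (\<integral>x. (\<phi> x)\<^sup>2 * hst \<nu> x \<partial>\<gamma>) \<le> (\<integral>x. (ch * dst \<nu>) * (\<phi> x)\<^sup>2 \<partial>\<gamma>)"
    proof (rule integral_norm_bound_ineq[OF integrable_mult_right[OF if2]])
      show "norm ((\<phi> x)\<^sup>2 * hst \<nu> x) \<le> ch * dst \<nu> * (\<phi> x)\<^sup>2" for x
        using mult_left_mono[OF hst_le[OF \<nu>, of x], of "(\<phi> x)\<^sup>2"] by (simp add: abs_mult mult_ac)
    qed
    then show ?thesis by (simp add: l2_square)
  qed
  from mult_left_mono[OF this \<delta>(1)]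
  have h: "\<delta> * (\<integral>x. (\<phi> x)\<^sup>2 * hst \<nu> x \<partial>\<gamma>) \<le> \<delta> * (ch * dst \<nu>) * (l2 \<phi>)\<^sup>2" by (simp add: mult.assoc)
  have n: "2 * \<delta> * (\<integral>x. \<phi> x * l0 x \<partial>\<gamma>) \<le> 0"
    using mult_left_mono[OF Lop_nonpos[OF r], of "2 * \<delta>"] \<delta>(1) by (simp add: l0_def)
  show ?thesis using main h n by (simp add: algebra_simps)
qed

end

end

end

end

section \<open>Approximation by test functions\<close>

text \<open>A clamp that is 1 up to radius \<open>R + 1\<close> and 0 beyond \<open>R + 2\<close>,
  smoothed at scale 1: hence 1 up to \<open>R\<close> and 0 beyond \<open>R + 3\<close>. The
  transition has fixed width, so that derivative bounds do not depend on \<open>R\<close>.\<close>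

definition cutoff :: "real \<Rightarrow> 'a::euclidean_space \<Rightarrow> real" where
  "cutoff R = conv (\<lambda>x. max 0 (min 1 (R + 2 - norm x))) (mollifier 1)"

lemma clamp_lipschitz: "\<bar>max 0 (min 1 (r - norm x)) - max 0 (min 1 (r - norm z))\<bar> \<le> norm (x - z)"
  using norm_triangle_ineq3[of x z] unfolding abs_le_iff max_def min_def by auto

lemma clamp_continuous: "continuous_on UNIV (\<lambda>x::'a::euclidean_space. max 0 (min 1 (r - norm x)))"
  by (intro continuous_intros)

lemma conv_diff_bound:
  fixes x z :: "'a::euclidean_space"
  assumes g: "locally_bdd g" and \<eta>: "test_function \<eta>"
    and b: "\<And>y. \<eta> y \<noteq> 0 \<Longrightarrow> \<bar>g (x - y) - g (z - y)\<bar> \<le> B" and B: "B \<ge> 0"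
  shows "\<bar>conv g \<eta> x - conv g \<eta> z\<bar> \<le> B * (\<integral>y. \<bar>\<eta> y\<bar> \<partial>lborel)"
proof -
  have "conv g \<eta> x - conv g \<eta> z = (\<integral>y. g (x - y) * \<eta> y - g (z - y) * \<eta> y \<partial>lborel)"
    using conv_reflect(2)[OF g \<eta>] by (simp add: conv_reflect(1)[OF g \<eta>])
  also have "norm \<dots> \<le> (\<integral>y. B * \<bar>\<eta> y\<bar> \<partial>lborel)"
  proof (rule integral_norm_bound_ineq)
    show "integrable lborel (\<lambda>y. B * \<bar>\<eta> y\<bar>)" using test_function_integrable[OF \<eta>] by simp
    show "norm (g (x - y) * \<eta> y - g (z - y) * \<eta> y) \<le> B * \<bar>\<eta> y\<bar>" for y
      using b[of y] by (cases "\<eta> y = 0") (auto simp: left_diff_distrib[symmetric] abs_mult intro: mult_right_mono)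
  qed
  finally show ?thesis by simp
qed

context
  fixes R :: real
begin

lemma locally_bdd_clamp: "locally_bdd (\<lambda>x::'a::euclidean_space. max 0 (min 1 (R + 2 - norm x)))"
  by (rule locally_bdd_continuous[OF clamp_continuous])

lemma smooth_cutoff: "smooth (cutoff R)"
  unfolding cutoff_def by (rule smooth_conv[OF locally_bdd_clamp test_function_mollifier]) simp

lemma cutoff_range: "0 \<le> cutoff R (x::'a::euclidean_space)" "cutoff R x \<le> 1"
proof -
  \<comment> \<open>The range \<open>[0, 1]\<close> is the ball of radius 1/2 around 1/2, the shape
    that \<open>conv_mollifier_bound\<close> asks for.\<close>
  have "\<bar>cutoff R x - 1/2\<bar> \<le> 1/2" unfolding cutoff_def
    by (rule conv_mollifier_bound[OF locally_bdd_clamp]) (auto simp: max_def min_def abs_if)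
  then show "0 \<le> cutoff R x" "cutoff R x \<le> 1" unfolding abs_le_iff by linarith+
qed

lemma cutoff_eq_1: assumes "norm x \<le> R" shows "cutoff R x = 1"
proof -
  have "\<bar>cutoff R x - 1\<bar> \<le> 0" unfolding cutoff_def
  proof (rule conv_mollifier_bound[OF locally_bdd_clamp])
    fix z :: 'a assume "norm z < 1"
    then have "norm (x - z) \<le> R + 1" using assms norm_triangle_ineq4[of x z] by simp
    then show "\<bar>max 0 (min 1 (R + 2 - norm (x - z))) - 1\<bar> \<le> 0" by simp
  qed simp
  then show ?thesis by simp
qed

lemma cutoff_eq_0: assumes "norm (x::'a::euclidean_space) > R + 3" shows "cutoff R x = 0"
  unfolding cutoff_def
  by (rule conv_eq_0[where R="R + 2" and r=1]) (use assms mollifier_eq_0[of 1, where 'a='a] in auto)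

lemma cutoff_lipschitz: "\<bar>cutoff R x - cutoff R z\<bar> \<le> norm (x - z)" for x :: "'a::euclidean_space"
proof -
  have "\<bar>cutoff R x - cutoff R z\<bar> \<le> norm (x - z) * (\<integral>y. \<bar>mollifier 1 y\<bar> \<partial>(lborel :: 'a measure))"
    unfolding cutoff_def
  proof (rule conv_diff_bound[OF locally_bdd_clamp test_function_mollifier])
    show "\<bar>max 0 (min 1 (R + 2 - norm (x - y))) - max 0 (min 1 (R + 2 - norm (z - y)))\<bar> \<le> norm (x - z)" for y
      using clamp_lipschitz[of "R + 2" "x - y" "z - y"] by simp
  qed simp_all
  then show ?thesis using integral_mollifier[of 1, where 'a='a] mollifier_nonneg[of 1, where 'a='a] by simp
qed

end

text \<open>The first bound comes from \<open>cutoff\<close> being 1-Lipschitz. For the second, the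
  derivative falls on the fixed mollifier of scale 1 while the clamp is 1-Lipschitz for every
  \<open>R\<close>; so \<open>L\<close> is obtained before \<open>R\<close>.\<close>

lemma cutoff_derivative_bounds:
  obtains L where "L \<ge> 1"
    "\<And>R (x::'a::euclidean_space) v. \<bar>frechet_derivative (cutoff R) (at x) v\<bar> \<le> L * norm v"
    "\<And>R (x::'a) z v. \<bar>frechet_derivative (cutoff R) (at x) v - frechet_derivative (cutoff R) (at z) v\<bar> \<le> L * norm (x - z) * norm v"
proof -
  let ?m = "mollifier 1 :: 'a \<Rightarrow> real"
  have m: "test_function ?m" by (rule test_function_mollifier) simp
  define N where "N b = (\<integral>y. \<bar>frechet_derivative ?m (at y) b\<bar> \<partial>lborel)" for b
  have N0: "N b \<ge> 0" for b unfolding N_def by (rule Bochner_Integration.integral_nonneg) simp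
  have d: "frechet_derivative (cutoff R) (at x) b = conv (\<lambda>x. max 0 (min 1 (R + 2 - norm x))) (\<lambda>x. frechet_derivative ?m (at x) b) x"
    for R and x b :: 'a
    unfolding cutoff_def by (rule frechet_derivative_eq[OF conv_has_derivative[OF locally_bdd_clamp m]])
  define L where "L = 1 + real DIM('a) * sum N Basis"
  have L1: "L \<ge> 1" using N0 by (simp add: L_def sum_nonneg)
  show ?thesis
  proof (rule that[OF L1])
    fix R and x v :: 'a
    have "norm (frechet_derivative (cutoff R) (at x) v) \<le> norm v"
    proof -
      have "((\<lambda>s. (cutoff R (x + s *\<^sub>R v) - cutoff R x) / s) \<longlongrightarrow> frechet_derivative (cutoff R) (at x) v) (at 0)"
        by (rule difference_quotient_tendsto[OF smooth_has_derivative[OF smooth_cutoff]])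
      from tendsto_norm[OF this] show ?thesis
      proof (rule tendsto_upperbound)
        show "\<forall>\<^sub>F s in at 0. norm ((cutoff R (x + s *\<^sub>R v) - cutoff R x) / s) \<le> norm v"
          unfolding eventually_at_filter
        proof (rule always_eventually, intro allI impI)
          fix s :: real assume "s \<noteq> 0"
          then show "norm ((cutoff R (x + s *\<^sub>R v) - cutoff R x) / s) \<le> norm v"
            using cutoff_lipschitz[of R "x + s *\<^sub>R v" x] by (simp add: abs_divide divide_le_eq mult.commute)
        qed
      qed simp
    qed
    also have "\<dots> \<le> L * norm v" using mult_right_mono[OF L1 norm_ge_zero[of v]] by simp
    finally show "\<bar>frechet_derivative (cutoff R) (at x) v\<bar> \<le> L * norm v" by simp
  next
    fix R and x z v :: 'a
    have "norm (frechet_derivative (cutoff R) (at x) b - frechet_derivative (cutoff R) (at z) b) \<le> sum N Basis * norm (x - z)"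
      if "b \<in> Basis" for b :: 'a
    proof -
      have "\<bar>frechet_derivative (cutoff R) (at x) b - frechet_derivative (cutoff R) (at z) b\<bar> \<le> norm (x - z) * N b"
        unfolding d N_def
      proof (rule conv_diff_bound[OF locally_bdd_clamp test_function_frechet[OF m]])
        show "\<bar>max 0 (min 1 (R + 2 - norm (x - y))) - max 0 (min 1 (R + 2 - norm (z - y)))\<bar> \<le> norm (x - z)" for y
          using clamp_lipschitz[of "R + 2" "x - y" "z - y"] by simp
      qed simp
      also have "\<dots> \<le> norm (x - z) * sum N Basis"
        by (intro mult_left_mono member_le_sum that N0) auto
      finally show ?thesis by (simp add: mult.commute)
    qed
    from frechet_derivative_diff_bound_basis[OF smooth_differentiable[OF smooth_cutoff] smooth_differentiable[OF smooth_cutoff] this]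
    have "norm (frechet_derivative (cutoff R) (at x) v - frechet_derivative (cutoff R) (at z) v)
       \<le> real DIM('a) * (sum N Basis * norm (x - z)) * norm v" .
    also have "\<dots> = real DIM('a) * sum N Basis * (norm (x - z) * norm v)" by simp
    also have "\<dots> \<le> L * (norm (x - z) * norm v)" by (intro mult_right_mono) (auto simp: L_def)
    finally show "\<bar>frechet_derivative (cutoff R) (at x) v - frechet_derivative (cutoff R) (at z) v\<bar> \<le> L * norm (x - z) * norm v"
      by (simp add: mult.assoc)
  qed
qed

text \<open>The derivative of \<open>g(y) \<eta>(x - y)\<close> in \<open>y\<close> integrates to 0,
  which moves the derivative from one factor to the other. Bounds on the mollified derivative then
  come from \<open>g'\<close>, without a loss depending on the scale of
  \<open>\<eta>\<close>.\<close>

lemma conv_derivative_swap: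
  assumes d: "\<And>y. (g has_derivative g' y) (at y)" and c: "continuous_on UNIV (\<lambda>y. g' y v)" and \<eta>: "test_function \<eta>"
  shows "conv g (\<lambda>x. frechet_derivative \<eta> (at x) v) x = conv (\<lambda>y. g' y v) \<eta> x"
proof -
  have cg: "continuous_on UNIV g" by (rule has_derivative_continuous_on, rule has_derivative_at_withinI, rule d)
  have s: "((\<lambda>y. x - y) has_derivative (\<lambda>v. - v)) (at y)" for y by (auto intro!: derivative_eq_intros)
  note sm = test_function_smooth[OF \<eta>]
  have n: "frechet_derivative \<eta> (at z) (- u) = - frechet_derivative \<eta> (at z) u" for z u
    by (rule linear_neg[OF linear_frechet_derivative[OF smooth_differentiable[OF sm]]])
  have i1: "integrable lborel (\<lambda>y. g' y v * \<eta> (x - y))" by (rule integrable_conv[OF locally_bdd_continuous[OF c] \<eta>])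
  have i2: "integrable lborel (\<lambda>y. g y * frechet_derivative \<eta> (at (x - y)) v)"
    by (rule integrable_conv[OF locally_bdd_continuous[OF cg] test_function_frechet[OF \<eta>]])
  have "(\<integral>y. g y * - frechet_derivative \<eta> (at (x - y)) v + g' y v * \<eta> (x - y) \<partial>lborel) = 0"
  proof (rule integral_directional_derivative_eq_0[where F="\<lambda>y. g y * \<eta> (x - y)"
        and F'="\<lambda>y v. g y * - frechet_derivative \<eta> (at (x - y)) v + g' y v * \<eta> (x - y)"])
    show "((\<lambda>y. g y * \<eta> (x - y)) has_derivative (\<lambda>v. g y * - frechet_derivative \<eta> (at (x - y)) v + g' y v * \<eta> (x - y))) (at y)" for y
      using has_derivative_mult[OF d has_derivative_compose[OF s smooth_has_derivative[OF sm]], of y] by (simp add: n)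
    show "integrable lborel (\<lambda>y. g y * \<eta> (x - y))" by (rule integrable_conv[OF locally_bdd_continuous[OF cg] \<eta>])
    show "integrable lborel (\<lambda>y. g y * - frechet_derivative \<eta> (at (x - y)) v + g' y v * \<eta> (x - y))"
      using i1 i2 by simp
    show "continuous_on UNIV (\<lambda>y. g y * - frechet_derivative \<eta> (at (x - y)) v + g' y v * \<eta> (x - y))"
      by (intro continuous_intros cg c continuous_on_compose2[OF smooth_continuous[OF sm, of UNIV]]
        continuous_on_compose2[OF smooth_continuous[OF smooth_frechet[OF sm], of UNIV]]) auto
  qed
  then show ?thesis using i1 i2 by (simp add: conv_def)
qed

section \<open>Approximation in the weighted Lipschitz class\<close>

context stein begin

text \<open>The mollifier reaches at most distance 1, where the weight changes by a factor of at
  most \<open>exp c\<close>; its mass 1 preserves the rest.\<close>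

lemma wlip_conv_mollifier:
  fixes g :: "'a \<Rightarrow> real"
  assumes g: "wlip A g" and e: "0 < \<epsilon>" "\<epsilon> \<le> 1"
  shows "wlip (exp c * A) (conv g (mollifier \<epsilon>))"
proof (rule wlipI)
  have A: "A \<ge> 0" by (rule wlip_nonneg[OF g])
  have lb: "locally_bdd g" by (rule locally_bdd_continuous[OF wlip_continuous[OF g]])
  have ww: "w (x - y) \<le> exp c * w x" if "norm y < \<epsilon>" for x y
  proof -
    have "c * norm ((x - y) - x) \<le> c * 1" using that e c_nonneg by (intro mult_left_mono) auto
    then have "exp (c * norm ((x - y) - x)) * w x \<le> exp c * w x" using w_nonneg by (intro mult_right_mono) auto
    then show ?thesis using w_le_exp[of "x - y" x] by simp
  qed
  show "norm (conv g (mollifier \<epsilon>) x) \<le> exp c * A * w x" for x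
  proof -
    have "\<bar>conv g (mollifier \<epsilon>) x - 0\<bar> \<le> A * (exp c * w x)"
    proof (rule conv_mollifier_bound[OF lb e(1)])
      fix z :: 'a assume z: "norm z < \<epsilon>"
      show "\<bar>g (x - z) - 0\<bar> \<le> A * (exp c * w x)"
        using order_trans[OF wlip_le[OF g] mult_left_mono[OF ww[OF z] A], of x] by simp
    qed
    then show ?thesis by (simp add: mult_ac)
  qed
  show "norm (conv g (mollifier \<epsilon>) x - conv g (mollifier \<epsilon>) z) \<le> exp c * A * max (w x) (w z) * norm (x - z)" for x z
  proof -
    have "\<bar>conv g (mollifier \<epsilon>) x - conv g (mollifier \<epsilon>) z\<bar> \<le> (A * (exp c * max (w x) (w z)) * norm (x - z)) * (\<integral>y. \<bar>mollifier \<epsilon> y\<bar> \<partial>(lborel :: 'a measure))"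
    proof (rule conv_diff_bound[OF lb test_function_mollifier[OF e(1)]])
      fix y :: 'a assume "mollifier \<epsilon> y \<noteq> 0"
      then have y: "norm y < \<epsilon>" using mollifier_eq_0[OF e(1), of y] by linarith
      have "max (w (x - y)) (w (z - y)) \<le> exp c * max (w x) (w z)"
        using ww[OF y, of x] ww[OF y, of z]
        by (meson max.bounded_iff max.cobounded1 max.cobounded2 mult_left_mono exp_ge_zero order_trans)
      then have "A * max (w (x - y)) (w (z - y)) * norm (x - z) \<le> A * (exp c * max (w x) (w z)) * norm (x - z)"
        using A by (intro mult_right_mono mult_left_mono) auto
      then show "\<bar>g (x - y) - g (z - y)\<bar> \<le> A * (exp c * max (w x) (w z)) * norm (x - z)"
        using wlip_diff_le[OF g, of "x - y" "z - y"] by simp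
    qed (use A max_w_pos(2) in simp)
    then show ?thesis
      using integral_mollifier[OF e(1), where 'a='a] mollifier_nonneg[OF e(1), where 'a='a] by (simp add: mult_ac)
  qed
qed

definition approx where
  "approx g n = conv (\<lambda>x. cutoff (real n) x * g x) (mollifier (1 / real (Suc n)))" for g :: "'a \<Rightarrow> real"

context
  fixes g :: "'a \<Rightarrow> real" and A assumes g: "wlip A g"
begin

lemma wlip_cutoff: "wlip (2 * A) (\<lambda>x. cutoff R x * g x)"
  using wlip_bilinear[OF bounded_bilinear_mult _ g, of "cutoff R" 1] cutoff_range[of R, where 'a='a] cutoff_lipschitz[of R, where 'a='a]
  by (simp add: abs_mult mult.commute[of "cutoff _ _"])

lemma test_function_approx: "test_function (approx g n)"
proof (rule test_functionI)
  show "smooth (approx g n)" unfolding approx_def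
    by (rule smooth_conv[OF locally_bdd_continuous[OF wlip_continuous[OF wlip_cutoff]] test_function_mollifier]) simp
  fix x :: 'a assume x: "norm x > real n + 3 + 1"
  show "approx g n x = 0" unfolding approx_def
  proof (rule conv_eq_0[OF _ _ x])
    show "cutoff (real n) y * g y = 0" if "norm y > real n + 3" for y using cutoff_eq_0[OF that] by simp
    show "mollifier (1 / real (Suc n)) y = 0" if "norm y > 1" for y :: 'a
    proof (rule mollifier_eq_0)
      have "1 / real (Suc n) \<le> 1" by simp
      then show "1 / real (Suc n) \<le> norm y" using that by linarith
    qed simp
  qed
qed

lemma wlip_approx: "wlip (2 * exp c * A) (approx g n)"
  unfolding approx_def using wlip_conv_mollifier[OF wlip_cutoff, of "1 / real (Suc n)"] by (simp add: mult_ac)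

end

text \<open>Once \<open>n\<close> is at least \<open>|x| + 2\<close>, the mollifier sees only points
  where \<open>f n\<close> and \<open>g\<close> agree, so the convergence is that of the
  mollification of \<open>g\<close>.\<close>

lemma conv_cutoff_tendsto:
  fixes g :: "'a \<Rightarrow> real"
  assumes cont: "continuous_on UNIV g" "\<And>n. continuous_on UNIV (f n)"
    and eq: "\<And>n x. norm x < real n \<Longrightarrow> f n x = g x"
  shows "(\<lambda>n. conv (f n) (mollifier (1 / real (Suc n))) x) \<longlonglongrightarrow> g x"
proof -
  obtain N :: nat where N: "norm x + 2 \<le> real N" using real_arch_simple by blast
  have "conv (f n) (mollifier (1 / real (Suc n))) x = conv g (mollifier (1 / real (Suc n))) x" if n: "n \<ge> N" for n
    unfolding conv_def
  proof (rule Bochner_Integration.integral_cong[OF refl])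
    fix y
    show "f n y * mollifier (1 / real (Suc n)) (x - y) = g y * mollifier (1 / real (Suc n)) (x - y)"
    proof (cases "norm (x - y) < 1")
      case True
      then have "norm y < real n" using N n norm_triangle_ineq2[of y x] by (simp add: norm_minus_commute)
      then show ?thesis using eq by simp
    next
      case False
      have "1 / real (Suc n) \<le> 1" by simp
      then have "1 / real (Suc n) \<le> norm (x - y)" using False by linarith
      then have "mollifier (1 / real (Suc n)) (x - y) = 0" by (intro mollifier_eq_0) auto
      then show ?thesis by simp
    qed
  qed
  then have "\<forall>\<^sub>F n in sequentially. conv g (mollifier (1 / real (Suc n))) x = conv (f n) (mollifier (1 / real (Suc n))) x"
    unfolding eventually_sequentially by metis
  from Lim_transform_eventually[OF conv_mollifier_tendsto[OF cont(1)] this] show ?thesis .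
qed

lemma approx_tendsto:
  assumes g: "wlip A g" shows "(\<lambda>n. approx g n x) \<longlonglongrightarrow> g x"
  unfolding approx_def
  by (rule conv_cutoff_tendsto[OF wlip_continuous[OF g] wlip_continuous[OF wlip_cutoff[OF g]]]) (simp add: cutoff_eq_1)

lemma wlip_derivative:
  assumes "reg A \<phi> \<phi>'" "dlip D \<phi>'" "A \<le> D" shows "wlip (D * norm v) (\<lambda>x. \<phi>' x v)"
proof (rule wlipI)
  show "norm (\<phi>' x v) \<le> D * norm v * w x" for x
    using order_trans[OF reg_derivative_le[OF assms(1), of x v], of "D * w x * norm v"] assms(3) w_nonneg[of x]
    by (simp add: mult_right_mono mult_ac)
  show "norm (\<phi>' x v - \<phi>' z v) \<le> D * norm v * max (w x) (w z) * norm (x - z)" for x z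
    using assms(2) by (simp add: dlip_def mult_ac)
qed

text \<open>\<open>ca\<close> comes from \<open>c\<close> and the cutoff bounds and is obtained
  before \<open>\<phi>\<close> and \<open>n\<close>. The gradients of the approximants are thus
  Lipschitz uniformly in \<open>n\<close> while they converge pointwise, which is enough to pass to
  the limit in the estimate of one time step.\<close>

lemma approx_C11:
  obtains ca where "ca \<ge> 0"
    "\<And>A D \<phi> \<phi>' n. reg A \<phi> \<phi>' \<Longrightarrow> dlip D \<phi>' \<Longrightarrow> A \<le> D \<Longrightarrow> dlip (ca * D) (\<lambda>x. frechet_derivative (approx \<phi> n) (at x))"
    "\<And>A D \<phi> \<phi>' x v. reg A \<phi> \<phi>' \<Longrightarrow> dlip D \<phi>' \<Longrightarrow> A \<le> D \<Longrightarrow> (\<lambda>n. frechet_derivative (approx \<phi> n) (at x) v) \<longlonglongrightarrow> \<phi>' x v"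
proof -
  obtain L where L: "L \<ge> 1"
    "\<And>R (x::'a) v. \<bar>frechet_derivative (cutoff R) (at x) v\<bar> \<le> L * norm v"
    "\<And>R (x::'a) z v. \<bar>frechet_derivative (cutoff R) (at x) v - frechet_derivative (cutoff R) (at z) v\<bar> \<le> L * norm (x - z) * norm v"
    by (rule cutoff_derivative_bounds[where 'a='a]) blast
  define G where "G \<phi> \<phi>' R x v = cutoff R x * \<phi>' x v + frechet_derivative (cutoff R) (at x) v * \<phi> x" for \<phi> \<phi>' R and x v :: 'a
  have G: "wlip ((2 + 2 * L) * D * norm v) (\<lambda>x. G \<phi> \<phi>' R x v)"
    and dG: "((\<lambda>x. cutoff R x * \<phi> x) has_derivative G \<phi> \<phi>' R x) (at x)"
    if r: "reg A \<phi> \<phi>'" and d: "dlip D \<phi>'" and AD: "A \<le> D" for A D \<phi> \<phi>' R x v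
  proof -
    have 1: "wlip (2 * (D * norm v)) (\<lambda>x. cutoff R x * \<phi>' x v)"
      by (rule wlip_cutoff[OF wlip_derivative[OF r d AD]])
    have "wlip (2 * A * (L * norm v)) (\<lambda>x. \<phi> x * frechet_derivative (cutoff R) (at x) v)"
      by (rule wlip_bilinear[OF bounded_bilinear_mult _ reg_wlip[OF r]])
         (use L in \<open>auto simp: abs_mult mult_ac\<close>)
    then have 2: "wlip (2 * D * (L * norm v)) (\<lambda>x. frechet_derivative (cutoff R) (at x) v * \<phi> x)"
      unfolding mult.commute[of "frechet_derivative _ _ _"]
      by (rule wlip_mono) (use AD L(1) in \<open>auto intro!: mult_right_mono\<close>)
    show "wlip ((2 + 2 * L) * D * norm v) (\<lambda>x. G \<phi> \<phi>' R x v)"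
      using wlip_add[OF 1 2] by (simp add: G_def algebra_simps)
    show "((\<lambda>x. cutoff R x * \<phi> x) has_derivative G \<phi> \<phi>' R x) (at x)" unfolding G_def[abs_def]
      by (rule has_derivative_mult[OF smooth_has_derivative[OF smooth_cutoff] reg_has_derivative[OF r]])
  qed
  have fd: "frechet_derivative (approx \<phi> n) (at x) v = conv (\<lambda>y. G \<phi> \<phi>' (real n) y v) (mollifier (1 / real (Suc n))) x"
    if r: "reg A \<phi> \<phi>'" and d: "dlip D \<phi>'" and AD: "A \<le> D" for A D \<phi> \<phi>' n x v
  proof -
    have t: "test_function (mollifier (1 / real (Suc n)) :: 'a \<Rightarrow> real)" by (rule test_function_mollifier) simp
    have "frechet_derivative (approx \<phi> n) (at x) v =
      conv (\<lambda>x. cutoff (real n) x * \<phi> x) (\<lambda>x. frechet_derivative (mollifier (1 / real (Suc n))) (at x) v) x"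
      unfolding approx_def
      by (rule frechet_derivative_eq[OF conv_has_derivative[OF locally_bdd_continuous[OF wlip_continuous[OF wlip_cutoff[OF reg_wlip[OF r]]]] t]])
    also have "\<dots> = conv (\<lambda>y. G \<phi> \<phi>' (real n) y v) (mollifier (1 / real (Suc n))) x"
      by (rule conv_derivative_swap[OF dG[OF r d AD] wlip_continuous[OF G[OF r d AD]] t])
    finally show ?thesis .
  qed
  show ?thesis
  proof (rule that[of "exp c * (2 + 2 * L)"])
    show "exp c * (2 + 2 * L) \<ge> 0" using L(1) by simp
    fix A D \<phi> \<phi>'
    assume r: "reg A \<phi> \<phi>'" and d: "dlip D \<phi>'" and AD: "A \<le> D"
    show "dlip (exp c * (2 + 2 * L) * D) (\<lambda>x. frechet_derivative (approx \<phi> n) (at x))" for n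
      unfolding dlip_def
    proof (intro allI)
      fix x z v
      have "wlip (exp c * ((2 + 2 * L) * D * norm v)) (\<lambda>x. frechet_derivative (approx \<phi> n) (at x) v)"
        unfolding fd[OF r d AD] by (rule wlip_conv_mollifier[OF G[OF r d AD]]) auto
      from wlip_diff_le[OF this, of x z]
      show "\<bar>frechet_derivative (approx \<phi> n) (at x) v - frechet_derivative (approx \<phi> n) (at z) v\<bar>
        \<le> exp c * (2 + 2 * L) * D * max (w x) (w z) * norm (x - z) * norm v" by (simp add: mult_ac)
    qed
    show "(\<lambda>n. frechet_derivative (approx \<phi> n) (at x) v) \<longlonglongrightarrow> \<phi>' x v" for x v
      unfolding fd[OF r d AD]
    proof (rule conv_cutoff_tendsto)
      show "continuous_on UNIV (\<lambda>x. \<phi>' x v)" by (rule dlip_continuous[OF d])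
      show "continuous_on UNIV (\<lambda>y. G \<phi> \<phi>' (real n) y v)" for n by (rule wlip_continuous[OF G[OF r d AD]])
      fix n :: nat and x :: 'a assume x: "norm x < real n"
      have "frechet_derivative (cutoff (real n)) (at x) v = 0"
      proof (rule frechet_derivative_eq)
        have "((\<lambda>x. 1) has_derivative (\<lambda>v. 0)) (at x)" by simp
        then show "(cutoff (real n) has_derivative (\<lambda>v. 0)) (at x)"
          by (rule has_derivative_transform_within_open[of _ _ x UNIV "ball 0 (real n)"]) (use x in \<open>auto simp: cutoff_eq_1\<close>)
      qed
      then show "G \<phi> \<phi>' (real n) x v = \<phi>' x v" using x by (simp add: G_def cutoff_eq_1)
    qed
  qed
qed

text \<open>\<open>grad V\<close> is cut off at a radius beyond which it is at most
  \<open>\<epsilon> w\<close>, so removing it there costs no more than that. The cut field is a test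
  function, hence as regular as required.\<close>

lemma qreg_exists:
  assumes "\<epsilon> > 0"
  obtains Lq q q' where "qreg Lq q q'" "\<And>x. norm (q x - grad V x) \<le> \<epsilon> * w x"
proof -
  obtain R where R: "R \<ge> 1" "\<And>x. norm x > R \<Longrightarrow> norm (grad V x) \<le> \<epsilon> * w x"
    by (rule grad_V_sublinear[OF assms]) blast
  define q where "q x = cutoff R x *\<^sub>R grad V x" for x
  have t: "test_function q"
  proof (rule test_functionI[of _ "R + 3"])
    show "smooth q" unfolding q_def[abs_def] by (intro smooth_scaleR smooth_cutoff grad_smooth V_smooth)
    show "q x = 0" if "norm x > R + 3" for x using cutoff_eq_0[OF that] by (simp add: q_def)
  qed
  obtain L where L: "L \<ge> 0" "\<And>x. norm (q x) \<le> L" "\<And>x v. norm (frechet_derivative q (at x) v) \<le> L * norm v"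
    "\<And>x z. norm (q x - q z) \<le> L * norm (x - z)"
    "\<And>x z v. norm (frechet_derivative q (at x) v - frechet_derivative q (at z) v) \<le> L * norm (x - z) * norm v"
    by (rule test_function_C11[OF t]) blast
  have "wlip (2 * cg * 1) q" unfolding q_def[abs_def]
    by (rule wlip_bilinear[OF bounded_bilinear.flip[OF bounded_bilinear_scaleR] _ wlip_grad_V])
       (use cutoff_range[of R, where 'a='a] cutoff_lipschitz[of R, where 'a='a] in auto)
  then have "qreg L q (\<lambda>x. frechet_derivative q (at x))"
    using L smooth_has_derivative[OF test_function_smooth[OF t]] by (simp add: qreg_def cq_def)
  moreover have "norm (q x - grad V x) \<le> \<epsilon> * w x" for x
  proof (cases "norm x > R")
    case True
    have "q x - grad V x = - ((1 - cutoff R x) *\<^sub>R grad V x)" by (simp add: q_def algebra_simps)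
    then have "norm (q x - grad V x) = \<bar>1 - cutoff R x\<bar> * norm (grad V x)" by (simp only: norm_minus_cancel norm_scaleR)
    also have "\<dots> \<le> 1 * norm (grad V x)"
      using cutoff_range[of R x] by (intro mult_right_mono) auto
    finally show ?thesis using R(2)[OF True] by simp
  next
    case False
    then show ?thesis using assms w_nonneg[of x] by (simp add: q_def cutoff_eq_1)
  qed
  ultimately show ?thesis by (rule that)
qed

end

section \<open>Measure solutions\<close>

text \<open>The parameter in the integrand is absorbed by pushing \<open>L x\<close> forward under
  \<open>\<lambda>y. (x, y)\<close>; this leaves a fixed integrand on the product space and a
  measurable family of measures.\<close>

lemma integral_kernel_measurable:
  fixes f :: "'a \<Rightarrow> 'b \<Rightarrow> 'c::{banach, second_countable_topology}"
  assumes f[measurable]: "case_prod f \<in> borel_measurable (M \<Otimes>\<^sub>M N)"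
    and L[measurable]: "L \<in> measurable M (subprob_algebra N)"
  shows "(\<lambda>x. integral\<^sup>L (L x) (f x)) \<in> borel_measurable M"
proof -
  note measurable_distr2[measurable]
  have "(\<lambda>x. integral\<^sup>L (distr (L x) (M \<Otimes>\<^sub>M N) (\<lambda>y. (x, y))) (case_prod f)) \<in> borel_measurable M"
    by (rule measurable_compose[OF _ integral_measurable_subprob_algebra[OF f]]) measurable
  then show ?thesis
  proof (rule measurable_cong[THEN iffD1, rotated])
    fix x assume x: "x \<in> space M"
    have s: "sets (L x) = sets N" using measurable_space[OF L x] by (simp add: space_subprob_algebra)
    show "integral\<^sup>L (distr (L x) (M \<Otimes>\<^sub>M N) (\<lambda>y. (x, y))) (case_prod f) = integral\<^sup>L (L x) (f x)"
      using x measurable_cong_sets[OF s refl] by (subst integral_distr) (auto intro: f)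
  qed
qed

lemma test_function_product:
  fixes \<eta> :: "real \<Rightarrow> real" and f :: "'a::euclidean_space \<Rightarrow> real"
  assumes \<eta>: "test_function \<eta>" and f: "test_function f"
  shows "test_function (\<lambda>p. \<eta> (fst p) * f (snd p))"
proof -
  obtain R1 where R1: "R1 > 0" "\<And>x. norm x > R1 \<Longrightarrow> \<eta> x = 0" by (rule test_function_support[OF \<eta>]) blast
  obtain R2 where R2: "R2 > 0" "\<And>x. norm x > R2 \<Longrightarrow> f x = 0" by (rule test_function_support[OF f]) blast
  show ?thesis
  proof (rule test_functionI)
    have "smooth (\<lambda>p::real \<times> 'a. \<eta> (0 + fst p))" by (rule smooth_affine[OF bounded_linear_fst test_function_smooth[OF \<eta>]])
    moreover have "smooth (\<lambda>p::real \<times> 'a. f (0 + snd p))" by (rule smooth_affine[OF bounded_linear_snd test_function_smooth[OF f]])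
    ultimately show "smooth (\<lambda>p. \<eta> (fst p) * f (snd p))" by (simp add: smooth_mult)
    fix p :: "real \<times> 'a" assume p: "norm p > R1 + R2"
    have "norm p \<le> norm (fst p) + norm (snd p)"
      using norm_Pair_le[of "fst p" "snd p"] by simp
    then have "norm (fst p) > R1 \<or> norm (snd p) > R2" using p by linarith
    then show "\<eta> (fst p) * f (snd p) = 0" using R1 R2 by auto
  qed
qed

lemma closed_indicator_limit:
  assumes A: "closed A" "A \<noteq> {}"
  shows "(\<lambda>n. max 0 (1 - real n * infdist x A)) \<longlonglongrightarrow> indicator A x"
proof (cases "x \<in> A")
  case False
  then have d: "infdist x A > 0" using A in_closed_iff_infdist_zero[of A x] infdist_nonneg[of x A] by simp
  obtain N :: nat where N: "1 / infdist x A \<le> real N" using real_arch_simple by blast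
  have "max 0 (1 - real n * infdist x A) = 0" if "n \<ge> N" for n
  proof -
    have "1 / infdist x A \<le> real n" using N that by linarith
    then show ?thesis using d by (simp add: divide_le_eq)
  qed
  then have "\<forall>\<^sub>F n in sequentially. max 0 (1 - real n * infdist x A) = 0" unfolding eventually_sequentially by blast
  then show ?thesis using False by (simp add: tendsto_eventually)
qed simp

context stein begin

lemma test_function_reg:
  assumes f: "test_function (f :: 'a \<Rightarrow> real)"
  obtains A where "reg A f (\<lambda>x. frechet_derivative f (at x))" "dlip A (\<lambda>x. frechet_derivative f (at x))"
proof -
  obtain L where L: "L \<ge> 0" "\<And>x. norm (f x) \<le> L" "\<And>x v. norm (frechet_derivative f (at x) v) \<le> L * norm v"
    "\<And>x z. norm (f x - f z) \<le> L * norm (x - z)"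
    "\<And>x z v. norm (frechet_derivative f (at x) v - frechet_derivative f (at z) v) \<le> L * norm (x - z) * norm v"
    by (rule test_function_C11[OF f]) blast
  have dl: "dlip L (\<lambda>x. frechet_derivative f (at x))" unfolding dlip_def
  proof (intro allI)
    fix x z v :: 'a
    have "L * norm (x - z) * norm v \<le> max (w x) (w z) * (L * norm (x - z) * norm v)"
      using mult_right_mono[OF max_w_pos(1)[of x z], of "L * norm (x - z) * norm v"] L(1) by simp
    then show "\<bar>frechet_derivative f (at x) v - frechet_derivative f (at z) v\<bar> \<le> L * max (w x) (w z) * norm (x - z) * norm v"
      using L(5)[of x v z] by (simp add: mult_ac)
  qed
  have "reg L f (\<lambda>x. frechet_derivative f (at x))"
    by (rule regI[OF wlip_lipschitz[OF L(2,4)] smooth_has_derivative[OF test_function_smooth[OF f]] dlip_continuous[OF dl]])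
  then show ?thesis using dl by (rule that)
qed

lemma reg_test_function:
  assumes f: "test_function f" and A: "wlip A f" shows "reg A f (\<lambda>x. frechet_derivative f (at x))"
proof -
  obtain B where B: "reg B f (\<lambda>x. frechet_derivative f (at x))" "dlip B (\<lambda>x. frechet_derivative f (at x))"
    by (rule test_function_reg[OF f])
  show ?thesis by (rule regI[OF A reg_has_derivative[OF B(1)] dlip_continuous[OF B(2)]])
qed

end

section \<open>A solution as a measurable family of measures\<close>

locale stein_flow = stein V K K2 c for V :: "'a::euclidean_space \<Rightarrow> real" and K K2 c +
  fixes \<rho> :: "real \<Rightarrow> 'a measure"
  assumes sol: "measure_solution K V \<rho>"
begin

text \<open>Constant extension to negative times, so that convolution in time makes sense on the
  whole line.\<close>

definition rt where "rt s = \<rho> (max 0 s)"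

lemma prob_rho: "t \<ge> 0 \<Longrightarrow> prob_space (\<rho> t)" and sets_rho: "t \<ge> 0 \<Longrightarrow> sets (\<rho> t) = sets borel"
  using sol by (auto simp: measure_solution_def)

lemma mass_rho:
  assumes "T > 0"
  obtains m where "m \<ge> 1" "\<And>t. 0 \<le> t \<Longrightarrow> t \<le> T \<Longrightarrow> adm (\<rho> t)" "\<And>t. 0 \<le> t \<Longrightarrow> t \<le> T \<Longrightarrow> mass (\<rho> t) \<le> m"
proof -
  have fin: "(SUP t\<in>{0..T}. \<integral>\<^sup>+ x. ennreal (1 + V x) \<partial>\<rho> t) < \<infinity>"
    using sol assms by (simp add: measure_solution_def)
  then obtain M where M: "M \<ge> 0" "(SUP t\<in>{0..T}. \<integral>\<^sup>+ x. ennreal (1 + V x) \<partial>\<rho> t) = ennreal M"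
    by (cases "SUP t\<in>{0..T}. \<integral>\<^sup>+ x. ennreal (1 + V x) \<partial>\<rho> t") auto
  have le: "(\<integral>\<^sup>+ x. ennreal (w x) \<partial>\<rho> t) \<le> ennreal M" if "0 \<le> t" "t \<le> T" for t
    unfolding M(2)[symmetric] w_def by (rule SUP_upper) (use that in auto)
  have i: "integrable (\<rho> t) w" if t: "0 \<le> t" "t \<le> T" for t
  proof (rule integrableI_nonneg)
    show "w \<in> borel_measurable (\<rho> t)" by (subst measurable_cong_sets[OF sets_rho[OF t(1)] refl]) simp
    show "(\<integral>\<^sup>+ x. ennreal (w x) \<partial>\<rho> t) < \<infinity>" using le[OF t] by (rule le_less_trans) simp
  qed (simp add: w_nonneg)
  show ?thesis
  proof (rule that[of "max 1 M"])
    fix t assume t: "0 \<le> t" "t \<le> T"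
    show "adm (\<rho> t)" unfolding adm_def using prob_rho[OF t(1)] sets_rho[OF t(1)] i[OF t] by simp
    have "ennreal (mass (\<rho> t)) \<le> ennreal M"
      using le[OF t] nn_integral_eq_integral[OF i[OF t]] by (simp add: mass_def w_nonneg)
    then show "mass (\<rho> t) \<le> max 1 M" using M(1) by (simp add: ennreal_le_iff)
  qed simp
qed

lemma adm_rho: "t \<ge> 0 \<Longrightarrow> adm (\<rho> t)"
  by (rule mass_rho[of "t + 1"]) auto

lemma adm_rt: "adm (rt s)" by (simp add: rt_def adm_rho)

lemma rt_continuous:
  fixes f :: "'a \<Rightarrow> real"
  assumes "continuous_on UNIV f" "bounded (range f)"
  shows "continuous_on UNIV (\<lambda>s. \<integral>x. f x \<partial>rt s)"
proof -
  have c: "continuous_on {0..} (\<lambda>t. \<integral>x. f x \<partial>\<rho> t)"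
    using sol assms by (auto simp: measure_solution_def narrowly_continuous_def)
  show ?thesis unfolding rt_def
    by (rule continuous_on_compose2[OF c]) (auto intro!: continuous_intros)
qed

text \<open>Closed sets generate the Borel sets, and their indicators are limits of bounded
  continuous functions, whose integrals depend continuously on time. Joint measurability of the
  velocity and measurability of \<open>J\<close> rest on this.\<close>

lemma rt_measurable [measurable]: "rt \<in> borel \<rightarrow>\<^sub>M subprob_algebra borel"
proof (rule measurable_prob_algebraD, rule measurable_prob_algebra_generated[where G="Collect closed" and \<Omega>=UNIV])
  show "sets (borel :: 'a measure) = sigma_sets UNIV (Collect closed)"
    by (subst borel_eq_closed) simp
  show "Int_stable (Collect closed :: 'a set set)" by (auto simp: Int_stable_def)
  show "prob_space (rt a)" "sets (rt a) = sets borel" for a using adm_rt by (auto simp: adm_def)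
  fix A :: "'a set" assume "A \<in> Collect closed"
  then have A: "closed A" by simp
  show "(\<lambda>a. emeasure (rt a) A) \<in> borel_measurable borel"
  proof (cases "A = {}")
    case False
    define h where "h n x = max 0 (1 - real n * infdist x A)" for n x
    have hc: "continuous_on UNIV (h n)" for n unfolding h_def by (intro continuous_intros)
    have hb: "\<bar>h n x\<bar> \<le> 1" for n x unfolding h_def using infdist_nonneg[of x A] by auto
    then have "bounded (range (h n))" for n by (auto simp: bounded_iff)
    then have m: "(\<lambda>s. \<integral>x. h n x \<partial>rt s) \<in> borel_measurable borel" for n
      by (intro borel_measurable_continuous_onI rt_continuous hc)
    have lim: "(\<lambda>n. \<integral>x. h n x \<partial>rt s) \<longlonglongrightarrow> measure (rt s) A" for s
    proof -
      have st: "sets (rt s) = sets borel" and ps: "prob_space (rt s)" using adm_rt by (auto simp: adm_def)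
      interpret prob_space "rt s" by (rule ps)
      have As: "A \<in> sets (rt s)" using A st by simp
      have "(\<lambda>n. \<integral>x. h n x \<partial>rt s) \<longlonglongrightarrow> (\<integral>x. indicator A x \<partial>rt s)"
      proof (rule integral_dominated_convergence[where w="\<lambda>_. 1"])
        show "AE x in rt s. (\<lambda>n. h n x) \<longlonglongrightarrow> indicator A x" unfolding h_def
          by (intro AE_I2 closed_indicator_limit A False)
        show "h n \<in> borel_measurable (rt s)" for n
          using borel_measurable_continuous_onI[OF hc] measurable_cong_sets[OF st refl] by blast
      qed (use As hb in auto)
      then show ?thesis using As by simp
    qed
    have "(\<lambda>s. measure (rt s) A) \<in> borel_measurable borel"
      by (rule borel_measurable_LIMSEQ_metric[OF m lim])
    moreover have "emeasure (rt s) A = ennreal (measure (rt s) A)" for s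
    proof -
      interpret prob_space "rt s" using adm_rt by (simp add: adm_def)
      show ?thesis by (rule emeasure_eq_measure)
    qed
    ultimately show ?thesis by simp
  qed simp
qed auto

text \<open>By the weak equation, minus the time derivative of the integral of \<open>f\<close>,
  when \<open>f'\<close> is the derivative of \<open>f\<close>. Only measurability and local
  boundedness in time are at hand, hence the detour through mollified time.\<close>

definition J where "J f' s = (\<integral>x. f' x (vel (rt s) x) \<partial>rt s)"

lemma vel_rt_measurable: "(\<lambda>p. vel (rt (fst p)) (snd p)) \<in> borel_measurable (borel \<Otimes>\<^sub>M borel)"
proof -
  have "(\<lambda>p. \<integral>y. Phi (snd p) y \<partial>rt (fst p)) \<in> borel_measurable (borel \<Otimes>\<^sub>M borel)"
    by (rule integral_kernel_measurable[where N=borel]) (simp_all add: case_prod_unfold)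
  then show ?thesis by (simp add: vel_eq[OF adm_rt])
qed

lemma J_measurable:
  assumes r: "reg A f f'" shows "J f' \<in> borel_measurable borel"
  unfolding J_def[abs_def]
proof (rule integral_kernel_measurable[OF _ rt_measurable])
  show "(\<lambda>(s, x). f' x (vel (rt s) x)) \<in> borel_measurable (borel \<Otimes>\<^sub>M borel)"
    using reg_measurable_compose[OF r _ vel_rt_measurable, of snd] by (simp add: case_prod_unfold)
qed

section \<open>Mass bounds and the weak equation in time\<close>

lemma vel_le_mass: "adm \<nu> \<Longrightarrow> norm (vel \<nu> x) \<le> cp * mass \<nu>"
  unfolding vel_eq by (rule adm_integral_bound[OF _ Phi_le])

lemma vel_lip_mass: assumes \<nu>: "adm \<nu>" shows "norm (vel \<nu> x - vel \<nu> z) \<le> cp * mass \<nu> * norm (x - z)"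
proof (rule lipschitz_if_derivative_bound[OF vel_has_derivative[OF \<nu>]])
  show "norm (dvel \<nu> x v) \<le> cp * mass \<nu> * norm v" for x v
    using adm_integral_bound[OF \<nu> wlip_le[OF wlip_dPhi]] by (simp add: dvel_def mult_ac)
qed

lemma vel_measurable: "adm \<nu> \<Longrightarrow> vel \<nu> \<in> borel_measurable borel"
  by (rule borel_measurable_continuous_onI, rule has_derivative_continuous_on, rule has_derivative_at_withinI,
      rule vel_has_derivative)

lemma integrable_derivative_vel:
  assumes r: "reg A f f'" and \<nu>: "adm \<nu>" and \<mu>: "adm \<mu>"
  shows "integrable \<mu> (\<lambda>x. f' x (vel \<nu> x))" "\<bar>\<integral>x. f' x (vel \<nu> x) \<partial>\<mu>\<bar> \<le> A * cp * mass \<nu> * mass \<mu>"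
proof -
  have b: "norm (f' x (vel \<nu> x)) \<le> (A * cp * mass \<nu>) * w x" for x
    using order_trans[OF reg_derivative_le[OF r] mult_left_mono[OF vel_le_mass[OF \<nu>]], of x x] reg_nonneg[OF r] w_nonneg[of x]
    by (simp add: mult_ac)
  show "integrable \<mu> (\<lambda>x. f' x (vel \<nu> x))"
    by (rule adm_integrable[OF \<mu> _ b]) (rule reg_measurable_compose[OF r _ vel_measurable[OF \<nu>]], simp)
  show "\<bar>\<integral>x. f' x (vel \<nu> x) \<partial>\<mu>\<bar> \<le> A * cp * mass \<nu> * mass \<mu>"
    using adm_integral_bound[OF \<mu> b] by simp
qed

text \<open>The solution is tested with products \<open>\<eta>(t) f(x)\<close>. As
  \<open>\<eta>\<close> vanishes for \<open>t \<le> 0\<close>, the initial term drops out and the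
  time integral extends to the whole line, whatever the values of \<open>rt\<close> at negative
  times.\<close>

lemma weak_form:
  fixes f :: "'a \<Rightarrow> real"
  assumes \<eta>: "test_function \<eta>" "\<And>s::real. s \<le> 0 \<Longrightarrow> \<eta> s = (0::real)" and f: "test_function f"
  shows "(\<integral>s. frechet_derivative \<eta> (at s) 1 * (\<integral>x. f x \<partial>rt s) - \<eta> s * J (\<lambda>x. frechet_derivative f (at x)) s \<partial>lborel) = 0"
proof -
  let ?f' = "\<lambda>x. frechet_derivative f (at x)"
  obtain A where r: "reg A f ?f'" by (rule test_function_reg[OF f])
  have d\<eta>: "(\<eta> has_derivative frechet_derivative \<eta> (at s)) (at s)" for s
    by (rule smooth_has_derivative[OF test_function_smooth[OF \<eta>(1)]])
  have lin: "frechet_derivative \<eta> (at s) h = frechet_derivative \<eta> (at s) 1 * h" for s h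
    using linear_scale[OF has_derivative_linear[OF d\<eta>], of s h 1] by (simp add: mult.commute)
  have dr: "deriv (\<lambda>s. \<eta> s * f x) s = frechet_derivative \<eta> (at s) 1 * f x" for s x
  proof (rule DERIV_imp_deriv)
    have "(\<eta> has_real_derivative frechet_derivative \<eta> (at s) 1) (at s)"
      unfolding has_field_derivative_def using d\<eta>[of s] lin[of s] by (metis (no_types, lifting) ext)
    then show "((\<lambda>s. \<eta> s * f x) has_real_derivative frechet_derivative \<eta> (at s) 1 * f x) (at s)"
      by (rule DERIV_cmult_right)
  qed
  have gr: "grad (\<lambda>y. \<eta> s * f y) x \<bullet> v = \<eta> s * ?f' x v" for s x v
    by (rule grad_inner[OF has_derivative_mult_right[OF reg_has_derivative[OF r]]])
  have d0: "frechet_derivative \<eta> (at s) 1 = 0" if "s < 0" for s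
  proof (rule frechet_derivative_eq)
    have "((\<lambda>x. 0) has_derivative (\<lambda>v. 0)) (at s)" by simp
    then show "(\<eta> has_derivative (\<lambda>v. 0)) (at s)"
      by (rule has_derivative_transform_within_open[of _ _ s UNIV "{..<0}"]) (use that \<eta>(2) in auto)
  qed
  have "(LINT t:{0..}|lborel. (\<integral>x. deriv (\<lambda>s. (\<lambda>p. \<eta> (fst p) * f (snd p)) (s, x)) t
              - grad (\<lambda>y. (\<lambda>p. \<eta> (fst p) * f (snd p)) (t, y)) x \<bullet> vel (\<rho> t) x \<partial>\<rho> t))
          + (\<integral>x. (\<lambda>p. \<eta> (fst p) * f (snd p)) (0, x) \<partial>\<rho> 0) = 0"
    using sol test_function_product[OF \<eta>(1) f] unfolding measure_solution_def by blast
  then have "(LINT t:{0..}|lborel. (\<integral>x. frechet_derivative \<eta> (at t) 1 * f x - \<eta> t * ?f' x (vel (\<rho> t) x) \<partial>\<rho> t)) = 0"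
    using \<eta>(2)[of 0] by (simp add: dr gr)
  moreover have "indicator {0..} t *\<^sub>R (\<integral>x. frechet_derivative \<eta> (at t) 1 * f x - \<eta> t * ?f' x (vel (\<rho> t) x) \<partial>\<rho> t)
      = frechet_derivative \<eta> (at t) 1 * (\<integral>x. f x \<partial>rt t) - \<eta> t * J ?f' t" for t
  proof (cases "t \<ge> 0")
    case True
    then have a: "adm (\<rho> t)" and rt: "rt t = \<rho> t" by (simp_all add: adm_rho rt_def)
    show ?thesis using True adm_integrable_wlip[OF a reg_wlip[OF r]] integrable_derivative_vel(1)[OF r a a]
      by (simp add: rt J_def)
  next
    case False
    then show ?thesis using \<eta>(2)[of t] d0[of t] by simp
  qed
  ultimately show ?thesis by (simp add: set_lebesgue_integral_def)
qed

lemma locally_bdd_J: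
  assumes r: "reg A f f'" shows "locally_bdd (J f')"
  unfolding locally_bdd_def
proof (intro conjI allI)
  show "J f' \<in> borel_measurable borel" by (rule J_measurable[OF r])
  fix R :: real
  obtain M where M: "M \<ge> 1" "\<And>t. 0 \<le> t \<Longrightarrow> t \<le> \<bar>R\<bar> + 1 \<Longrightarrow> mass (\<rho> t) \<le> M"
    by (rule mass_rho[of "\<bar>R\<bar> + 1"]) auto
  have "\<bar>J f' s\<bar> \<le> A * cp * M * M" if "norm s \<le> R" for s
  proof -
    have "mass (rt s) \<le> M" unfolding rt_def using that by (intro M) auto
    then have "A * cp * mass (rt s) * mass (rt s) \<le> A * cp * M * M"
      using reg_nonneg[OF r] cp_nonneg mass_nonneg M(1) by (intro mult_mono mult_left_mono) auto
    then show ?thesis unfolding J_def using integrable_derivative_vel(2)[OF r adm_rt adm_rt] order_trans by blast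
  qed
  then show "\<exists>B. \<forall>y. norm y \<le> R \<longrightarrow> \<bar>J f' y\<bar> \<le> B" by blast
qed

text \<open>The test function in time is the mollifier centred at \<open>r\<close>;
  \<open>\<epsilon> \<le> r\<close> makes it vanish for nonpositive times, as
  \<open>weak_form\<close> demands.\<close>

lemma mollified_derivative:
  fixes f :: "'a \<Rightarrow> real"
  assumes f: "test_function f" and e: "\<epsilon> > 0" "\<epsilon> \<le> r"
  shows "(conv (\<lambda>s. \<integral>x. f x \<partial>rt s) (mollifier \<epsilon>) has_real_derivative
     - conv (J (\<lambda>x. frechet_derivative f (at x))) (mollifier \<epsilon>) r) (at r)"
proof -
  let ?f' = "\<lambda>x. frechet_derivative f (at x)"
  let ?F = "\<lambda>s. \<integral>x. f x \<partial>rt s"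
  let ?m = "mollifier \<epsilon> :: real \<Rightarrow> real"
  obtain A where r: "reg A f ?f'" by (rule test_function_reg[OF f])
  note tm = test_function_mollifier[OF e(1), where 'a=real]
  have cF: "continuous_on UNIV ?F"
  proof (rule rt_continuous)
    show "continuous_on UNIV f" by (rule smooth_continuous[OF test_function_smooth[OF f]])
    show "bounded (range f)" using test_function_bounded[OF f] unfolding bounded_iff by (metis rangeE)
  qed
  have lF: "locally_bdd ?F" by (rule locally_bdd_continuous[OF cF])
  have dm: "(?m has_derivative frechet_derivative ?m (at s)) (at s)" for s
    by (rule smooth_has_derivative[OF test_function_smooth[OF tm]])
  have lin: "frechet_derivative ?m (at s) h = h * frechet_derivative ?m (at s) 1" for s h
    using linear_scale[OF has_derivative_linear[OF dm], of s h 1] by simp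
  define \<eta> where "\<eta> s = ?m (r + - s)" for s
  have t\<eta>: "test_function \<eta>"
  proof (rule test_functionI[of _ "\<bar>r\<bar> + \<epsilon>"])
    show "smooth \<eta>" unfolding \<eta>_def
      by (rule smooth_affine[OF bounded_linear_minus[OF bounded_linear_ident] test_function_smooth[OF tm]])
    show "\<eta> s = 0" if "norm s > \<bar>r\<bar> + \<epsilon>" for s
      unfolding \<eta>_def using that by (intro mollifier_eq_0[OF e(1)]) auto
  qed
  have \<eta>0: "\<eta> s = 0" if "s \<le> 0" for s
    unfolding \<eta>_def using that e by (intro mollifier_eq_0) auto
  have d\<eta>: "frechet_derivative \<eta> (at s) 1 = - frechet_derivative ?m (at (r - s)) 1" for s
  proof -
    have s: "((\<lambda>s. r + - s) has_derivative (\<lambda>v. - v)) (at s)" by (auto intro!: derivative_eq_intros)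
    have "frechet_derivative \<eta> (at s) 1 = frechet_derivative ?m (at (r + - s)) (- 1)"
      unfolding \<eta>_def by (rule frechet_derivative_eq[OF has_derivative_compose[OF s dm]])
    then show ?thesis using lin[of "r - s" "-1"] by simp
  qed
  have i1: "integrable lborel (\<lambda>s. ?F s * frechet_derivative ?m (at (r - s)) 1)"
    by (rule integrable_conv[OF lF test_function_frechet[OF tm]])
  have i2: "integrable lborel (\<lambda>s. J ?f' s * ?m (r - s))" by (rule integrable_conv[OF locally_bdd_J[OF r] tm])
  have "(\<integral>s. - (?F s * frechet_derivative ?m (at (r - s)) 1) - J ?f' s * ?m (r - s) \<partial>lborel) = 0"
    using weak_form[OF t\<eta> \<eta>0 f] unfolding d\<eta> by (simp add: \<eta>_def mult.commute)
  then have eq: "conv ?F (\<lambda>x. frechet_derivative ?m (at x) 1) r = - conv (J ?f') ?m r"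
    using i1 i2 by (simp add: conv_def)
  have "(conv ?F ?m has_derivative (\<lambda>v. conv ?F (\<lambda>x. frechet_derivative ?m (at x) v) r)) (at r)"
    by (rule conv_has_derivative[OF lF tm])
  also have "(\<lambda>v. conv ?F (\<lambda>x. frechet_derivative ?m (at x) v) r) = (\<lambda>v. - conv (J ?f') ?m r * v)"
  proof
    fix v
    have "conv ?F (\<lambda>x. frechet_derivative ?m (at x) v) r = v * conv ?F (\<lambda>x. frechet_derivative ?m (at x) 1) r"
      unfolding conv_def lin[of _ v] by (simp add: mult.left_commute[of _ v])
    then show "conv ?F (\<lambda>x. frechet_derivative ?m (at x) v) r = - conv (J ?f') ?m r * v" unfolding eq by simp
  qed
  finally show ?thesis unfolding has_field_derivative_def .
qed

text \<open>With mollified time the integral of \<open>f\<close> is differentiable and the mean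
  value inequality applies; then the scale tends to 0, by narrow continuity. Comparing
  \<open>J\<close> with a constant \<open>j\<close> yields both a Lipschitz bound
  (\<open>j = 0\<close>) and the consistency of an Euler step (\<open>j\<close> the value at the
  left end).\<close>

lemma time_increment:
  fixes f :: "'a \<Rightarrow> real"
  assumes f: "test_function f" and ab: "0 \<le> a" "a \<le> b"
    and j: "\<And>s. a \<le> s \<Longrightarrow> s \<le> b \<Longrightarrow> \<bar>J (\<lambda>x. frechet_derivative f (at x)) s - j\<bar> \<le> M"
  shows "\<bar>(\<integral>x. f x \<partial>\<rho> b) - (\<integral>x. f x \<partial>\<rho> a) + (b - a) * j\<bar> \<le> M * (b - a)"
proof -
  let ?f' = "\<lambda>x. frechet_derivative f (at x)"
  let ?F = "\<lambda>s. \<integral>x. f x \<partial>rt s"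
  obtain A where r: "reg A f ?f'" by (rule test_function_reg[OF f])
  have cF: "continuous_on UNIV ?F"
  proof (rule rt_continuous)
    show "continuous_on UNIV f" by (rule smooth_continuous[OF test_function_smooth[OF f]])
    show "bounded (range f)" using test_function_bounded[OF f] unfolding bounded_iff by (metis rangeE)
  qed
  \<comment> \<open>The points lie strictly inside the interval, so that a small mollifier around
    any point of \<open>[p, q]\<close> stays within \<open>[a, b]\<close>, where \<open>J\<close> is
    controlled.\<close>
  have inner: "\<bar>?F q - ?F p + (q - p) * j\<bar> \<le> M * (q - p)" if pq: "a < p" "p \<le> q" "q < b" for p q
  proof -
    let ?G = "\<lambda>n. conv ?F (mollifier (1 / real (Suc n)))"
    obtain N where N: "1 / real (Suc N) < min (p - a) (b - q)" using nat_approx_posE[of "min (p - a) (b - q)"] pq by auto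
    have "\<bar>?G n q - ?G n p + (q - p) * j\<bar> \<le> M * (q - p)" if n: "n \<ge> N" for n
    proof -
      have e: "1 / real (Suc n) > 0" by simp
      have "1 / real (Suc n) \<le> 1 / real (Suc N)" using n by (simp add: frac_le)
      then have en: "1 / real (Suc n) < p - a" "1 / real (Suc n) < b - q" using N by auto
      have d: "(?G n has_real_derivative - conv (J ?f') (mollifier (1 / real (Suc n))) x) (at x)" if "p \<le> x" for x
        by (rule mollified_derivative[OF f e]) (use en that ab in linarith)
      have d': "((\<lambda>x. ?G n x + x * j) has_derivative (\<lambda>v. (- conv (J ?f') (mollifier (1 / real (Suc n))) x + j) * v)) (at x within {p..q})"
        if "x \<in> {p..q}" for x
      proof -
        have "((\<lambda>x. ?G n x + x * j) has_real_derivative (- conv (J ?f') (mollifier (1 / real (Suc n))) x + 1 * j)) (at x)"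
          by (intro DERIV_add d DERIV_cmult_right DERIV_ident) (use that in simp)
        then have "((\<lambda>x. ?G n x + x * j) has_derivative (\<lambda>v. (- conv (J ?f') (mollifier (1 / real (Suc n))) x + j) * v)) (at x)"
          by (simp add: has_field_derivative_def)
        then show ?thesis by (rule has_derivative_at_withinI)
      qed
      have "norm ((?G n q + q * j) - (?G n p + p * j)) \<le> M * norm (q - p)"
      proof (rule differentiable_bound[OF _ d'])
        fix x assume x: "x \<in> {p..q}"
        have "\<bar>conv (J ?f') (mollifier (1 / real (Suc n))) x - j\<bar> \<le> M"
        proof (rule conv_mollifier_bound[OF locally_bdd_J[OF r] e])
          fix z :: real assume "norm z < 1 / real (Suc n)"
          then have "\<bar>z\<bar> < p - a" "\<bar>z\<bar> < b - q" using en by auto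
          then show "\<bar>J ?f' (x - z) - j\<bar> \<le> M" using x by (intro j) (auto simp: abs_less_iff)
        qed
        then show "onorm (\<lambda>v. (- conv (J ?f') (mollifier (1 / real (Suc n))) x + j) * v) \<le> M"
          by (intro onorm_bound) (auto simp: abs_mult intro!: mult_right_mono)
      qed (use pq in auto)
      then show ?thesis using pq by (simp add: algebra_simps)
    qed
    then have ev: "\<forall>\<^sub>F n in sequentially. \<bar>?G n q - ?G n p + (q - p) * j\<bar> \<le> M * (q - p)"
      unfolding eventually_sequentially by blast
    have "(\<lambda>n. \<bar>?G n q - ?G n p + (q - p) * j\<bar>) \<longlonglongrightarrow> \<bar>?F q - ?F p + (q - p) * j\<bar>"
      by (intro tendsto_intros conv_mollifier_tendsto cF)
    then show ?thesis by (rule tendsto_upperbound) (use ev in auto)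
  qed
  have rr: "rt a = \<rho> a" "rt b = \<rho> b" using ab by (auto simp: rt_def)
  show ?thesis
  proof (cases "a = b")
    case False
    then have ab': "a < b" using ab by simp
    \<comment> \<open>The offset 3 keeps both points within a third of the interval from its ends,
      so \<open>p n \<le> q n\<close> holds for every \<open>n\<close>.\<close>
    define p where "p n = a + (b - a) / real (n + 3)" for n
    define q where "q n = b - (b - a) / real (n + 3)" for n
    have z: "(\<lambda>n. (b - a) / real (n + 3)) \<longlonglongrightarrow> 0" by real_asymp
    have p: "p \<longlonglongrightarrow> a" using tendsto_add[OF tendsto_const z, of a] by (simp add: p_def[abs_def])
    have q: "q \<longlonglongrightarrow> b" using tendsto_diff[OF tendsto_const z, of b] by (simp add: q_def[abs_def])
    have "\<bar>?F (q n) - ?F (p n) + (q n - p n) * j\<bar> \<le> M * (q n - p n)" for n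
    proof (rule inner)
      define t where "t = (b - a) / real (n + 3)"
      have d: "0 < t" using ab' by (simp add: t_def)
      have "t \<le> (b - a) / 3" unfolding t_def by (rule divide_left_mono) (use ab' in auto)
      then have d3: "3 * t \<le> b - a" by simp
      show "a < p n" "q n < b" using d unfolding p_def q_def t_def[symmetric] by simp_all
      show "p n \<le> q n" using d d3 unfolding p_def q_def t_def[symmetric] by simp
    qed
    moreover have "(\<lambda>n. \<bar>?F (q n) - ?F (p n) + (q n - p n) * j\<bar>) \<longlonglongrightarrow> \<bar>?F b - ?F a + (b - a) * j\<bar>"
      by (intro tendsto_intros p q continuous_on_tendsto_compose[OF cF p] continuous_on_tendsto_compose[OF cF q]) auto
    moreover have "(\<lambda>n. M * (q n - p n)) \<longlonglongrightarrow> M * (b - a)" by (intro tendsto_intros p q)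
    ultimately have "\<bar>?F b - ?F a + (b - a) * j\<bar> \<le> M * (b - a)"
      by (intro LIMSEQ_le[of "\<lambda>n. \<bar>?F (q n) - ?F (p n) + (q n - p n) * j\<bar>" _ "\<lambda>n. M * (q n - p n)"]) auto
    then show ?thesis by (simp add: rr)
  qed simp
qed

end

context stein begin

lemma wlip_vector_bound:
  fixes f :: "'a \<Rightarrow> 'b::euclidean_space"
  assumes \<mu>: "adm \<mu>" and \<nu>: "adm \<nu>" and f: "wlip A f" and M: "M \<ge> 0"
    and b: "\<And>B (g :: 'a \<Rightarrow> real). wlip B g \<Longrightarrow> \<bar>(\<integral>x. g x \<partial>\<mu>) - (\<integral>x. g x \<partial>\<nu>)\<bar> \<le> M * B"
  shows "norm ((\<integral>x. f x \<partial>\<mu>) - (\<integral>x. f x \<partial>\<nu>)) \<le> 2 * M * A"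
proof (cases "(\<integral>x. f x \<partial>\<mu>) - (\<integral>x. f x \<partial>\<nu>) = 0")
  case True
  then show ?thesis using wlip_nonneg[OF f] M by simp
next
  case False
  define u where "u = (\<integral>x. f x \<partial>\<mu>) - (\<integral>x. f x \<partial>\<nu>)"
  have u: "norm u > 0" using False by (simp add: u_def)
  have "wlip (2 * A * norm u) (\<lambda>x. f x \<bullet> u)"
    by (rule wlip_bilinear[OF bounded_bilinear_inner _ f]) (auto simp: Cauchy_Schwarz_ineq2)
  from b[OF this] have "u \<bullet> u \<le> M * (2 * A * norm u)"
    using adm_integrable_wlip[OF \<mu> f] adm_integrable_wlip[OF \<nu> f] by (simp add: u_def inner_diff_left)
  then have "norm u * norm u \<le> (2 * M * A) * norm u"
    by (simp add: dot_square_norm power2_eq_square mult_ac)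
  then show ?thesis using u by (simp add: u_def)
qed

lemma approx_integral_tendsto:
  assumes \<nu>: "adm \<nu>" and g: "wlip A g"
  shows "(\<lambda>n. \<integral>x. approx g n x \<partial>\<nu>) \<longlonglongrightarrow> (\<integral>x. g x \<partial>\<nu>)"
proof (rule integral_dominated_convergence[where w="\<lambda>x. 2 * exp c * A * w x"])
  have s: "sets \<nu> = sets borel" using \<nu> by (simp add: adm_def)
  show "g \<in> borel_measurable \<nu>" "\<And>n. approx g n \<in> borel_measurable \<nu>"
    using wlip_measurable[OF g] wlip_measurable[OF wlip_approx[OF g]] by (simp_all add: measurable_cong_sets[OF s refl])
  show "integrable \<nu> (\<lambda>x. 2 * exp c * A * w x)" using \<nu> by (simp add: adm_def)
  show "AE x in \<nu>. (\<lambda>n. approx g n x) \<longlonglongrightarrow> g x" by (intro AE_I2 approx_tendsto[OF g])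
  show "AE x in \<nu>. norm (approx g n x) \<le> 2 * exp c * A * w x" for n by (intro AE_I2 wlip_le[OF wlip_approx[OF g]])
qed

end

section \<open>Lipschitz continuity in time and consistency of one step\<close>

context stein_flow begin

context
  fixes T m :: real
  assumes T: "T > 0" and m: "m \<ge> 1" and mass_le: "\<And>t. 0 \<le> t \<Longrightarrow> t \<le> T \<Longrightarrow> mass (\<rho> t) \<le> m"
begin

text \<open>\<open>cp * m * m\<close> bounds \<open>J\<close> for a test function of weighted
  Lipschitz constant 1, with one mass for the velocity and one for the measure of integration;
  \<open>2 * exp c\<close> is the price of approximation by test functions.\<close>

definition lt where "lt = 2 * exp c * (cp * m * m)"

lemma lt_nonneg: "lt \<ge> 0" using cp_nonneg m by (simp add: lt_def)

lemma lipschitz_in_time_test: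
  assumes f: "test_function f" and A: "wlip A f" and ab: "0 \<le> a" "a \<le> b" "b \<le> T"
  shows "\<bar>(\<integral>x. f x \<partial>\<rho> b) - (\<integral>x. f x \<partial>\<rho> a)\<bar> \<le> A * cp * m * m * (b - a)"
proof -
  have "\<bar>J (\<lambda>x. frechet_derivative f (at x)) s - 0\<bar> \<le> A * cp * m * m" if s: "a \<le> s" "s \<le> b" for s
  proof -
    have ms: "mass (rt s) \<le> m" unfolding rt_def using ab s by (intro mass_le) auto
    have "\<bar>J (\<lambda>x. frechet_derivative f (at x)) s\<bar> \<le> A * cp * mass (rt s) * mass (rt s)"
      unfolding J_def by (rule integrable_derivative_vel(2)[OF reg_test_function[OF f A] adm_rt adm_rt])
    also have "\<dots> \<le> A * cp * m * m"
      using wlip_nonneg[OF A] cp_nonneg mass_nonneg m by (intro mult_mono mult_left_mono ms) auto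
    finally show ?thesis by simp
  qed
  from time_increment[OF f ab(1,2) this] show ?thesis by simp
qed

lemma lipschitz_in_time:
  assumes g: "wlip A g" and ab: "0 \<le> a" "a \<le> b" "b \<le> T"
  shows "\<bar>(\<integral>x. g x \<partial>\<rho> b) - (\<integral>x. g x \<partial>\<rho> a)\<bar> \<le> (lt * (b - a)) * A"
proof (rule LIMSEQ_le_const2)
  have ad: "adm (\<rho> a)" "adm (\<rho> b)" using ab by (auto intro: adm_rho)
  show "(\<lambda>n. \<bar>(\<integral>x. approx g n x \<partial>\<rho> b) - (\<integral>x. approx g n x \<partial>\<rho> a)\<bar>) \<longlonglongrightarrow> \<bar>(\<integral>x. g x \<partial>\<rho> b) - (\<integral>x. g x \<partial>\<rho> a)\<bar>"
    by (intro tendsto_intros approx_integral_tendsto[OF _ g] ad)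
  show "\<exists>N. \<forall>n\<ge>N. \<bar>(\<integral>x. approx g n x \<partial>\<rho> b) - (\<integral>x. approx g n x \<partial>\<rho> a)\<bar> \<le> (lt * (b - a)) * A"
    using lipschitz_in_time_test[OF test_function_approx[OF g] wlip_approx[OF g] ab] by (auto simp: lt_def mult_ac)
qed

lemma vel_lipschitz_in_time:
  assumes ab: "0 \<le> a" "a \<le> b" "b \<le> T"
  shows "norm (vel (\<rho> b) x - vel (\<rho> a) x) \<le> 2 * (lt * (b - a)) * cp"
proof -
  have ad: "adm (\<rho> a)" "adm (\<rho> b)" using ab by (auto intro: adm_rho)
  show ?thesis unfolding vel_eq[OF ad(1)] vel_eq[OF ad(2)]
    by (rule wlip_vector_bound[OF ad(2,1) wlip_Phi _ lipschitz_in_time[OF _ ab]]) (use lt_nonneg ab in auto)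
qed

lemma dst_lipschitz_in_time:
  assumes st: "0 \<le> s" "s \<le> T" "0 \<le> t" "t \<le> T"
  shows "dst (\<rho> t) \<le> dst (\<rho> s) + lt * 2 * c * \<bar>t - s\<bar>"
proof (rule dst_least)
  fix \<phi> :: "'a \<Rightarrow> real" assume b: "bl_norm \<phi> \<le> 1"
  have wl: "wlip (2 * c * 1) (\<lambda>x. \<phi> x * w x)" by (rule wlip_of_bl) (use b in auto)
  have "\<bar>(\<integral>x. \<phi> x * w x \<partial>\<rho> t) - (\<integral>x. \<phi> x * w x \<partial>\<rho> s)\<bar> \<le> (lt * \<bar>t - s\<bar>) * (2 * c * 1)"
    using lipschitz_in_time[OF wl, of s t] lipschitz_in_time[OF wl, of t s] st
    by (cases "s \<le> t") (auto simp: abs_minus_commute)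
  moreover have "(\<integral>x. \<phi> x * w x \<partial>\<rho> s) - (\<integral>x. \<phi> x * w x \<partial>\<gamma>) \<le> dst (\<rho> s)"
    by (rule dst_upper[OF adm_rho[OF st(1)] b])
  ultimately show "(\<integral>x. \<phi> x * w x \<partial>\<rho> t) - (\<integral>x. \<phi> x * w x \<partial>\<gamma>) \<le> dst (\<rho> s) + lt * 2 * c * \<bar>t - s\<bar>"
    by (simp add: mult_ac abs_le_iff)
qed

text \<open>Makes the transport term an admissible integrand for \<open>lipschitz_in_time\<close>;
  apart from Taylor's formula, this is what the Lipschitz bound on \<open>\<phi>'\<close> serves
  for.\<close>

lemma wlip_derivative_vel:
  assumes r: "reg A \<phi> \<phi>'" and d: "dlip D \<phi>'" and D: "D \<ge> 0" and \<nu>: "adm \<nu>" and mn: "mass \<nu> \<le> m"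
  shows "wlip ((A + D) * (cp * m)) (\<lambda>x. \<phi>' x (vel \<nu> x))"
proof (rule wlipI)
  have A: "A \<ge> 0" by (rule reg_nonneg[OF r])
  have cm: "cp * mass \<nu> \<le> cp * m" by (rule mult_left_mono[OF mn cp_nonneg])
  have cm0: "0 \<le> cp * m" using cp_nonneg m by simp
  have v: "norm (vel \<nu> x) \<le> cp * m" for x using vel_le_mass[OF \<nu>, of x] cm by linarith
  have vl: "norm (vel \<nu> x - vel \<nu> z) \<le> cp * m * norm (x - z)" for x z
    using vel_lip_mass[OF \<nu>, of x z] mult_right_mono[OF cm, of "norm (x - z)"] by simp
  show "norm (\<phi>' x (vel \<nu> x)) \<le> (A + D) * (cp * m) * w x" for x
  proof -
    have "norm (\<phi>' x (vel \<nu> x)) \<le> A * w x * (cp * m)"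
      using order_trans[OF reg_derivative_le[OF r] mult_left_mono[OF v]] A w_nonneg[of x] by simp
    also have "\<dots> \<le> A * w x * (cp * m) + D * w x * (cp * m)" using D cm0 w_nonneg[of x] by simp
    finally show ?thesis by (simp add: algebra_simps)
  qed
  show "norm (\<phi>' x (vel \<nu> x) - \<phi>' z (vel \<nu> z)) \<le> (A + D) * (cp * m) * max (w x) (w z) * norm (x - z)" for x z
  proof -
    let ?m = "max (w x) (w z)"
    have "\<phi>' x (vel \<nu> x) - \<phi>' z (vel \<nu> z) = (\<phi>' x (vel \<nu> x) - \<phi>' z (vel \<nu> x)) + \<phi>' z (vel \<nu> x - vel \<nu> z)"
      by (simp add: linear_diff[OF reg_linear[OF r]])
    also have "norm \<dots> \<le> D * ?m * norm (x - z) * (cp * m) + (A * ?m) * (cp * m * norm (x - z))"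
    proof (rule norm_triangle_mono)
      have "\<bar>\<phi>' x (vel \<nu> x) - \<phi>' z (vel \<nu> x)\<bar> \<le> D * ?m * norm (x - z) * norm (vel \<nu> x)" using d by (simp add: dlip_def)
      also have "\<dots> \<le> D * ?m * norm (x - z) * (cp * m)" by (rule mult_left_mono[OF v]) (use D max_w_pos(2) in simp)
      finally show "norm (\<phi>' x (vel \<nu> x) - \<phi>' z (vel \<nu> x)) \<le> D * ?m * norm (x - z) * (cp * m)" by simp
      have "\<bar>\<phi>' z (vel \<nu> x - vel \<nu> z)\<bar> \<le> A * w z * norm (vel \<nu> x - vel \<nu> z)" by (rule reg_derivative_le[OF r])
      also have "\<dots> \<le> (A * ?m) * (cp * m * norm (x - z))"
        by (intro mult_mono mult_left_mono vl) (use A max_w_pos(2) in auto)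
      finally show "norm (\<phi>' z (vel \<nu> x - vel \<nu> z)) \<le> (A * ?m) * (cp * m * norm (x - z))" by simp
    qed
    finally show ?thesis by (simp add: algebra_simps)
  qed
qed

text \<open>\<open>J\<close> is compared with its value at the left end. Two things change by a
  multiple of \<open>s - a\<close>: the velocity, which contributes \<open>2 A\<close>, and the
  measure, tested with a frozen integrand of constant proportional to \<open>A + D\<close>. Together
  this is \<open>3 A + D\<close>.\<close>

lemma one_step_test:
  assumes f: "test_function f" and A: "wlip A f" and d: "dlip D (\<lambda>x. frechet_derivative f (at x))" and D: "D \<ge> 0"
    and ab: "0 \<le> a" "a \<le> b" "b \<le> T"
  shows "\<bar>(\<integral>x. f x \<partial>\<rho> b) - (\<integral>x. f x \<partial>\<rho> a) + (b - a) * (\<integral>x. frechet_derivative f (at x) (vel (\<rho> a) x) \<partial>\<rho> a)\<bar>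
    \<le> (lt * cp * m * (3 * A + D)) * (b - a)\<^sup>2"
proof -
  let ?f' = "\<lambda>x. frechet_derivative f (at x)"
  note r = reg_test_function[OF f A]
  have A0: "A \<ge> 0" by (rule wlip_nonneg[OF A])
  have ad: "adm (\<rho> a)" using ab by (auto intro: adm_rho)
  have ma: "mass (\<rho> a) \<le> m" using ab by (intro mass_le) auto
  have "\<bar>J ?f' s - (\<integral>x. ?f' x (vel (\<rho> a) x) \<partial>\<rho> a)\<bar> \<le> (lt * cp * m * (3 * A + D)) * (b - a)" if s: "a \<le> s" "s \<le> b" for s
  proof -
    have as: "adm (\<rho> s)" "mass (\<rho> s) \<le> m" and rs: "rt s = \<rho> s" using ab s by (auto intro: adm_rho mass_le simp: rt_def)
    note i1 = integrable_derivative_vel(1)[OF r as(1) as(1)] and i2 = integrable_derivative_vel(1)[OF r ad as(1)]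
    have "\<bar>(\<integral>x. ?f' x (vel (\<rho> s) x) \<partial>\<rho> s) - (\<integral>x. ?f' x (vel (\<rho> a) x) \<partial>\<rho> s)\<bar> \<le> (A * (2 * (lt * (s - a)) * cp)) * m"
    proof -
      have "(\<integral>x. ?f' x (vel (\<rho> s) x) \<partial>\<rho> s) - (\<integral>x. ?f' x (vel (\<rho> a) x) \<partial>\<rho> s) = (\<integral>x. ?f' x (vel (\<rho> s) x - vel (\<rho> a) x) \<partial>\<rho> s)"
        using i1 i2 by (simp add: linear_diff[OF reg_linear[OF r]])
      also have "norm \<dots> \<le> (A * (2 * (lt * (s - a)) * cp)) * mass (\<rho> s)"
      proof (rule adm_integral_bound[OF as(1)])
        fix x
        have "norm (vel (\<rho> s) x - vel (\<rho> a) x) \<le> 2 * (lt * (s - a)) * cp"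
          by (rule vel_lipschitz_in_time) (use ab s in auto)
        from order_trans[OF reg_derivative_le[OF r, of x] mult_left_mono[OF this, of "A * w x"]]
        show "norm (?f' x (vel (\<rho> s) x - vel (\<rho> a) x)) \<le> (A * (2 * (lt * (s - a)) * cp)) * w x"
          using A0 w_nonneg[of x] by (simp add: mult_ac)
      qed
      also have "\<dots> \<le> (A * (2 * (lt * (s - a)) * cp)) * m"
        by (rule mult_left_mono[OF as(2)]) (use A0 lt_nonneg cp_nonneg s in simp)
      finally show ?thesis by simp
    qed
    moreover have "\<bar>(\<integral>x. ?f' x (vel (\<rho> a) x) \<partial>\<rho> s) - (\<integral>x. ?f' x (vel (\<rho> a) x) \<partial>\<rho> a)\<bar> \<le> (lt * (s - a)) * ((A + D) * (cp * m))"
      by (rule lipschitz_in_time[OF wlip_derivative_vel[OF r d D ad ma]]) (use ab s in auto)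
    moreover have "(A * (2 * (lt * (s - a)) * cp)) * m + (lt * (s - a)) * ((A + D) * (cp * m)) = (lt * cp * m * (3 * A + D)) * (s - a)"
      by (simp add: algebra_simps)
    moreover have "(lt * cp * m * (3 * A + D)) * (s - a) \<le> (lt * cp * m * (3 * A + D)) * (b - a)"
      by (rule mult_left_mono) (use s A0 D lt_nonneg cp_nonneg m in auto)
    ultimately show ?thesis unfolding J_def rs by linarith
  qed
  from time_increment[OF f ab(1,2) this] show ?thesis by (simp add: power2_eq_square mult_ac)
qed

text \<open>The iterates of the scheme need not be test functions; approximation reaches them
  because the constants of the approximants do not depend on \<open>n\<close>. In the constant,
  \<open>6 exp c\<close> is the earlier 3 times the factor \<open>2 exp c\<close> that approximation
  puts on \<open>A\<close>.\<close>

lemma one_step: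
  obtains C where "C \<ge> 0" "\<And>A D \<phi> \<phi>' a b. reg A \<phi> \<phi>' \<Longrightarrow> dlip D \<phi>' \<Longrightarrow> A \<le> D \<Longrightarrow> 0 \<le> a \<Longrightarrow> a \<le> b \<Longrightarrow> b \<le> T \<Longrightarrow>
    \<bar>(\<integral>x. \<phi> x \<partial>\<rho> b) - (\<integral>x. \<phi> x \<partial>\<rho> a) + (b - a) * (\<integral>x. \<phi>' x (vel (\<rho> a) x) \<partial>\<rho> a)\<bar> \<le> C * D * (b - a)\<^sup>2"
proof -
  obtain ca where ca: "ca \<ge> 0"
    "\<And>A D \<phi> \<phi>' n. reg A \<phi> \<phi>' \<Longrightarrow> dlip D \<phi>' \<Longrightarrow> A \<le> D \<Longrightarrow> dlip (ca * D) (\<lambda>x. frechet_derivative (approx \<phi> n) (at x))"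
    "\<And>A D \<phi> \<phi>' x v. reg A \<phi> \<phi>' \<Longrightarrow> dlip D \<phi>' \<Longrightarrow> A \<le> D \<Longrightarrow> (\<lambda>n. frechet_derivative (approx \<phi> n) (at x) v) \<longlonglongrightarrow> \<phi>' x v"
    by (rule approx_C11) blast
  show ?thesis
  proof (rule that[of "lt * cp * m * (6 * exp c + ca)"])
    show "lt * cp * m * (6 * exp c + ca) \<ge> 0" using lt_nonneg cp_nonneg m ca(1) by simp
    fix A D \<phi> \<phi>' a b
    assume r: "reg A \<phi> \<phi>'" and d: "dlip D \<phi>'" and AD: "A \<le> D" and ab: "0 \<le> a" "a \<le> b" "b \<le> T"
    have A0: "A \<ge> 0" by (rule reg_nonneg[OF r])
    have ad: "adm (\<rho> a)" "adm (\<rho> b)" using ab by (auto intro: adm_rho)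
    have sa: "sets (\<rho> a) = sets borel" using ad by (simp add: adm_def)
    let ?f = "\<lambda>n x. frechet_derivative (approx \<phi> n) (at x)"
    note wl = reg_wlip[OF r]
    have rn: "reg (2 * exp c * A) (approx \<phi> n) (?f n)" for n
      by (rule reg_test_function[OF test_function_approx[OF wl] wlip_approx[OF wl]])
    have lim: "(\<lambda>n. \<integral>x. ?f n x (vel (\<rho> a) x) \<partial>\<rho> a) \<longlonglongrightarrow> (\<integral>x. \<phi>' x (vel (\<rho> a) x) \<partial>\<rho> a)"
    proof (rule integral_dominated_convergence[where w="\<lambda>x. 2 * exp c * A * (cp * mass (\<rho> a)) * w x"])
      show "(\<lambda>x. \<phi>' x (vel (\<rho> a) x)) \<in> borel_measurable (\<rho> a)"
        using integrable_derivative_vel(1)[OF r ad(1) ad(1)] by simp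
      show "(\<lambda>x. ?f n x (vel (\<rho> a) x)) \<in> borel_measurable (\<rho> a)" for n
        using integrable_derivative_vel(1)[OF rn ad(1) ad(1)] by simp
      show "integrable (\<rho> a) (\<lambda>x. 2 * exp c * A * (cp * mass (\<rho> a)) * w x)" using ad by (simp add: adm_def)
      show "AE x in \<rho> a. (\<lambda>n. ?f n x (vel (\<rho> a) x)) \<longlonglongrightarrow> \<phi>' x (vel (\<rho> a) x)"
        by (intro AE_I2 ca(3)[OF r d AD])
      show "AE x in \<rho> a. norm (?f n x (vel (\<rho> a) x)) \<le> 2 * exp c * A * (cp * mass (\<rho> a)) * w x" for n
      proof (rule AE_I2)
        fix x
        show "norm (?f n x (vel (\<rho> a) x)) \<le> 2 * exp c * A * (cp * mass (\<rho> a)) * w x"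
          using order_trans[OF reg_derivative_le[OF rn[of n], of x] mult_left_mono[OF vel_le_mass[OF ad(1), of x], of "2 * exp c * A * w x"]] A0 w_nonneg[of x]
          by (simp add: mult_ac)
      qed
    qed
    have main: "\<bar>(\<integral>x. approx \<phi> n x \<partial>\<rho> b) - (\<integral>x. approx \<phi> n x \<partial>\<rho> a) + (b - a) * (\<integral>x. ?f n x (vel (\<rho> a) x) \<partial>\<rho> a)\<bar>
      \<le> lt * cp * m * (6 * exp c + ca) * D * (b - a)\<^sup>2" for n
    proof -
      have "\<bar>(\<integral>x. approx \<phi> n x \<partial>\<rho> b) - (\<integral>x. approx \<phi> n x \<partial>\<rho> a) + (b - a) * (\<integral>x. ?f n x (vel (\<rho> a) x) \<partial>\<rho> a)\<bar>
        \<le> (lt * cp * m * (3 * (2 * exp c * A) + ca * D)) * (b - a)\<^sup>2"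
        by (rule one_step_test[OF test_function_approx[OF wl] wlip_approx[OF wl] ca(2)[OF r d AD] _ ab]) (use ca A0 AD in simp)
      also have "\<dots> \<le> (lt * cp * m * (6 * exp c * D + ca * D)) * (b - a)\<^sup>2"
        by (intro mult_right_mono mult_left_mono) (use AD lt_nonneg cp_nonneg m in auto)
      finally show ?thesis by (simp add: algebra_simps)
    qed
    show "\<bar>(\<integral>x. \<phi> x \<partial>\<rho> b) - (\<integral>x. \<phi> x \<partial>\<rho> a) + (b - a) * (\<integral>x. \<phi>' x (vel (\<rho> a) x) \<partial>\<rho> a)\<bar>
      \<le> lt * cp * m * (6 * exp c + ca) * D * (b - a)\<^sup>2"
    proof (rule LIMSEQ_le_const2)
      show "(\<lambda>n. \<bar>(\<integral>x. approx \<phi> n x \<partial>\<rho> b) - (\<integral>x. approx \<phi> n x \<partial>\<rho> a) + (b - a) * (\<integral>x. ?f n x (vel (\<rho> a) x) \<partial>\<rho> a)\<bar>)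
        \<longlonglongrightarrow> \<bar>(\<integral>x. \<phi> x \<partial>\<rho> b) - (\<integral>x. \<phi> x \<partial>\<rho> a) + (b - a) * (\<integral>x. \<phi>' x (vel (\<rho> a) x) \<partial>\<rho> a)\<bar>"
        by (intro tendsto_intros lim approx_integral_tendsto[OF _ wl] ad)
    qed (use main in blast)
  qed
qed

end

end

section \<open>Iteration of the dual Euler scheme\<close>

text \<open>Every growth factor is at least 1, so each forcing term may be multiplied by the full
  product of factors; the result is one exponential times a plain sum.\<close>

lemma discrete_gronwall:
  fixes a k :: "nat \<Rightarrow> real"
  assumes step: "\<And>j. j < N \<Longrightarrow> a (Suc j) \<le> exp (\<delta> * k j) * a j + \<delta> * h"
    and k: "\<And>j. j < N \<Longrightarrow> k j \<ge> 0" and nn: "\<delta> \<ge> 0" "h \<ge> 0"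
  shows "n \<le> N \<Longrightarrow> a n \<le> exp (\<delta> * (\<Sum>j<n. k j)) * (a 0 + real n * \<delta> * h)"
proof (induction n)
  case (Suc n)
  have kn: "1 \<le> exp (\<delta> * k n)" using k[of n] nn Suc.prems by simp
  have "0 \<le> \<delta> * (\<Sum>j<n. k j)" using k nn Suc.prems by (intro mult_nonneg_nonneg sum_nonneg) auto
  then have e1: "1 \<le> exp (\<delta> * (\<Sum>j<n. k j))" by simp
  have "a (Suc n) \<le> exp (\<delta> * k n) * a n + \<delta> * h" using step Suc.prems by simp
  also have "\<dots> \<le> exp (\<delta> * k n) * (exp (\<delta> * (\<Sum>j<n. k j)) * (a 0 + real n * \<delta> * h))
      + (exp (\<delta> * k n) * exp (\<delta> * (\<Sum>j<n. k j))) * (\<delta> * h)"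
  proof (rule add_mono)
    show "exp (\<delta> * k n) * a n \<le> exp (\<delta> * k n) * (exp (\<delta> * (\<Sum>j<n. k j)) * (a 0 + real n * \<delta> * h))"
      using Suc by (intro mult_left_mono) auto
    have "1 * 1 \<le> exp (\<delta> * k n) * exp (\<delta> * (\<Sum>j<n. k j))" using kn e1 by (intro mult_mono) auto
    from mult_right_mono[OF this, of "\<delta> * h"]
    show "\<delta> * h \<le> (exp (\<delta> * k n) * exp (\<delta> * (\<Sum>j<n. k j))) * (\<delta> * h)" using nn by simp
  qed
  also have "\<dots> = exp (\<delta> * (\<Sum>j<Suc n. k j)) * (a 0 + real (Suc n) * \<delta> * h)"
    by (simp add: exp_add distrib_left algebra_simps)
  finally show ?case .
qed simp

text \<open>For \<open>exp (- k G)\<close> the hypothesis becomes linear: its derivative is at least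
  \<open>- k a\<close>, so it stays above \<open>1 - k a t\<close> by the mean value theorem, and
  \<open>y t\<close> is at most \<open>a\<close> divided by it.\<close>

lemma nonlinear_gronwall:
  fixes y G :: "real \<Rightarrow> real"
  assumes G: "\<And>s. 0 \<le> s \<Longrightarrow> s \<le> t \<Longrightarrow> (G has_real_derivative y s) (at s within {0..t})" and G0: "G 0 = 0"
    and y: "\<And>s. 0 \<le> s \<Longrightarrow> s \<le> t \<Longrightarrow> y s \<le> a * exp (k * G s)"
    and nn: "a \<ge> 0" "k \<ge> 0" "t \<ge> 0" and small: "k * a * t < 1"
  shows "y t \<le> a / (1 - k * a * t)"
proof -
  let ?Z = "\<lambda>s. exp (- k * G s)"
  have d: "(?Z has_derivative (\<lambda>h. (?Z s * (- k * y s)) * h)) (at s within {0..t})" if "0 \<le> s" "s \<le> t" for s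
  proof -
    have "(?Z has_real_derivative ?Z s * (- k * y s)) (at s within {0..t})"
      by (rule derivative_eq_intros G[OF that] refl)+ simp
    then show ?thesis unfolding has_field_derivative_def .
  qed
  obtain s where s: "s \<in> {0..t}" "?Z t - ?Z 0 = (?Z s * (- k * y s)) * (t - 0)"
    using mvt_very_simple[of 0 t ?Z "\<lambda>s h. (?Z s * (- k * y s)) * h"] d nn(3) by auto
  have "?Z s * y s \<le> ?Z s * (a * exp (k * G s))" using y s(1) by (intro mult_left_mono) auto
  also have "\<dots> = a" by (simp add: exp_minus)
  finally have "k * (?Z s * y s) * t \<le> k * a * t" using nn by (intro mult_right_mono mult_left_mono)
  then have Z: "1 - k * a * t \<le> ?Z t" using s(2) G0 by (simp add: mult_ac)
  have "y t \<le> a * exp (k * G t)" using y nn(3) by simp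
  also have "\<dots> = a / ?Z t" by (simp add: exp_minus field_simps)
  also have "\<dots> \<le> a / (1 - k * a * t)" using Z small nn(1) by (intro divide_left_mono) auto
  finally show ?thesis .
qed

context stein begin

lemma reg_mono: assumes "reg A \<phi> \<phi>'" "A \<le> B" shows "reg B \<phi> \<phi>'"
  by (rule regI[OF wlip_mono[OF reg_wlip[OF assms(1)] assms(2)] reg_has_derivative[OF assms(1)] gr_cont[OF reg_gr[OF assms(1)]]])

lemma dlip_mono: assumes "dlip D \<phi>'" "D \<le> E" shows "dlip E \<phi>'"
  unfolding dlip_def
proof (intro allI)
  fix x z v :: 'a
  have "D * (max (w x) (w z) * norm (x - z) * norm v) \<le> E * (max (w x) (w z) * norm (x - z) * norm v)"
    using assms(2) max_w_pos(2) by (intro mult_right_mono) auto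
  then show "\<bar>\<phi>' x v - \<phi>' z v\<bar> \<le> E * max (w x) (w z) * norm (x - z) * norm v"
    using assms(1) unfolding dlip_def by (simp add: mult.assoc) (meson order_trans)
qed

end

section \<open>The backward iteration\<close>

context stein_flow begin

context
  fixes T m P D0 C1 \<epsilon> Lq :: real and f :: "'a \<Rightarrow> real" and f' and q q' and G :: "real \<Rightarrow> real"
  assumes T: "T > 0" and m: "m \<ge> 1" and mass_le: "\<And>t. 0 \<le> t \<Longrightarrow> t \<le> T \<Longrightarrow> mass (\<rho> t) \<le> m"
    and f: "reg P f f'" "dlip D0 f'" "D0 \<ge> 0"
    and C1: "C1 \<ge> 0" "\<And>A D \<phi> \<phi>' a b. reg A \<phi> \<phi>' \<Longrightarrow> dlip D \<phi>' \<Longrightarrow> A \<le> D \<Longrightarrow> 0 \<le> a \<Longrightarrow> a \<le> b \<Longrightarrow> b \<le> T \<Longrightarrow>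
      \<bar>(\<integral>x. \<phi> x \<partial>\<rho> b) - (\<integral>x. \<phi> x \<partial>\<rho> a) + (b - a) * (\<integral>x. \<phi>' x (vel (\<rho> a) x) \<partial>\<rho> a)\<bar> \<le> C1 * D * (b - a)\<^sup>2"
    and q: "qreg Lq q q'" and \<epsilon>: "\<And>x. norm (q x - grad V x) \<le> \<epsilon> * w x"
    and G: "\<And>t. 0 \<le> t \<Longrightarrow> t \<le> T \<Longrightarrow> (G has_real_derivative dst (\<rho> t)) (at t within {0..T})"
begin

text \<open>Crude constants, which may depend on \<open>T\<close>, \<open>m\<close> and
  \<open>f\<close>: they reach the final estimate only with a factor \<open>\<delta>\<close> or
  \<open>\<epsilon>\<close>. \<open>Pm\<close> and \<open>Dm\<close> bound the weighted Lipschitz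
  constants of all iterates and of their gradients. \<open>Ca\<close> and \<open>Cc\<close>, the
  factors of \<open>\<epsilon>\<close>, must not involve \<open>Lq\<close>, since \<open>Lq\<close>
  depends on \<open>\<epsilon>\<close>; \<open>Cb\<close> and \<open>Cd\<close>, the factors of
  \<open>\<delta>\<close>, may.\<close>

definition Ly where "Ly = lt m * 2 * c"
definition bm where "bm = cv * (dst (\<rho> 0) + Ly * T)"
definition Pm where "Pm = exp (T * ((c + 1) * bm + cl * M2)) * P"
definition Ca where "Ca = 2 * Pm * (c * Pm * mass \<gamma>) * M2\<^sup>2"
definition Cc where "Cc = (m + mass \<gamma>) * (c * Pm * mass \<gamma>)"
definition Cdlip where "Cdlip = Pm * (exp (c * bm) * (2 * c * c * m) + (c + 4 * c * Lq) * mass \<gamma>)"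
definition Dm where "Dm = exp (T * ((c + 2) * bm)) * (D0 + T * Cdlip) + Pm"
definition Crm where "Crm = Dm * exp (c * bm) * bm\<^sup>2"
definition Pcm where "Pcm = Pm * bm + cl * (Pm * M2)"
definition Cb where "Cb = (Pcm\<^sup>2 + Crm\<^sup>2 + 2 * Crm * (Pm + Pcm)) * M2\<^sup>2"
definition Cd where "Cd = (m + mass \<gamma>) * Crm + C1 * Dm"

lemma Ly_nonneg: "Ly \<ge> 0" unfolding Ly_def using lt_nonneg[OF T m mass_le] c_nonneg by simp

lemma bm_nonneg: "bm \<ge> 0"
  unfolding bm_def using cv_nonneg Ly_nonneg T dst_nonneg[OF adm_rho[of 0]] by simp

lemma dst_le_bm: "0 \<le> t \<Longrightarrow> t \<le> T \<Longrightarrow> cv * dst (\<rho> t) \<le> bm"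
proof -
  assume t: "0 \<le> t" "t \<le> T"
  have "dst (\<rho> t) \<le> dst (\<rho> 0) + Ly * \<bar>t - 0\<bar>"
    unfolding Ly_def by (rule dst_lipschitz_in_time[OF T m mass_le]) (use t T in auto)
  also have "\<dots> \<le> dst (\<rho> 0) + Ly * T" using t Ly_nonneg by (simp add: mult_left_mono)
  finally show ?thesis unfolding bm_def by (rule mult_left_mono) (rule cv_nonneg)
qed

lemma P_nonneg: "P \<ge> 0" by (rule reg_nonneg[OF f(1)])
lemma Pm_nonneg: "Pm \<ge> 0" unfolding Pm_def using P_nonneg by simp
lemma Lq_nonneg: "Lq \<ge> 0" by (rule qregD(7)[OF q])
lemma Cdlip_nonneg: "Cdlip \<ge> 0"
  unfolding Cdlip_def using Pm_nonneg c_nonneg m Lq_nonneg mass_nonneg[of \<gamma>] by (intro mult_nonneg_nonneg add_nonneg_nonneg) auto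
lemma Dm_ge: "Pm \<le> Dm" "Dm \<ge> 0" "exp (T * ((c + 2) * bm)) * (D0 + T * Cdlip) \<le> Dm"
  unfolding Dm_def using Pm_nonneg f(3) T Cdlip_nonneg by (auto intro!: add_nonneg_nonneg mult_nonneg_nonneg)

lemma \<epsilon>_nonneg: "\<epsilon> \<ge> 0"
  using order_trans[OF norm_ge_zero \<epsilon>[of 0]] w_pos[of 0] by (simp add: zero_le_mult_iff)

context
  fixes N :: nat and \<delta> :: real
  assumes N: "N \<ge> 1" and \<delta>: "\<delta> = T / real N" "\<delta> \<le> 1"
begin

lemma \<delta>_pos: "\<delta> > 0" and N\<delta>: "real N * \<delta> = T"
  using N T by (auto simp: \<delta>)

text \<open>Time runs backwards: step \<open>j\<close> covers the interval from \<open>tau j\<close>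
  to \<open>T - j \<delta>\<close>, and velocity and distance are evaluated at its left end, hence
  \<open>Suc j\<close>.\<close>

definition tau where "tau j = T - real (Suc j) * \<delta>"

lemma tau: assumes "j < N" shows "0 \<le> tau j" "tau j + \<delta> = T - real j * \<delta>" "tau j \<le> tau j + \<delta>" "tau j + \<delta> \<le> T" "tau j \<le> T"
proof -
  have "real (Suc j) * \<delta> \<le> real N * \<delta>" using assms \<delta>_pos by (intro mult_right_mono) auto
  then show "0 \<le> tau j" by (simp add: tau_def N\<delta>)
  have "0 \<le> real j * \<delta>" using \<delta>_pos by simp
  then show "tau j + \<delta> = T - real j * \<delta>" "tau j \<le> tau j + \<delta>" "tau j + \<delta> \<le> T" "tau j \<le> T"
    using \<delta>_pos by (auto simp: tau_def algebra_simps)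
qed

definition it where
  "it = rec_nat (f, f') (\<lambda>j p. (step (\<rho> (tau j)) \<delta> (fst p) (snd p) q, dstep (\<rho> (tau j)) \<delta> (snd p) q q'))"

definition y where "y j = dst (\<rho> (tau j))"

text \<open>The recursion keeps the actual distance \<open>y j\<close> and the actual L2 norm of the
  iterate, so it can be read twice: crudely in \<open>pj_le\<close>, for the error constants, and
  sharply in \<open>pj_N\<close>, for the final estimate.\<close>

definition pj where
  "pj = rec_nat P (\<lambda>j p. p * exp ((c + 1) * (\<delta> * (cv * y j))) + \<delta> * (cl * l2 (fst (it j))))"

definition dj where
  "dj = rec_nat D0 (\<lambda>j d. d * exp ((c + 2) * (\<delta> * (cv * y j)))
     + \<delta> * (pj j * (exp (c * \<delta> * (cv * y j)) * (2 * c * c * mass (\<rho> (tau j))) + (c + 4 * c * Lq) * mass \<gamma>)))"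

lemma it_0: "it 0 = (f, f')" and it_Suc: "it (Suc j) = (step (\<rho> (tau j)) \<delta> (fst (it j)) (snd (it j)) q, dstep (\<rho> (tau j)) \<delta> (snd (it j)) q q')"
  by (simp_all add: it_def)

lemma pj_0: "pj 0 = P" and pj_Suc: "pj (Suc j) = pj j * exp ((c + 1) * (\<delta> * (cv * y j))) + \<delta> * (cl * l2 (fst (it j)))"
  by (simp_all add: pj_def)

lemma dj_0: "dj 0 = D0" and dj_Suc: "dj (Suc j) = dj j * exp ((c + 2) * (\<delta> * (cv * y j)))
     + \<delta> * (pj j * (exp (c * \<delta> * (cv * y j)) * (2 * c * c * mass (\<rho> (tau j))) + (c + 4 * c * Lq) * mass \<gamma>))"
  by (simp_all add: dj_def)

lemma invariant: "j \<le> N \<Longrightarrow> reg (pj j) (fst (it j)) (snd (it j)) \<and> dlip (dj j) (snd (it j)) \<and> dj j \<ge> 0"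
proof (induction j)
  case 0
  then show ?case using f by (simp add: it_0 pj_0 dj_0)
next
  case (Suc j)
  then have jN: "j < N" and r: "reg (pj j) (fst (it j)) (snd (it j))" and d: "dlip (dj j) (snd (it j))" "dj j \<ge> 0" by auto
  have a: "adm (\<rho> (tau j))" by (rule adm_rho[OF tau(1)[OF jN]])
  have \<delta>0: "0 \<le> \<delta>" using \<delta>_pos by simp
  \<comment> \<open>Here \<open>b\<close> is \<open>cv * y j\<close> itself, so that the growth
    factors match the recursions of \<open>pj\<close> and \<open>dj\<close>.\<close>
  note st = a \<delta>0 \<delta>(2) eq_refl[OF refl] r d q
  have "0 \<le> dj (Suc j)"
    unfolding dj_Suc using d(2) \<delta>0 reg_nonneg[OF r] c_nonneg mass_nonneg Lq_nonneg
    by (intro add_nonneg_nonneg mult_nonneg_nonneg) auto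
  then show ?case
    using reg_step[OF st] dlip_step[OF st] by (simp add: it_Suc pj_Suc dj_Suc y_def)
qed

lemma y_bounds: "j < N \<Longrightarrow> 0 \<le> y j" "j < N \<Longrightarrow> cv * y j \<le> bm"
  unfolding y_def using dst_nonneg[OF adm_rho[OF tau(1)]] dst_le_bm tau by auto

text \<open>The L2 norm is at most \<open>M2\<close> times the weighted Lipschitz constant, which
  closes the recursion at the price of a rate \<open>cl * M2\<close> that does not vanish with the
  distance.\<close>

lemma pj_le: assumes "j \<le> N" shows "pj j \<le> Pm"
proof -
  let ?C4 = "(c + 1) * bm + cl * M2"
  have C4: "?C4 \<ge> 0" using c_nonneg bm_nonneg cl_nonneg M2_ge_1 by simp
  have step: "pj (Suc i) \<le> exp (\<delta> * ?C4) * pj i + \<delta> * 0" if i: "i < N" for i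
  proof -
    have r: "reg (pj i) (fst (it i)) (snd (it i))" using invariant i by simp
    have p0: "pj i \<ge> 0" by (rule reg_nonneg[OF r])
    have e: "exp ((c + 1) * (\<delta> * (cv * y i))) \<le> exp ((c + 1) * (\<delta> * bm))"
      using y_bounds(2)[OF i] \<delta>_pos c_nonneg by (simp add: mult_left_mono)
    have e1: "1 \<le> exp ((c + 1) * (\<delta> * bm))" using \<delta>_pos c_nonneg bm_nonneg by simp
    have cm: "0 \<le> \<delta> * (cl * M2)" using \<delta>_pos cl_nonneg M2_ge_1 by simp
    have "pj (Suc i) \<le> pj i * exp ((c + 1) * (\<delta> * bm)) + \<delta> * (cl * (pj i * M2))"
      unfolding pj_Suc using e p0 \<delta>_pos l2_le[OF reg_wlip[OF r]] cl_nonneg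
      by (intro add_mono mult_left_mono) auto
    also have "\<dots> \<le> pj i * exp ((c + 1) * (\<delta> * bm)) + (\<delta> * (cl * M2)) * (pj i * exp ((c + 1) * (\<delta> * bm)))"
      using mult_left_mono[OF mult_left_mono[OF e1 p0] cm] by (simp add: mult_ac)
    also have "\<dots> = pj i * exp ((c + 1) * (\<delta> * bm)) * (1 + \<delta> * (cl * M2))" by (simp add: algebra_simps)
    also have "\<dots> \<le> pj i * exp ((c + 1) * (\<delta> * bm)) * exp (\<delta> * (cl * M2))"
      using p0 by (intro mult_left_mono exp_ge_add_one_self) auto
    also have "\<dots> = exp (\<delta> * ?C4) * pj i" by (simp add: exp_add[symmetric] algebra_simps)
    finally show ?thesis by simp
  qed
  have "pj j \<le> exp (\<delta> * (\<Sum>i<j. ?C4)) * (pj 0 + real j * \<delta> * 0)"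
    by (rule discrete_gronwall[where a=pj and k="\<lambda>_. ?C4" and h=0, OF step C4 _ _ assms]) (use \<delta>_pos in auto)
  also have "\<dots> = exp ((real j * \<delta>) * ?C4) * P" by (simp add: pj_0 mult_ac)
  also have "\<dots> \<le> exp (T * ?C4) * P"
  proof (intro mult_right_mono P_nonneg)
    have "real j * \<delta> \<le> T" unfolding N\<delta>[symmetric] using assms \<delta>_pos by (intro mult_right_mono) auto
    then show "exp ((real j * \<delta>) * ?C4) \<le> exp (T * ?C4)" using C4 by (simp add: mult_right_mono)
  qed
  finally show ?thesis by (simp add: Pm_def)
qed

lemma dj_le: assumes "j \<le> N" shows "dj j \<le> Dm"
proof -
  let ?C = "(c + 2) * bm"
  have C0: "?C \<ge> 0" using c_nonneg bm_nonneg by simp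
  have step: "dj (Suc i) \<le> exp (\<delta> * ?C) * dj i + \<delta> * Cdlip" if i: "i < N" for i
  proof -
    have d0: "dj i \<ge> 0" and r: "reg (pj i) (fst (it i)) (snd (it i))" using invariant i by simp_all
    have b: "\<delta> * (cv * y i) \<le> \<delta> * bm" using y_bounds(2)[OF i] \<delta>_pos by simp
    have "(c + 2) * (\<delta> * (cv * y i)) \<le> \<delta> * ?C" using mult_left_mono[OF b, of "c + 2"] c_nonneg by (simp add: mult_ac)
    then have e: "exp ((c + 2) * (\<delta> * (cv * y i))) \<le> exp (\<delta> * ?C)" by simp
    have "\<delta> * (cv * y i) \<le> 1 * bm"
      using order_trans[OF b mult_right_mono[OF \<delta>(2) bm_nonneg]] by simp
    from mult_left_mono[OF this c_nonneg] have e2: "exp (c * \<delta> * (cv * y i)) \<le> exp (c * bm)" by (simp add: mult.assoc)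
    have mm: "mass (\<rho> (tau i)) \<le> m" by (rule mass_le[OF tau(1)[OF i] tau(5)[OF i]])
    have "pj i * (exp (c * \<delta> * (cv * y i)) * (2 * c * c * mass (\<rho> (tau i))) + (c + 4 * c * Lq) * mass \<gamma>) \<le> Cdlip"
      unfolding Cdlip_def
    proof (rule mult_mono[OF pj_le])
      show "exp (c * \<delta> * (cv * y i)) * (2 * c * c * mass (\<rho> (tau i))) + (c + 4 * c * Lq) * mass \<gamma>
         \<le> exp (c * bm) * (2 * c * c * m) + (c + 4 * c * Lq) * mass \<gamma>"
        using mm e2 mass_nonneg c_nonneg by (intro add_right_mono mult_mono mult_left_mono) auto
      show "0 \<le> exp (c * \<delta> * (cv * y i)) * (2 * c * c * mass (\<rho> (tau i))) + (c + 4 * c * Lq) * mass \<gamma>"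
        using mass_nonneg c_nonneg Lq_nonneg by (intro add_nonneg_nonneg mult_nonneg_nonneg) auto
    qed (use i Pm_nonneg in auto)
    then show ?thesis unfolding dj_Suc using mult_left_mono[OF e d0] \<delta>_pos
      by (intro add_mono mult_left_mono) (auto simp: mult.commute)
  qed
  have "dj j \<le> exp (\<delta> * (\<Sum>i<j. ?C)) * (dj 0 + real j * \<delta> * Cdlip)"
    by (rule discrete_gronwall[where a=dj and k="\<lambda>_. ?C" and h=Cdlip, OF step C0 _ _ assms]) (use \<delta>_pos Cdlip_nonneg in auto)
  also have "\<dots> = exp ((real j * \<delta>) * ?C) * (D0 + (real j * \<delta>) * Cdlip)" by (simp add: dj_0 mult_ac)
  also have "\<dots> \<le> exp (T * ?C) * (D0 + T * Cdlip)"
  proof -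
    have "real j * \<delta> \<le> T" unfolding N\<delta>[symmetric] using assms \<delta>_pos by (intro mult_right_mono) auto
    then show ?thesis using C0 Cdlip_nonneg \<delta>_pos f(3)
      by (intro mult_mono add_left_mono mult_right_mono add_nonneg_nonneg) (auto intro!: mult_right_mono)
  qed
  finally show ?thesis using Dm_ge(3) by linarith
qed

lemma uniform: "j \<le> N \<Longrightarrow> reg Pm (fst (it j)) (snd (it j))" "j \<le> N \<Longrightarrow> dlip Dm (snd (it j))"
  using invariant[of j] reg_mono[OF _ pj_le] dlip_mono[OF _ dj_le] by auto

definition S where "S = \<delta> * (\<Sum>j<N. y j)"

text \<open>By the mean value theorem the increment of \<open>G\<close> over a step is
  \<open>\<delta>\<close> times the distance at some time within it, and the distance varies there
  by at most \<open>Ly * \<delta>\<close>. The increments telescope.\<close>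

lemma S_le: "S \<le> (G T - G 0) + \<delta> * (Ly * T)"
proof -
  have st: "\<delta> * y j \<le> (G (T - real j * \<delta>) - G (T - real (Suc j) * \<delta>)) + \<delta> * (Ly * \<delta>)" if j: "j < N" for j
  proof -
    have d: "(G has_derivative (\<lambda>h. dst (\<rho> t) * h)) (at t within {tau j..tau j + \<delta>})" if "tau j \<le> t" "t \<le> tau j + \<delta>" for t
    proof -
      have "(G has_derivative (\<lambda>h. dst (\<rho> t) * h)) (at t within {0..T})"
        using G[of t] that tau[OF j] by (simp add: has_field_derivative_def)
      then show ?thesis by (rule has_derivative_subset) (use tau[OF j] in auto)
    qed
    obtain t where t: "t \<in> {tau j..tau j + \<delta>}" "G (tau j + \<delta>) - G (tau j) = dst (\<rho> t) * (tau j + \<delta> - tau j)"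
      using mvt_very_simple[OF tau(3)[OF j] d] by auto
    have "y j \<le> dst (\<rho> t) + Ly * \<bar>tau j - t\<bar>"
      unfolding y_def Ly_def by (rule dst_lipschitz_in_time[OF T m mass_le]) (use t(1) tau(1,4,5)[OF j] in auto)
    also have "\<dots> \<le> dst (\<rho> t) + Ly * \<delta>" using t(1) Ly_nonneg by (intro add_left_mono mult_left_mono) auto
    finally have "\<delta> * y j \<le> \<delta> * (dst (\<rho> t) + Ly * \<delta>)" using \<delta>_pos by (intro mult_left_mono) auto
    also have "\<dots> = (G (tau j + \<delta>) - G (tau j)) + \<delta> * (Ly * \<delta>)" unfolding t(2) by (simp add: algebra_simps)
    finally show ?thesis unfolding tau(2)[OF j] unfolding tau_def .
  qed
  have "S \<le> (\<Sum>j<N. (G (T - real j * \<delta>) - G (T - real (Suc j) * \<delta>)) + \<delta> * (Ly * \<delta>))"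
    unfolding S_def sum_distrib_left by (rule sum_mono) (use st in auto)
  also have "\<dots> = (G T - G (T - real N * \<delta>)) + real N * (\<delta> * (Ly * \<delta>))"
    using sum_lessThan_telescope'[of "\<lambda>j. G (T - real j * \<delta>)" N] by (simp add: sum.distrib)
  also have "\<dots> = (G T - G 0) + \<delta> * (Ly * T)" using N\<delta> by (simp add: mult_ac)
  finally show ?thesis .
qed

lemma sum_y_le: "n \<le> N \<Longrightarrow> \<delta> * (\<Sum>j<n. y j) \<le> S"
  unfolding S_def using \<delta>_pos y_bounds(1) by (intro mult_left_mono sum_mono2) auto

text \<open>Here dissipativity pays off: apart from the error terms, the L2 norm of the iterates
  grows only at the rate \<open>ch * y\<close>, so the length of the time interval matters only
  through the integral of the distance.\<close>

lemma l2_it: assumes "n \<le> N" shows "(l2 (fst (it n)))\<^sup>2 \<le> exp (ch * S) * ((P * M2)\<^sup>2 + T * (\<epsilon> * Ca + \<delta> * Cb))"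
proof -
  have Ca0: "Ca \<ge> 0" unfolding Ca_def using Pm_nonneg c_nonneg mass_nonneg by simp
  have Crm0: "Crm \<ge> 0" unfolding Crm_def using Dm_ge(2) by simp
  have Pcm0: "Pcm \<ge> 0" unfolding Pcm_def using Pm_nonneg bm_nonneg cl_nonneg M2_ge_1 by simp
  have Cb0: "Cb \<ge> 0" unfolding Cb_def using Crm0 Pcm0 Pm_nonneg by simp
  have h0: "0 \<le> \<epsilon> * Ca + \<delta> * Cb" using Ca0 Cb0 \<epsilon>_nonneg \<delta>_pos by simp
  have step: "(l2 (fst (it (Suc j))))\<^sup>2 \<le> exp (\<delta> * (ch * y j)) * (l2 (fst (it j)))\<^sup>2 + \<delta> * (\<epsilon> * Ca + \<delta> * Cb)" if j: "j < N" for j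
  proof -
    have \<delta>0: "0 \<le> \<delta>" using \<delta>_pos by simp
    \<comment> \<open>Now \<open>b\<close> is the time-uniform \<open>bm\<close>, and the iterates
      enter with \<open>Pm\<close> and \<open>Dm\<close>, so that the errors do not depend on
      \<open>j\<close>.\<close>
    note st = adm_rho[OF tau(1)[OF j]] \<delta>0 \<delta>(2) dst_le_bm[OF tau(1)[OF j] tau(5)[OF j]]
      uniform(1)[OF less_imp_le[OF j]] uniform(2)[OF less_imp_le[OF j]] Dm_ge(2) q
    have Cr: "Cr bm Dm = Crm" unfolding Crm_def by (rule Cr_def[OF st])
    have Pc: "Pc bm Pm = Pcm" unfolding Pcm_def by (rule Pc_def[OF st \<epsilon>])
    have "(l2 (fst (it (Suc j))))\<^sup>2 \<le> (1 + \<delta> * (ch * y j)) * (l2 (fst (it j)))\<^sup>2 + \<delta> * (\<epsilon> * Ca) + \<delta>\<^sup>2 * Cb"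
      using energy_step[OF st \<epsilon>] unfolding Cr Pc by (simp add: it_Suc y_def Ca_def Cb_def)
    also have "(1 + \<delta> * (ch * y j)) * (l2 (fst (it j)))\<^sup>2 \<le> exp (\<delta> * (ch * y j)) * (l2 (fst (it j)))\<^sup>2"
      by (intro mult_right_mono exp_ge_add_one_self) simp
    finally show ?thesis by (simp add: algebra_simps power2_eq_square)
  qed
  have k: "0 \<le> ch * y j" if "j < N" for j using ch_nonneg y_bounds(1)[OF that] by simp
  have "(l2 (fst (it n)))\<^sup>2 \<le> exp (\<delta> * (\<Sum>j<n. ch * y j)) * ((l2 (fst (it 0)))\<^sup>2 + real n * \<delta> * (\<epsilon> * Ca + \<delta> * Cb))"
    by (rule discrete_gronwall[where a="\<lambda>n. (l2 (fst (it n)))\<^sup>2" and k="\<lambda>j. ch * y j" and h="\<epsilon> * Ca + \<delta> * Cb", OF step k _ h0 assms]) (use \<delta>_pos in auto)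
  also have "\<dots> \<le> exp (ch * S) * ((P * M2)\<^sup>2 + T * (\<epsilon> * Ca + \<delta> * Cb))"
  proof (rule mult_mono[OF _ add_mono])
    show "exp (\<delta> * (\<Sum>j<n. ch * y j)) \<le> exp (ch * S)"
      using mult_left_mono[OF sum_y_le[OF assms] ch_nonneg] by (simp add: sum_distrib_left[symmetric] mult_ac)
    show "(l2 (fst (it 0)))\<^sup>2 \<le> (P * M2)\<^sup>2"
      using l2_le[OF reg_wlip[OF f(1)]] l2_nonneg by (simp add: it_0 power_mono)
    have "real n * \<delta> \<le> T" unfolding N\<delta>[symmetric] using assms \<delta>_pos by (intro mult_right_mono) auto
    then show "real n * \<delta> * (\<epsilon> * Ca + \<delta> * Cb) \<le> T * (\<epsilon> * Ca + \<delta> * Cb)" using h0 by (rule mult_right_mono)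
    show "0 \<le> (l2 (fst (it 0)))\<^sup>2 + real n * \<delta> * (\<epsilon> * Ca + \<delta> * Cb)" using h0 \<delta>_pos by simp
  qed simp
  finally show ?thesis .
qed

text \<open>With the L2 norm already controlled, the contribution of \<open>L\<close> is a forcing
  term of fixed size per unit time instead of a growth rate; it adds up to a multiple of
  \<open>T\<close>, not to an exponential.\<close>

lemma pj_N: "pj N \<le> exp ((c + 1) * cv * S) * (P + T * (cl * sqrt (exp (ch * S) * ((P * M2)\<^sup>2 + T * (\<epsilon> * Ca + \<delta> * Cb)))))"
proof -
  let ?\<Lambda> = "sqrt (exp (ch * S) * ((P * M2)\<^sup>2 + T * (\<epsilon> * Ca + \<delta> * Cb)))"
  have l: "l2 (fst (it j)) \<le> ?\<Lambda>" if "j \<le> N" for j using l2_it[OF that] by (rule real_le_rsqrt)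
  have \<Lambda>0: "?\<Lambda> \<ge> 0" by (rule order_trans[OF l2_nonneg l[of 0]]) simp
  have step: "pj (Suc j) \<le> exp (\<delta> * ((c + 1) * (cv * y j))) * pj j + \<delta> * (cl * ?\<Lambda>)" if j: "j < N" for j
  proof -
    have "\<delta> * (cl * l2 (fst (it j))) \<le> \<delta> * (cl * ?\<Lambda>)"
      using l[of j] j \<delta>_pos cl_nonneg by (intro mult_left_mono) auto
    then show ?thesis by (simp add: pj_Suc mult_ac)
  qed
  have k: "0 \<le> (c + 1) * (cv * y j)" if "j < N" for j using c_nonneg cv_nonneg y_bounds(1)[OF that] by simp
  have "pj N \<le> exp (\<delta> * (\<Sum>j<N. (c + 1) * (cv * y j))) * (pj 0 + real N * \<delta> * (cl * ?\<Lambda>))"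
    by (rule discrete_gronwall[where a=pj and k="\<lambda>j. (c + 1) * (cv * y j)" and h="cl * ?\<Lambda>", OF step k _ _ order_refl]) (use \<delta>_pos cl_nonneg \<Lambda>0 in auto)
  also have "\<delta> * (\<Sum>j<N. (c + 1) * (cv * y j)) = (c + 1) * cv * S"
    by (simp add: S_def sum_distrib_left mult_ac)
  finally show ?thesis unfolding pj_0 N\<delta> .
qed

text \<open>Links the claim, \<open>j = 0\<close> at time \<open>T\<close>, with the initial datum,
  \<open>j = N\<close> at time 0.\<close>

definition X where "X j = (\<integral>x. fst (it j) x \<partial>\<rho> (T - real j * \<delta>)) - (\<integral>x. fst (it j) x \<partial>\<gamma>)"

text \<open>\<open>dual_step\<close> leaves over the transport term at \<open>tau j\<close>, and the
  evolution of the solution from \<open>tau j\<close> to \<open>tau j + \<delta>\<close> produces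
  the same term through \<open>C1\<close>; the two cancel.\<close>

lemma X_step: assumes j: "j < N" shows "\<bar>X (Suc j) - X j\<bar> \<le> \<delta> * (\<epsilon> * Cc + \<delta> * Cd)"
proof -
  have \<delta>0: "0 \<le> \<delta>" using \<delta>_pos by simp
  note u = uniform(1)[OF less_imp_le[OF j]] uniform(2)[OF less_imp_le[OF j]]
  note st = adm_rho[OF tau(1)[OF j]] \<delta>0 \<delta>(2) dst_le_bm[OF tau(1)[OF j] tau(5)[OF j]] u Dm_ge(2) q
  have Cr: "Cr bm Dm = Crm" unfolding Crm_def by (rule Cr_def[OF st])
  have Crm0: "Crm \<ge> 0" unfolding Crm_def using Dm_ge(2) by simp
  let ?\<phi> = "fst (it j)" and ?I = "\<integral>x. snd (it j) x (vel (\<rho> (tau j)) x) \<partial>\<rho> (tau j)"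
  have t1: "T - real (Suc j) * \<delta> = tau j" by (simp add: tau_def)
  have 1: "\<bar>X (Suc j) - ((\<integral>x. ?\<phi> x \<partial>\<rho> (tau j)) - (\<integral>x. ?\<phi> x \<partial>\<gamma>) - \<delta> * ?I)\<bar>
      \<le> (mass (\<rho> (tau j)) + mass \<gamma>) * (\<delta>\<^sup>2 * Crm + \<delta> * (\<epsilon> * (c * Pm * mass \<gamma>)))"
    using dual_step[OF st \<epsilon>] unfolding Cr X_def t1 it_Suc by simp
  also have "\<dots> \<le> (m + mass \<gamma>) * (\<delta>\<^sup>2 * Crm + \<delta> * (\<epsilon> * (c * Pm * mass \<gamma>)))"
    using mass_le[OF tau(1)[OF j] tau(5)[OF j]] Crm0 \<delta>0 \<epsilon>_nonneg c_nonneg Pm_nonneg mass_nonneg[of \<gamma>]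
    by (intro mult_right_mono) auto
  finally have 1: "\<bar>X (Suc j) - ((\<integral>x. ?\<phi> x \<partial>\<rho> (tau j)) - (\<integral>x. ?\<phi> x \<partial>\<gamma>) - \<delta> * ?I)\<bar>
      \<le> (m + mass \<gamma>) * (\<delta>\<^sup>2 * Crm + \<delta> * (\<epsilon> * (c * Pm * mass \<gamma>)))" .
  have 2: "\<bar>(\<integral>x. ?\<phi> x \<partial>\<rho> (tau j + \<delta>)) - (\<integral>x. ?\<phi> x \<partial>\<rho> (tau j)) + \<delta> * ?I\<bar> \<le> C1 * Dm * \<delta>\<^sup>2"
    using C1(2)[OF u Dm_ge(1) tau(1,3,4)[OF j]] by simp
  have "\<bar>X (Suc j) - X j\<bar> \<le> (m + mass \<gamma>) * (\<delta>\<^sup>2 * Crm + \<delta> * (\<epsilon> * (c * Pm * mass \<gamma>))) + C1 * Dm * \<delta>\<^sup>2"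
    using 1 2 unfolding X_def[of j] tau(2)[OF j, symmetric] by linarith
  also have "\<dots> = \<delta> * (\<epsilon> * Cc + \<delta> * Cd)" by (simp add: Cc_def Cd_def algebra_simps power2_eq_square)
  finally show ?thesis .
qed

lemma discrete_estimate:
  "\<bar>(\<integral>x. f x \<partial>\<rho> T) - (\<integral>x. f x \<partial>\<gamma>)\<bar> \<le>
    (1 + c) * (exp ((c + 1) * cv * ((G T - G 0) + \<delta> * (Ly * T))) *
      (P + T * (cl * sqrt (exp (ch * ((G T - G 0) + \<delta> * (Ly * T))) * ((P * M2)\<^sup>2 + T * (\<epsilon> * Ca + \<delta> * Cb)))))) * dst (\<rho> 0)
    + T * (\<epsilon> * Cc + \<delta> * Cd)"
proof -
  let ?S = "(G T - G 0) + \<delta> * (Ly * T)"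
  have "\<bar>X n - X 0\<bar> \<le> real n * (\<delta> * (\<epsilon> * Cc + \<delta> * Cd))" if "n \<le> N" for n
    using that
  proof (induction n)
    case (Suc n)
    then show ?case using X_step[of n] by (simp add: algebra_simps)
  qed simp
  from this[of N] have 1: "\<bar>X N - X 0\<bar> \<le> T * (\<epsilon> * Cc + \<delta> * Cd)" unfolding N\<delta>[symmetric] by (simp add: mult.assoc)
  have z: "T - real N * \<delta> = 0" using N\<delta> by simp
  have "\<bar>X N\<bar> \<le> (1 + c) * pj N * dst (\<rho> 0)"
    unfolding X_def z by (rule wlip_dst[OF adm_rho[OF order_refl] reg_wlip[OF conjunct1[OF invariant[OF order_refl]]]])
  also have "\<dots> \<le> (1 + c) * (exp ((c + 1) * cv * ?S) *
      (P + T * (cl * sqrt (exp (ch * ?S) * ((P * M2)\<^sup>2 + T * (\<epsilon> * Ca + \<delta> * Cb)))))) * dst (\<rho> 0)"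
  proof (intro mult_right_mono mult_left_mono order_trans[OF pj_N])
    have eta: "0 \<le> (P * M2)\<^sup>2 + T * (\<epsilon> * Ca + \<delta> * Cb)"
    proof -
      have "0 \<le> exp (ch * S) * ((P * M2)\<^sup>2 + T * (\<epsilon> * Ca + \<delta> * Cb))"
        by (rule order_trans[OF _ l2_it[OF le0]]) simp
      then show ?thesis by (simp add: zero_le_mult_iff)
    qed
    have "exp (ch * S) * ((P * M2)\<^sup>2 + T * (\<epsilon> * Ca + \<delta> * Cb)) \<le> exp (ch * ?S) * ((P * M2)\<^sup>2 + T * (\<epsilon> * Ca + \<delta> * Cb))"
      using mult_left_mono[OF S_le ch_nonneg] by (intro mult_right_mono eta) simp
    then have sq: "sqrt (exp (ch * S) * ((P * M2)\<^sup>2 + T * (\<epsilon> * Ca + \<delta> * Cb))) \<le> sqrt (exp (ch * ?S) * ((P * M2)\<^sup>2 + T * (\<epsilon> * Ca + \<delta> * Cb)))"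
      by simp
    have "(c + 1) * cv * S \<le> (c + 1) * cv * ?S" using S_le c_nonneg cv_nonneg by (intro mult_left_mono) auto
    then show "exp ((c + 1) * cv * S) * (P + T * (cl * sqrt (exp (ch * S) * ((P * M2)\<^sup>2 + T * (\<epsilon> * Ca + \<delta> * Cb)))))
      \<le> exp ((c + 1) * cv * ?S) * (P + T * (cl * sqrt (exp (ch * ?S) * ((P * M2)\<^sup>2 + T * (\<epsilon> * Ca + \<delta> * Cb)))))"
      using sq T cl_nonneg P_nonneg eta
      by (intro mult_mono add_left_mono mult_left_mono add_nonneg_nonneg mult_nonneg_nonneg) auto
  qed (use c_nonneg dst_nonneg[OF adm_rho[of 0]] in auto)
  finally have 2: "\<bar>X N\<bar> \<le> (1 + c) * (exp ((c + 1) * cv * ?S) *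
      (P + T * (cl * sqrt (exp (ch * ?S) * ((P * M2)\<^sup>2 + T * (\<epsilon> * Ca + \<delta> * Cb)))))) * dst (\<rho> 0)" .
  have "X 0 = (\<integral>x. f x \<partial>\<rho> T) - (\<integral>x. f x \<partial>\<gamma>)" by (simp add: X_def it_0)
  then show ?thesis using 1 2 by linarith
qed

end

text \<open>Only \<open>\<delta>\<close> tends to 0 here; \<open>\<epsilon>\<close>, and with it
  \<open>q\<close> and \<open>Lq\<close>, is still fixed.\<close>

lemma limit_estimate:
  "\<bar>(\<integral>x. f x \<partial>\<rho> T) - (\<integral>x. f x \<partial>\<gamma>)\<bar> \<le>
    (1 + c) * (exp ((c + 1) * cv * (G T - G 0)) *
      (P + T * (cl * sqrt (exp (ch * (G T - G 0)) * ((P * M2)\<^sup>2 + T * (\<epsilon> * Ca)))))) * dst (\<rho> 0) + T * (\<epsilon> * Cc)"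
proof -
  let ?d = "\<lambda>n. T / real (Suc n)"
  let ?R = "\<lambda>\<delta>. (1 + c) * (exp ((c + 1) * cv * ((G T - G 0) + \<delta> * (Ly * T))) *
      (P + T * (cl * sqrt (exp (ch * ((G T - G 0) + \<delta> * (Ly * T))) * ((P * M2)\<^sup>2 + T * (\<epsilon> * Ca + \<delta> * Cb)))))) * dst (\<rho> 0)
    + T * (\<epsilon> * Cc + \<delta> * Cd)"
  have d: "?d \<longlonglongrightarrow> 0" by real_asymp
  have "(\<lambda>n. ?R (?d n)) \<longlonglongrightarrow> ?R 0" by (intro tendsto_intros d)
  then have lim: "(\<lambda>n. ?R (?d n)) \<longlonglongrightarrow> (1 + c) * (exp ((c + 1) * cv * (G T - G 0)) *
      (P + T * (cl * sqrt (exp (ch * (G T - G 0)) * ((P * M2)\<^sup>2 + T * (\<epsilon> * Ca)))))) * dst (\<rho> 0) + T * (\<epsilon> * Cc)"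
    by simp
  obtain n0 :: nat where n0: "T \<le> real n0" using real_arch_simple by blast
  show ?thesis
  proof (rule LIMSEQ_le_const[OF lim], intro exI[of _ n0] allI impI)
    fix n assume "n \<ge> n0"
    then have "?d n \<le> 1" using n0 by simp
    then show "\<bar>(\<integral>x. f x \<partial>\<rho> T) - (\<integral>x. f x \<partial>\<gamma>)\<bar> \<le> ?R (?d n)"
      by (intro discrete_estimate[of "Suc n"]) auto
  qed
qed

end

end

section \<open>From test functions to the dual distance\<close>

context stein begin

text \<open>The exponents add up: \<open>(c + 1) * cv\<close> from the transport of the weighted
  Lipschitz constant, \<open>ch\<close> from the growth of the L2 norm.\<close>

definition rate where "rate = (c + 1) * cv + ch"
text \<open>\<open>1 + c\<close> turns a weighted Lipschitz constant into a multiple of the dual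
  distance, \<open>1 + cl * M2\<close> combines the transported function with the contribution of
  \<open>L\<close>, and \<open>4 * exp c * c\<close> is the weighted Lipschitz constant of the
  approximated test function: \<open>2 * c\<close> for \<open>\<phi> w\<close>, times
  \<open>2 * exp c\<close>.\<close>

definition lin_const where "lin_const = (1 + c) * (1 + cl * M2) * (4 * exp c * c)"

lemma rate_nonneg: "rate \<ge> 0" unfolding rate_def using c_nonneg cv_nonneg ch_nonneg by simp

lemma lin_const_ge_1: "lin_const \<ge> 1"
proof -
  have "1 * 1 * 1 \<le> (1 + c) * (1 + cl * M2) * (4 * exp c * c)"
  proof (intro mult_mono)
    have "1 \<le> exp c" using c_nonneg by simp
    then have "1 * 1 \<le> (4 * exp c) * c" using c_ge_1 by (intro mult_mono) linarith+
    then show "1 \<le> 4 * exp c * c" by simp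
  qed (use c_nonneg cl_nonneg M2_ge_1 in auto)
  then show ?thesis by (simp add: lin_const_def)
qed

end

context stein_flow begin

text \<open>Now \<open>\<epsilon>\<close> tends to 0; \<open>Ca\<close> and \<open>Cc\<close> are
  fixed before \<open>q\<close> is chosen. Of \<open>f\<close> only the weighted Lipschitz constant
  \<open>P\<close> survives, while \<open>D0\<close>, which depends on the smoothness of
  \<open>f\<close>, has vanished with \<open>\<delta>\<close>. This makes the estimate stable under
  approximation.\<close>

lemma dual_estimate:
  assumes T: "T > 0" and f: "test_function f" "wlip P f"
    and G: "\<And>t. 0 \<le> t \<Longrightarrow> t \<le> T \<Longrightarrow> (G has_real_derivative dst (\<rho> t)) (at t within {0..T})"
  shows "\<bar>(\<integral>x. f x \<partial>\<rho> T) - (\<integral>x. f x \<partial>\<gamma>)\<bar> \<le>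
    (1 + c) * (exp ((c + 1) * cv * (G T - G 0)) *
      (P + T * (cl * sqrt (exp (ch * (G T - G 0)) * (P * M2)\<^sup>2)))) * dst (\<rho> 0)"
proof -
  obtain m where m: "m \<ge> 1" "\<And>t. 0 \<le> t \<Longrightarrow> t \<le> T \<Longrightarrow> mass (\<rho> t) \<le> m" by (rule mass_rho[OF T]) blast
  obtain D0 where D0: "reg D0 f (\<lambda>x. frechet_derivative f (at x))" "dlip D0 (\<lambda>x. frechet_derivative f (at x))"
    by (rule test_function_reg[OF f(1)])
  show ?thesis
  proof (rule one_step[OF T m])
    fix C1 assume C1: "C1 \<ge> 0" "\<And>A D \<phi> \<phi>' a b. reg A \<phi> \<phi>' \<Longrightarrow> dlip D \<phi>' \<Longrightarrow> A \<le> D \<Longrightarrow> 0 \<le> a \<Longrightarrow> a \<le> b \<Longrightarrow> b \<le> T \<Longrightarrow>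
    \<bar>(\<integral>x. \<phi> x \<partial>\<rho> b) - (\<integral>x. \<phi> x \<partial>\<rho> a) + (b - a) * (\<integral>x. \<phi>' x (vel (\<rho> a) x) \<partial>\<rho> a)\<bar> \<le> C1 * D * (b - a)\<^sup>2"
    let ?Ca = "Ca T m P" and ?Cc = "Cc T m P"
    let ?R = "\<lambda>\<epsilon>. (1 + c) * (exp ((c + 1) * cv * (G T - G 0)) *
        (P + T * (cl * sqrt (exp (ch * (G T - G 0)) * ((P * M2)\<^sup>2 + T * (\<epsilon> * ?Ca)))))) * dst (\<rho> 0) + T * (\<epsilon> * ?Cc)"
    have le: "\<bar>(\<integral>x. f x \<partial>\<rho> T) - (\<integral>x. f x \<partial>\<gamma>)\<bar> \<le> ?R \<epsilon>" if e: "\<epsilon> > 0" for \<epsilon>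
    proof -
      obtain Lq q q' where q: "qreg Lq q q'" "\<And>x. norm (q x - grad V x) \<le> \<epsilon> * w x" by (rule qreg_exists[OF e]) blast
      show ?thesis
        by (rule limit_estimate[OF T m reg_test_function[OF f] D0(2) reg_nonneg[OF D0(1)] C1(1) _ q G])
          (assumption | rule C1(2))+
    qed
    have d: "(\<lambda>n. 1 / real (Suc n)) \<longlonglongrightarrow> 0" by real_asymp
    have "(\<lambda>n. ?R (1 / real (Suc n))) \<longlonglongrightarrow> ?R 0" by (intro tendsto_intros d)
    then have "\<bar>(\<integral>x. f x \<partial>\<rho> T) - (\<integral>x. f x \<partial>\<gamma>)\<bar> \<le> ?R 0"
      by (rule LIMSEQ_le_const) (intro exI allI impI le, simp)
    then show ?thesis by simp
  qed
qed

lemma dst_estimate: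
  assumes T: "T \<ge> 0"
    and G: "\<And>t. 0 \<le> t \<Longrightarrow> t \<le> T \<Longrightarrow> (G has_real_derivative dst (\<rho> t)) (at t within {0..T})"
  shows "dst (\<rho> T) \<le> lin_const * (1 + T) * dst (\<rho> 0) * exp (rate * (G T - G 0))"
proof (cases "T = 0")
  case True
  then show ?thesis using mult_right_mono[OF lin_const_ge_1 dst_nonneg[OF adm_rho[of 0]]] by simp
next
  case False
  then have T: "T > 0" using T by simp
  let ?I = "G T - G 0"
  obtain t where "t \<in> {0..T}" "?I = dst (\<rho> t) * (T - 0)"
    using mvt_very_simple[of 0 T G "\<lambda>t h. dst (\<rho> t) * h"] G T by (auto simp: has_field_derivative_def)
  then have I: "?I \<ge> 0" using dst_nonneg[OF adm_rho[of t]] T by simp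
  let ?P = "4 * exp c * c"
  let ?B = "(1 + c) * (exp ((c + 1) * cv * ?I) * (?P + T * (cl * sqrt (exp (ch * ?I) * (?P * M2)\<^sup>2)))) * dst (\<rho> 0)"
  have y0: "dst (\<rho> 0) \<ge> 0" by (rule dst_nonneg[OF adm_rho]) simp
  have "dst (\<rho> T) \<le> ?B"
  proof (rule dst_least)
    fix \<phi> :: "'a \<Rightarrow> real" assume b: "bl_norm \<phi> \<le> 1"
    have wl: "wlip (2 * c * 1) (\<lambda>x. \<phi> x * w x)" by (rule wlip_of_bl) (use b in auto)
    have lim: "(\<lambda>n. (\<integral>x. approx (\<lambda>x. \<phi> x * w x) n x \<partial>\<rho> T) - (\<integral>x. approx (\<lambda>x. \<phi> x * w x) n x \<partial>\<gamma>))
      \<longlonglongrightarrow> (\<integral>x. \<phi> x * w x \<partial>\<rho> T) - (\<integral>x. \<phi> x * w x \<partial>\<gamma>)"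
      by (intro tendsto_diff approx_integral_tendsto[OF _ wl] adm_gibbs adm_rho) (use T in simp)
    have wa: "wlip ?P (approx (\<lambda>x. \<phi> x * w x) n)" for n using wlip_approx[OF wl, of n] by (simp add: mult_ac)
    show "(\<integral>x. \<phi> x * w x \<partial>\<rho> T) - (\<integral>x. \<phi> x * w x \<partial>\<gamma>) \<le> ?B"
      using dual_estimate[OF T test_function_approx[OF wl] wa G] abs_le_D1
      by (intro LIMSEQ_le_const2[OF lim]) blast
  qed
  also have "?B \<le> (1 + c) * (exp ((c + 1) * cv * ?I) * ((1 + cl * M2) * ?P * (1 + T) * exp (ch * ?I))) * dst (\<rho> 0)"
  proof (intro mult_right_mono mult_left_mono y0)
    have P0: "?P \<ge> 0" using c_nonneg by simp
    have M0: "M2 \<ge> 0" using M2_ge_1 by simp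
    have e1: "1 \<le> exp (ch * ?I)" using ch_nonneg I by simp
    \<comment> \<open>The root would give half the exponent; enlarging it to the full
      \<open>ch * ?I\<close> lets a single exponential be factored out.\<close>
    have "exp (ch * ?I) * 1 \<le> exp (ch * ?I) * exp (ch * ?I)" using e1 by (intro mult_left_mono) auto
    then have "exp (ch * ?I) * (?P * M2)\<^sup>2 \<le> (exp (ch * ?I))\<^sup>2 * (?P * M2)\<^sup>2"
      by (intro mult_right_mono zero_le_power2) (simp add: power2_eq_square)
    also have "\<dots> = (exp (ch * ?I) * (?P * M2))\<^sup>2" by (simp add: power_mult_distrib)
    finally have "sqrt (exp (ch * ?I) * (?P * M2)\<^sup>2) \<le> sqrt ((exp (ch * ?I) * (?P * M2))\<^sup>2)" by (rule real_sqrt_le_mono)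
    also have "\<dots> = exp (ch * ?I) * (?P * M2)"
      by (rule real_sqrt_unique[OF refl]) (intro mult_nonneg_nonneg P0 M0 exp_ge_zero)
    finally have sq: "sqrt (exp (ch * ?I) * (?P * M2)\<^sup>2) \<le> exp (ch * ?I) * (?P * M2)" .
    have "?P + T * (cl * sqrt (exp (ch * ?I) * (?P * M2)\<^sup>2)) \<le> ?P * exp (ch * ?I) + T * (cl * (exp (ch * ?I) * (?P * M2)))"
    proof (intro add_mono)
      show "?P \<le> ?P * exp (ch * ?I)" using mult_left_mono[OF e1 P0] unfolding mult_1_right .
      show "T * (cl * sqrt (exp (ch * ?I) * (?P * M2)\<^sup>2)) \<le> T * (cl * (exp (ch * ?I) * (?P * M2)))"
        using T by (intro mult_left_mono sq cl_nonneg) simp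
    qed
    also have "\<dots> = (1 + T * (cl * M2)) * (?P * exp (ch * ?I))" by (simp add: algebra_simps)
    also have "\<dots> \<le> ((1 + cl * M2) * (1 + T)) * (?P * exp (ch * ?I))"
    proof (rule mult_right_mono)
      show "1 + T * (cl * M2) \<le> (1 + cl * M2) * (1 + T)" using cl_nonneg M0 T by (simp add: algebra_simps)
      show "0 \<le> ?P * exp (ch * ?I)" by (rule mult_nonneg_nonneg[OF P0 exp_ge_zero])
    qed
    finally show "?P + T * (cl * sqrt (exp (ch * ?I) * (?P * M2)\<^sup>2)) \<le> (1 + cl * M2) * ?P * (1 + T) * exp (ch * ?I)"
      by (simp only: mult_ac)
  qed (use c_nonneg in auto)
  also have "\<dots> = lin_const * (1 + T) * dst (\<rho> 0) * (exp ((c + 1) * cv * ?I) * exp (ch * ?I))"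
    by (simp add: lin_const_def mult_ac)
  also have "exp ((c + 1) * cv * ?I) * exp (ch * ?I) = exp (rate * ?I)"
    by (simp add: rate_def exp_add[symmetric] algebra_simps)
  finally show ?thesis .
qed

lemma dst_continuous:
  assumes T: "T > 0" shows "continuous_on {0..T} (\<lambda>t. dst (\<rho> t))"
proof -
  obtain m where m: "m \<ge> 1" "\<And>t. 0 \<le> t \<Longrightarrow> t \<le> T \<Longrightarrow> mass (\<rho> t) \<le> m" by (rule mass_rho[OF T]) blast
  note l = dst_lipschitz_in_time[OF T m]
  show ?thesis
  proof (rule lipschitz_on_continuous_on, rule lipschitz_onI)
    show "0 \<le> lt m * 2 * c" using lt_nonneg[OF T m] c_nonneg by simp
    show "dist (dst (\<rho> s)) (dst (\<rho> t)) \<le> lt m * 2 * c * dist s t" if "s \<in> {0..T}" "t \<in> {0..T}" for s t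
      using l[of s t] l[of t s] that by (auto simp: dist_real_def abs_le_iff abs_minus_commute)
  qed
qed

text \<open>One constant has to dominate both \<open>lin_const\<close> in the numerator and
  \<open>rate * lin_const\<close> in the denominator; \<open>(rate + 1) * lin_const\<close> does.
  \<open>G\<close> is the integral of the distance, differentiable because the distance is
  continuous in time.\<close>

lemma dst_le_while_small:
  assumes t: "t \<ge> 0" and small: "1 - (rate + 1) * lin_const * t * (t + 1) * dst (\<rho> 0) > 0"
  shows "dst (\<rho> t) \<le> (rate + 1) * lin_const * (t + 1) * dst (\<rho> 0) / (1 - (rate + 1) * lin_const * (t + 1) * t * dst (\<rho> 0))"
proof -
  let ?C = "(rate + 1) * lin_const" and ?y = "dst (\<rho> 0)"
  \<comment> \<open>The factor \<open>1 + s\<close> is frozen at the final time \<open>t\<close>,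
    since the Gronwall lemma asks for a constant; this produces the product
    \<open>(t + 1) * t\<close> in the denominator.\<close>
  let ?a = "lin_const * (t + 1) * ?y"
  define G where "G s = integral {0..s} (\<lambda>t. dst (\<rho> t))" for s
  have y0: "?y \<ge> 0" by (rule dst_nonneg[OF adm_rho]) simp
  have a0: "?a \<ge> 0" using lin_const_ge_1 t y0 by simp
  have G: "(G has_real_derivative dst (\<rho> s)) (at s within {0..t})" if "0 \<le> s" "s \<le> t" for s
  \<comment> \<open>For \<open>t = 0\<close> the interval is a single point, and every number is a
    derivative within it.\<close>
  proof (cases "t = 0")
    case True
    then show ?thesis using that by (simp add: has_field_derivative_def has_derivative_within_singleton_iff bounded_linear_mult_right)
  next
    case False
    then show ?thesis unfolding G_def[abs_def]
      using integral_has_real_derivative[OF dst_continuous] that t by simp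
  qed
  have G0: "G 0 = 0" by (simp add: G_def)
  have y: "dst (\<rho> s) \<le> ?a * exp (rate * G s)" if s: "0 \<le> s" "s \<le> t" for s
  proof -
    have "dst (\<rho> s) \<le> lin_const * (1 + s) * ?y * exp (rate * (G s - G 0))"
    proof (rule dst_estimate[OF s(1)])
      show "(G has_real_derivative dst (\<rho> r)) (at r within {0..s})" if "0 \<le> r" "r \<le> s" for r
        using G[of r] s that by (auto intro: DERIV_subset)
    qed
    also have "\<dots> \<le> ?a * exp (rate * G s)"
      using s lin_const_ge_1 y0 unfolding G0 by (intro mult_mono mult_right_mono mult_left_mono) auto
    finally show ?thesis .
  qed
  have e: "rate * ?a * t \<le> ?C * (t + 1) * t * ?y"
  proof -
    have "rate * (?a * t) \<le> (rate + 1) * (?a * t)" using a0 t by (intro mult_right_mono) auto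
    then show ?thesis by (simp add: mult_ac)
  qed
  have small': "?C * (t + 1) * t * ?y < 1" using small by (simp add: mult_ac)
  have "dst (\<rho> t) \<le> ?a / (1 - rate * ?a * t)"
    by (rule nonlinear_gronwall[OF G G0 y a0 rate_nonneg t]) (use e small' in auto)
  also have "\<dots> \<le> (?C * (t + 1) * ?y) / (1 - ?C * (t + 1) * t * ?y)"
  proof (rule frac_le)
    have "1 * ?a \<le> (rate + 1) * ?a" using rate_nonneg a0 by (intro mult_right_mono) auto
    then show le: "?a \<le> ?C * (t + 1) * ?y" by (simp add: mult.assoc)
    show "0 \<le> ?C * (t + 1) * ?y" by (rule order_trans[OF a0 le])
  qed (use e small' a0 rate_nonneg in auto)
  finally show ?thesis .
qed

end

section \<open>The main estimate\<close>

theorem theorem1p2: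
  fixes K V :: "'a::euclidean_space \<Rightarrow> real"
  assumes K_nonneg: "\<And>x. K x \<ge> 0"
    and K_even: "\<And>x. K x = K (- x)"
    and K_posdef: "positive_definite_kernel K"
    and V_smooth: "smooth V"
    and V_nonneg: "\<And>x. V x \<ge> 0"
    and V_growth: "power_growth V"
    and K_continuous: "continuous_on UNIV K"
    and K_sobolev: "sobolev_inf 3 K"
    and BL1: "(SUP x. bl_norm (\<lambda>y. (grad V x /\<^sub>R (1 + V y)) \<bullet> grad K (x - y))) < \<infinity>"
    and BL2: "(SUP x. bl_norm (\<lambda>y. (grad V x \<bullet> grad V y) / (1 + V y) * K (x - y))) < \<infinity>"
  shows "\<exists>C>0. \<forall>\<rho>. measure_solution K V \<rho> \<longrightarrow>
    (\<forall>t\<ge>0. 1 - C * t * (t + 1) * blv_norm_diff V (\<rho> 0) (gibbs V) > 0 \<longrightarrow>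
       blv_norm_diff V (\<rho> t) (gibbs V)
         \<le> C * (t + 1) * blv_norm_diff V (\<rho> 0) (gibbs V)
             / (1 - C * (t + 1) * t * blv_norm_diff V (\<rho> 0) (gibbs V)))"
proof -
  interpret confining V using V_smooth V_nonneg V_growth by unfold_locales
  obtain K2 c1 where K2: "c1 \<ge> 1" "\<And>x. (K has_derivative (\<lambda>v. grad K x \<bullet> v)) (at x)"
    "\<And>x. (grad K has_derivative K2 x) (at x)" "\<And>x. \<bar>K x\<bar> \<le> c1" "\<And>x. norm (grad K x) \<le> c1"
    "\<And>x v. norm (K2 x v) \<le> c1 * norm v" "\<And>x z v. norm (K2 x v - K2 z v) \<le> c1 * norm (x - z) * norm v"
    using sobolev_3_imp_C21[OF K_continuous K_sobolev] by auto
  obtain c2 where c2: "c2 \<ge> 0" "\<And>x. norm (grad V x) \<le> c2 * w x" by (rule grad_V_bound) blast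
  obtain c3 where c3: "c3 \<ge> 0" "\<And>x v. norm (hess x v) \<le> c3 * w x * norm v" by (rule hess_bound) blast
  have fin: thesis if "s < \<infinity>" "\<And>r. 0 \<le> r \<Longrightarrow> s = ennreal r \<Longrightarrow> thesis" for s :: ennreal and thesis
    using that by (cases s) auto
  obtain c4 where c4: "c4 \<ge> 0" "(SUP x. bl_norm (\<lambda>y. (grad V x /\<^sub>R (1 + V y)) \<bullet> grad K (x - y))) = ennreal c4" by (rule fin[OF BL1])
  obtain c5 where c5: "c5 \<ge> 0" "(SUP x. bl_norm (\<lambda>y. (grad V x \<bullet> grad V y) / (1 + V y) * K (x - y))) = ennreal c5" by (rule fin[OF BL2])
  \<comment> \<open>The sum dominates every bound, as all summands are nonnegative. It is fixed
    before any solution is considered, so the final constant depends on \<open>K\<close> and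
    \<open>V\<close> only.\<close>
  define c where "c = c1 + c2 + c3 + c4 + c5"
  have le: "c1 \<le> c" "c2 \<le> c" "c3 \<le> c" "c4 \<le> c" "c5 \<le> c" using K2(1) c2 c3 c4 c5 by (simp_all add: c_def)
  interpret stein V K K2 c
  proof unfold_locales
    show "c \<ge> 1" using K2(1) le by simp
    show "norm (grad V x) \<le> c * w x" for x
      by (rule order_trans[OF c2(2) mult_right_mono[OF le(2) w_nonneg]])
    show "norm (hess x v) \<le> c * w x * norm v" for x v
      by (rule order_trans[OF c3(2) mult_right_mono[OF mult_right_mono[OF le(3) w_nonneg] norm_ge_zero]])
    show "\<bar>K x\<bar> \<le> c" "norm (grad K x) \<le> c" for x using K2(4)[of x] K2(5)[of x] le by simp_all
    show "norm (K2 x v) \<le> c * norm v" for x v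
      by (rule order_trans[OF K2(6) mult_right_mono[OF le(1) norm_ge_zero]])
    show "norm (K2 x v - K2 z v) \<le> c * norm (x - z) * norm v" for x z v
      by (rule order_trans[OF K2(7) mult_right_mono[OF mult_right_mono[OF le(1) norm_ge_zero] norm_ge_zero]])
    show "K (- x) = K x" for x using K_even[of x] by simp
    show "bl_norm (\<lambda>y. (grad V x /\<^sub>R w y) \<bullet> grad K (x - y)) \<le> ennreal c" for x
    proof -
      have "bl_norm (\<lambda>y. (grad V x /\<^sub>R (1 + V y)) \<bullet> grad K (x - y)) \<le> ennreal c4"
        unfolding c4(2)[symmetric] by (rule SUP_upper) simp
      also have "\<dots> \<le> ennreal c" by (rule ennreal_leI[OF le(4)])
      finally show ?thesis by (simp add: w_def)
    qed
    show "bl_norm (\<lambda>y. (grad V x \<bullet> grad V y) / w y * K (x - y)) \<le> ennreal c" for x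
    proof -
      have "bl_norm (\<lambda>y. (grad V x \<bullet> grad V y) / (1 + V y) * K (x - y)) \<le> ennreal c5"
        unfolding c5(2)[symmetric] by (rule SUP_upper) simp
      also have "\<dots> \<le> ennreal c" by (rule ennreal_leI[OF le(5)])
      finally show ?thesis by (simp add: w_def)
    qed
  qed (fact K2 K_posdef)+
  show ?thesis
  proof (intro exI[of _ "(rate + 1) * lin_const"] conjI allI impI)
    show "0 < (rate + 1) * lin_const" using rate_nonneg lin_const_ge_1 by (intro mult_pos_pos) auto
    fix \<rho> :: "real \<Rightarrow> 'a measure" and t :: real
    assume sol: "measure_solution K V \<rho>" and t: "0 \<le> t"
      and small: "1 - (rate + 1) * lin_const * t * (t + 1) * blv_norm_diff V (\<rho> 0) (gibbs V) > 0"
    interpret stein_flow V K K2 c \<rho> using sol by unfold_locales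
    show "blv_norm_diff V (\<rho> t) (gibbs V)
         \<le> (rate + 1) * lin_const * (t + 1) * blv_norm_diff V (\<rho> 0) (gibbs V)
             / (1 - (rate + 1) * lin_const * (t + 1) * t * blv_norm_diff V (\<rho> 0) (gibbs V))"
      by (rule dst_le_while_small[OF t small])
  qed
qed

end
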